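(* There is a polynomial-time algorithm that, given a connected edge-colored graph $G$, outputs a properly colored tree in $G$ of order at least $\min\{|V(G)|,\,2\delta^c(G)+1\}$ whenever $G$ contains such a tree.
   Context: An edge-colored graph is a finite simple graph $G=(V,E)$ together with a map $c\colon E\to[k]$ for some positive integer $k$. For a vertex $v$, the color degree $d^c_G(v)$ is the number of distinct colors on the edges incident to $v$, i.e., $|\{c(vu): u\in N_G(v)\}|$, and the minimum color degree is $\delta^c(G)=\min_{v\in V} d^c_G(v)$. A subgraph $H$ of $G$ is properly colored if any two adjacent edges of $H$ (edges sharing an endpoint) have distinct colors. A properly colored tree is a subgraph that is a tree and is properly colored. The order of a tree is its number of vertices. *)

theory Defs
  imports "HOL-Computational_Algebra.Polynomial" "HOL-Library.Log_Nat"
begin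

section \<open>Edge-colored graphs and properly colored trees\<close>

text \<open>A graph is a pair of a vertex set and a set of edges, an edge being a two-element set of
  vertices. A coloring is a function on all sets; only its values on edges matter.\<close>

definition simple_graph :: "'a set \<Rightarrow> 'a set set \<Rightarrow> bool" where
  "simple_graph V E \<longleftrightarrow> finite V \<and> E \<subseteq> {{u, v} | u v. u \<in> V \<and> v \<in> V \<and> u \<noteq> v}"

definition edge_colored_graph :: "'a set \<Rightarrow> 'a set set \<Rightarrow> ('a set \<Rightarrow> nat) \<Rightarrow> bool" where
  "edge_colored_graph V E c \<longleftrightarrow> simple_graph V E \<and> (\<exists>k>0. c ` E \<subseteq> {1..k})"

definition connected_graph :: "'a set \<Rightarrow> 'a set set \<Rightarrow> bool" where
  "connected_graph V E \<longleftrightarrow> V \<noteq> {} \<and> (\<forall>u\<in>V. \<forall>v\<in>V. (u, v) \<in> {(x, y). {x, y} \<in> E}\<^sup>*)"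

definition color_degree :: "'a set set \<Rightarrow> ('a set \<Rightarrow> nat) \<Rightarrow> 'a \<Rightarrow> nat" where
  "color_degree E c v = card {c {v, u} | u. {v, u} \<in> E}"

definition min_color_degree :: "'a set \<Rightarrow> 'a set set \<Rightarrow> ('a set \<Rightarrow> nat) \<Rightarrow> nat" where
  "min_color_degree V E c = Min (color_degree E c ` V)"

definition is_cycle :: "'a set set \<Rightarrow> 'a list \<Rightarrow> bool" where
  "is_cycle E p \<longleftrightarrow> length p \<ge> 3 \<and> distinct p \<and>
     (\<forall>i<length p. {p ! i, p ! (Suc i mod length p)} \<in> E)"

definition is_tree :: "'a set \<Rightarrow> 'a set set \<Rightarrow> bool" where
  "is_tree W F \<longleftrightarrow> simple_graph W F \<and> connected_graph W F \<and> (\<nexists>p. is_cycle F p)"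

definition subgraph :: "'a set \<Rightarrow> 'a set set \<Rightarrow> 'a set \<Rightarrow> 'a set set \<Rightarrow> bool" where
  "subgraph W F V E \<longleftrightarrow> simple_graph W F \<and> W \<subseteq> V \<and> F \<subseteq> E"

definition properly_colored :: "'a set set \<Rightarrow> ('a set \<Rightarrow> nat) \<Rightarrow> bool" where
  "properly_colored F c \<longleftrightarrow> (\<forall>e\<in>F. \<forall>f\<in>F. e \<noteq> f \<and> e \<inter> f \<noteq> {} \<longrightarrow> c e \<noteq> c f)"

definition pc_tree_in ::
  "'a set \<Rightarrow> 'a set set \<Rightarrow> 'a set \<Rightarrow> 'a set set \<Rightarrow> ('a set \<Rightarrow> nat) \<Rightarrow> bool" where
  "pc_tree_in W F V E c \<longleftrightarrow> subgraph W F V E \<and> is_tree W F \<and> properly_colored F c"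


section \<open>Model of computation\<close>

text \<open>A random access machine with structured control flow. A program accesses finitely many
  memories (named by natural numbers), each an unbounded array of natural numbers with
  indirect addressing; scalar variables are cells at constant addresses. The only arithmetic
  is addition and truncated subtraction. Since there is no multiplication, cells have at most
  polynomially many bits after polynomially many steps, so polynomial time for this
  unit-cost model is the same as for Turing machines.\<close>

type_synonym store = "nat \<Rightarrow> nat \<Rightarrow> nat"

datatype expr = Const nat | Cell nat expr | Plus expr expr | Minus expr expr

datatype com =
    Skip
  | Assign nat expr expr  \<comment> \<open>\<open>Assign x a e\<close> writes \<open>e\<close> to address \<open>a\<close> of memory \<open>x\<close>\<close>
  | Seq com com
  | If expr com com       \<comment> \<open>a nonzero value counts as true\<close>
  | While expr com

primrec val :: "expr \<Rightarrow> store \<Rightarrow> nat" where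
  "val (Const n) s = n"
| "val (Cell x a) s = s x (val a s)"
| "val (Plus a b) s = val a s + val b s"
| "val (Minus a b) s = val a s - val b s"

text \<open>\<open>exec p s T t\<close>: started in store \<open>s\<close>, program \<open>p\<close> halts after \<open>T\<close> steps in store \<open>t\<close>.
  Evaluating an expression is charged a constant, which is adequate because a
  fixed program contains only finitely many expressions.\<close>

inductive exec :: "com \<Rightarrow> store \<Rightarrow> nat \<Rightarrow> store \<Rightarrow> bool" where
  Skip: "exec Skip s 1 s"
| Assign: "exec (Assign x a e) s 1 (s(x := (s x)(val a s := val e s)))"
| Seq: "exec p s m s' \<Longrightarrow> exec q s' n t \<Longrightarrow> exec (Seq p q) s (m + n) t"
| IfTrue: "val b s \<noteq> 0 \<Longrightarrow> exec p s n t \<Longrightarrow> exec (If b p q) s (Suc n) t"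
| IfFalse: "val b s = 0 \<Longrightarrow> exec q s n t \<Longrightarrow> exec (If b p q) s (Suc n) t"
| WhileFalse: "val b s = 0 \<Longrightarrow> exec (While b p) s 1 s"
| WhileTrue: "val b s \<noteq> 0 \<Longrightarrow> exec p s m s' \<Longrightarrow> exec (While b p) s' n t \<Longrightarrow>
    exec (While b p) s (Suc (m + n)) t"

inductive_cases SkipE: "exec Skip s n t"
inductive_cases AssignE: "exec (Assign x a e) s n t"
inductive_cases SeqE: "exec (Seq p q) s n t"
inductive_cases IfE: "exec (If b p q) s n t"
inductive_cases WhileE: "exec (While b p) s n t"

lemma exec_deterministic:
  "exec p s n t \<Longrightarrow> exec p s n' t' \<Longrightarrow> n' = n \<and> t' = t"
proof (induction arbitrary: n' t' rule: exec.induct)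
  case (Skip s)
  then show ?case by (rule SkipE) simp
next
  case (Assign x a e s)
  then show ?case by (rule AssignE) simp
next
  case (Seq p s m s1 q n t)
  from Seq.prems show ?case by (rule SeqE) (use Seq.IH in blast)
next
  case (IfTrue b s p n t q)
  from IfTrue.prems show ?case
    by (rule IfE) (use IfTrue.hyps(1) IfTrue.IH in \<open>metis neq0_conv\<close>)+
next
  case (IfFalse b s q n t p)
  from IfFalse.prems show ?case
    by (rule IfE) (use IfFalse.hyps(1) IfFalse.IH in \<open>metis neq0_conv\<close>)+
next
  case (WhileFalse b s p)
  from WhileFalse.prems show ?case by (rule WhileE) (use WhileFalse.hyps in simp_all)
next
  case (WhileTrue b s p m s1 n t)
  from WhileTrue.prems show ?case
    by (rule WhileE) (use WhileTrue.hyps(1) WhileTrue.IH in \<open>metis neq0_conv\<close>)+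
qed


section \<open>Input and output\<close>

text \<open>A graph on the vertices \<open>0, \<dots>, n - 1\<close> is presented by \<open>n\<close> followed by its colored adjacency
  matrix, row by row. Colors are positive, so the entry 0 means that there is no edge.\<close>

definition encode :: "nat \<Rightarrow> nat set set \<Rightarrow> (nat set \<Rightarrow> nat) \<Rightarrow> nat list" where
  "encode n E c =
     n # concat (map (\<lambda>u. map (\<lambda>v. if {u, v} \<in> E then c {u, v} else 0) [0..<n]) [0..<n])"

text \<open>Length in bits, with one separator per number.\<close>

definition input_size :: "nat list \<Rightarrow> nat" where
  "input_size w = (\<Sum>x\<leftarrow>w. nat (bitlen (int x)) + 1)"

text \<open>The input is placed in memory 0; all other cells are initially 0.\<close>

definition load :: "nat list \<Rightarrow> store" where
  "load w = (\<lambda>x i. if x = 0 \<and> i < length w then w ! i else 0)"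

text \<open>The output graph is read off from memory 1 (indicator of its vertices) and memory 2
  (adjacency matrix). An entry on either side of the diagonal suffices for an edge; a nonzero
  diagonal entry yields a loop and thus never a simple graph.\<close>

definition out_vertices :: "nat \<Rightarrow> store \<Rightarrow> nat set" where
  "out_vertices n t = {v. v < n \<and> t 1 v \<noteq> 0}"

definition out_edges :: "nat \<Rightarrow> store \<Rightarrow> nat set set" where
  "out_edges n t = {{u, v} | u v. u < n \<and> v < n \<and> t 2 (u * n + v) \<noteq> 0}"

end

theory Submission imports Defs begin

text \<open>Let \<open>d\<close> be the minimum color degree. The algorithm first tries all trees with at most 7 vertices, which
  settles \<open>d \<le> 3\<close>, and then repeatedly tries to replace the best tree \<open>(X, T)\<close>. For a vertex \<open>v\<close> outside
  \<open>X\<close>, thin out the graph on \<open>U = X \<union> {v}\<close>, without losing a color at any vertex, until every edge is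
  the only one of its color at one of its ends. Then \<open>having a common endpoint and the same color\<close> is an
  equivalence relation on edges, so that a largest properly colored forest is a largest common
  independent set of a graphic and a partition matroid, and augmenting walks find it. The same
  is done after deleting a vertex \<open>t\<close> of \<open>U\<close> and the edges at a vertex \<open>r\<close> with the color of some edge
  \<open>{r, b}\<close> that leaves \<open>U - {t}\<close>; if that forest spans, then \<open>{r, b}\<close> extends it.

  If every attempt fails, then each comes with a dual certificate: a set \<open>M\<close> of edges of the forest \<open>F\<close> such that
  every edge between different components of \<open>F - M\<close> meets an edge of \<open>M\<close> of the same color.
  For \<open>d \<ge> 4\<close> and \<open>|X| \<le> 2d\<close>, counting color degrees against the certificate for \<open>U\<close> forces
  \<open>|U| = 2d + 1\<close> and leaves two rigid configurations: either \<open>2d - 1\<close> monochromatic stars cover all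
  edges inside \<open>U\<close>, or \<open>d\<close> such stars cover all of them that do not lie inside a set of \<open>d\<close> vertices. The
  certificates of the other attempts extend this to all edges of the graph. Since a properly
  colored tree has at most one edge in each star, it has at most \<open>2d\<close> vertices.\<close>

section \<open>Forests and properly colored trees\<close>

text \<open>Why \<open>2 * d\<close>: if no single edge extends \<open>X\<close>, an edge leaving
  \<open>X\<close> at \<open>w\<close> repeats the color of a tree edge at \<open>w\<close>. So the
  graph on \<open>U\<close> still shows at least \<open>d\<close> colors at every vertex except
  perhaps \<open>v\<close>. On the other side, a certificate \<open>M\<close> for a forest that does
  not span splits \<open>U\<close> into at least \<open>card M + 2\<close> components, and a color
  leading from \<open>w\<close> to another component comes from a star of \<open>M\<close> centered
  at one of the two ends. Summing over the centers, and counting each pair of centers once, yields a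
  quadratic inequality that only the rigid cases satisfy. Deleting \<open>t\<close> makes room for
  \<open>{r, b}\<close>: a spanning tree on the remaining \<open>card X\<close> vertices plus this
  edge beats \<open>X\<close>, and forbidding its color at \<open>r\<close> beforehand keeps the
  result proper. The rigid configurations are robust enough to have a spanning forest after such
  deletions, so an edge outside their pattern would give an improvement. Robustness is shown by
  comparing 2 with \<open>d - 2\<close> and 3 with \<open>d - 1\<close>. This calls for
  \<open>d \<ge> 4\<close> and leaves trees with up to \<open>2 * 3 + 1 = 7\<close> vertices to
  exhaustive search.\<close>

definition conn :: "'a set set \<Rightarrow> ('a \<times> 'a) set" where
  "conn F = {(x, y). {x, y} \<in> F}\<^sup>*"

text \<open>Every edge is a bridge. Stating acyclicity by reachability makes insertion and exchange
  of edges a matter of \<open>conn\<close>; \<open>is_cycle_not_acyc\<close> gives the link to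
  \<open>is_cycle\<close>.\<close>

definition acyc :: "'a set set \<Rightarrow> bool" where
  "acyc F \<longleftrightarrow> (\<forall>a b. {a, b} \<in> F \<longrightarrow> (a, b) \<notin> conn (F - {{a, b}}))"

definition crossing :: "'a set set \<Rightarrow> 'a set \<Rightarrow> bool" where
  "crossing F e \<longleftrightarrow> (\<exists>a b. e = {a, b} \<and> (a, b) \<notin> conn F)"

definition parts :: "'a set \<Rightarrow> 'a set set \<Rightarrow> 'a set set" where
  "parts W F = (\<lambda>x. conn F `` {x}) ` W"

definition doubletons :: "'a set \<Rightarrow> 'a set set" where
  "doubletons W = {{a, b} | a b. a \<in> W \<and> b \<in> W \<and> a \<noteq> b}"

lemma doubleton_in_iff [simp]: "{a, b} \<in> doubletons W \<longleftrightarrow> a \<in> W \<and> b \<in> W \<and> a \<noteq> b"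
  by (auto simp: doubletons_def doubleton_eq_iff)

lemma doubletonsE:
  assumes "e \<in> doubletons W" "a \<in> e"
  obtains x where "e = {a, x}" "a \<in> W" "x \<in> W" "a \<noteq> x"
proof -
  obtain u v where uv: "e = {u, v}" "u \<in> W" "v \<in> W" "u \<noteq> v" using assms(1) unfolding doubletons_def by blast
  show thesis
  proof (cases "a = u")
    case True
    then show ?thesis using that[of v] uv by simp
  next
    case False
    then have "a = v" using assms(2) uv by simp
    then show ?thesis using that[of u] uv by (simp add: insert_commute)
  qed
qed

lemma doubletons_mono: "U \<subseteq> W \<Longrightarrow> doubletons U \<subseteq> doubletons W"
  by (auto simp: doubletons_def)

section \<open>Connectivity and acyclicity by reachability\<close>

lemma conn_refl [simp]: "(x, x) \<in> conn F"
  by (simp add: conn_def)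

lemma conn_edge: "{x, y} \<in> F \<Longrightarrow> (x, y) \<in> conn F"
  unfolding conn_def by (rule r_into_rtrancl) simp

lemma conn_trans: "(x, y) \<in> conn F \<Longrightarrow> (y, z) \<in> conn F \<Longrightarrow> (x, z) \<in> conn F"
  unfolding conn_def by (rule rtrancl_trans)

lemma conn_sym: "(x, y) \<in> conn F \<Longrightarrow> (y, x) \<in> conn F"
proof -
  have "sym {(x, y). {x, y} \<in> F}" by (auto simp: sym_def insert_commute)
  then show "(x, y) \<in> conn F \<Longrightarrow> (y, x) \<in> conn F"
    unfolding conn_def by (meson sym_rtrancl symD)
qed

lemma conn_mono: "F \<subseteq> G \<Longrightarrow> conn F \<subseteq> conn G"
  unfolding conn_def by (intro rtrancl_mono) auto

lemma conn_induct [consumes 1, case_names refl step]: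
  assumes "(x, y) \<in> conn F" "P x" "\<And>y z. (x, y) \<in> conn F \<Longrightarrow> {y, z} \<in> F \<Longrightarrow> P y \<Longrightarrow> P z"
  shows "P y"
  using assms(1) unfolding conn_def
  by (induction rule: rtrancl_induct) (use assms(2,3) in \<open>auto simp: conn_def\<close>)

lemma conn_insert:
  "(x, y) \<in> conn (insert {a, b} F) \<longleftrightarrow>
     (x, y) \<in> conn F \<or> (x, a) \<in> conn F \<and> (b, y) \<in> conn F \<or> (x, b) \<in> conn F \<and> (a, y) \<in> conn F"
  (is "?L \<longleftrightarrow> ?R")
proof
  assume ?L
  then show ?R
  proof (induction rule: conn_induct)
    case refl
    then show ?case by simp
  next
    case (step y z)
    show ?case
    proof (cases "{y, z} \<in> F")
      case True
      then show ?thesis using step.IH by (meson conn_edge conn_trans)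
    next
      case False
      then have "y = a \<and> z = b \<or> y = b \<and> z = a" using step.hyps by (auto simp: doubleton_eq_iff)
      then show ?thesis using step.IH by (meson conn_refl conn_sym conn_trans)
    qed
  qed
next
  have m: "conn F \<subseteq> conn (insert {a, b} F)" by (rule conn_mono) auto
  have e: "(a, b) \<in> conn (insert {a, b} F)" by (rule conn_edge) simp
  assume ?R
  then show ?L using m e by (meson conn_sym conn_trans subsetD)
qed

lemma conn_closed:
  assumes "(x, y) \<in> conn F" "F \<subseteq> doubletons W" "x \<in> W" shows "y \<in> W"
  using assms(1)
proof (induction rule: conn_induct)
  case refl
  then show ?case by (rule assms(3))
next
  case (step y z)
  have "{y, z} \<in> doubletons W" using step.hyps assms(2) by blast
  then show ?case by simp
qed

lemma conn_empty [simp]: "(x, y) \<in> conn {} \<longleftrightarrow> x = y"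
  by (simp add: conn_def)

lemma conn_insert_conn:
  assumes "(a, b) \<in> conn F" shows "conn (insert {a, b} F) = conn F"
proof -
  have "(x, y) \<in> conn (insert {a, b} F) \<longleftrightarrow> (x, y) \<in> conn F" for x y
    using assms unfolding conn_insert by (meson conn_sym conn_trans)
  then show ?thesis by auto
qed

lemma crossing_pair: "crossing F {a, b} \<longleftrightarrow> (a, b) \<notin> conn F"
  unfolding crossing_def by (metis conn_sym doubleton_eq_iff)

lemma crossing_mono: "F \<subseteq> G \<Longrightarrow> crossing G e \<Longrightarrow> crossing F e"
  unfolding crossing_def using conn_mono by blast

lemma acyc_empty [simp]: "acyc {}"
  by (simp add: acyc_def)

lemma acyc_subset: "acyc F \<Longrightarrow> G \<subseteq> F \<Longrightarrow> acyc G"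
proof -
  assume F: "acyc F" and G: "G \<subseteq> F"
  show "acyc G" unfolding acyc_def
  proof (intro allI impI)
    fix a b assume "{a, b} \<in> G"
    then have "(a, b) \<notin> conn (F - {{a, b}})" using F G unfolding acyc_def by blast
    moreover have "conn (G - {{a, b}}) \<subseteq> conn (F - {{a, b}})" by (rule conn_mono) (use G in blast)
    ultimately show "(a, b) \<notin> conn (G - {{a, b}})" by blast
  qed
qed

lemma acyc_insert:
  assumes F: "acyc F" and ab: "(a, b) \<notin> conn F" shows "acyc (insert {a, b} F)"
  unfolding acyc_def
proof (intro allI impI)
  fix x y assume xy: "{x, y} \<in> insert {a, b} F"
  show "(x, y) \<notin> conn (insert {a, b} F - {{x, y}})"
  proof (cases "{x, y} = {a, b}")
    case True
    then have "insert {a, b} F - {{x, y}} \<subseteq> F" by auto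
    then show ?thesis using ab True conn_mono by (metis conn_sym doubleton_eq_iff subsetD)
  next
    case False
    then have xyF: "{x, y} \<in> F" using xy by simp
    define G where "G = F - {{x, y}}"
    have G: "G \<subseteq> F" "insert {a, b} F - {{x, y}} = insert {a, b} G" using False by (auto simp: G_def)
    have nx: "(x, y) \<notin> conn G" using F xyF unfolding acyc_def G_def by blast
    have "(x, y) \<in> conn F" by (rule conn_edge[OF xyF])
    then show ?thesis
      unfolding G(2) conn_insert using nx ab conn_mono[OF G(1)] by (meson conn_sym conn_trans subsetD)
  qed
qed

text \<open>In a forest the path from \<open>a\<close> to \<open>b\<close> is unique, so a set of
  edges that cuts it contains an edge that cuts it alone. The induction finds the edge whose removal
  makes the difference: its ends are joined to \<open>a\<close> and \<open>b\<close> by what is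
  left, and it is a bridge of \<open>F\<close>.\<close>

lemma acyc_cut:
  assumes F: "acyc F" and M: "finite M" and ab: "(a, b) \<in> conn F" "(a, b) \<notin> conn (F - M)"
  shows "\<exists>f\<in>M \<inter> F. (a, b) \<notin> conn (F - {f})"
  using M ab(2)
proof (induction M rule: finite_induct)
  case empty
  then show ?case using ab(1) by simp
next
  case (insert f M)
  show ?case
  proof (cases "(a, b) \<in> conn (F - M)")
    case False
    then show ?thesis using insert.IH by blast
  next
    case True
    have fF: "f \<in> F" "f \<notin> M"
    proof -
      have "F - insert f M = F - M" if "f \<notin> F \<or> f \<in> M" using that by blast
      then show "f \<in> F" "f \<notin> M" using True insert.prems by metis+
    qed
    have "\<exists>x y. f = {x, y}"
    proof (rule ccontr)
      assume "\<nexists>x y. f = {x, y}"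
      then have "{(x, y). {x, y} \<in> F - insert f M} = {(x, y). {x, y} \<in> F - M}" by auto
      then show False using True insert.prems unfolding conn_def by simp
    qed
    then obtain x y where f: "f = {x, y}" by blast
    define G where "G = F - insert f M"
    have "F - M = insert {x, y} G" using fF f by (auto simp: G_def)
    then have c: "(a, x) \<in> conn G \<and> (y, b) \<in> conn G \<or> (a, y) \<in> conn G \<and> (x, b) \<in> conn G"
      using True insert.prems conn_insert G_def by metis
    have GF: "conn G \<subseteq> conn (F - {f})" by (rule conn_mono) (auto simp: G_def)
    have "(x, y) \<notin> conn (F - {f})" using F fF f unfolding acyc_def by blast
    then have "(a, b) \<notin> conn (F - {f})" using c GF by (meson conn_sym conn_trans subsetD)
    then show ?thesis using fF by blast
  qed
qed

lemma doubletons_finite: "finite W \<Longrightarrow> finite (doubletons W)"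
proof -
  assume "finite W"
  moreover have "doubletons W \<subseteq> Pow W" by (auto simp: doubletons_def)
  ultimately show ?thesis using finite_subset by blast
qed

lemma conn_class_eq: "conn F `` {x} = conn F `` {y} \<longleftrightarrow> (x, y) \<in> conn F"
proof
  assume "conn F `` {x} = conn F `` {y}"
  then show "(x, y) \<in> conn F" using conn_refl[of y F] by blast
next
  assume "(x, y) \<in> conn F"
  then have "(x, z) \<in> conn F \<longleftrightarrow> (y, z) \<in> conn F" for z by (meson conn_sym conn_trans)
  then show "conn F `` {x} = conn F `` {y}" by auto
qed

text \<open>Rank formula for forests: each new edge is a bridge and merges exactly two components.
  The later counts of components rest on it.\<close>

lemma card_parts:
  assumes W: "finite W" and F: "F \<subseteq> doubletons W" "acyc F"
  shows "card (parts W F) + card F = card W"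
proof -
  have "finite F" using F(1) doubletons_finite[OF W] finite_subset by blast
  then show ?thesis using F
  proof (induction F rule: finite_induct)
    case empty
    have "parts W {} = (\<lambda>x. {x}) ` W" by (auto simp: parts_def)
    then show ?case by (simp add: card_image)
  next
    case (insert e F)
    obtain a b where e: "e = {a, b}" "a \<in> W" "b \<in> W" "a \<noteq> b"
      using insert.prems(1) by (auto simp: doubletons_def)
    have nab: "(a, b) \<notin> conn F"
    proof -
      have "insert e F - {{a, b}} = F" using e insert.hyps by auto
      then show ?thesis using insert.prems(2) e(1) unfolding acyc_def by (metis insertI1)
    qed
    have IH: "card (parts W F) + card F = card W"
      using insert.IH insert.prems acyc_subset by blast
    let ?A = "conn F `` {a}" and ?B = "conn F `` {b}"
    have cl: "conn (insert e F) `` {x} = (if x \<in> ?A \<union> ?B then ?A \<union> ?B else conn F `` {x})" for x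
    proof -
      have "(x, z) \<in> conn (insert e F) \<longleftrightarrow>
        (if (a, x) \<in> conn F \<or> (b, x) \<in> conn F then (a, z) \<in> conn F \<or> (b, z) \<in> conn F else (x, z) \<in> conn F)" for z
      proof -
        have sw: "(u, w) \<in> conn F \<longleftrightarrow> (u', w) \<in> conn F" if "(u', u) \<in> conn F" for u u' w
          using that conn_class_eq[of F u' u] by blast
        show ?thesis
        proof (cases "(a, x) \<in> conn F")
          case True
          then show ?thesis using sw[OF True] nab by (simp add: e(1) conn_insert)
        next
          case nax: False
          show ?thesis
          proof (cases "(b, x) \<in> conn F")
            case True
            then show ?thesis using sw[OF True] by (auto simp add: e(1) conn_insert)
          next
            case False
            then show ?thesis using nax by (auto simp add: e(1) conn_insert dest: conn_sym)
          qed
        qed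
      qed
      then show ?thesis by (simp only: set_eq_iff Image_singleton_iff Un_iff split: if_splits) meson
    qed
    have AB: "?A \<in> parts W F" "?B \<in> parts W F" "?A \<noteq> ?B"
      using e(2,3) nab by (auto simp add: parts_def conn_class_eq simp del: Image_singleton_iff)
    have aw: "a \<in> ?A" "b \<in> ?B" by auto
    have disj: "P = ?A \<or> P = ?B \<or> P \<inter> (?A \<union> ?B) = {}" if "P \<in> parts W F" for P
    proof -
      obtain x where x: "P = conn F `` {x}" using \<open>P \<in> parts W F\<close> by (auto simp: parts_def)
      have "P = conn F `` {z}" if "z \<in> P" for z using that x conn_class_eq[of F x z] by simp
      moreover have "?A = conn F `` {z}" if "z \<in> ?A" for z using that conn_class_eq[of F a z] by simp
      moreover have "?B = conn F `` {z}" if "z \<in> ?B" for z using that conn_class_eq[of F b z] by simp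
      ultimately show ?thesis by blast
    qed
    have "parts W (insert e F) = insert (?A \<union> ?B) (parts W F - {?A, ?B})"
    proof (intro equalityI subsetI)
      fix P assume "P \<in> parts W (insert e F)"
      then obtain x where x: "x \<in> W" "P = conn (insert e F) `` {x}" by (auto simp: parts_def)
      show "P \<in> insert (?A \<union> ?B) (parts W F - {?A, ?B})"
      proof (cases "x \<in> ?A \<union> ?B")
        case True
        then show ?thesis using x cl by auto
      next
        case False
        then have P: "P = conn F `` {x}" using x cl by auto
        then have "x \<in> P" by auto
        then have "P \<noteq> ?A" "P \<noteq> ?B" using False by auto
        then show ?thesis using P x by (auto simp: parts_def)
      qed
    next
      fix P assume P: "P \<in> insert (?A \<union> ?B) (parts W F - {?A, ?B})"
      show "P \<in> parts W (insert e F)"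
      proof (cases "P = ?A \<union> ?B")
        case True
        then have "P = conn (insert e F) `` {a}" using cl[of a] by simp
        then show ?thesis using e unfolding parts_def by (simp add: rev_image_eqI)
      next
        case False
        then have P': "P \<in> parts W F" "P \<noteq> ?A" "P \<noteq> ?B" using P by auto
        then obtain x where x: "x \<in> W" "P = conn F `` {x}" by (auto simp: parts_def)
        then have "x \<in> P" by auto
        then have "x \<notin> ?A \<union> ?B" using disj[OF P'(1)] P' by blast
        then have "P = conn (insert e F) `` {x}" using cl[of x] x by simp
        then show ?thesis using x unfolding parts_def by (simp add: rev_image_eqI)
      qed
    qed
    moreover have "?A \<union> ?B \<notin> parts W F - {?A, ?B}"
      using disj[of "?A \<union> ?B"] aw by blast
    moreover have fin: "finite (parts W F)" using W by (simp add: parts_def)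
    ultimately have "card (parts W (insert e F)) = Suc (card (parts W F - {?A, ?B}))"
      by simp
    moreover have "card (parts W F - {?A, ?B}) = card (parts W F) - 2"
      using AB fin by (simp add: card_Diff_subset)
    moreover have "card {?A, ?B} \<le> card (parts W F)"
      by (rule card_mono[OF fin]) (use AB in auto)
    then have "card (parts W F) \<ge> 2" using AB(3) by simp
    ultimately show ?case using IH insert.hyps by simp
  qed
qed

lemma is_cycle_not_acyc:
  assumes "is_cycle F p" shows "\<not> acyc F"
proof
  assume F: "acyc F"
  have p: "length p \<ge> 3" "distinct p" and E: "\<And>i. i < length p \<Longrightarrow> {p ! i, p ! (Suc i mod length p)} \<in> F"
    using assms by (auto simp: is_cycle_def)
  define l where "l = length p - 1"
  have l: "Suc l = length p" "l \<ge> 2" using p by (auto simp: l_def)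
  define e where "e = {p ! 0, p ! l}"
  have eF: "e \<in> F" using E[of l] l by (auto simp: e_def insert_commute)
  have "(p ! 0, p ! i) \<in> conn (F - {e})" if "i \<le> l" for i
    using that
  proof (induction i)
    case 0
    then show ?case by simp
  next
    case (Suc i)
    have "{p ! i, p ! Suc i} \<in> F" using E[of i] Suc.prems l by simp
    \<comment> \<open>The length of at least 3 enters here: with two vertices the closing edge would
      be the edge along the list.\<close>
    moreover have "{p ! i, p ! Suc i} \<noteq> e"
    proof
      assume "{p ! i, p ! Suc i} = e"
      then have "p ! i = p ! 0 \<and> p ! Suc i = p ! l \<or> p ! i = p ! l \<and> p ! Suc i = p ! 0"
        by (auto simp: e_def doubleton_eq_iff)
      moreover have "i < length p" "Suc i < length p" "0 < length p" "l < length p" using Suc.prems l by auto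
      ultimately show False using p(2) l Suc.prems by (auto simp: nth_eq_iff_index_eq)
    qed
    ultimately have "{p ! i, p ! Suc i} \<in> F - {e}" by simp
    then show ?case using Suc conn_edge conn_trans by (metis Suc_leD)
  qed
  then have "(p ! 0, p ! l) \<in> conn (F - {e})" by simp
  then show False using F eF unfolding acyc_def e_def by blast
qed

text \<open>A tree together with an order of construction, which is how the program produces it.
  Since the new vertex \<open>b\<close> is isolated before, only the colors at \<open>r\<close> have
  to be checked.\<close>

inductive grown :: "'a set \<Rightarrow> 'a set set \<Rightarrow> ('a set \<Rightarrow> nat) \<Rightarrow> 'a set \<Rightarrow> 'a set set \<Rightarrow> bool"
  for V E c where
  single: "x \<in> V \<Longrightarrow> grown V E c {x} {}"
| extend: "grown V E c Y F \<Longrightarrow> r \<in> Y \<Longrightarrow> b \<notin> Y \<Longrightarrow> {r, b} \<in> E \<Longrightarrow>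
    (\<And>x. {r, x} \<in> F \<Longrightarrow> c {r, x} \<noteq> c {r, b}) \<Longrightarrow> grown V E c (insert b Y) (insert {r, b} F)"

text \<open>\<open>properly_colored\<close> with the common endpoint named; the two agree on sets of
  two-element edges by \<open>pc_properly_colored\<close>.\<close>

definition pc :: "('a set \<Rightarrow> nat) \<Rightarrow> 'a set set \<Rightarrow> bool" where
  "pc c F \<longleftrightarrow> (\<forall>a x y. {a, x} \<in> F \<and> {a, y} \<in> F \<and> c {a, x} = c {a, y} \<longrightarrow> x = y)"

lemma grown_props:
  assumes "grown V E c Y F" "E \<subseteq> doubletons V"
  shows "Y \<subseteq> V" "F \<subseteq> E" "F \<subseteq> doubletons Y" "finite Y" "finite F" "card Y = Suc (card F)" "acyc F" "pc c F"
    "\<And>x y. x \<in> Y \<Longrightarrow> y \<in> Y \<Longrightarrow> (x, y) \<in> conn F" "Y \<noteq> {}"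
proof -
  have "Y \<subseteq> V \<and> F \<subseteq> E \<and> F \<subseteq> doubletons Y \<and> finite Y \<and> finite F \<and> card Y = Suc (card F) \<and> acyc F \<and> pc c F
    \<and> (\<forall>x\<in>Y. \<forall>y\<in>Y. (x, y) \<in> conn F) \<and> Y \<noteq> {}"
    using assms
  proof (induction rule: grown.induct)
    case (single x)
    then show ?case by (auto simp: pc_def)
  next
    case (extend Y F r b)
    have IH: "Y \<subseteq> V" "F \<subseteq> E" "F \<subseteq> doubletons Y" "finite Y" "finite F" "card Y = Suc (card F)" "acyc F" "pc c F"
      "\<And>x y. x \<in> Y \<Longrightarrow> y \<in> Y \<Longrightarrow> (x, y) \<in> conn F"
      using extend.IH extend.prems by auto
    have nb: "{x, b} \<notin> F" for x using IH(3) extend.hyps(3) doubleton_in_iff[of x b Y] by blast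
    have "r \<noteq> b" using extend.hyps by blast
    have nconn: "(r, b) \<notin> conn F" using conn_closed[OF _ IH(3)] extend.hyps by blast
    have "b \<in> V" using extend.hyps(4) extend.prems doubleton_in_iff[of r b V] by blast
    moreover have "insert {r, b} F \<subseteq> doubletons (insert b Y)"
      using IH(3) extend.hyps(2) \<open>r \<noteq> b\<close> doubletons_mono[of Y "insert b Y"] by auto
    moreover have "acyc (insert {r, b} F)" by (rule acyc_insert[OF IH(7) nconn])
    moreover have "pc c (insert {r, b} F)"
      unfolding pc_def
    proof (intro allI impI)
      fix a x y assume h: "{a, x} \<in> insert {r, b} F \<and> {a, y} \<in> insert {r, b} F \<and> c {a, x} = c {a, y}"
      have nb': "{b, x} \<notin> F" for x using nb[of x] by (simp add: insert_commute)
      have c: "{r, x} \<in> F \<Longrightarrow> c {r, x} \<noteq> c {r, b}" for x using extend.hyps(5) .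
      show "x = y"
      proof (cases "{a, x} \<in> F")
        case True
        show ?thesis
        proof (cases "{a, y} \<in> F")
          case True
          then show ?thesis using IH(8) \<open>{a, x} \<in> F\<close> h unfolding pc_def by blast
        next
          case False
          then have "{a, y} = {r, b}" using h by simp
          then show ?thesis using \<open>{a, x} \<in> F\<close> nb' c h by (auto simp: doubleton_eq_iff)
        qed
      next
        case False
        then have ax: "{a, x} = {r, b}" using h by simp
        show ?thesis
        proof (cases "{a, y} \<in> F")
          case True
          then show ?thesis using ax nb' c h by (fastforce simp: doubleton_eq_iff)
        next
          case False
          then have "{a, y} = {r, b}" using h by simp
          then show ?thesis using ax by (auto simp: doubleton_eq_iff)
        qed
      qed
    qed
    moreover have "{r, b} \<notin> F" using nb by blast
    moreover have "\<forall>x\<in>insert b Y. \<forall>y\<in>insert b Y. (x, y) \<in> conn (insert {r, b} F)"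
      using IH(9) extend.hyps(2) by (auto simp: conn_insert)
    ultimately show ?case using IH extend.hyps by auto
  qed
  then show "Y \<subseteq> V" "F \<subseteq> E" "F \<subseteq> doubletons Y" "finite Y" "finite F" "card Y = Suc (card F)" "acyc F" "pc c F"
    "\<And>x y. x \<in> Y \<Longrightarrow> y \<in> Y \<Longrightarrow> (x, y) \<in> conn F" "Y \<noteq> {}" by auto
qed

section \<open>Passage to the graph notions of the statement\<close>

lemma simple_graph_doubletons: "simple_graph V E \<longleftrightarrow> finite V \<and> E \<subseteq> doubletons V"
  by (simp add: simple_graph_def doubletons_def)

lemma pc_properly_colored:
  assumes "F \<subseteq> doubletons W" shows "properly_colored F c \<longleftrightarrow> pc c F"
proof
  assume F: "properly_colored F c"
  show "pc c F" unfolding pc_def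
  proof (intro allI impI)
    fix a x y assume h: "{a, x} \<in> F \<and> {a, y} \<in> F \<and> c {a, x} = c {a, y}"
    have "\<not> ({a, x} \<noteq> {a, y} \<and> {a, x} \<inter> {a, y} \<noteq> {})"
      using F[unfolded properly_colored_def, rule_format, of "{a, x}" "{a, y}"] h by argo
    then have "{a, x} = {a, y}" by simp
    then show "x = y" by (auto simp: doubleton_eq_iff)
  qed
next
  assume F: "pc c F"
  show "properly_colored F c" unfolding properly_colored_def
  proof (intro ballI impI notI)
    fix e f assume h: "e \<in> F" "f \<in> F" "e \<noteq> f \<and> e \<inter> f \<noteq> {}" "c e = c f"
    then obtain a where a: "a \<in> e" "a \<in> f" by blast
    obtain x where x: "e = {a, x}" using doubletonsE[of e W a] h(1) a assms by blast
    obtain y where y: "f = {a, y}" using doubletonsE[of f W a] h(2) a assms by blast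
    show False using F h x y unfolding pc_def by blast
  qed
qed

lemma grown_pc_tree_in:
  assumes "grown V E c Y F" "simple_graph V E" shows "pc_tree_in Y F V E c"
proof -
  have E: "E \<subseteq> doubletons V" using assms(2) by (simp add: simple_graph_doubletons)
  note g = grown_props[OF assms(1) E]
  show ?thesis
    using g is_cycle_not_acyc[of F] pc_properly_colored[OF g(3)]
    by (auto simp: pc_tree_in_def subgraph_def is_tree_def simple_graph_doubletons connected_graph_def conn_def[symmetric])
qed

lemma connected_extension:
  assumes "\<And>x y. x \<in> W \<Longrightarrow> y \<in> W \<Longrightarrow> (x, y) \<in> conn F" "Y \<subseteq> W" "Y \<noteq> {}" "Y \<noteq> W"
  shows "\<exists>r b. r \<in> Y \<and> b \<notin> Y \<and> {r, b} \<in> F"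
proof -
  obtain x y where xy: "x \<in> Y" "y \<in> W" "y \<notin> Y" using assms by blast
  have "(x, y) \<in> conn F" using assms xy by blast
  then show ?thesis
  proof (rule contrapos_pp)
    assume h: "\<nexists>r b. r \<in> Y \<and> b \<notin> Y \<and> {r, b} \<in> F"
    have "y \<in> Y" if "(x, y) \<in> conn F" for y
      using that by (induction rule: conn_induct) (use h xy in auto)
    then show "(x, y) \<notin> conn F" using xy by blast
  qed
qed

text \<open>Growth inside a connected properly colored \<open>T\<close> never gets stuck: an edge of
  \<open>F\<close> at \<open>r\<close> with the color of \<open>{r, b}\<close> would be
  \<open>{r, b}\<close> itself, which does not lie inside \<open>Y\<close>.\<close>

lemma grown_extend_within:
  assumes g: "grown V E c Y F" and E: "E \<subseteq> doubletons V" and T: "T \<subseteq> E" "pc c T" "F \<subseteq> T" "Y \<subseteq> W" "Y \<noteq> W"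
    and con: "\<And>x y. x \<in> W \<Longrightarrow> y \<in> W \<Longrightarrow> (x, y) \<in> conn T"
  shows "\<exists>r b. r \<in> Y \<and> b \<notin> Y \<and> {r, b} \<in> T \<and> grown V E c (insert b Y) (insert {r, b} F)"
proof -
  note p = grown_props[OF g E]
  obtain r b where rb: "r \<in> Y" "b \<notin> Y" "{r, b} \<in> T"
    using connected_extension[OF con T(4) p(10) T(5)] by blast
  have "{r, x} \<in> F \<Longrightarrow> c {r, x} \<noteq> c {r, b}" for x
  proof
    assume h: "{r, x} \<in> F" "c {r, x} = c {r, b}"
    then have "x = b" using T rb unfolding pc_def by blast
    then have "{r, b} \<in> doubletons Y" using h p(3) by blast
    then show False using rb by simp
  qed
  then have "grown V E c (insert b Y) (insert {r, b} F)"
    using extend[OF g rb(1,2)] rb(3) T(1) by blast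
  then show ?thesis using rb by blast
qed

section \<open>Forests without conflicts\<close>

text \<open>Reflexive on edges. Hence an edge of \<open>M\<close> is its own witness in
  \<open>stuck\<close>, and membership in \<open>F\<close> is already a conflict with
  \<open>F\<close>.\<close>

definition conf :: "('a set \<Rightarrow> nat) \<Rightarrow> 'a set \<Rightarrow> 'a set \<Rightarrow> bool" where
  "conf c e f \<longleftrightarrow> e \<inter> f \<noteq> {} \<and> c e = c f"

lemma conf_sym: "conf c e f \<Longrightarrow> conf c f e"
  by (auto simp: conf_def)

text \<open>Edges in conflict form the classes of a partition matroid. A walk that augments \<open>F\<close> ends in an edge
  without conflict; \<open>marks F j\<close> are the edges of \<open>F\<close> that are reached in \<open>j\<close> rounds from the edges
  joining two components of \<open>F\<close>, and \<open>stuck\<close> is the dual certificate.\<close>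

locale star_graph =
  fixes H :: "'a set set" and W :: "'a set" and c :: "'a set \<Rightarrow> nat"
  assumes H: "H \<subseteq> doubletons W" and W: "finite W"
    and conf_trans: "\<And>e f g. e \<in> H \<Longrightarrow> f \<in> H \<Longrightarrow> g \<in> H \<Longrightarrow> conf c e f \<Longrightarrow> conf c f g \<Longrightarrow> conf c e g"
begin

definition indep :: "'a set set \<Rightarrow> bool" where
  "indep F \<longleftrightarrow> F \<subseteq> H \<and> acyc F \<and> (\<forall>e\<in>F. \<forall>f\<in>F. conf c e f \<longrightarrow> e = f)"

primrec marks :: "'a set set \<Rightarrow> nat \<Rightarrow> 'a set set" where
  "marks F 0 = {}"
| "marks F (Suc j) = marks F j \<union> {f \<in> F. \<exists>e\<in>H - F. crossing (F - marks F j) e \<and> conf c e f}"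

definition sink :: "'a set set \<Rightarrow> 'a set \<Rightarrow> bool" where
  "sink F e \<longleftrightarrow> e \<in> H - F \<and> (\<forall>f\<in>F. \<not> conf c e f)"

definition reach :: "'a set set \<Rightarrow> nat \<Rightarrow> bool" where
  "reach F j \<longleftrightarrow> (\<exists>e. sink F e \<and> crossing (F - marks F j) e)"

definition stuck :: "'a set set \<Rightarrow> bool" where
  "stuck F \<longleftrightarrow> (\<exists>M\<subseteq>F. \<forall>e\<in>H. crossing (F - M) e \<longrightarrow> (\<exists>f\<in>M. conf c e f))"

text \<open>Lexicographic measure for termination: the size of \<open>F\<close> first, then how
  short the shortest augmenting walk is. The factor \<open>n\<close> bounds the second term.\<close>

definition potential :: "nat \<Rightarrow> 'a set set \<Rightarrow> nat" where
  "potential n F = card F * n + (n - (LEAST j. reach F j))"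

lemma finite_H: "finite H"
  using H doubletons_finite[OF W] finite_subset by blast

lemma H_pair: "e \<in> H \<Longrightarrow> \<exists>a b. e = {a, b} \<and> a \<in> W \<and> b \<in> W \<and> a \<noteq> b"
  using H unfolding doubletons_def by blast

lemma conf_self: "e \<in> H \<Longrightarrow> conf c e e"
  using H_pair unfolding conf_def by blast

lemma indep_finite: "indep F \<Longrightarrow> finite F"
  using finite_H finite_subset unfolding indep_def by blast

lemma indep_empty: "indep {}"
  by (simp add: indep_def)

lemma marks_subset: "marks F j \<subseteq> F"
  by (induction j) auto

lemma marks_mono: "i \<le> j \<Longrightarrow> marks F i \<subseteq> marks F j"
  by (rule lift_Suc_mono_le[of "marks F"]) auto

lemma not_crossing_edge: "e \<in> F \<Longrightarrow> F \<subseteq> H \<Longrightarrow> \<not> crossing F e"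
proof -
  assume e: "e \<in> F" "F \<subseteq> H"
  then obtain a b where ab: "e = {a, b}" using H_pair[of e] by blast
  have "(a, b) \<in> conn F" by (rule conn_edge) (use e ab in simp)
  then show ?thesis unfolding ab crossing_pair by simp
qed

text \<open>The marks cannot grow strictly through \<open>n\<close> layers inside fewer than
  \<open>n\<close> edges, so some layer repeats; it is the certificate. A crossing edge outside
  \<open>F\<close> is no sink, so it conflicts with an edge of \<open>F\<close>, and the next layer,
  which is the same one, marks that edge.\<close>

lemma stuck_if_not_reach:
  assumes F: "indep F" and n: "card F < n" and nr: "\<And>j. j < n \<Longrightarrow> \<not> reach F j"
  shows "stuck F"
proof -
  have "\<exists>j<n. marks F (Suc j) = marks F j"
  proof (rule ccontr)
    assume h: "\<not> ?thesis"
    have "j \<le> n \<Longrightarrow> j \<le> card (marks F j)" for j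
    proof (induction j)
      case (Suc j)
      have "marks F j \<subseteq> marks F (Suc j)" by (rule marks_mono) simp
      moreover have "marks F (Suc j) \<noteq> marks F j" using h Suc.prems Suc_le_lessD by blast
      ultimately have "marks F j \<subset> marks F (Suc j)" by blast
      then have "card (marks F j) < card (marks F (Suc j))"
        by (rule psubset_card_mono[OF finite_subset[OF marks_subset indep_finite[OF F]]])
      then show ?case using Suc by simp
    qed simp
    then have "n \<le> card (marks F n)" by blast
    then show False
      using n card_mono[OF indep_finite[OF F] marks_subset[of F n]] by linarith
  qed
  then obtain j where j: "j < n" "marks F (Suc j) = marks F j" by blast
  have "\<exists>f\<in>marks F j. conf c e f" if e: "e \<in> H" "crossing (F - marks F j) e" for e
  proof (cases "e \<in> F")
    case True
    have "e \<in> marks F j"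
      using not_crossing_edge[of e "F - marks F j"] F True e(2) unfolding indep_def by blast
    then show ?thesis using conf_self[OF e(1)] by blast
  next
    case False
    then have "\<not> sink F e" using nr[OF j(1)] e(2) unfolding reach_def by blast
    then obtain f where f: "f \<in> F" "conf c e f" using False e(1) unfolding sink_def by blast
    then have "f \<in> marks F (Suc j)" using False e unfolding marks.simps by blast
    then show ?thesis using f j(2) by blast
  qed
  then show ?thesis unfolding stuck_def using marks_subset by blast
qed

lemma indep_add:
  assumes "indep F" "sink F e" "crossing F e"
  shows "indep (insert e F)" "card (insert e F) = Suc (card F)"
proof -
  obtain a b where e: "e = {a, b}" "(a, b) \<notin> conn F" using assms(3) unfolding crossing_def by blast
  have F: "F \<subseteq> H" "acyc F" "\<And>e f. e \<in> F \<Longrightarrow> f \<in> F \<Longrightarrow> conf c e f \<Longrightarrow> e = f"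
    using assms(1) unfolding indep_def by auto
  have "acyc (insert e F)" unfolding e(1) by (rule acyc_insert[OF F(2) e(2)])
  moreover have eF: "e \<in> H" "e \<notin> F" and n1: "\<And>f. f \<in> F \<Longrightarrow> \<not> conf c e f"
    using assms(2) unfolding sink_def by auto
  moreover have n2: "\<not> conf c f e" if "f \<in> F" for f using n1[OF that] conf_sym by blast
  ultimately show "indep (insert e F)" unfolding indep_def using F by blast
  show "card (insert e F) = Suc (card F)" using indep_finite[OF assms(1)] eF by simp
qed

text \<open>\<open>acyc_cut\<close> for the marked edges: the cycle that \<open>e\<close> closes
  with \<open>F\<close> contains a marked edge, and removing that edge alone opens it.\<close>

lemma exchange_exists:
  assumes F: "indep F" and e: "e \<in> H" "crossing (F - marks F j) e" "\<not> crossing F e"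
  shows "\<exists>f\<in>marks F j. crossing (F - {f}) e"
proof -
  obtain a b where ab: "e = {a, b}" using H_pair[OF e(1)] by blast
  have "\<exists>f\<in>marks F j \<inter> F. (a, b) \<notin> conn (F - {f})"
    using acyc_cut[of F "marks F j" a b] F e finite_subset[OF marks_subset indep_finite[OF F]]
    unfolding indep_def ab crossing_pair by blast
  then show ?thesis unfolding ab crossing_pair by blast
qed

text \<open>Exchanging at the sink end of a shortest augmenting walk shortens the walk, because every
  earlier layer of marks survives the exchange.\<close>

lemma indep_exchange:
  assumes F: "indep F" and least: "\<And>i. i < j \<Longrightarrow> \<not> reach F i"
    and e: "sink F e" "crossing (F - marks F j) e" "\<not> crossing F e"
    and f: "f \<in> marks F j" "crossing (F - {f}) e"
  defines "F' \<equiv> insert e (F - {f})"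
  shows "indep F'" "card F' = card F" "j > 0" "reach F' (j - 1)"
proof -
  have j0: "j > 0" using e(2,3) by (cases j) auto
  then obtain i where i: "j = Suc i" using gr0_implies_Suc by blast
  have fF: "f \<in> F" using f(1) marks_subset by blast
  have eH: "e \<in> H" "e \<notin> F" and ec: "\<And>g. g \<in> F \<Longrightarrow> \<not> conf c e g" using e(1) unfolding sink_def by auto
  have Ff: "indep (F - {f})" using F acyc_subset[of F "F - {f}"] unfolding indep_def by blast
  have "sink (F - {f}) e" using e(1) unfolding sink_def by blast
  from indep_add[OF Ff this f(2)] show F': "indep F'" and "card F' = card F"
    using card_Suc_Diff1[OF indep_finite[OF F] fF] unfolding F'_def by simp_all
  \<comment> \<open>A sink crossing an earlier layer would make that layer reachable, against the
    minimality of \<open>j\<close>.\<close>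
  have nc: "\<not> crossing (F - marks F l) e" if "l < j" for l
    using least[OF that] e(1) unfolding reach_def by blast
  have cr: "crossing (F' - marks F' l) g"
    if l: "l < j" and mm: "marks F l \<subseteq> marks F' l" and g: "crossing (F - marks F l) g" for l g
  proof -
    obtain a b where ab: "e = {a, b}" using H_pair[OF eH(1)] by blast
    have "(a, b) \<in> conn (F - marks F l)" using nc[OF l] unfolding ab crossing_pair by blast
    then have "conn (insert e (F - marks F l)) = conn (F - marks F l)" unfolding ab by (rule conn_insert_conn)
    moreover have "conn (F' - marks F' l) \<subseteq> conn (insert e (F - marks F l))"
      by (rule conn_mono) (use mm in \<open>auto simp: F'_def\<close>)
    ultimately show ?thesis using g unfolding crossing_def by blast
  qed
  \<comment> \<open>So \<open>f\<close> is marked only in the last layer, and its removal leaves the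
    earlier marks intact.\<close>
  have f_not: "f \<notin> marks F i"
    using crossing_mono[of "F - marks F i" "F - {f}" e] f(2) nc[of i] i by blast
  have mm: "l \<le> i \<Longrightarrow> marks F l \<subseteq> marks F' l" for l
  proof (induction l)
    case (Suc l)
    have IH: "marks F l \<subseteq> marks F' l" using Suc by simp
    have "g \<in> marks F' (Suc l)" if g: "g \<in> F" "h \<in> H - F" "crossing (F - marks F l) h" "conf c h g"
      "g \<in> marks F (Suc l)" for g h
    proof -
      have "g \<noteq> f" using f_not marks_mono[OF Suc.prems, of F] g(5) by blast
      then have "g \<in> F'" using g by (simp add: F'_def)
      moreover have "h \<noteq> e" using ec g(1,4) by blast
      then have "h \<in> H - F'" using g by (simp add: F'_def)
      moreover have "crossing (F' - marks F' l) h" using cr[OF _ IH g(3)] Suc.prems i by simp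
      ultimately show ?thesis using g(4) by auto
    qed
    then show ?case using IH by auto
  qed simp
  show "j > 0" by (rule j0)
  \<comment> \<open>The edge that caused the mark on \<open>f\<close> is the new sink:
    \<open>conf\<close> is transitive on \<open>H\<close>, so a conflict of \<open>h\<close> with
    \<open>F'\<close> would give a conflict of \<open>f\<close> with \<open>e\<close> or with
    another edge of \<open>F\<close>.\<close>
  obtain h where h: "h \<in> H - F" "crossing (F - marks F i) h" "conf c h f"
    using f(1) f_not unfolding i by auto
  have he: "h \<noteq> e" using ec fF h(3) by blast
  have fH: "f \<in> H" "F \<subseteq> H" using fF F unfolding indep_def by auto
  have "sink F' h"
    unfolding sink_def
  proof (intro conjI ballI notI)
    show "h \<in> H - F'" using h he by (simp add: F'_def)
    fix g assume g: "g \<in> F'" "conf c h g"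
    have gH: "g \<in> H" using F' g unfolding indep_def by blast
    have fg: "conf c f g" using conf_trans[OF fH(1) _ gH conf_sym[OF h(3)] g(2)] h(1) by blast
    show False
    proof (cases "g = e")
      case True
      then show ?thesis using fg ec[OF fF] conf_sym by blast
    next
      case False
      then have "g \<in> F" "g \<noteq> f" using g by (auto simp: F'_def)
      then show ?thesis using F fF fg unfolding indep_def by blast
    qed
  qed
  then show "reach F' (j - 1)"
    unfolding reach_def using cr[OF _ mm h(2)] i by auto
qed

lemma potential_add:
  assumes "card F' = Suc (card F)" "(LEAST j. reach F' j) < n"
  shows "potential n F < potential n F'"
proof -
  have "card F' * n = card F * n + n" using assms(1) by simp
  moreover have "n - (LEAST j. reach F j) \<le> n" "0 < n - (LEAST j. reach F' j)" using assms(2) by simp_all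
  ultimately show ?thesis unfolding potential_def by linarith
qed

lemma potential_exchange:
  assumes "card F' = card F" "\<And>i. i < j \<Longrightarrow> \<not> reach F i" "reach F j" "j > 0" "reach F' (j - 1)" "j < n"
  shows "potential n F < potential n F'"
proof -
  have "(LEAST i. reach F i) = j" using assms(2,3) by (metis LeastI Least_le linorder_neqE_nat not_less)
  moreover have "(LEAST i. reach F' i) \<le> j - 1" using assms(5) by (rule Least_le)
  ultimately show ?thesis using assms by (simp add: potential_def)
qed

lemma indep_card:
  assumes "indep F" "W \<noteq> {}" shows "card F < card W"
proof -
  have "F \<subseteq> doubletons W" "acyc F" using assms H unfolding indep_def by auto
  then have "card (parts W F) + card F = card W" by (rule card_parts[OF W])
  moreover have "card (parts W F) > 0" using assms(2) W by (simp add: parts_def card_gt_0_iff)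
  ultimately show ?thesis by simp
qed

text \<open>The rank formula for \<open>F - M\<close>. If \<open>F\<close> lacks two edges to be a
  spanning tree at least, then \<open>F - M\<close> has at least \<open>card M + 2\<close>
  components, the number on which all counting arguments build.\<close>

lemma stuck_parts:
  assumes "indep F" "M \<subseteq> F"
  shows "card (parts W (F - M)) + card F = card W + card M"
proof -
  have "F - M \<subseteq> doubletons W" "acyc (F - M)"
    using assms H acyc_subset[of F "F - M"] unfolding indep_def by auto
  then have "card (parts W (F - M)) + card (F - M) = card W" by (rule card_parts[OF W])
  moreover have "card (F - M) + card M = card F"
    using assms indep_finite[OF assms(1)]
    by (metis card_Diff_subset card_mono finite_subset le_add_diff_inverse2)
  ultimately show ?thesis by simp
qed

end

section \<open>Counting color degrees\<close>

text \<open>In terms of the slacks of the hypotheses, the main inequality bounds a sum of nonnegative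
  products by zero.\<close>

lemma arith_many_centers:
  fixes d z M q n0 k Y0 Y1 A B :: int
  assumes "d \<ge> 4" "z \<ge> d" "M \<ge> 1" "q = z - M + 1" "q + n0 \<ge> k + 2" "k \<ge> z" "Y0 \<ge> n0" "Y1 \<ge> 0"
    "z + Y1 + Y0 \<le> 2 * d + 1" "A \<le> z + M * (M - 1)" "B \<le> M * Y1"
    "2 * z * (d + 1) \<le> A + 2 * B + 2 * k + z * z"
  shows "z + Y1 + Y0 = 2 * d + 1 \<and> A = z + M * (M - 1) \<and> B = M * Y1 \<and> k = z \<and> Y0 = n0 \<and>
    (z = 2 * d - 1 \<and> M = 1 \<and> Y1 = 0 \<or> z = d \<and> M = d \<and> Y1 = 0 \<or> z = d \<and> M = d - 1 \<and> Y1 = 1)"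
proof -
  define a where "a = z + M * (M - 1) - A"
  define b where "b = M * Y1 - B"
  define \<delta> where "\<delta> = k - z"
  define \<beta> where "\<beta> = n0 - (k + 1 - z + M)"
  define \<alpha> where "\<alpha> = Y0 - n0"
  \<comment> \<open>One less than the number of vertices that are no centers.
    \<open>M \<le> u \<le> z\<close> is what makes the products in \<open>key\<close>
    nonnegative.\<close>
  define u where "u = Y1 + Y0 - 1"
  define \<epsilon> where "\<epsilon> = 2 * d - z - u"
  have nn: "a \<ge> 0" "b \<ge> 0" "\<delta> \<ge> 0" "\<beta> \<ge> 0" "\<alpha> \<ge> 0" "\<epsilon> \<ge> 0"
    using assms by (auto simp: a_def b_def \<delta>_def \<beta>_def \<alpha>_def \<epsilon>_def u_def)
  have Y1: "Y1 = u - M - \<delta> - \<beta> - \<alpha>" by (simp add: u_def \<delta>_def \<beta>_def \<alpha>_def)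
  have uM: "u \<ge> M" using Y1 assms(8) nn by simp
  have zu: "z \<ge> u" using assms(2) nn(6) by (simp add: \<epsilon>_def)
  have d2: "2 * d = z + u + \<epsilon>" by (simp add: \<epsilon>_def)
  have key: "(z - u) * (u - 1) + (u - M) * (u - M - 1) + z * \<epsilon> + 2 * (M - 1) * \<delta> + 2 * M * (\<alpha> + \<beta>) + a + 2 * b \<le> 0"
  proof -
    have "A = z + M * (M - 1) - a" "B = M * (u - M - \<delta> - \<beta> - \<alpha>) - b" "k = z + \<delta>"
      using Y1 by (auto simp: a_def b_def \<delta>_def)
    moreover have "z * (z + u + \<epsilon>) + 2 * z \<le> A + 2 * B + 2 * k + z * z"
    proof -
      have "2 * z * (d + 1) = z * (2 * d) + 2 * z" by (simp add: algebra_simps)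
      then show ?thesis using assms(12) unfolding d2 by simp
    qed
    ultimately show ?thesis by (simp add: algebra_simps)
  qed
  have t1: "(z - u) * (u - 1) \<ge> 0" using zu uM assms(3) by simp
  have t2: "(u - M) * (u - M - 1) \<ge> 0"
    by (cases "u = M") (use uM in auto)
  have t3: "z * \<epsilon> \<ge> 0" using nn assms by simp
  have t4: "2 * (M - 1) * \<delta> \<ge> 0" using nn assms by simp
  have t5: "2 * M * (\<alpha> + \<beta>) \<ge> 0" using nn assms by simp
  have z1: "(z - u) * (u - 1) = 0" using key t1 t2 t3 t4 t5 nn by linarith
  have z2: "(u - M) * (u - M - 1) = 0" using key t1 t2 t3 t4 t5 nn by linarith
  have z3: "z * \<epsilon> = 0" using key t1 t2 t3 t4 t5 nn by linarith
  have z4: "2 * (M - 1) * \<delta> = 0" using key t1 t2 t3 t4 t5 nn by linarith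
  have z5: "2 * M * (\<alpha> + \<beta>) = 0" using key t1 t2 t3 t4 t5 nn by linarith
  have z6: "a = 0" "b = 0" using key t1 t2 t3 t4 t5 nn by linarith+
  have e0: "\<epsilon> = 0" using z3 assms by simp
  have ab0: "\<alpha> = 0" "\<beta> = 0" using z5 assms(3) nn by auto
  have cases: "u = 1 \<and> M = 1 \<or> z = u \<and> (M = u \<or> M = u - 1)"
    using z1 z2 uM assms(3) by auto
  \<comment> \<open>For \<open>M = 1\<close> the coefficient of \<delta> in \<open>z4\<close>
    vanishes; then \<open>u = 1\<close>, and \<open>Y1 \<ge> 0\<close> forces \<delta> = 0.\<close>
  have d0: "\<delta> = 0"
  proof (cases "M = 1")
    case True
    then have "u = 1" using cases d2 e0 assms(1) by auto
    then show ?thesis using Y1 assms(8) nn True by simp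
  next
    case False
    then show ?thesis using z4 by simp
  qed
  have eqs: "z + Y1 + Y0 = 2 * d + 1" "A = z + M * (M - 1)" "B = M * Y1" "k = z" "Y0 = n0"
    using e0 ab0 d0 z6 by (auto simp: a_def b_def \<delta>_def \<alpha>_def \<epsilon>_def u_def)
  have "z = 2 * d - 1 \<and> M = 1 \<and> Y1 = 0 \<or> z = d \<and> M = d \<and> Y1 = 0 \<or> z = d \<and> M = d - 1 \<and> Y1 = 1"
  proof -
    consider "u = 1" "M = 1" | "z = u" "M = u" | "z = u" "M = u - 1" using cases by blast
    then show ?thesis
    proof cases
      case 1
      then show ?thesis using d2 e0 ab0 d0 Y1 by simp
    next
      case 2
      then show ?thesis using d2 e0 ab0 d0 Y1 by simp
    next
      case 3
      then show ?thesis using d2 e0 ab0 d0 Y1 by simp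
    qed
  qed
  then show ?thesis using eqs by blast
qed

text \<open>The same for fewer than \<open>d\<close> centers. There a component without center has
  at least \<open>d + 1 - z\<close> vertices unless it is \<open>{v}\<close>, which is the origin of
  the bound on \<open>Y0\<close>. The one numerical solution left is refuted in
  \<open>count_parts\<close> by a single vertex.\<close>

lemma arith_few_centers:
  fixes d z M q n0 k Y0 Y1 A B :: int
  assumes "d \<ge> 4" "1 \<le> z" "z < d" "M \<ge> 1" "M \<le> z" "q = z - M + 1" "q + n0 \<ge> k + 2" "k \<ge> z"
    "Y0 \<ge> (d + 1 - z) * (n0 - 1) + 1" "Y1 \<ge> 0"
    "z + Y1 + Y0 \<le> 2 * d + 1" "A \<le> z + M * (M - 1)" "B \<le> M * Y1"
    "2 * z * (d + 1) \<le> A + 2 * B + 2 * k + z * z"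
  shows "z = 1 \<and> M = 1 \<and> n0 = 2 \<and> Y0 = d + 1 \<and> Y1 = d - 1"
proof -
  define a where "a = z + M * (M - 1) - A"
  define b where "b = M * Y1 - B"
  define \<delta> where "\<delta> = k - z"
  define \<beta> where "\<beta> = n0 - (k + 1 - z + M)"
  define s where "s = d + 1 - z"
  define \<alpha> where "\<alpha> = Y0 - (s * (n0 - 1) + 1)"
  define \<epsilon> where "\<epsilon> = 2 * d + 1 - z - Y1 - Y0"
  define t where "t = z - M"
  have nn: "a \<ge> 0" "b \<ge> 0" "\<delta> \<ge> 0" "\<beta> \<ge> 0" "\<alpha> \<ge> 0" "\<epsilon> \<ge> 0" "t \<ge> 0" "s \<ge> 2"
    using assms by (auto simp: a_def b_def \<delta>_def \<beta>_def \<alpha>_def \<epsilon>_def t_def s_def)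
  have n0: "n0 = M + \<delta> + \<beta> + 1" by (simp add: \<delta>_def \<beta>_def)
  have Y0: "Y0 = s * (M + \<delta> + \<beta>) + 1 + \<alpha>" using n0 by (simp add: \<alpha>_def)
  have Y1: "Y1 = 2 * d - z - \<epsilon> - s * (M + \<delta> + \<beta>) - \<alpha>" using Y0 by (simp add: \<epsilon>_def)
  have d: "d = M + t + s - 1" by (simp add: s_def t_def)
  have zt: "z = M + t" by (simp add: t_def)
  have key: "t * (t + 1) + 2 * (M * (M - 1)) + 2 * ((s - 2) * (t + M * (M - 1))) + 2 * (\<delta> * (M * s - 1))
     + 2 * (M * s * \<beta>) + 2 * (M * \<alpha>) + 2 * (M * \<epsilon>) + a + 2 * b \<le> 0"
  proof -
    have "A = z + M * (M - 1) - a" "B = M * Y1 - b" "k = z + \<delta>"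
      by (auto simp: a_def b_def \<delta>_def)
    then show ?thesis using assms(14) unfolding Y1 zt d by (simp add: algebra_simps)
  qed
  have mm: "M * (M - 1) \<ge> 0" using assms(4) by simp
  have "M * s \<ge> 1 * 2" by (rule mult_mono) (use assms(4) nn in auto)
  then have t4: "\<delta> * (M * s - 1) \<ge> \<delta>" using nn(3) mult_left_mono[of 1 "M * s - 1" \<delta>] by simp
  have t1: "t * (t + 1) \<ge> t" using nn(7) mult_left_mono[of 1 "t + 1" t] by simp
  have t3: "(s - 2) * (t + M * (M - 1)) \<ge> 0" using nn mm by simp
  have t5: "M * s * \<beta> \<ge> \<beta>" using nn(4) \<open>M * s \<ge> 1 * 2\<close> mult_right_mono[of 1 "M * s" \<beta>] by simp
  have t6: "M * \<alpha> \<ge> \<alpha>" using nn(5) assms(4) mult_right_mono[of 1 M \<alpha>] by simp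
  have t7: "M * \<epsilon> \<ge> \<epsilon>" using nn(6) assms(4) mult_right_mono[of 1 M \<epsilon>] by simp
  have z: "t = 0" "M * (M - 1) = 0" "\<delta> = 0" "\<beta> = 0" "\<alpha> = 0" "\<epsilon> = 0"
    using key t1 mm t3 t4 t5 t6 t7 nn by linarith+
  then have "M = 1" using assms(4) by auto
  then show ?thesis using z n0 Y0 Y1 zt d by simp
qed

lemma card_eq_sum_one:
  assumes "finite S" "(\<Sum>P\<in>S. f P) \<le> card S" "\<And>P. P \<in> S \<Longrightarrow> 1 \<le> f P" "P \<in> S"
  shows "f P = (1::nat)"
proof (rule ccontr)
  assume "f P \<noteq> 1"
  then have "f P > 1" using assms(3)[OF assms(4)] by simp
  then have "(\<Sum>P\<in>S. 1) < (\<Sum>P\<in>S. f P)"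
    by (intro sum_strict_mono_ex1) (use assms in auto)
  then show False using assms(2) by simp
qed

lemma sum_by_parts:
  fixes g :: "'a set \<Rightarrow> nat"
  assumes "finite U" "Z \<subseteq> U" "\<And>x y. x \<in> U \<Longrightarrow> y \<in> U \<Longrightarrow> y \<in> part x \<longleftrightarrow> part y = part x"
  shows "(\<Sum>z\<in>Z. g (part z)) = (\<Sum>P\<in>part ` Z. card (P \<inter> Z) * g P)"
proof -
  have fZ: "finite Z" using assms finite_subset by blast
  have "(\<Sum>z\<in>Z. g (part z)) = (\<Sum>P\<in>part ` Z. \<Sum>z | z \<in> Z \<and> part z = P. g (part z))"
    by (rule sum.image_gen[OF fZ])
  also have "\<dots> = (\<Sum>P\<in>part ` Z. card (P \<inter> Z) * g P)"
  proof (rule sum.cong[OF refl])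
    fix P assume "P \<in> part ` Z"
    then obtain x where x: "x \<in> Z" "P = part x" by blast
    have "{z \<in> Z. part z = P} = P \<inter> Z" using assms(2,3) x by blast
    moreover have "(\<Sum>z | z \<in> Z \<and> part z = P. g (part z)) = (\<Sum>z | z \<in> Z \<and> part z = P. g P)"
      by (rule sum.cong) auto
    ultimately show "(\<Sum>z | z \<in> Z \<and> part z = P. g (part z)) = card (P \<inter> Z) * g P" by simp
  qed
  finally show ?thesis .
qed

text \<open>The pairs counted by \<open>I\<close>, their reverses, and the pairs inside a common
  part are disjoint subsets of \<open>Z \<times> Z\<close>.\<close>

lemma sum_oriented_pairs:
  assumes Z: "finite Z" and I: "\<And>z. z \<in> Z \<Longrightarrow> I z \<subseteq> Z - part z"
    and asym: "\<And>x z. z \<in> Z \<Longrightarrow> x \<in> I z \<Longrightarrow> z \<notin> I x"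
    and self: "\<And>z. z \<in> Z \<Longrightarrow> part z \<inter> Z = {x \<in> Z. part x = part z}"
  shows "2 * (\<Sum>z\<in>Z. card (I z)) + (\<Sum>z\<in>Z. card (part z \<inter> Z)) \<le> card Z * card Z"
proof -
  let ?A = "SIGMA z:Z. I z" and ?B = "SIGMA z:Z. part z \<inter> Z"
  have fin: "finite (I z)" if "z \<in> Z" for z using I[OF that] Z finite_subset by blast
  have A: "card ?A = (\<Sum>z\<in>Z. card (I z))" by (rule card_SigmaI) (use Z fin in auto)
  have B: "card ?B = (\<Sum>z\<in>Z. card (part z \<inter> Z))" by (rule card_SigmaI) (use Z in auto)
  have fA: "finite ?A" "finite ?B" using Z fin by auto
  have C: "card (?A\<inverse>) = card ?A" by simp
  have "card ?A + card (?A\<inverse>) + card ?B = card (?A \<union> ?A\<inverse> \<union> ?B)"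
  proof -
    have "?A \<inter> ?A\<inverse> = {}" using asym by blast
    moreover have "(?A \<union> ?A\<inverse>) \<inter> ?B = {}"
    proof -
      have False if "z \<in> Z" "x \<in> I z" "x \<in> part z \<or> x \<in> Z \<and> z \<in> part x" for x z
      proof -
        have x: "x \<in> Z" "x \<notin> part z" using I that by blast+
        then have "z \<in> part x" using that(3) by blast
        then have "z \<in> {y \<in> Z. part y = part x}" using self[OF x(1)] that(1) by blast
        then have "x \<in> {y \<in> Z. part y = part z}" using x by auto
        then have "x \<in> part z" using self[OF that(1)] by blast
        then show False using x by blast
      qed
      then show ?thesis by blast
    qed
    ultimately show ?thesis using fA by (simp add: card_Un_disjoint)
  qed
  also have "\<dots> \<le> card (Z \<times> Z)" by (rule card_mono) (use Z I in auto)
  finally show ?thesis using A B C by (simp add: card_cartesian_product)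
qed

text \<open>Here \<open>part x\<close> is the component of \<open>x\<close> in \<open>F - M\<close>, \<open>cn x\<close> the number of edges of \<open>M\<close> with center \<open>x\<close>, and
  \<open>I w\<close> the set of centers that account for the colors at \<open>w\<close> toward other components which do not
  come from stars centered at \<open>w\<close>.\<close>

theorem count_parts:
  fixes U :: "'a set" and part :: "'a \<Rightarrow> 'a set" and cn :: "'a \<Rightarrow> nat" and I :: "'a \<Rightarrow> 'a set" and d :: nat
  defines "Z \<equiv> {x \<in> U. cn x > 0}"
  assumes U: "finite U" and part: "\<And>x. x \<in> U \<Longrightarrow> x \<in> part x \<and> part x \<subseteq> U"
    "\<And>x y. x \<in> U \<Longrightarrow> y \<in> U \<Longrightarrow> y \<in> part x \<longleftrightarrow> part y = part x"
    and N: "(\<Sum>x\<in>U. cn x) + 2 \<le> card (part ` U)" and v: "v \<in> U" "v \<notin> Z" and d: "d \<ge> 4"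
    and U2: "card U \<le> 2 * d + 1"
    and deg: "\<And>w. w \<in> U \<Longrightarrow> w \<noteq> v \<Longrightarrow> d + 1 \<le> card (part w) + cn w + card (I w)"
    and I: "\<And>w. w \<in> U \<Longrightarrow> I w \<subseteq> Z - part w" and asym: "\<And>x z. z \<in> Z \<Longrightarrow> x \<in> I z \<Longrightarrow> z \<notin> I x"
    and v2: "Z = {} \<Longrightarrow> card (part v) \<ge> 2"
  shows "card U = 2 * d + 1 \<and> (\<forall>z\<in>Z. cn z = 1) \<and>
    (card Z = 2 * d - 1 \<and> (\<forall>x\<in>U. part x = {x}) \<or>
     card Z = d \<and> (\<exists>D\<in>part ` U. card D = d \<and> (\<forall>x\<in>U - D. part x = {x}) \<and> card (Z - D) \<le> 1))"
proof -
  define PZ where "PZ = part ` Z"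
  define P0 where "P0 = part ` U - PZ"
  define k where "k = (\<Sum>x\<in>U. cn x)"
  define z where "z = card Z"
  define q where "q = card PZ"
  define n0 where "n0 = card P0"
  define Y1 where "Y1 = (\<Sum>P\<in>PZ. card (P - Z))"
  define Y0 where "Y0 = (\<Sum>P\<in>P0. card P)"
  define A where "A = (\<Sum>P\<in>PZ. card (P \<inter> Z) * card (P \<inter> Z))"
  define B where "B = (\<Sum>P\<in>PZ. card (P \<inter> Z) * card (P - Z))"
  have ZU: "Z \<subseteq> U" and fZ: "finite Z" using U by (auto simp: Z_def)
  have fin: "finite (part ` U)" "finite PZ" "finite P0" using U fZ by (auto simp: PZ_def P0_def)
  have PZU: "PZ \<subseteq> part ` U" using ZU by (auto simp: PZ_def)
  have finP: "finite P" "P \<subseteq> U" "P \<noteq> {}" if P: "P \<in> part ` U" for P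
  proof -
    obtain x where x: "x \<in> U" "P = part x" using P by blast
    show "P \<subseteq> U" "P \<noteq> {}" using part(1)[OF x(1)] x by auto
    then show "finite P" using U finite_subset by blast
  qed
  have member: "part x = P" if P: "P \<in> part ` U" and x: "x \<in> P" for x P
  proof -
    obtain y where y: "y \<in> U" "P = part y" using P by blast
    have "x \<in> U" using x finP(2)[OF P] by blast
    then show ?thesis using part(2)[OF y(1) \<open>x \<in> U\<close>] y x by simp
  qed
  have PZ_iff: "P \<in> PZ \<longleftrightarrow> P \<inter> Z \<noteq> {}" if P: "P \<in> part ` U" for P
  proof
    assume "P \<in> PZ"
    then obtain x where "x \<in> Z" "P = part x" by (auto simp: PZ_def)
    then show "P \<inter> Z \<noteq> {}" using part(1) ZU by blast
  next
    assume "P \<inter> Z \<noteq> {}"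
    then obtain x where x: "x \<in> P" "x \<in> Z" by blast
    then show "P \<in> PZ" using member[OF P x(1)] by (auto simp: PZ_def)
  qed
  have Pc: "card P = card (P \<inter> Z) + card (P - Z)" if "P \<in> part ` U" for P
    by (subst card_Un_disjoint[symmetric]) (use finP(1)[OF that] in \<open>auto intro: arg_cong[where f=card]\<close>)
  have cardU: "card U = (\<Sum>P\<in>part ` U. card P)"
  proof -
    have "card U = (\<Sum>x\<in>U. 1)" by simp
    also have "\<dots> = (\<Sum>P\<in>part ` U. card (P \<inter> U) * 1)"
      by (rule sum_by_parts[OF U order_refl part(2), where g="\<lambda>_. 1"])
    also have "\<dots> = (\<Sum>P\<in>part ` U. card P)"
      by (rule sum.cong) (use finP(2) in \<open>auto simp: Int_absorb2\<close>)
    finally show ?thesis .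
  qed
  have split: "(\<Sum>P\<in>part ` U. f P) = (\<Sum>P\<in>PZ. f P) + (\<Sum>P\<in>P0. f P)" for f :: "'a set \<Rightarrow> nat"
    using sum.subset_diff[OF PZU fin(1), of f] by (simp add: P0_def)
  have zsum: "(\<Sum>P\<in>PZ. card (P \<inter> Z)) = z"
    using sum_by_parts[OF U ZU part(2), where g="\<lambda>_. 1"] by (simp add: PZ_def z_def)
  have sz: "card U = z + Y1 + Y0"
    unfolding cardU split using zsum Pc PZU by (simp add: Y1_def Y0_def sum.distrib subset_iff)
  have nN: "k + 2 \<le> q + n0"
    using N card_Diff_subset[OF fin(2) PZU] card_mono[OF fin(1) PZU] by (simp add: k_def q_def n0_def P0_def)
  have kZ: "k = (\<Sum>x\<in>Z. cn x)"
    unfolding k_def by (rule sum.mono_neutral_right[OF U ZU]) (auto simp: Z_def)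
  have kz: "z \<le> k"
    unfolding kZ z_def using sum_mono[of Z "\<lambda>_. 1" cn] by (simp add: Z_def Suc_le_eq)
  have zP1: "card (P \<inter> Z) \<ge> 1" if "P \<in> PZ" for P
    using PZ_iff[of P] that PZU fZ by (auto simp: Suc_le_eq card_gt_0_iff)
  have P1: "card P \<ge> 1" if "P \<in> part ` U" for P
    using finP[OF that] by (simp add: Suc_le_eq card_gt_0_iff)
  have Y0n: "n0 \<le> Y0"
    unfolding n0_def Y0_def using sum_mono[of P0 "\<lambda>_. 1" card] P1 by (simp add: P0_def)
  \<comment> \<open>The degree bounds summed over the centers and doubled, so that
    \<open>sum_oriented_pairs\<close> can absorb the terms \<open>card (I w)\<close>.\<close>
  have degsum: "2 * z * (d + 1) \<le> A + 2 * B + 2 * k + z * z"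
  proof -
    have "z * (d + 1) = (\<Sum>w\<in>Z. d + 1)" by (simp add: z_def)
    also have "\<dots> \<le> (\<Sum>w\<in>Z. card (part w) + cn w + card (I w))"
      by (rule sum_mono) (use deg ZU v in blast)
    also have "\<dots> = (\<Sum>w\<in>Z. card (part w)) + k + (\<Sum>w\<in>Z. card (I w))"
      by (simp add: sum.distrib kZ)
    finally have 1: "z * (d + 1) \<le> (\<Sum>w\<in>Z. card (part w)) + k + (\<Sum>w\<in>Z. card (I w))" .
    have "(\<Sum>w\<in>Z. card (part w)) = (\<Sum>P\<in>PZ. card (P \<inter> Z) * card P)"
      unfolding PZ_def by (rule sum_by_parts[OF U ZU part(2)])
    also have "\<dots> = (\<Sum>P\<in>PZ. card (P \<inter> Z) * card (P \<inter> Z) + card (P \<inter> Z) * card (P - Z))"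
      by (rule sum.cong) (use Pc PZU in \<open>auto simp: distrib_left subset_iff\<close>)
    also have "\<dots> = A + B" by (simp add: A_def B_def sum.distrib)
    finally have 2: "(\<Sum>w\<in>Z. card (part w)) = A + B" .
    have "2 * (\<Sum>w\<in>Z. card (I w)) + (\<Sum>w\<in>Z. card (part w \<inter> Z)) \<le> card Z * card Z"
    proof (rule sum_oriented_pairs[OF fZ _ asym])
      show "I w \<subseteq> Z - part w" if "w \<in> Z" for w using I ZU that by blast
      show "part w \<inter> Z = {x \<in> Z. part x = part w}" if "w \<in> Z" for w
        using part(2)[of w] ZU that by blast
    qed
    moreover have "(\<Sum>w\<in>Z. card (part w \<inter> Z)) = A"
      unfolding A_def PZ_def by (rule sum_by_parts[OF U ZU part(2), where g="\<lambda>P. card (P \<inter> Z)"])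
    ultimately show ?thesis using 1 2 by (simp add: z_def)
  qed
  \<comment> \<open>Without centers every part other than \<open>{v}\<close> has at least
    \<open>d + 1\<close> vertices, \<open>v2\<close> excludes \<open>{v}\<close>, and two such parts
    exceed \<open>2 * d + 1\<close>.\<close>
  have Z0: "Z \<noteq> {}"
  proof
    assume Z: "Z = {}"
    have big: "d + 1 \<le> card (part w)" if "w \<in> U" "w \<noteq> v" for w
    proof -
      have "cn w = 0" using that(1) Z by (auto simp: Z_def)
      moreover have "I w = {}" using I[OF that(1)] Z by blast
      ultimately show ?thesis using deg[OF that] by simp
    qed
    have "2 \<le> card (part v)" using v2 Z by simp
    then have "part v \<noteq> {v}" by auto
    then obtain w where w: "w \<in> part v" "w \<noteq> v" using part(1)[OF v(1)] by blast
    have wU: "w \<in> U" using w part(1)[OF v(1)] by blast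
    have pv: "part w = part v" using part(2)[OF v(1) wU] w by simp
    then have bv: "d + 1 \<le> card (part v)" using big[OF wU w(2)] by simp
    have "2 \<le> card (part ` U)" using N by simp
    then have "part ` U \<noteq> {part v}" by auto
    then obtain x where x: "x \<in> U" "part x \<noteq> part v" using v(1) by blast
    have "x \<noteq> v" using x by blast
    then have bx: "d + 1 \<le> card (part x)" using big x by blast
    have "(\<Sum>P\<in>{part v, part x}. card P) \<le> (\<Sum>P\<in>part ` U. card P)"
      by (rule sum_mono2) (use fin x v in auto)
    then show False using cardU U2 bv bx x(2) by simp
  qed
  have q1: "q \<ge> 1" and z1: "z \<ge> 1" using Z0 fin fZ by (auto simp: q_def z_def PZ_def Suc_le_eq card_gt_0_iff)
  \<comment> \<open>The largest number of centers that one part can hold when \<open>q\<close> parts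
    share \<open>z\<close> centers and each has at least one.\<close>
  define M where "M = int z - int q + 1"
  have rest: "card (P \<inter> Z) + (q - 1) \<le> z" if P: "P \<in> PZ" for P
  proof -
    have "q - 1 = (\<Sum>P\<in>PZ - {P}. 1)" using P fin(2) by (simp add: q_def)
    also have "\<dots> \<le> (\<Sum>P\<in>PZ - {P}. card (P \<inter> Z))" by (rule sum_mono) (use zP1 in auto)
    finally show ?thesis using sum.remove[OF fin(2) P, of "\<lambda>P. card (P \<inter> Z)"] zsum by simp
  qed
  have zM: "int (card (P \<inter> Z)) \<le> M" if P: "P \<in> PZ" for P
    using rest[OF P] q1 by (simp add: M_def)
  have qz: "q \<le> z" using sum_mono[of PZ "\<lambda>_. 1" "\<lambda>P. card (P \<inter> Z)"] zP1 zsum by (simp add: q_def)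
  have M1: "M \<ge> 1" "M \<le> int z" using qz q1 by (auto simp: M_def)
  \<comment> \<open>\<open>A - z\<close> is the sum of \<open>p * (p - 1)\<close> over the parts,
    \<open>p\<close> being the number of centers. Replacing the first factor by \<open>M\<close>
    leaves \<open>M * (z - q)\<close>, and \<open>z - q = M - 1\<close>.\<close>
  have Ab: "int A \<le> int z + M * (M - 1)"
  proof -
    have "int A - int z = (\<Sum>P\<in>PZ. int (card (P \<inter> Z)) * (int (card (P \<inter> Z)) - 1))"
      unfolding zsum[symmetric] A_def by (simp add: sum_subtractf algebra_simps)
    also have "\<dots> \<le> (\<Sum>P\<in>PZ. M * (int (card (P \<inter> Z)) - 1))"
    proof (intro sum_mono mult_right_mono)
      fix P assume P: "P \<in> PZ"
      show "int (card (P \<inter> Z)) \<le> M" by (rule zM[OF P])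
      show "0 \<le> int (card (P \<inter> Z)) - 1" using zP1[OF P] by linarith
    qed
    also have "\<dots> = M * (int z - int q)"
      by (simp add: sum_distrib_left[symmetric] sum_subtractf q_def zsum[symmetric])
    finally show ?thesis by (simp add: M_def)
  qed
  have Bb: "int B \<le> M * int Y1"
  proof -
    have "int B = (\<Sum>P\<in>PZ. int (card (P \<inter> Z)) * int (card (P - Z)))" by (simp add: B_def)
    also have "\<dots> \<le> (\<Sum>P\<in>PZ. M * int (card (P - Z)))"
      by (rule sum_mono, rule mult_right_mono) (use zM in auto)
    finally show ?thesis by (simp add: Y1_def sum_distrib_left)
  qed
  have deg': "2 * int z * (int d + 1) \<le> int A + 2 * int B + 2 * int k + int z * int z"
    using degsum[folded of_nat_le_iff[where 'a=int]]
    by (simp only: of_nat_add of_nat_mult of_nat_numeral of_nat_1)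
  have small: "card P + z \<ge> d + 1" if P: "P \<in> P0" "P \<noteq> {v}" for P
  proof -
    have PU: "P \<in> part ` U" using P by (simp add: P0_def)
    obtain w where w: "w \<in> P" "w \<noteq> v" using P(2) finP(3)[OF PU] by blast
    have wU: "w \<in> U" using finP(2)[OF PU] w by blast
    have "w \<notin> Z" using PZ_iff[OF PU] P(1) w by (auto simp: P0_def)
    then have "cn w = 0" using wU by (simp add: Z_def)
    moreover have "card (I w) \<le> z" unfolding z_def by (rule card_mono[OF fZ]) (use I[OF wU] in blast)
    ultimately show ?thesis using deg[OF wU w(2)] member[OF PU w(1)] by simp
  qed
  have zd: "z \<ge> d"
  proof (rule ccontr)
    assume "\<not> z \<ge> d"
    then have zd: "z < d" by simp
    then have dz: "int (d + 1 - z) = int d + 1 - int z" by simp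
    have Y0s: "int Y0 \<ge> (int d + 1 - int z) * (int n0 - 1) + 1"
    proof (cases "{v} \<in> P0")
      case True
      have "(\<Sum>P\<in>P0 - {{v}}. d + 1 - z) \<le> (\<Sum>P\<in>P0 - {{v}}. card P)"
      proof (rule sum_mono)
        fix P assume "P \<in> P0 - {{v}}"
        then show "d + 1 - z \<le> card P" using small[of P] by simp
      qed
      moreover have "Y0 = 1 + (\<Sum>P\<in>P0 - {{v}}. card P)"
        using sum.remove[OF fin(3) True, of card] by (simp add: Y0_def)
      moreover have "card (P0 - {{v}}) = n0 - 1" "n0 \<ge> 1"
        using True fin(3) by (auto simp: n0_def Suc_le_eq card_gt_0_iff)
      ultimately have "1 + (n0 - 1) * (d + 1 - z) \<le> Y0" "n0 \<ge> 1" by auto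
      then have "int (1 + (n0 - 1) * (d + 1 - z)) \<le> int Y0" by linarith
      moreover have "int (1 + (n0 - 1) * (d + 1 - z)) = (int d + 1 - int z) * (int n0 - 1) + 1"
        using of_nat_diff[OF \<open>n0 \<ge> 1\<close>, where 'a=int] dz by (simp only: of_nat_add of_nat_mult of_nat_1 mult.commute add.commute)
      ultimately show ?thesis by simp
    next
      case False
      have "(\<Sum>P\<in>P0. d + 1 - z) \<le> (\<Sum>P\<in>P0. card P)"
      proof (rule sum_mono)
        fix P assume "P \<in> P0"
        moreover from this have "P \<noteq> {v}" using False by blast
        ultimately show "d + 1 - z \<le> card P" using small[of P] by simp
      qed
      then have "n0 * (d + 1 - z) \<le> Y0" by (simp add: Y0_def n0_def)
      then have "int (n0 * (d + 1 - z)) \<le> int Y0" by linarith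
      moreover have "int (n0 * (d + 1 - z)) = (int d + 1 - int z) * int n0"
        using dz by (simp only: of_nat_mult mult.commute)
      ultimately show ?thesis using zd by (simp add: algebra_simps)
    qed
    have "int z = 1 \<and> M = 1 \<and> int n0 = 2 \<and> int Y0 = int d + 1 \<and> int Y1 = int d - 1"
      by (rule arith_few_centers[where q="int q" and k="int k" and A="int A" and B="int B"])
        (use d z1 zd M1 nN kz Y0s sz U2 Ab Bb deg' in \<open>auto simp: M_def\<close>)
    then have e: "z = 1" "q = 1" "n0 = 2" "Y0 = d + 1" "Y1 = d - 1" using d by (auto simp: M_def)
    have vP0: "{v} \<in> P0"
    proof (rule ccontr)
      assume h: "{v} \<notin> P0"
      have "(\<Sum>P\<in>P0. d) \<le> (\<Sum>P\<in>P0. card P)"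
      proof (rule sum_mono)
        fix P assume "P \<in> P0"
        moreover from this have "P \<noteq> {v}" using h by blast
        ultimately show "d \<le> card P" using small[of P] e(1) by simp
      qed
      then show False using e d by (simp add: Y0_def n0_def)
    qed
    \<comment> \<open>The surviving case: one center, lying in a part of \<open>d\<close> vertices.
      Any other vertex of that part has no star and no center outside the part, so
      \<open>deg\<close> would ask for \<open>d + 1\<close> vertices in the part.\<close>
    have "\<exists>P. PZ = {P}" using e(2) card_1_singleton_iff[of PZ] unfolding q_def by simp
    then obtain P where P: "PZ = {P}" by blast
    then have PU: "P \<in> part ` U" using PZU by blast
    have "card (P - Z) = d - 1" using e(5) P by (simp add: Y1_def)
    then have "0 < card (P - Z)" using d by simp
    then have "P - Z \<noteq> {}" unfolding card_gt_0_iff by blast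
    then obtain w where w: "w \<in> P" "w \<notin> Z" by blast
    have wU: "w \<in> U" using finP(2)[OF PU] w by blast
    have "w \<noteq> v"
    proof
      assume "w = v"
      have "{v} \<in> part ` U" using vP0 by (simp add: P0_def)
      from member[OF this] member[OF PU w(1)] have "{v} = P" using \<open>w = v\<close> by simp
      then show False using vP0 P by (simp add: P0_def)
    qed
    have "Z \<subseteq> P"
    proof
      fix x assume x: "x \<in> Z"
      then have "part x \<in> PZ" unfolding PZ_def by (rule imageI)
      then have "part x = P" using P by simp
      moreover have "x \<in> part x" using part(1) x ZU by blast
      ultimately show "x \<in> P" by simp
    qed
    then have "I w = {}" using I[OF wU] member[OF PU w(1)] by blast
    moreover have "cn w = 0" using w wU by (simp add: Z_def)
    moreover have "card P = d"
      using Pc[OF PU] \<open>card (P - Z) = d - 1\<close> \<open>Z \<subseteq> P\<close> e(1) d by (simp add: z_def Int_absorb1)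
    ultimately show False using deg[OF wU \<open>w \<noteq> v\<close>] member[OF PU w(1)] by simp
  qed
  have main: "int z + int Y1 + int Y0 = 2 * int d + 1 \<and> int A = int z + M * (M - 1) \<and> int B = M * int Y1 \<and>
    int k = int z \<and> int Y0 = int n0 \<and>
    (int z = 2 * int d - 1 \<and> M = 1 \<and> int Y1 = 0 \<or> int z = int d \<and> M = int d \<and> int Y1 = 0 \<or>
     int z = int d \<and> M = int d - 1 \<and> int Y1 = 1)"
    by (rule arith_many_centers[where q="int q"])
      (use d zd M1 nN kz Y0n sz U2 Ab Bb deg' in \<open>auto simp: M_def\<close>)
  have cn1: "\<forall>z\<in>Z. cn z = 1"
  proof
    fix x assume x: "x \<in> Z"
    have "k = z" using main by linarith
    then have "(\<Sum>x\<in>Z. cn x) \<le> card Z" using kZ by (simp add: z_def)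
    from card_eq_sum_one[OF fZ this _ x] show "cn x = 1" by (auto simp: Z_def)
  qed
  have single0: "card P = 1" if "P \<in> P0" for P
  proof -
    have "Y0 = n0" using main by linarith
    then have "(\<Sum>P\<in>P0. card P) \<le> card P0" by (simp add: Y0_def n0_def)
    moreover have "1 \<le> card P" if "P \<in> P0" for P using P1 that by (simp add: P0_def)
    ultimately show ?thesis using card_eq_sum_one[OF fin(3), of card P] that by blast
  qed
  have singleton: "part x = {x}" if h: "x \<in> U" "card (part x) = 1" for x
  proof -
    have "\<exists>y. part x = {y}" using h(2) card_1_singleton_iff[of "part x"] by simp
    then obtain y where y: "part x = {y}" by blast
    then show ?thesis using part(1)[OF h(1)] by simp
  qed
  have yc0: "card (P - Z) = 0" if "Y1 = 0" "P \<in> PZ" for P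
    using that fin(2) by (simp add: Y1_def)
  consider (a) "z = 2 * d - 1" "M = 1" "Y1 = 0" | (b) "z = d" "M = int d" "Y1 = 0" | (c) "z = d" "M = int d - 1" "Y1 = 1"
    using main d by auto
  then have "card Z = 2 * d - 1 \<and> (\<forall>x\<in>U. part x = {x}) \<or>
     card Z = d \<and> (\<exists>D\<in>part ` U. card D = d \<and> (\<forall>x\<in>U - D. part x = {x}) \<and> card (Z - D) \<le> 1)"
  proof cases
    case a
    have "card (part x) = 1" if x: "x \<in> U" for x
    proof (cases "part x \<in> PZ")
      case True
      then have "card (part x \<inter> Z) = 1" using zM[OF True] zP1[OF True] a(2) by simp
      then show ?thesis using Pc[of "part x"] yc0[OF a(3) True] x by simp
    next
      case False
      then show ?thesis using single0[of "part x"] x by (simp add: P0_def)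
    qed
    then show ?thesis using a singleton by (simp add: z_def)
  next
    case b
    have "q = 1" using b by (simp add: M_def)
    then have "\<exists>P. PZ = {P}" using card_1_singleton_iff[of PZ] unfolding q_def by simp
    then obtain P where P: "PZ = {P}" by blast
    have PU: "P \<in> part ` U" using P PZU by blast
    have ZP: "Z \<subseteq> P"
    proof
      fix x assume x: "x \<in> Z"
      then have "part x \<in> PZ" unfolding PZ_def by (rule imageI)
      then have "part x = P" using P by simp
      moreover have "x \<in> part x" using part(1) x ZU by blast
      ultimately show "x \<in> P" by simp
    qed
    have "card P = d" using Pc[OF PU] yc0[OF b(3), of P] P ZP b(1) by (simp add: z_def Int_absorb1)
    moreover have "part x = {x}" if "x \<in> U - P" for x
    proof -
      have "part x \<noteq> P" using that part(1) by blast
      then have "part x \<in> P0" using that P by (simp add: P0_def)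
      then show ?thesis using single0 singleton that by blast
    qed
    moreover have "card (Z - P) \<le> 1"
    proof -
      have "Z - P = {}" using ZP by blast
      then have "card (Z - P) = 0" by (simp only: card.empty)
      then show ?thesis by linarith
    qed
    ultimately have "\<exists>D\<in>part ` U. card D = d \<and> (\<forall>x\<in>U - D. part x = {x}) \<and> card (Z - D) \<le> 1"
      using PU by blast
    then show ?thesis using b(1) unfolding z_def by blast
  next
    case c
    have "card PZ = 2" using c d by (simp add: M_def q_def)
    then obtain P Q where PQ: "PZ = {P, Q}" "P \<noteq> Q" unfolding card_2_iff by blast
    have PU: "P \<in> part ` U" "Q \<in> part ` U" using PQ PZU by auto
    let ?p = "card (P \<inter> Z)" and ?r = "card (Q \<inter> Z)"
    have s: "?p + ?r = d" using zsum PQ c by simp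
    have yy: "card (P - Z) + card (Q - Z) = 1" using c(3) PQ by (simp add: Y1_def)
    have "int A = int d + (int d - 1) * (int d - 2)" using main c d by auto
    moreover have "int A = int ?p * int ?p + int ?r * int ?r" using PQ by (simp add: A_def)
    moreover have "int d = int ?p + int ?r" using s by simp
    \<comment> \<open>With \<open>p + r = d\<close> and
      \<open>p * p + r * r = d + (d - 1) * (d - 2)\<close> the product \<open>p * r\<close> equals
      \<open>d - 1\<close>.\<close>
    ultimately have "(int ?p - 1) * (int ?r - 1) = 0" by (simp add: algebra_simps)
    then have pr: "?p = 1 \<or> ?r = 1" by auto
    \<comment> \<open>The value of \<open>B\<close> places the only vertex of
      \<open>P \<union> Q\<close> that is no center in the part with \<open>d - 1\<close>
      centers.\<close>
    have Beq: "int ?p * int (card (P - Z)) + int ?r * int (card (Q - Z)) = int d - 1"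
      using main c d PQ by (auto simp: B_def)
    have core: ?thesis if X: "X \<in> part ` U" "Y \<in> part ` U" "PZ = {X, Y}" "X \<noteq> Y"
      and n: "card (X \<inter> Z) = d - 1" "card (Y \<inter> Z) = 1" "card (X - Z) = 1" "card (Y - Z) = 0" for X Y
    proof -
      have "card X = d" using Pc[OF X(1)] n d by simp
      moreover have cY: "card Y = 1" using Pc[OF X(2)] n by simp
      moreover have "part x = {x}" if x: "x \<in> U - X" for x
      proof -
        have "part x \<noteq> X" using x part(1) by blast
        then have "part x = Y \<or> part x \<in> P0" using x X(3) by (auto simp: P0_def)
        then show ?thesis using single0 singleton x cY by blast
      qed
      moreover have "card (Z - X) \<le> 1"
      proof -
        have "Z - X = Z - X \<inter> Z" by blast
        then have "card (Z - X) = card Z - card (X \<inter> Z)" using fZ by (simp add: card_Diff_subset)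
        then show ?thesis using n c(1) by (simp add: z_def)
      qed
      ultimately have "\<exists>D\<in>part ` U. card D = d \<and> (\<forall>x\<in>U - D. part x = {x}) \<and> card (Z - D) \<le> 1"
        using X(1) by blast
      then show ?thesis using c(1) unfolding z_def by blast
    qed
    show ?thesis
    proof (cases "?r = 1")
      case True
      then have p: "?p = d - 1" using s by simp
      have "card (P - Z) = 1 \<and> card (Q - Z) = 0"
        using Beq yy p True d by (cases "card (P - Z)") auto
      then show ?thesis using core[OF PU PQ(1,2)] p True by simp
    next
      case False
      then have p: "?p = 1" "?r = d - 1" using pr s by auto
      have "card (Q - Z) = 1 \<and> card (P - Z) = 0"
        using Beq yy p d by (cases "card (Q - Z)") auto
      then show ?thesis using core[OF PU(2,1)] PQ p by (simp add: insert_commute)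
    qed
  qed
  then show ?thesis using main sz cn1 by auto
qed

section \<open>Rigid configurations\<close>

definition unique_at :: "('a set \<Rightarrow> nat) \<Rightarrow> 'a set set \<Rightarrow> 'a \<Rightarrow> 'a \<Rightarrow> bool" where
  "unique_at c H a b \<longleftrightarrow> (\<forall>x. {a, x} \<in> H \<and> c {a, x} = c {a, b} \<longrightarrow> x = b)"

text \<open>Equivalently, every color class is a disjoint union of stars, which is what makes
  \<open>conf\<close> transitive.\<close>

definition star_colored :: "('a set \<Rightarrow> nat) \<Rightarrow> 'a set set \<Rightarrow> bool" where
  "star_colored c H \<longleftrightarrow> (\<forall>a b. {a, b} \<in> H \<longrightarrow> unique_at c H a b \<or> unique_at c H b a)"

text \<open>The output of the forest computation in the case of failure: the certificate of
  \<open>stuck\<close> together with the fact that the forest has at least two components.\<close>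

definition deficient :: "('a set \<Rightarrow> nat) \<Rightarrow> 'a set set \<Rightarrow> 'a set \<Rightarrow> 'a set set \<Rightarrow> 'a set set \<Rightarrow> bool" where
  "deficient c H W F M \<longleftrightarrow> F \<subseteq> H \<and> acyc F \<and> (\<forall>e\<in>F. \<forall>f\<in>F. conf c e f \<longrightarrow> e = f) \<and> M \<subseteq> F \<and>
     (\<forall>e\<in>H. crossing (F - M) e \<longrightarrow> (\<exists>f\<in>M. conf c e f)) \<and> card F + 2 \<le> card W"

lemma unique_atD: "unique_at c H a b \<Longrightarrow> {a, x} \<in> H \<Longrightarrow> c {a, x} = c {a, b} \<Longrightarrow> x = b"
  unfolding unique_at_def by blast

lemma unique_at_conf:
  assumes H: "H \<subseteq> doubletons W" and e: "e \<in> H" "a \<in> e" and u: "unique_at c H a b" and ce: "c e = c {a, b}"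
  shows "e = {a, b}"
proof -
  obtain x where x: "e = {a, x}" using doubletonsE[of e W a] H e by blast
  then have "x = b" using unique_atD[OF u, of x] e(1) ce by simp
  then show ?thesis using x by simp
qed

lemma star_colored_subset: "star_colored c H \<Longrightarrow> G \<subseteq> H \<Longrightarrow> star_colored c G"
  unfolding star_colored_def unique_at_def by blast

text \<open>Let \<open>f = {a, b}\<close> be alone in its color at \<open>b\<close>. An edge in
  conflict with \<open>f\<close> is \<open>f\<close> itself or contains \<open>a\<close>, so two
  such edges share \<open>a\<close> unless one of them is \<open>f\<close>.\<close>

lemma star_colored_conf_trans:
  assumes H: "H \<subseteq> doubletons W" "star_colored c H"
    and efg: "e \<in> H" "f \<in> H" "g \<in> H" "conf c e f" "conf c f g"
  shows "conf c e g"
proof -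
  obtain a b where ab: "f = {a, b}" using H(1) efg(2) unfolding doubletons_def by blast
  have core: "conf c e g" if f: "f = {a, b}" and u: "unique_at c H b a" for a b
  proof -
    have bb: "c f = c {b, a}" using f by (simp add: insert_commute)
    show ?thesis
    proof (cases "b \<in> e \<or> b \<in> g")
      case True
      then have "e = f \<or> g = f"
      proof
        assume "b \<in> e"
        then have "e = {b, a}" using unique_at_conf[OF H(1) efg(1) _ u] efg(4) bb by (simp add: conf_def)
        then show ?thesis using f by (simp add: insert_commute)
      next
        assume "b \<in> g"
        then have "g = {b, a}" using unique_at_conf[OF H(1) efg(3) _ u] efg(5) bb by (simp add: conf_def)
        then show ?thesis using f by (simp add: insert_commute)
      qed
      then show ?thesis using efg(4,5) by auto
    next
      case False
      then have "a \<in> e" "a \<in> g" using efg(4,5) f by (auto simp: conf_def)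
      then show ?thesis using efg(4,5) by (auto simp: conf_def)
    qed
  qed
  have "unique_at c H a b \<or> unique_at c H b a" using H(2) efg(2) ab unfolding star_colored_def by blast
  then show ?thesis using core[of a b] core[of b a] ab by (auto simp: insert_commute)
qed

lemma star_graph_intro:
  assumes "H \<subseteq> doubletons W" "finite W" "star_colored c H" shows "star_graph H W c"
  by unfold_locales (use assms star_colored_conf_trans in blast)+

lemma card_three_Un: "finite A \<Longrightarrow> finite B \<Longrightarrow> finite C \<Longrightarrow> card (A \<union> B \<union> C) \<le> card A + card B + card C"
  by (meson card_Un_le le_trans add_le_mono1)

lemma tight_three_Un:
  assumes fin: "finite A" "finite B" "finite C" and le: "card A + card B + card C \<le> card (A \<union> B \<union> C)"
  shows "A \<inter> B = {}" "A \<inter> C = {}" "B \<inter> C = {}"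
proof -
  have 1: "card (A \<union> B \<union> C) + card ((A \<union> B) \<inter> C) = card (A \<union> B) + card C"
    using card_Un_Int[of "A \<union> B" C] fin by simp
  have 2: "card (A \<union> B) + card (A \<inter> B) = card A + card B"
    using card_Un_Int[of A B] fin by simp
  have "card (A \<inter> B) = 0" "card ((A \<union> B) \<inter> C) = 0" using 1 2 le by linarith+
  then have e: "A \<inter> B = {}" "(A \<union> B) \<inter> C = {}" using fin by simp_all
  then show "A \<inter> B = {}" "A \<inter> C = {}" "B \<inter> C = {}" by blast+
qed

text \<open>The rigid case with \<open>d\<close> stars; \<open>Z\<close> is the set of centers and
  \<open>\<kappa>\<close> gives the star colors. Edges inside the clique \<open>D\<close> are unique
  in color at both ends and escape the stars. The last conjunct serves the one center that may lie
  outside \<open>D\<close>.\<close>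

definition clique_structure ::
  "('a set \<Rightarrow> nat) \<Rightarrow> 'a set set \<Rightarrow> 'a set \<Rightarrow> 'a \<Rightarrow> nat \<Rightarrow> 'a set \<Rightarrow> 'a set \<Rightarrow> ('a \<Rightarrow> nat) \<Rightarrow> bool" where
  "clique_structure c H U v d D Z \<kappa> \<longleftrightarrow>
     D \<subseteq> U \<and> card D = d \<and> Z \<subseteq> U \<and> card Z = d \<and> card (Z - D) \<le> 1 \<and> v \<in> U \<and> v \<notin> Z \<and> v \<notin> D \<and> inj_on \<kappa> Z \<and>
     (\<forall>q\<in>U - D - {v}. \<forall>z\<in>Z. z \<noteq> q \<and> (z \<in> D \<or> q \<notin> Z) \<longrightarrow> {z, q} \<in> H \<and> c {z, q} = \<kappa> z) \<and>
     (\<forall>a\<in>D. \<forall>b\<in>D. a \<noteq> b \<longrightarrow> {a, b} \<in> H \<and> unique_at c H a b) \<and>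
     (\<forall>e\<in>H. \<not> e \<subseteq> D \<longrightarrow> (\<exists>z\<in>Z. z \<in> e \<and> c e = \<kappa> z)) \<and>
     (\<forall>q\<in>Z - D. \<forall>a\<in>D. {a, q} \<in> H)"

text \<open>The rigid case with \<open>2 * d - 1\<close> stars. \<open>I z\<close> is the
  in-neighborhood of \<open>z\<close> in a regular tournament on \<open>Z\<close>: the edge between
  two centers belongs to the star of its tail.\<close>

definition tournament_structure ::
  "('a set \<Rightarrow> nat) \<Rightarrow> 'a set set \<Rightarrow> 'a set \<Rightarrow> 'a \<Rightarrow> 'a \<Rightarrow> nat \<Rightarrow> 'a set \<Rightarrow> ('a \<Rightarrow> nat) \<Rightarrow> ('a \<Rightarrow> 'a set) \<Rightarrow> bool" where
  "tournament_structure c H U v y d Z \<kappa> I \<longleftrightarrow>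
     U = insert y (insert v Z) \<and> card Z = 2 * d - 1 \<and> y \<noteq> v \<and> y \<notin> Z \<and> v \<notin> Z \<and> inj_on \<kappa> Z \<and>
     (\<forall>e\<in>H. \<exists>z\<in>Z. z \<in> e \<and> c e = \<kappa> z) \<and>
     (\<forall>z\<in>Z. I z \<subseteq> Z \<and> card (I z) = d - 1 \<and> z \<notin> I z \<and> (\<forall>x\<in>I z. z \<notin> I x \<and> {x, z} \<in> H \<and> c {x, z} = \<kappa> x)) \<and>
     (\<forall>x\<in>Z. \<forall>z\<in>Z. x \<noteq> z \<longrightarrow> {x, z} \<in> H) \<and>
     2 \<le> card {z \<in> Z. {z, y} \<in> H}"

text \<open>The failure of the spanning forest on \<open>U = X \<union> {v}\<close>. Only
  \<open>v\<close> is exempt from the bound on the color degree, because its edges may leave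
  \<open>U\<close> in colors of their own; in return its colors inside \<open>U\<close> are
  distinct.\<close>

locale deficient_forest =
  fixes U :: "'a set" and H :: "'a set set" and c :: "'a set \<Rightarrow> nat" and v :: 'a and d :: nat
    and F M :: "'a set set"
  assumes U: "finite U" and H: "H \<subseteq> doubletons U" and star: "star_colored c H" and vU: "v \<in> U"
    and v_unique: "\<And>x. {v, x} \<in> H \<Longrightarrow> unique_at c H v x"
    and def: "deficient c H U F M"
    and d: "4 \<le> d" and U2: "card U \<le> 2 * d + 1"
    and deg: "\<And>w. w \<in> U \<Longrightarrow> w \<noteq> v \<Longrightarrow> d \<le> card {c {w, x} | x. {w, x} \<in> H}"
    and vdeg: "\<exists>x. {v, x} \<in> H"
begin

text \<open>An edge is the only one of its color at one of its ends; its center is the other end. No center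
  is \<open>v\<close>, because the colors at \<open>v\<close> are distinct.\<close>

definition center :: "'a set \<Rightarrow> 'a" where
  "center f = (SOME z. \<exists>b. f = {z, b} \<and> z \<noteq> v \<and> unique_at c H b z)"

definition part :: "'a \<Rightarrow> 'a set" where "part w = conn (F - M) `` {w}"

definition own :: "'a \<Rightarrow> 'a set set" where "own w = {f \<in> M. center f = w}"

definition Z :: "'a set" where "Z = {x \<in> U. card (own x) > 0}"

text \<open>A color carried by stars at both ends of an edge is credited to \<open>own w\<close>
  alone. The last conjunct enforces this and makes \<open>I\<close> asymmetric.\<close>

definition I :: "'a \<Rightarrow> 'a set" where
  "I w = {x \<in> U. x \<notin> part w \<and> {x, w} \<in> H \<and> c {x, w} \<in> c ` own x \<and> c {x, w} \<notin> c ` own w}"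

text \<open>The choice is determined: by \<open>rigid\<close> each center has exactly one edge in
  \<open>own z\<close>.\<close>

definition \<kappa> :: "'a \<Rightarrow> nat" where "\<kappa> z = c (SOME f. f \<in> own z)"

lemma FM: "F \<subseteq> H" "acyc F" "\<And>e f. e \<in> F \<Longrightarrow> f \<in> F \<Longrightarrow> conf c e f \<Longrightarrow> e = f" "M \<subseteq> F"
    "\<And>e. e \<in> H \<Longrightarrow> crossing (F - M) e \<Longrightarrow> \<exists>f\<in>M. conf c e f" "card F + 2 \<le> card U"
  using def unfolding deficient_def by auto

lemma finite_M: "finite M" "finite (own w)"
proof -
  have "finite H" using H doubletons_finite[OF U] finite_subset by blast
  moreover have "M \<subseteq> H" using FM(1,4) by blast
  ultimately show "finite M" by (rule rev_finite_subset)
  then show "finite (own w)" by (simp add: own_def)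
qed

lemma center:
  assumes "f \<in> H"
  obtains b where "f = {center f, b}" "center f \<noteq> v" "unique_at c H b (center f)" "center f \<in> U" "b \<in> U"
proof -
  obtain a b where ab: "f = {a, b}" "a \<noteq> b" "a \<in> U" "b \<in> U" using assms H unfolding doubletons_def by blast
  have "\<exists>z. \<exists>b. f = {z, b} \<and> z \<noteq> v \<and> unique_at c H b z"
  proof (cases "a = v \<or> b = v")
    case True
    then obtain x where x: "f = {v, x}" "x \<noteq> v" using ab by (auto simp: insert_commute)
    then have "unique_at c H v x" using v_unique assms by blast
    then show ?thesis using x by (intro exI[of _ x] exI[of _ v]) (simp add: insert_commute)
  next
    case False
    have "unique_at c H a b \<or> unique_at c H b a" using star ab assms unfolding star_colored_def by blast
    then show ?thesis
    proof
      assume "unique_at c H a b"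
      then show ?thesis using ab False by (intro exI[of _ b] exI[of _ a]) (simp add: insert_commute)
    next
      assume "unique_at c H b a"
      then show ?thesis using ab False by (intro exI[of _ a] exI[of _ b]) simp
    qed
  qed
  then have "\<exists>b. f = {center f, b} \<and> center f \<noteq> v \<and> unique_at c H b (center f)"
    unfolding center_def by (rule someI_ex)
  then obtain b where b: "f = {center f, b}" "center f \<noteq> v" "unique_at c H b (center f)" by blast
  have "{center f, b} \<in> doubletons U" using b(1) assms H by auto
  then show ?thesis using that[OF b] by simp
qed

lemma H_edge: "{w, x} \<in> H \<Longrightarrow> w \<in> U \<and> x \<in> U \<and> w \<noteq> x"
  using subsetD[OF H, of "{w, x}"] by simp

lemma part_props:
  assumes "x \<in> U" shows "x \<in> part x" "part x \<subseteq> U" "y \<in> part x \<longleftrightarrow> part y = part x" "finite (part x)"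
proof -
  show "x \<in> part x" by (simp add: part_def)
  have "F - M \<subseteq> doubletons U" using FM(1) H by blast
  then show 1: "part x \<subseteq> U" using conn_closed assms unfolding part_def by fastforce
  show "y \<in> part x \<longleftrightarrow> part y = part x" using conn_class_eq[of "F - M" x y] by (auto simp: part_def)
  show "finite (part x)" using 1 U finite_subset by blast
qed

lemma crossing_part: "crossing (F - M) {x, y} \<longleftrightarrow> y \<notin> part x"
  by (simp add: crossing_pair part_def)

text \<open>The certificate provides \<open>f\<close> in \<open>M\<close> with the color of
  \<open>{w, x}\<close> and a common end. Since \<open>f\<close> is alone in its color at the end
  that is not its center, the center is \<open>w\<close> or \<open>x\<close>.\<close>

lemma covered:
  assumes e: "{w, x} \<in> H" "x \<notin> part w"
  shows "c {w, x} \<in> c ` own w \<or> x \<in> I w"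
proof -
  have wx: "w \<in> U" "x \<in> U" "w \<noteq> x" using H_edge[OF e(1)] by auto
  obtain f where f: "f \<in> M" "conf c {w, x} f" using FM(5)[OF e(1)] e(2) crossing_part by blast
  have fH: "f \<in> H" using f FM by blast
  obtain b where b: "f = {center f, b}" "center f \<noteq> v" "unique_at c H b (center f)" using center[OF fH] by metis
  have cf: "c {w, x} = c f" using f(2) by (simp add: conf_def)
  have "center f \<in> {w, x}"
  proof (cases "b \<in> {w, x}")
    case True
    then have "{w, x} = {b, center f}"
      using unique_at_conf[OF H e(1) _ b(3)] cf b(1) by (simp add: insert_commute)
    then show ?thesis by auto
  next
    case False
    obtain u where u: "u \<in> {w, x}" "u \<in> f" using f(2) unfolding conf_def by blast
    have "f \<subseteq> {center f, b}" using b(1) by (rule equalityD1)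
    then show ?thesis using u False by blast
  qed
  then show ?thesis
  proof
    assume "center f = w"
    then have "f \<in> own w" using f(1) by (simp add: own_def)
    then show ?thesis using cf by blast
  next
    assume "center f \<in> {x}"
    then have "f \<in> own x" using f(1) by (simp add: own_def)
    then have "c {x, w} \<in> c ` own x" using cf by (auto simp: insert_commute)
    then show ?thesis using e wx by (auto simp: I_def insert_commute)
  qed
qed

lemma own_Z: "own x \<noteq> {} \<Longrightarrow> x \<in> Z"
proof -
  assume "own x \<noteq> {}"
  then obtain f where f: "f \<in> own x" by blast
  then have "f \<in> H" "center f = x" using FM by (auto simp: own_def)
  then have "x \<in> U" using center[of f] by metis
  then show ?thesis using f finite_M(2)[of x] unfolding Z_def by (auto simp: card_gt_0_iff)
qed

lemma I_Z: "I w \<subseteq> Z - part w"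
  using own_Z unfolding I_def by blast

lemma I_asym: "x \<in> I z \<Longrightarrow> z \<notin> I x"
  by (auto simp: I_def insert_commute)

lemma v_not_Z: "v \<notin> Z"
proof
  assume "v \<in> Z"
  then obtain f where "f \<in> M" "center f = v" unfolding Z_def own_def by (auto simp: card_gt_0_iff)
  moreover from this have "f \<in> H" using FM by blast
  ultimately show False using center[of f] by metis
qed

lemma finite_I: "finite (I w)"
  using U by (simp add: I_def)

text \<open>Splits the colors at \<open>w\<close> by origin: edges inside the part, stars centered
  at \<open>w\<close>, and stars centered in another part.\<close>

lemma colors_at:
  assumes "w \<in> U"
  defines "A \<equiv> (\<lambda>x. c {w, x}) ` {x \<in> part w - {w}. {w, x} \<in> H}"
    and "B \<equiv> c ` own w" and "C \<equiv> (\<lambda>x. c {w, x}) ` I w"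
  shows "{c {w, x} | x. {w, x} \<in> H} \<subseteq> A \<union> B \<union> C" "finite A" "finite B" "finite C"
    "card A \<le> card (part w) - 1" "card B \<le> card (own w)" "card C \<le> card (I w)"
proof -
  show "{c {w, x} | x. {w, x} \<in> H} \<subseteq> A \<union> B \<union> C"
  proof
    fix \<gamma> assume "\<gamma> \<in> {c {w, x} | x. {w, x} \<in> H}"
    then obtain x where x: "\<gamma> = c {w, x}" "{w, x} \<in> H" by blast
    then have "w \<noteq> x" using H_edge[OF x(2)] by blast
    then show "\<gamma> \<in> A \<union> B \<union> C" using x covered[OF x(2)] by (cases "x \<in> part w") (auto simp: A_def B_def C_def)
  qed
  show "finite A" "finite B" "finite C"
    using part_props(4)[OF assms(1)] finite_M finite_I by (auto simp: A_def B_def C_def)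
  have "card A \<le> card {x \<in> part w - {w}. {w, x} \<in> H}"
    unfolding A_def by (rule card_image_le) (use part_props(4)[OF assms(1)] in simp)
  also have "\<dots> \<le> card (part w - {w})"
    by (rule card_mono) (use part_props(4)[OF assms(1)] in auto)
  finally show "card A \<le> card (part w) - 1" using part_props(1)[OF assms(1)] by simp
  show "card B \<le> card (own w)" unfolding B_def by (rule card_image_le[OF finite_M(2)])
  show "card C \<le> card (I w)" unfolding C_def by (rule card_image_le[OF finite_I])
qed

lemma part_card_pos: "w \<in> U \<Longrightarrow> card (part w) \<ge> 1"
  using part_props[of w] by (auto simp: Suc_le_eq card_gt_0_iff)

lemma degree_bound:
  assumes w: "w \<in> U" "w \<noteq> v" shows "d + 1 \<le> card (part w) + card (own w) + card (I w)"
proof -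
  note a = colors_at[OF w(1)]
  have "d \<le> card {c {w, x} | x. {w, x} \<in> H}" by (rule deg[OF w])
  also have "\<dots> \<le> card ((\<lambda>x. c {w, x}) ` {x \<in> part w - {w}. {w, x} \<in> H} \<union> c ` own w \<union> (\<lambda>x. c {w, x}) ` I w)"
    by (rule card_mono[OF _ a(1)]) (use a in simp)
  also have "\<dots> \<le> (card (part w) - 1) + card (own w) + card (I w)"
    using card_three_Un[OF a(2-4)] a(5-7) by linarith
  finally show ?thesis using part_card_pos[OF w(1)] by linarith
qed

text \<open>Equality in \<open>degree_bound\<close> leaves no waste: the three sets of colors are
  disjoint, \<open>w\<close> is joined to its whole part, and neither these edges nor those toward
  \<open>I w\<close> repeat a color.\<close>

lemma tight:
  assumes w: "w \<in> U" "w \<noteq> v" and t: "card (part w) + card (own w) + card (I w) \<le> d + 1"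
  shows "\<And>x. x \<in> part w \<Longrightarrow> x \<noteq> w \<Longrightarrow> {w, x} \<in> H \<and> unique_at c H w x"
    "inj_on (\<lambda>x. c {w, x}) (I w)"
    "\<And>x. x \<in> I w \<Longrightarrow> c {w, x} \<notin> c ` own w"
    "\<And>x. x \<in> part w \<Longrightarrow> x \<noteq> w \<Longrightarrow> c {w, x} \<notin> c ` own w"
proof -
  let ?N = "{x \<in> part w - {w}. {w, x} \<in> H}"
  let ?A = "(\<lambda>x. c {w, x}) ` ?N" and ?B = "c ` own w" and ?C = "(\<lambda>x. c {w, x}) ` I w"
  note a = colors_at[OF w(1)]
  have "d \<le> card {c {w, x} | x. {w, x} \<in> H}" by (rule deg[OF w])
  also have "\<dots> \<le> card (?A \<union> ?B \<union> ?C)" by (rule card_mono[OF _ a(1)]) (use a in simp)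
  finally have d1: "d \<le> card (?A \<union> ?B \<union> ?C)" .
  have p1: "card (part w) \<ge> 1" by (rule part_card_pos[OF w(1)])
  have u: "card (?A \<union> ?B \<union> ?C) \<le> card ?A + card ?B + card ?C" by (rule card_three_Un[OF a(2-4)])
  have s: "(card (part w) - 1) + card (own w) + card (I w) \<le> d" using t p1 by linarith
  have eq: "card ?A = card (part w) - 1" "card ?C = card (I w)"
    "card ?A + card ?B + card ?C \<le> card (?A \<union> ?B \<union> ?C)"
    using d1 u s a(5-7) by linarith+
  note disj = tight_three_Un[OF a(2-4) eq(3)]
  have fN: "finite ?N" "finite (part w - {w})" using part_props(4)[OF w(1)] by auto
  have "card (part w - {w}) = card (part w) - 1" using part_props(1)[OF w(1)] by simp
  then have cN: "card (part w - {w}) \<le> card ?A" using eq(1) by simp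
  have "card ?A \<le> card ?N" by (rule card_image_le[OF fN(1)])
  moreover have "card ?N \<le> card (part w - {w})" by (rule card_mono[OF fN(2)]) blast
  ultimately have "card ?N = card (part w - {w})" "card ?A = card ?N" using cN by linarith+
  then have N: "?N = part w - {w}" "inj_on (\<lambda>x. c {w, x}) ?N"
    using card_subset_eq[OF fN(2), of ?N] eq_card_imp_inj_on[OF fN(1)] by blast+
  show 2: "inj_on (\<lambda>x. c {w, x}) (I w)" using eq_card_imp_inj_on[OF finite_I] eq(2) by blast
  show 3: "c {w, x} \<notin> c ` own w" if "x \<in> I w" for x using disj(3) that by blast
  show 4: "c {w, x} \<notin> c ` own w" if "x \<in> part w" "x \<noteq> w" for x
  proof -
    have "x \<in> ?N" using that N(1) by blast
    then have "c {w, x} \<in> ?A" by (rule imageI)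
    then show ?thesis using disj(1) by blast
  qed
  show "{w, x} \<in> H \<and> unique_at c H w x" if x: "x \<in> part w" "x \<noteq> w" for x
  proof
    have xN: "x \<in> ?N" using x N(1) by blast
    then show "{w, x} \<in> H" by blast
    have xA: "c {w, x} \<in> ?A" using xN by (rule imageI)
    show "unique_at c H w x" unfolding unique_at_def
    proof (intro allI impI)
      fix y assume y: "{w, y} \<in> H \<and> c {w, y} = c {w, x}"
      show "y = x"
      proof (cases "y \<in> part w")
        case True
        have "y \<noteq> w" using y H_edge[of w y] by blast
        then have "y \<in> ?N" using True y by blast
        then show ?thesis using N(2) xN y unfolding inj_on_def by blast
      next
        case False
        then have "c {w, y} \<in> ?B \<or> c {w, y} \<in> ?C" using covered[of w y] y by blast
        then have "c {w, x} \<in> ?B \<or> c {w, x} \<in> ?C" using y by simp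
        then show ?thesis using xA disj(1,2) by blast
      qed
    qed
  qed
qed

lemma own_sum: "(\<Sum>x\<in>U. card (own x)) = card M"
proof -
  have "card M = (\<Sum>f\<in>M. 1)" by simp
  also have "\<dots> = (\<Sum>x\<in>center ` M. \<Sum>f | f \<in> M \<and> center f = x. 1)"
    by (rule sum.image_gen[OF finite_M(1)])
  also have "\<dots> = (\<Sum>x\<in>center ` M. card (own x))" by (simp add: own_def)
  also have "\<dots> = (\<Sum>x\<in>U. card (own x))"
  proof (rule sum.mono_neutral_left[OF U])
    show "center ` M \<subseteq> U" using center FM by (metis image_subsetI subsetD)
    show "\<forall>i\<in>U - center ` M. card (own i) = 0"
    proof
      fix i assume "i \<in> U - center ` M"
      then have "own i = {}" by (auto simp: own_def)
      then show "card (own i) = 0" by simp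
    qed
  qed
  finally show ?thesis by simp
qed

lemma parts_image: "part ` U = parts U (F - M)"
  by (simp add: part_def parts_def)

lemma parts_count: "card M + 2 \<le> card (part ` U)"
proof -
  interpret star_graph H U c by (rule star_graph_intro[OF H U star])
  have "indep F" unfolding indep_def using FM by blast
  then show ?thesis using stuck_parts[OF _ FM(4)] FM(6) unfolding parts_image by fastforce
qed

lemma rigid:
  "card U = 2 * d + 1" "\<And>z. z \<in> Z \<Longrightarrow> card (own z) = 1"
  "card Z = 2 * d - 1 \<and> (\<forall>x\<in>U. part x = {x}) \<or>
     card Z = d \<and> (\<exists>D\<in>part ` U. card D = d \<and> (\<forall>x\<in>U - D. part x = {x}) \<and> card (Z - D) \<le> 1)"
proof -
  have r: "card U = 2 * d + 1 \<and> (\<forall>z\<in>{x \<in> U. card (own x) > 0}. card (own z) = 1) \<and>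
    (card {x \<in> U. card (own x) > 0} = 2 * d - 1 \<and> (\<forall>x\<in>U. part x = {x}) \<or>
     card {x \<in> U. card (own x) > 0} = d \<and> (\<exists>D\<in>part ` U. card D = d \<and> (\<forall>x\<in>U - D. part x = {x}) \<and>
       card ({x \<in> U. card (own x) > 0} - D) \<le> 1))"
  proof (rule count_parts[where v=v and I=I])
    show "finite U" by (rule U)
    show "x \<in> part x \<and> part x \<subseteq> U" if "x \<in> U" for x using part_props[OF that] by blast
    show "(y \<in> part x) = (part y = part x)" if "x \<in> U" "y \<in> U" for x y using part_props(3)[OF that(1)] by blast
    show "(\<Sum>x\<in>U. card (own x)) + 2 \<le> card (part ` U)" using parts_count own_sum by simp
    show "v \<in> U" by (rule vU)
    show "v \<notin> {x \<in> U. card (own x) > 0}" using v_not_Z by (simp add: Z_def)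
    show "4 \<le> d" by (rule d)
    show "card U \<le> 2 * d + 1" by (rule U2)
    show "d + 1 \<le> card (part w) + card (own w) + card (I w)" if "w \<in> U" "w \<noteq> v" for w
      by (rule degree_bound[OF that])
    show "I w \<subseteq> {x \<in> U. card (own x) > 0} - part w" if "w \<in> U" for w
      using I_Z[of w] by (simp add: Z_def)
    show "z \<notin> I x" if "x \<in> I z" for x z by (rule I_asym[OF that])
    \<comment> \<open>Without stars no edge leaves a part, so a neighbor of \<open>v\<close> lies in
      the part of \<open>v\<close>.\<close>
    assume Z0: "{x \<in> U. card (own x) > 0} = {}"
    obtain x where x: "{v, x} \<in> H" using vdeg by blast
    then have xU: "x \<in> U" "x \<noteq> v" using H_edge[of v x] by blast+
    have "x \<in> part v"
    proof (rule ccontr)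
      assume "x \<notin> part v"
      then have "c {v, x} \<in> c ` own v \<or> x \<in> I v" using covered[OF x] by blast
      then have "own v \<noteq> {} \<or> x \<in> Z" using I_Z by blast
      then show False using own_Z Z0 unfolding Z_def by blast
    qed
    then have "card {v, x} \<le> card (part v)"
      by (intro card_mono part_props(4)[OF vU]) (use part_props(1)[OF vU] in blast)
    then show "card (part v) \<ge> 2" using xU by simp
  qed
  note r' = r[folded Z_def]
  show "card U = 2 * d + 1" using r' by blast
  show "card (own z) = 1" if "z \<in> Z" for z using r' that by blast
  show "card Z = 2 * d - 1 \<and> (\<forall>x\<in>U. part x = {x}) \<or>
     card Z = d \<and> (\<exists>D\<in>part ` U. card D = d \<and> (\<forall>x\<in>U - D. part x = {x}) \<and> card (Z - D) \<le> 1)"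
    using r' by blast
qed

lemma own_color: "c ` own z = (if z \<in> Z then {\<kappa> z} else {})"
proof (cases "z \<in> Z")
  case True
  then obtain f where f: "own z = {f}" using rigid(2) card_1_singletonE by blast
  then show ?thesis using True by (simp add: \<kappa>_def)
next
  case False
  then show ?thesis using own_Z by auto
qed

lemma I_color: "x \<in> I w \<Longrightarrow> x \<in> Z \<and> {x, w} \<in> H \<and> c {x, w} = \<kappa> x \<and> x \<noteq> w"
proof -
  assume x: "x \<in> I w"
  then have "x \<in> Z" using I_Z by blast
  moreover have "{x, w} \<in> H" "c {x, w} \<in> c ` own x" using x by (auto simp: I_def)
  moreover from this have "x \<noteq> w" using H_edge[of x w] by blast
  ultimately show ?thesis using own_color[of x] by simp
qed

lemma Z_sub: "Z \<subseteq> U" "finite Z"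
  using U by (auto simp: Z_def)

lemma own_card: "card (own w) = (if w \<in> Z then 1 else 0)"
proof (cases "w \<in> Z")
  case True
  then show ?thesis using rigid(2) by simp
next
  case False
  then have "own w = {}" using own_Z by blast
  then show ?thesis using False by simp
qed

lemma cover_Z:
  assumes e: "{w, x} \<in> H" "x \<notin> part w"
  shows "\<exists>z\<in>Z. z \<in> {w, x} \<and> c {w, x} = \<kappa> z"
  using covered[OF e]
proof
  assume "c {w, x} \<in> c ` own w"
  then show ?thesis using own_color[of w] by (auto split: if_splits)
next
  assume "x \<in> I w"
  from I_color[OF this] show ?thesis by (intro bexI[of _ x]) (auto simp: insert_commute)
qed

lemma two_not_one: "card A \<le> Suc 0 \<Longrightarrow> finite A \<Longrightarrow> x \<in> A \<Longrightarrow> y \<in> A \<Longrightarrow> x = y"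
  using card_le_Suc0_iff_eq by blast

text \<open>The two cases are those of \<open>rigid\<close>; equality in \<open>degree_bound\<close>
  then pins down the edges. By \<open>ext\<close>, the color of \<open>{v, w}\<close> is found at
  \<open>w\<close> on another pair inside \<open>U\<close>, which keeps \<open>v\<close> out of
  \<open>D\<close>.\<close>

lemma clique_or_tournament:
  assumes ext: "\<And>w. {v, w} \<in> H \<Longrightarrow> \<exists>x\<in>U - {v}. x \<noteq> w \<and> c {w, x} = c {v, w}"
  shows "(\<exists>D. clique_structure c H U v d D Z \<kappa>) \<or> (\<exists>y. tournament_structure c H U v y d Z \<kappa> I)"
  using rigid(3)
proof
  assume "card Z = d \<and> (\<exists>D\<in>part ` U. card D = d \<and> (\<forall>x\<in>U - D. part x = {x}) \<and> card (Z - D) \<le> 1)"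
  then obtain D where Zd: "card Z = d" and D: "D \<in> part ` U" "card D = d"
    "\<And>x. x \<in> U - D \<Longrightarrow> part x = {x}" "card (Z - D) \<le> 1" by blast
  have DU: "D \<subseteq> U" using D(1) part_props(2) by blast
  have fD: "finite D" using DU U finite_subset by blast
  have pD: "part w = D" if "w \<in> D" for w
  proof -
    obtain x where x: "x \<in> U" "D = part x" using D(1) by blast
    then show ?thesis using part_props(3)[OF x(1), of w] that by simp
  qed
  have fZD: "finite (Z - D)" using Z_sub by blast
  have outside: "q = p" if "q \<in> Z - D" "p \<in> Z - D" for p q
    using two_not_one[OF _ fZD that] D(4) by simp
  have cover: "\<exists>z\<in>Z. z \<in> e \<and> c e = \<kappa> z" if e: "e \<in> H" "\<not> e \<subseteq> D" for e
  proof -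
    obtain x where x: "x \<in> e" "x \<notin> D" using e(2) by blast
    obtain w where w: "e = {x, w}" using doubletonsE[of e U x] x(1) e(1) H by blast
    have xw: "x \<in> U" "w \<noteq> x" using H_edge[of x w] e(1) w by auto
    then have "w \<notin> part x" using D(3)[of x] x(2) by simp
    then show ?thesis using cover_Z[of x w] e(1) w by simp
  qed
  have Iq: "I q = Z" if q: "q \<in> U" "q \<notin> D" "q \<notin> Z" "q \<noteq> v" for q
  proof -
    have "d \<le> card (I q)" using degree_bound[OF q(1,4)] D(3)[of q] q own_card[of q] by simp
    moreover have "I q \<subseteq> Z" using I_Z by blast
    ultimately show ?thesis using Zd Z_sub(2) card_seteq by metis
  qed
  have Ip: "I p = Z - {p}" if p: "p \<in> Z" "p \<notin> D" for p
  proof -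
    have pU: "p \<in> U" "p \<noteq> v" using p Z_sub v_not_Z by auto
    have pp: "part p = {p}" using D(3)[of p] p pU by simp
    have "d - 1 \<le> card (I p)" using degree_bound[OF pU] pp own_card[of p] p by simp
    moreover have "I p \<subseteq> Z - {p}" using I_Z[of p] pp by blast
    moreover have "card (Z - {p}) = d - 1" using Zd p by simp
    ultimately show ?thesis using Z_sub(2) card_seteq[of "Z - {p}" "I p"] by simp
  qed
  have full: "{z, q} \<in> H \<and> c {z, q} = \<kappa> z"
    if q: "q \<in> U - D - {v}" and z: "z \<in> Z" "z \<noteq> q" "z \<in> D \<or> q \<notin> Z" for q z
  proof (cases "q \<in> Z")
    case False
    then have "z \<in> I q" using Iq[of q] q z by blast
    then show ?thesis using I_color by blast
  next
    case True
    then have "z \<in> I q" using Ip[of q] q z by blast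
    then show ?thesis using I_color by blast
  qed
  \<comment> \<open>A center outside \<open>D\<close> has every other center in its
    \<open>I\<close>, so by asymmetry it cannot occur in theirs.\<close>
  have Iw: "I w = {}" if w: "w \<in> Z" "w \<in> D" for w
  proof (rule ccontr)
    assume "I w \<noteq> {}"
    then obtain x where x: "x \<in> I w" by blast
    then have xZ: "x \<in> Z - D" using I_Z[of w] pD[OF w(2)] by blast
    then have "w \<in> I x" using Ip[of x] w by blast
    then show False using I_asym[OF x] by blast
  qed
  have tightZ: "card (part w) + card (own w) + card (I w) \<le> d + 1" if w: "w \<in> Z" "w \<in> D" for w
    using Iw[OF w] pD[OF w(2)] D(2) own_card[of w] w by simp
  have Zne: "w \<in> U" "w \<noteq> v" if "w \<in> Z" for w using that Z_sub v_not_Z by auto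
  have cZD: "card (Z \<inter> D) \<ge> d - 1"
  proof -
    have "card Z = card (Z \<inter> D) + card (Z - D)"
      using card_Un_disjoint[of "Z \<inter> D" "Z - D"] Z_sub(2) by (simp add: Int_Diff_disjoint Int_Diff_Un)
    then show ?thesis using Zd D(4) by simp
  qed
  \<comment> \<open>Otherwise take a center \<open>w\<close> in \<open>D\<close> and the vertex
    \<open>x\<close> that \<open>ext\<close> gives for it. If \<open>x\<close> lies in
    \<open>D\<close>, the color of \<open>{w, v}\<close> is not unique at \<open>w\<close>; if not,
    this color is the star color of \<open>w\<close>, which \<open>tight\<close> keeps off the edges
    inside \<open>D\<close>.\<close>
  have "v \<notin> D"
  proof
    assume vD: "v \<in> D"
    have "Z \<inter> D \<noteq> {}" using cZD d by auto
    then obtain w where w: "w \<in> Z" "w \<in> D" by blast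
    note t = tight[OF Zne[OF w(1)] tightZ[OF w]]
    have wv: "w \<noteq> v" using Zne[OF w(1)] by blast
    have "{w, v} \<in> H \<and> unique_at c H w v" using t(1)[of v] vD pD[OF w(2)] wv by simp
    then have wvH: "{w, v} \<in> H" "unique_at c H w v" by auto
    have cw: "c {w, v} \<notin> c ` own w" using t(4)[of v] vD pD[OF w(2)] wv by simp
    obtain x where x: "x \<in> U - {v}" "x \<noteq> w" "c {w, x} = c {v, w}"
      using ext[of w] wvH(1) by (auto simp: insert_commute)
    have cx: "c {w, x} = c {w, v}" using x(3) by (simp add: insert_commute)
    show False
    proof (cases "x \<in> D")
      case True
      then have "{w, x} \<in> H" using t(1)[of x] pD[OF w(2)] x(2) by simp
      then show False using unique_atD[OF wvH(2)] cx x(1) by blast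
    next
      case False
      then have "{w, x} \<in> H \<and> c {w, x} = \<kappa> w" using full[of x w] x w by simp
      then show False using cw cx own_color[of w] w(1) by simp
    qed
  qed
  then have vD: "v \<notin> D" .
  have DZ: "card (D - Z) \<le> 1"
  proof -
    have "card D = card (Z \<inter> D) + card (D - Z)"
      using card_Int_Diff[OF fD, of Z] by (simp add: Int_commute)
    then show ?thesis using D(2) cZD d by simp
  qed
  have D_tight: "card (part w) + card (own w) + card (I w) \<le> d + 1" and D0: "w \<notin> Z \<Longrightarrow> \<forall>p\<in>Z - D. p \<in> I w"
    if w: "w \<in> D" for w
  proof -
    have wU: "w \<in> U" "w \<noteq> v" using w DU vD by auto
    have IwZ: "I w \<subseteq> Z - D" using I_Z[of w] pD[OF w] by blast
    then have cI: "card (I w) \<le> 1" using card_mono[OF fZD IwZ] D(4) by linarith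
    show "card (part w) + card (own w) + card (I w) \<le> d + 1"
    proof (cases "w \<in> Z")
      case True
      then show ?thesis using tightZ w by blast
    next
      case False
      then show ?thesis using own_card[of w] pD[OF w] D(2) cI by simp
    qed
    assume "w \<notin> Z"
    then have "card (I w) \<ge> 1" using degree_bound[OF wU] own_card[of w] pD[OF w] D(2) by simp
    then have "I w \<noteq> {}" by auto
    then show "\<forall>p\<in>Z - D. p \<in> I w" using IwZ outside by blast
  qed
  have clique: "{a, b} \<in> H \<and> unique_at c H a b" if ab: "a \<in> D" "b \<in> D" "a \<noteq> b" for a b
  proof -
    have "a \<in> U" "a \<noteq> v" using ab DU vD by auto
    then show ?thesis using tight(1)[OF _ _ D_tight[OF ab(1)], of b] pD[OF ab(1)] ab by simp
  qed
  have special: "{a, q} \<in> H" if q: "q \<in> Z - D" and a: "a \<in> D" for q a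
  proof (cases "a \<in> Z")
    case True
    have "q \<in> U - D - {v}" using q Zne by blast
    moreover have "a \<noteq> q" using q a by blast
    ultimately show ?thesis using full[of q a] True a by blast
  next
    case False
    then have "q \<in> I a" using D0[OF a] q by blast
    then show ?thesis using I_color[of q a] by (simp add: insert_commute)
  qed
  \<comment> \<open>\<open>U - D\<close> has \<open>d + 1 \<ge> 5\<close> vertices, so some
    \<open>q\<close> there is neither \<open>v\<close> nor a center. It receives a star edge from
    every center, and \<open>tight\<close> makes their colors distinct.\<close>
  have "inj_on \<kappa> Z"
  proof -
    have "card (U - D) = d + 1" using rigid(1) D(2) DU fD by (simp add: card_Diff_subset)
    moreover have "card (U - D) \<le> card (U - D - Z - {v}) + card (insert v (Z - D))"
    proof -
      have "U - D \<subseteq> (U - D - Z - {v}) \<union> insert v (Z - D)" by blast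
      then have "card (U - D) \<le> card ((U - D - Z - {v}) \<union> insert v (Z - D))"
        by (rule card_mono[rotated]) (use U fZD in simp)
      then show ?thesis using card_Un_le le_trans by blast
    qed
    moreover have "card (insert v (Z - D)) \<le> 2" using D(4) fZD by (simp add: card_insert_if)
    ultimately have "card (U - D - Z - {v}) > 0" using d by linarith
    then have "U - D - Z - {v} \<noteq> {}" unfolding card_gt_0_iff by blast
    then obtain q where q: "q \<in> U" "q \<notin> D" "q \<notin> Z" "q \<noteq> v" by blast
    have "card (part q) + card (own q) + card (I q) \<le> d + 1"
      using D(3)[of q] q own_card[of q] Iq[OF q] Zd by simp
    from tight(2)[OF q(1,4) this] have "inj_on (\<lambda>x. c {q, x}) Z" using Iq[OF q] by simp
    moreover have "c {q, x} = \<kappa> x" if "x \<in> Z" for x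
      using I_color[of x q] Iq[OF q] that by (simp add: insert_commute)
    ultimately show ?thesis unfolding inj_on_def by simp
  qed
  then have "clique_structure c H U v d D Z \<kappa>"
    unfolding clique_structure_def
    using DU D(2,4) Z_sub(1) Zd vU v_not_Z vD full clique cover special by blast
  then show ?thesis by blast
next
  assume h: "card Z = 2 * d - 1 \<and> (\<forall>x\<in>U. part x = {x})"
  have Zc: "card Z = 2 * d - 1" using h by blast
  have single: "part x = {x}" if "x \<in> U" for x using h that by blast
  have Zne: "w \<in> U" "w \<noteq> v" if "w \<in> Z" for w using that Z_sub v_not_Z by auto
  have Ib: "d - 1 \<le> card (I z)" if z: "z \<in> Z" for z
    using degree_bound[OF Zne[OF z]] single[OF Zne(1)[OF z]] own_card[of z] z by simp
  have Isub: "I z \<subseteq> Z - {z}" if z: "z \<in> Z" for z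
    using I_Z[of z] single[OF Zne(1)[OF z]] by simp
  let ?A = "SIGMA z:Z. I z"
  let ?P = "{(x, z). x \<in> Z \<and> z \<in> Z \<and> x \<noteq> z}"
  have cA: "card ?A = (\<Sum>z\<in>Z. card (I z))" by (rule card_SigmaI) (use Z_sub finite_I in auto)
  have fA: "finite ?A" using Z_sub finite_I by blast
  have cP: "card ?P = (2 * d - 1) * (2 * d - 2)"
  proof -
    have "?P = (SIGMA x:Z. Z - {x})" by blast
    then have "card ?P = (\<Sum>x\<in>Z. card (Z - {x}))" using Z_sub by simp
    also have "\<dots> = (\<Sum>x\<in>Z. 2 * d - 2)" by (rule sum.cong) (use Zc in auto)
    finally show ?thesis using Zc by simp
  qed
  have AP: "?A \<union> ?A\<inverse> \<subseteq> ?P" using Isub by blast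
  have fP: "finite ?P" by (rule finite_subset[of _ "Z \<times> Z"]) (use Z_sub in auto)
  have "?A \<inter> ?A\<inverse> = {}" using I_asym by blast
  then have cAA: "card (?A \<union> ?A\<inverse>) = 2 * card ?A" using card_Un_disjoint[of ?A "?A\<inverse>"] fA by simp
  \<comment> \<open>\<open>Z\<close> has \<open>(2 * d - 1) * (d - 1)\<close> unordered pairs, and
    the lower bounds on \<open>card (I z)\<close> add up to the same number. So every pair is
    oriented and every in-degree is exactly \<open>d - 1\<close>.\<close>
  have low: "(2 * d - 1) * (d - 1) \<le> card ?A"
  proof -
    have "(\<Sum>z\<in>Z. d - 1) \<le> (\<Sum>z\<in>Z. card (I z))" by (rule sum_mono) (use Ib in blast)
    then show ?thesis using cA Zc by simp
  qed
  have up: "2 * card ?A \<le> card ?P" using card_mono[OF fP AP] cAA by simp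
  have dd: "2 * ((2 * d - 1) * (d - 1)) = (2 * d - 1) * (2 * d - 2)"
    using d by (simp add: mult.left_commute right_diff_distrib')
  have eqA: "2 * card ?A = card ?P" "card ?A = (2 * d - 1) * (d - 1)" using low up cP dd by linarith+
  have full: "?A \<union> ?A\<inverse> = ?P" by (rule card_subset_eq[OF fP AP]) (use cAA eqA in simp)
  have Ieq: "card (I z) = d - 1" if z: "z \<in> Z" for z
  proof (rule ccontr)
    assume "card (I z) \<noteq> d - 1"
    then have "d - 1 < card (I z)" using Ib[OF z] by linarith
    then have "(\<Sum>z\<in>Z. d - 1) < (\<Sum>z\<in>Z. card (I z))"
      by (intro sum_strict_mono_ex1) (use Z_sub Ib z in auto)
    then show False using cA eqA Zc by simp
  qed
  have tz: "card (part z) + card (own z) + card (I z) \<le> d + 1" if z: "z \<in> Z" for z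
    using Ieq[OF z] single[OF Zne(1)[OF z]] own_card[of z] z d by simp
  have rel: "x \<in> I z \<or> z \<in> I x" if "x \<in> Z" "z \<in> Z" "x \<noteq> z" for x z
  proof -
    have "(z, x) \<in> ?P" using that by blast
    then have "(z, x) \<in> ?A \<union> ?A\<inverse>" using full by simp
    then show ?thesis by blast
  qed
  have kne: "\<kappa> x \<noteq> \<kappa> z" if "x \<in> I z" "z \<in> Z" for x z
  proof -
    have "c {z, x} \<notin> c ` own z" using tight(3)[OF Zne[OF that(2)] tz[OF that(2)] that(1)] .
    moreover have "c {z, x} = \<kappa> x" using I_color[OF that(1)] by (simp add: insert_commute)
    ultimately show ?thesis using own_color[of z] that(2) by simp
  qed
  have inj: "inj_on \<kappa> Z"
  proof (rule inj_onI, rule ccontr)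
    fix x z assume "x \<in> Z" "z \<in> Z" "\<kappa> x = \<kappa> z" "x \<noteq> z"
    then show False using rel[of x z] kne[of x z] kne[of z x] by metis
  qed
  have "card (U - insert v Z) = 1"
  proof -
    have "card (insert v Z) = 2 * d" using Zc Z_sub v_not_Z d by simp
    moreover have "insert v Z \<subseteq> U" using Z_sub vU by blast
    ultimately show ?thesis using rigid(1) card_Diff_subset[of "insert v Z" U] Z_sub by simp
  qed
  then have "\<exists>y. U - insert v Z = {y}" using card_1_singleton_iff[of "U - insert v Z"] by simp
  then obtain y where y: "U - insert v Z = {y}" by blast
  have yU: "y \<in> U" "y \<noteq> v" "y \<notin> Z" using y by blast+
  have Uy: "U = insert y (insert v Z)" using y Z_sub vU by blast
  have y2: "2 \<le> card {z \<in> Z. {z, y} \<in> H}"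
  proof -
    have "d \<le> card (I y)" using degree_bound[OF yU(1,2)] single[OF yU(1)] own_card[of y] yU by simp
    moreover have "I y \<subseteq> {z \<in> Z. {z, y} \<in> H}" using I_color by blast
    then have "card (I y) \<le> card {z \<in> Z. {z, y} \<in> H}" by (rule card_mono[rotated]) (use Z_sub in simp)
    ultimately show ?thesis using d by linarith
  qed
  have cover: "\<exists>z\<in>Z. z \<in> e \<and> c e = \<kappa> z" if e: "e \<in> H" for e
  proof -
    obtain w x where w: "e = {w, x}" using e H unfolding doubletons_def by blast
    have "w \<in> U" "w \<noteq> x" using H_edge[of w x] e w by auto
    then have "x \<notin> part w" using single by auto
    then show ?thesis using cover_Z[of w x] e w by simp
  qed
  have arcs: "I z \<subseteq> Z \<and> card (I z) = d - 1 \<and> z \<notin> I z \<and> (\<forall>x\<in>I z. z \<notin> I x \<and> {x, z} \<in> H \<and> c {x, z} = \<kappa> x)"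
    if z: "z \<in> Z" for z
    using Isub[OF z] Ieq[OF z] I_asym I_color by blast
  have pairs: "{x, z} \<in> H" if "x \<in> Z" "z \<in> Z" "x \<noteq> z" for x z
    using rel[OF that] I_color[of x z] I_color[of z x] by (auto simp: insert_commute)
  have "tournament_structure c H U v y d Z \<kappa> I"
    unfolding tournament_structure_def
    using Uy Zc yU v_not_Z inj cover arcs pairs y2 by blast
  then show ?thesis by blast
qed

end

section \<open>Successful attempts in rigid configurations\<close>

text \<open>What a forest on \<open>W\<close> may use so that an edge of color \<gamma> from
  \<open>r\<close> to a vertex outside \<open>W\<close> can be added afterwards.\<close>

definition restrict_edges :: "('a set \<Rightarrow> nat) \<Rightarrow> 'a set set \<Rightarrow> 'a set \<Rightarrow> 'a \<Rightarrow> nat \<Rightarrow> 'a set set" where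
  "restrict_edges c H W r \<gamma> = {e \<in> H. e \<subseteq> W \<and> \<not> (r \<in> e \<and> c e = \<gamma>)}"

lemma restrict_edgesI: "e \<in> H \<Longrightarrow> e \<subseteq> W \<Longrightarrow> \<not> (r \<in> e \<and> c e = \<gamma>) \<Longrightarrow> e \<in> restrict_edges c H W r \<gamma>"
  unfolding restrict_edges_def by blast

lemma restrict_edges_subset: "restrict_edges c H W r \<gamma> \<subseteq> H"
  unfolding restrict_edges_def by blast

lemma restrict_edges_doubletons:
  assumes "H \<subseteq> doubletons U" shows "restrict_edges c H W r \<gamma> \<subseteq> doubletons W"
proof
  fix e assume "e \<in> restrict_edges c H W r \<gamma>"
  then have e: "e \<in> doubletons U" "e \<subseteq> W" using assms by (auto simp: restrict_edges_def)
  then obtain p q where "e = {p, q}" "p \<noteq> q" unfolding doubletons_def by blast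
  then show "e \<in> doubletons W" using e(2) by simp
qed

lemma parts_meeting:
  assumes "finite W" "S \<subseteq> W"
  shows "card (parts W G) \<le> card (parts S G) + card (parts (W - S) G - parts S G)"
proof -
  have "parts W G = parts S G \<union> (parts (W - S) G - parts S G)"
    using assms(2) by (auto simp: parts_def)
  then show ?thesis by (metis card_Un_le)
qed

text \<open>At most \<open>card M\<close> centers have their star represented in \<open>M\<close>,
  so two components avoid these centers, and one of them, \<open>P\<close>, avoids \<open>b\<close>
  too. A star outside \<open>M\<close> keeps its available edges inside one component, so an arc
  leaving \<open>P\<close> must be forbidden: it ends in \<open>r\<close> and has color \<gamma>,
  and there is at most one. Then \<open>Q = Z - P\<close> receives too few arcs for its in-degrees;
  and if \<open>Q\<close> is empty, \<open>z1\<close> pulls \<open>b\<close> into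
  \<open>P\<close>.\<close>

lemma tournament_not_deficient:
  assumes T: "tournament_structure c H U v y d Z \<kappa> I" and H: "H \<subseteq> doubletons U" and U: "finite U" and d: "d \<ge> 4"
    and b: "b = y \<or> b = v"
    and W: "W = insert b Z" and r: "r \<in> Z \<Longrightarrow> \<gamma> \<noteq> \<kappa> r"
    and z1: "z1 \<in> Z" "{z1, b} \<in> restrict_edges c H W r \<gamma>"
  shows "\<not> deficient c (restrict_edges c H W r \<gamma>) W F M"
proof
  let ?H = "restrict_edges c H W r \<gamma>"
  assume def: "deficient c ?H W F M"
  have FM: "F \<subseteq> ?H" "acyc F" "\<And>e f. e \<in> F \<Longrightarrow> f \<in> F \<Longrightarrow> conf c e f \<Longrightarrow> e = f" "M \<subseteq> F"
    "\<And>e. e \<in> ?H \<Longrightarrow> crossing (F - M) e \<Longrightarrow> \<exists>f\<in>M. conf c e f" "card F + 2 \<le> card W"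
    using def unfolding deficient_def by auto
  have Ts: "U = insert y (insert v Z)" "card Z = 2 * d - 1" "y \<notin> Z" "v \<notin> Z" "inj_on \<kappa> Z"
    and cov: "\<And>e. e \<in> H \<Longrightarrow> \<exists>z\<in>Z. z \<in> e \<and> c e = \<kappa> z"
    and arcs: "\<And>z. z \<in> Z \<Longrightarrow> I z \<subseteq> Z" "\<And>z. z \<in> Z \<Longrightarrow> card (I z) = d - 1" "\<And>z. z \<in> Z \<Longrightarrow> z \<notin> I z"
      "\<And>z x. z \<in> Z \<Longrightarrow> x \<in> I z \<Longrightarrow> z \<notin> I x" "\<And>z x. z \<in> Z \<Longrightarrow> x \<in> I z \<Longrightarrow> {x, z} \<in> H \<and> c {x, z} = \<kappa> x"
    using T unfolding tournament_structure_def by auto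
  have fZ: "finite Z" using U Ts(1) by simp
  have fW: "finite W" using fZ W by simp
  have bZ: "b \<notin> Z" using b Ts by blast
  have HH: "?H \<subseteq> H" "?H \<subseteq> doubletons W"
    by (rule restrict_edges_subset, rule restrict_edges_doubletons[OF H])
  have finM: "finite M" using FM(1,4) HH(2) doubletons_finite[OF fW] by (meson finite_subset)
  define G where "G = F - M"
  define ZK where "ZK = {z \<in> Z. \<exists>f\<in>M. z \<in> f \<and> c f = \<kappa> z}"
  define zz where "zz f = (SOME z. z \<in> Z \<and> z \<in> f \<and> c f = \<kappa> z)" for f
  have MH: "f \<in> H" if "f \<in> M" for f using that FM HH by blast
  have "ZK \<subseteq> zz ` M"
  proof
    fix z assume "z \<in> ZK"
    then obtain f where f: "z \<in> Z" "f \<in> M" "z \<in> f" "c f = \<kappa> z" by (auto simp: ZK_def)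
    have "zz f \<in> Z \<and> zz f \<in> f \<and> c f = \<kappa> (zz f)"
      unfolding zz_def by (rule someI[of _ z]) (use f in blast)
    then have "zz f = z" using f Ts(5) unfolding inj_on_def by metis
    then show "z \<in> zz ` M" using f(2) by blast
  qed
  then have cZK: "card ZK \<le> card M" by (rule surj_card_le[OF finM])
  have nocross: "\<not> crossing G e" if e: "e \<in> ?H" "z \<in> Z" "c e = \<kappa> z" "z \<notin> ZK" for e z
  proof
    assume "crossing G e"
    then obtain f where f: "f \<in> M" "conf c e f" using FM(5)[OF e(1)] unfolding G_def by blast
    obtain z' where z': "z' \<in> Z" "z' \<in> f" "c f = \<kappa> z'" using cov[OF MH[OF f(1)]] by blast
    then have "\<kappa> z' = \<kappa> z" using f(2) e(3) by (simp add: conf_def)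
    then have "z' = z" using Ts(5) z'(1) e(2) unfolding inj_on_def by blast
    then show False using e(2,4) z' f(1) by (auto simp: ZK_def)
  qed
  have "card (parts W G) + card F = card W + card M"
  proof -
    have "G \<subseteq> doubletons W" "acyc G" using FM(1,2) HH(2) acyc_subset[of F G] by (auto simp: G_def)
    then have "card (parts W G) + card G = card W" by (rule card_parts[OF fW])
    moreover have "card G + card M = card F"
      unfolding G_def using FM(1,4) HH(2) doubletons_finite[OF fW] finM
      by (metis card_Diff_subset card_mono finite_subset le_add_diff_inverse2)
    ultimately show ?thesis by simp
  qed
  then have N: "card M + 2 \<le> card (parts W G)" using FM(6) by linarith
  have ZKW: "ZK \<subseteq> W" using W by (auto simp: ZK_def)
  have "card (parts ZK G) \<le> card M"
  proof -
    have "finite ZK" using fZ by (simp add: ZK_def)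
    then show ?thesis unfolding parts_def using card_image_le[of ZK "\<lambda>x. conn G `` {x}"] cZK by linarith
  qed
  moreover have "card (parts W G) \<le> card (parts ZK G) + card (parts (W - ZK) G - parts ZK G)"
    by (rule parts_meeting[OF fW ZKW])
  ultimately have two: "2 \<le> card (parts (W - ZK) G - parts ZK G)" using N by linarith
  have "\<not> parts (W - ZK) G - parts ZK G \<subseteq> {conn G `` {b}}"
  proof
    assume "parts (W - ZK) G - parts ZK G \<subseteq> {conn G `` {b}}"
    then have "card (parts (W - ZK) G - parts ZK G) \<le> card {conn G `` {b}}" by (rule card_mono[rotated]) simp
    then show False using two by simp
  qed
  then obtain P where P: "P \<in> parts (W - ZK) G" "P \<notin> parts ZK G" "P \<noteq> conn G `` {b}" by blast
  obtain z0 where z0: "z0 \<in> W" "P = conn G `` {z0}" using P(1) unfolding parts_def by blast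
  have mem: "P = conn G `` {x}" if "x \<in> P" for x
    using that z0 conn_class_eq[of G z0 x] by simp
  have GW: "G \<subseteq> doubletons W" using FM(1) HH(2) by (auto simp: G_def)
  have PW: "P \<subseteq> W" using conn_closed[OF _ GW z0(1)] z0(2) by blast
  have bP: "b \<notin> P" using mem P(3) by blast
  have PZ: "P \<subseteq> Z" using PW bP W by blast
  have PK: "x \<notin> ZK" if "x \<in> P" for x
  proof
    assume "x \<in> ZK"
    then have "conn G `` {x} \<in> parts ZK G" unfolding parts_def by (rule imageI)
    then show False using mem[OF that] P(2) by simp
  qed
  have stay: "w \<in> P" if "x \<in> P" "{x, w} \<in> ?H" "c {x, w} = \<kappa> x" for x w
  proof -
    have "\<not> crossing G {x, w}" using nocross[OF that(2) _ that(3)] PK PZ that(1) by blast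
    then show ?thesis using mem[OF that(1)] unfolding crossing_pair by blast
  qed
  define Q where "Q = Z - P"
  have fQ: "finite Q" "finite P" using fZ PZ finite_subset by (auto simp: Q_def)
  have z0P: "z0 \<in> P" using z0 by simp
  show False
  proof (cases "Q = {}")
    case True
    then have "z1 \<in> P" using z1(1) by (auto simp: Q_def)
    moreover have "c {z1, b} = \<kappa> z1"
    proof -
      have "{z1, b} \<in> H" using z1(2) HH by blast
      from cov[OF this] show ?thesis using bZ by auto
    qed
    ultimately have "b \<in> P" using stay z1(2) by blast
    then show False using bP by blast
  next
    case False
    have one: "w = r \<and> \<kappa> x = \<gamma>" if "w \<in> Q" "x \<in> I w" "x \<in> P" for w x
    proof -
      have w: "w \<in> Z" "w \<notin> P" using that by (auto simp: Q_def)
      have xw: "{x, w} \<in> H" "c {x, w} = \<kappa> x" using arcs(5)[OF w(1) that(2)] by auto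
      have "{x, w} \<notin> ?H" using stay[OF that(3) _ xw(2)] w(2) by blast
      moreover have "{x, w} \<subseteq> W" using w(1) PZ that(3) W by blast
      ultimately have rr: "r \<in> {x, w}" "c {x, w} = \<gamma>" using xw(1) by (auto simp: restrict_edges_def)
      have "r \<noteq> x" using r PZ that(3) rr(2) xw(2) by blast
      then have "r = w" using rr(1) by blast
      then show ?thesis using rr(2) xw(2) by simp
    qed
    have sumP: "(\<Sum>w\<in>Q. card (I w \<inter> P)) \<le> 1"
    proof -
      have c1: "card (I w \<inter> P) \<le> (if w = r then 1 else 0)" if "w \<in> Q" for w
      proof (cases "w = r")
        case True
        have "x = x'" if "x \<in> I w \<inter> P" "x' \<in> I w \<inter> P" for x x'
        proof -
          have "\<kappa> x = \<kappa> x'" using one[OF \<open>w \<in> Q\<close>] that by (metis IntE)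
          then show ?thesis using Ts(5) PZ that unfolding inj_on_def by blast
        qed
        then have "card (I w \<inter> P) \<le> Suc 0"
          using card_le_Suc0_iff_eq[of "I w \<inter> P"] fQ(2) by blast
        then show ?thesis using True by simp
      next
        case False
        then have "I w \<inter> P = {}" using one[OF \<open>w \<in> Q\<close>] by blast
        then show ?thesis by simp
      qed
      have "(\<Sum>w\<in>Q. card (I w \<inter> P)) \<le> (\<Sum>w\<in>Q. if w = r then 1 else 0)" by (rule sum_mono[OF c1])
      also have "\<dots> \<le> 1" using fQ(1) by (simp add: sum.delta)
      finally show ?thesis .
    qed
    have "2 * (\<Sum>z\<in>Q. card (I z \<inter> Q)) + (\<Sum>z\<in>Q. card ({z} \<inter> Q)) \<le> card Q * card Q"
    proof (rule sum_oriented_pairs[OF fQ(1)])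
      show "I z \<inter> Q \<subseteq> Q - {z}" if "z \<in> Q" for z using arcs(3) that by (auto simp: Q_def)
      show "z \<notin> I x \<inter> Q" if "z \<in> Q" "x \<in> I z \<inter> Q" for x z using arcs(4) that by (auto simp: Q_def)
      show "{z} \<inter> Q = {x \<in> Q. {x} = {z}}" if "z \<in> Q" for z using that by auto
    qed
    moreover have "(\<Sum>z\<in>Q. card ({z} \<inter> Q)) = card Q"
    proof -
      have "(\<Sum>z\<in>Q. card ({z} \<inter> Q)) = (\<Sum>z\<in>Q. 1)" by (rule sum.cong) auto
      then show ?thesis by simp
    qed
    ultimately have sumQ: "2 * (\<Sum>z\<in>Q. card (I z \<inter> Q)) + card Q \<le> card Q * card Q" by simp
    have "card Q * (d - 1) = (\<Sum>z\<in>Q. card (I z))" using arcs(2) by (simp add: Q_def)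
    also have "\<dots> \<le> (\<Sum>z\<in>Q. card (I z \<inter> P) + card (I z \<inter> Q))"
    proof (rule sum_mono)
      fix z assume "z \<in> Q"
      then have "I z \<subseteq> Z" using arcs(1) by (auto simp: Q_def)
      then have "I z = (I z \<inter> P) \<union> (I z \<inter> Q)" by (auto simp: Q_def)
      then show "card (I z) \<le> card (I z \<inter> P) + card (I z \<inter> Q)" by (metis card_Un_le)
    qed
    also have "\<dots> = (\<Sum>z\<in>Q. card (I z \<inter> P)) + (\<Sum>z\<in>Q. card (I z \<inter> Q))" by (rule sum.distrib)
    finally have "card Q * (d - 1) \<le> 1 + (\<Sum>z\<in>Q. card (I z \<inter> Q))" using sumP by linarith
    then have main: "2 * (card Q * (d - 1)) + card Q \<le> 2 + card Q * card Q" using sumQ by linarith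
    have q1: "1 \<le> card Q" using False fQ by (simp add: Suc_le_eq card_gt_0_iff)
    have "card Q < card Z" by (rule psubset_card_mono[OF fZ]) (use z0P PZ in \<open>auto simp: Q_def\<close>)
    then have q2: "card Q \<le> 2 * d - 2" using Ts(2) by linarith
    define q where "q = int (card Q)"
    have "2 * (q * (int d - 1)) + q \<le> 2 + q * q"
    proof -
      have "int (2 * (card Q * (d - 1)) + card Q) \<le> int (2 + card Q * card Q)" using main by linarith
      moreover have "int (d - 1) = int d - 1" using d by simp
      ultimately show ?thesis by (simp only: of_nat_add of_nat_mult of_nat_numeral q_def)
    qed
    \<comment> \<open>\<open>card Q\<close> lies between 1 and \<open>2 * d - 2\<close>. At both
      ends of this range the inequality reads \<open>2 * d - 2 \<le> 2\<close>, and in between it is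
      stronger.\<close>
    moreover have "(q - 1) * (2 * int d - 2 - q) \<ge> 0" using q1 q2 d by (simp add: q_def)
    ultimately have "2 * int d - 2 \<le> 2" by (simp add: algebra_simps)
    then show False using d by simp
  qed
qed

text \<open>Split \<open>M\<close> into the edges inside \<open>D\<close> and the rest,
  \<open>M2\<close>. The clique breaks into at most \<open>1 + card M1\<close> components, so the
  components missing \<open>D\<close> outnumber \<open>ZK\<close>, the centers with a star in
  \<open>M2\<close>. But a center of \<open>D\<close> outside \<open>ZK\<close> ties all vertices
  outside \<open>D\<close> except possibly \<open>v\<close> and \<open>r\<close> to
  \<open>D\<close>; and if \<open>ZK\<close> contains all centers of \<open>D\<close>, it has at
  least \<open>d - 1\<close> elements, too many for the components left.\<close>

lemma clique_not_deficient:
  assumes S: "clique_structure c H U v d D Z \<kappa>" and H: "H \<subseteq> doubletons U" and U: "finite U" "card U = 2 * d + 1"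
    and d: "d \<ge> 4" and t: "t \<in> U" "t \<notin> D" "t \<notin> Z" and W: "W = U - {t}" and r: "r \<in> Z \<Longrightarrow> \<gamma> \<noteq> \<kappa> r"
    and v: "v \<noteq> t \<Longrightarrow> \<exists>z\<in>Z. {z, v} \<in> restrict_edges c H W r \<gamma>"
  shows "\<not> deficient c (restrict_edges c H W r \<gamma>) W F M"
proof
  let ?H = "restrict_edges c H W r \<gamma>"
  assume def: "deficient c ?H W F M"
  have FM: "F \<subseteq> ?H" "acyc F" "\<And>e f. e \<in> F \<Longrightarrow> f \<in> F \<Longrightarrow> conf c e f \<Longrightarrow> e = f" "M \<subseteq> F"
    "\<And>e. e \<in> ?H \<Longrightarrow> crossing (F - M) e \<Longrightarrow> \<exists>f\<in>M. conf c e f" "card F + 2 \<le> card W"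
    using def unfolding deficient_def by auto
  have Ss: "D \<subseteq> U" "card D = d" "Z \<subseteq> U" "card Z = d" "card (Z - D) \<le> 1" "v \<in> U" "v \<notin> Z" "v \<notin> D" "inj_on \<kappa> Z"
    and full: "\<And>q z. q \<in> U \<Longrightarrow> q \<notin> D \<Longrightarrow> q \<noteq> v \<Longrightarrow> z \<in> Z \<Longrightarrow> z \<noteq> q \<Longrightarrow> z \<in> D \<or> q \<notin> Z \<Longrightarrow> {z, q} \<in> H \<and> c {z, q} = \<kappa> z"
    and clique: "\<And>a b. a \<in> D \<Longrightarrow> b \<in> D \<Longrightarrow> a \<noteq> b \<Longrightarrow> {a, b} \<in> H \<and> unique_at c H a b"
    and cov: "\<And>e. e \<in> H \<Longrightarrow> \<not> e \<subseteq> D \<Longrightarrow> \<exists>z\<in>Z. z \<in> e \<and> c e = \<kappa> z"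
    using S unfolding clique_structure_def by auto
  have fin: "finite Z" "finite D" "finite W" using U(1) Ss W finite_subset by auto
  have HH: "?H \<subseteq> H" "?H \<subseteq> doubletons W"
    by (rule restrict_edges_subset, rule restrict_edges_doubletons[OF H])
  have finM: "finite M" using FM(1,4) HH(2) doubletons_finite[OF fin(3)] by (meson finite_subset)
  define G where "G = F - M"
  define p where "p x = conn G `` {x}" for x
  have p_eq: "p x = p y \<longleftrightarrow> \<not> crossing G {x, y}" for x y
    unfolding p_def crossing_pair conn_class_eq by simp
  have MH: "f \<in> H" if "f \<in> M" for f using that FM HH by blast
  have pair: "\<exists>a b. e = {a, b} \<and> a \<noteq> b \<and> a \<in> U \<and> b \<in> U" if "e \<in> H" for e
    using that H unfolding doubletons_def by blast
  have inD: "e = f" if e: "e \<subseteq> D" "e \<in> H" and f: "f \<in> H" and cf: "conf c e f" for e f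
  proof -
    obtain a where a: "a \<in> e" "a \<in> f" using cf unfolding conf_def by blast
    obtain b where b: "e = {a, b}" "a \<noteq> b" using doubletonsE[of e U a] a(1) e(2) H by blast
    have "unique_at c H a b" using clique[of a b] b e(1) by blast
    from unique_at_conf[OF H f a(2) this] show ?thesis using cf b(1) by (simp add: conf_def)
  qed
  define M1 where "M1 = {f \<in> M. f \<subseteq> D}"
  define M2 where "M2 = M - M1"
  have cM: "card M = card M1 + card M2"
    unfolding M2_def using finM card_Diff_subset[of M1 M] card_mono[of M M1] finite_subset[of M1 M]
    by (simp add: M1_def)
  define ZK where "ZK = {z \<in> Z. \<exists>f\<in>M2. z \<in> f \<and> c f = \<kappa> z}"
  define zz where "zz f = (SOME z. z \<in> Z \<and> z \<in> f \<and> c f = \<kappa> z)" for f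
  have "ZK \<subseteq> zz ` M2"
  proof
    fix z assume "z \<in> ZK"
    then obtain f where f: "z \<in> Z" "f \<in> M2" "z \<in> f" "c f = \<kappa> z" by (auto simp: ZK_def)
    have "zz f \<in> Z \<and> zz f \<in> f \<and> c f = \<kappa> (zz f)"
      unfolding zz_def by (rule someI[of _ z]) (use f in blast)
    then have "zz f = z" using f Ss(9) unfolding inj_on_def by metis
    then show "z \<in> zz ` M2" using f(2) by blast
  qed
  moreover have fM2: "finite M2" using finM by (simp add: M2_def)
  ultimately have cZK: "card ZK \<le> card M2" using surj_card_le by blast
  have ZKZ: "ZK \<subseteq> Z" by (auto simp: ZK_def)
  have fZK: "finite ZK" using ZKZ fin finite_subset by blast
  have stayD: "\<not> crossing G e" if e: "e \<in> ?H" "e \<subseteq> D" "e \<notin> M1" for e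
  proof
    assume "crossing G e"
    then obtain f where f: "f \<in> M" "conf c e f" using FM(5)[OF e(1)] unfolding G_def by blast
    have "e = f" using inD[OF e(2) _ MH[OF f(1)] f(2)] e(1) HH by blast
    then show False using e f by (auto simp: M1_def)
  qed
  have stay: "\<not> crossing G e" if e: "e \<in> ?H" "z \<in> Z" "c e = \<kappa> z" "\<not> e \<subseteq> D" "z \<notin> ZK" for e z
  proof
    assume "crossing G e"
    then obtain f where f: "f \<in> M" "conf c e f" using FM(5)[OF e(1)] unfolding G_def by blast
    have eH: "e \<in> H" using e(1) HH by blast
    have "\<not> f \<subseteq> D" using inD[OF _ MH[OF f(1)] eH] conf_sym[OF f(2)] e(4) by blast
    then have fM: "f \<in> M2" using f(1) by (simp add: M2_def M1_def)
    obtain z' where z': "z' \<in> Z" "z' \<in> f" "c f = \<kappa> z'" using cov[OF MH[OF f(1)] \<open>\<not> f \<subseteq> D\<close>] by blast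
    then have "\<kappa> z' = \<kappa> z" using f(2) e(3) by (simp add: conf_def)
    then have "z' = z" using Ss(9) z'(1) e(2) unfolding inj_on_def by blast
    then show False using e(2,5) z' fM by (auto simp: ZK_def)
  qed
  have DW: "D \<subseteq> W" using Ss(1) t W by blast
  have partsD: "card (parts D G) \<le> 1 + card M1"
  proof -
    \<comment> \<open>Edges inside \<open>D\<close> are forbidden only at \<open>r\<close>, and at
      most one of them has color \<gamma>. As \<open>d \<ge> 4\<close>, some \<open>x\<close> in
      \<open>D\<close> avoids \<open>r\<close> and this edge and keeps all its edges inside
      \<open>D\<close>.\<close>
    define bad where "bad = {w \<in> D. w \<noteq> r \<and> r \<in> D \<and> c {r, w} = \<gamma>}"
    have bad1: "w = w'" if "w \<in> bad" "w' \<in> bad" for w w'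
    proof -
      have "{r, w'} \<in> H" "unique_at c H r w'" "{r, w} \<in> H" using clique that by (auto simp: bad_def)
      then show ?thesis using unique_atD[of c H r w' w] that by (simp add: bad_def)
    qed
    have fb: "finite bad" using fin(2) by (simp add: bad_def)
    have "\<forall>a\<in>bad. \<forall>b\<in>bad. a = b" using bad1 by blast
    then have "card bad \<le> Suc 0" using card_le_Suc0_iff_eq[OF fb] by blast
    then have "card (insert r bad) \<le> 2" using fin(2) by (simp add: card_insert_if bad_def)
    then have "\<not> D \<subseteq> insert r bad"
      using card_mono[of "insert r bad" D] fin(2) Ss(2) d by (fastforce simp: bad_def)
    then obtain x where x: "x \<in> D" "x \<noteq> r" "x \<notin> bad" by blast
    have edge: "{x, w} \<in> ?H" if w: "w \<in> D" "w \<noteq> x" for w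
    proof -
      have "{x, w} \<in> H" using clique x w by blast
      moreover have "{x, w} \<subseteq> W" using x w DW by blast
      moreover have "\<not> (r \<in> {x, w} \<and> c {x, w} = \<gamma>)"
      proof
        assume h: "r \<in> {x, w} \<and> c {x, w} = \<gamma>"
        then have "w = r" using x(2) by blast
        then have "x \<in> bad" using h x w by (auto simp: bad_def insert_commute)
        then show False using x(3) by blast
      qed
      ultimately show ?thesis by (rule restrict_edgesI)
    qed
    define B where "B = {w \<in> D. w \<noteq> x \<and> {x, w} \<in> M1}"
    have "parts D G \<subseteq> insert (p x) (p ` B)"
    proof
      fix P assume "P \<in> parts D G"
      then obtain w where w: "w \<in> D" "P = p w" by (auto simp: parts_def p_def)
      show "P \<in> insert (p x) (p ` B)"
      proof (cases "w = x \<or> {x, w} \<in> M1")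
        case True
        then show ?thesis using w by (auto simp: B_def)
      next
        case False
        have "\<not> crossing G {x, w}" using stayD[OF edge[of w]] w x False by blast
        then show ?thesis using p_eq w by blast
      qed
    qed
    then have "card (parts D G) \<le> card (insert (p x) (p ` B))"
      by (rule card_mono[rotated]) (use fin(2) in \<open>simp add: B_def\<close>)
    also have "\<dots> \<le> Suc (card (p ` B))" by (rule card_insert_le_m1) simp_all
    also have "card (p ` B) \<le> card B" by (rule card_image_le) (use fin(2) in \<open>simp add: B_def\<close>)
    also have "card B \<le> card M1"
    proof (rule card_inj_on_le[where f="\<lambda>w. {x, w}"])
      show "inj_on (\<lambda>w. {x, w}) B" by (auto simp: inj_on_def doubleton_eq_iff)
      show "(\<lambda>w. {x, w}) ` B \<subseteq> M1" by (auto simp: B_def)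
      show "finite M1" using finM by (simp add: M1_def)
    qed
    finally show ?thesis by simp
  qed
  define R where "R = parts (W - D) G - parts D G"
  have "card (parts W G) + card F = card W + card M"
  proof -
    have "G \<subseteq> doubletons W" "acyc G" using FM(1,2) HH(2) acyc_subset[of F G] by (auto simp: G_def)
    then have "card (parts W G) + card G = card W" by (rule card_parts[OF fin(3)])
    moreover have "card G + card M = card F"
      unfolding G_def using FM(1,4) HH(2) doubletons_finite[OF fin(3)] finM
      by (metis card_Diff_subset card_mono finite_subset le_add_diff_inverse2)
    ultimately show ?thesis by simp
  qed
  then have N: "card M + 2 \<le> card (parts W G)" using FM(6) by linarith
  have "card (parts W G) \<le> card (parts D G) + card R" unfolding R_def by (rule parts_meeting[OF fin(3) DW])
  then have RK: "card ZK < card R" using N partsD cM cZK by linarith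
  define merged where "merged q \<longleftrightarrow> p q \<in> parts D G" for q
  have mergedI: "merged q" if "w \<in> D" "p q = p w" for q w
    using that unfolding merged_def parts_def p_def by blast
  have R_sub: "R \<subseteq> p ` {q \<in> W - D. \<not> merged q}"
    unfolding R_def merged_def parts_def p_def by blast
  have cardWD: "card (W - D) = d"
  proof -
    have "card W = 2 * d" using U t W by simp
    then show ?thesis using Ss(2) DW fin by (simp add: card_Diff_subset)
  qed
  have out: "q = q'" if "q \<in> Z - D" "q' \<in> Z - D" for q q'
    using card_le_Suc0_iff_eq[of "Z - D"] Ss(5) fin(1) that by auto
  have cZD: "d - 1 \<le> card (Z \<inter> D)" using card_Int_Diff[OF fin(1), of D] Ss(4,5) by linarith
  have pmerge: "p z = p q"
    if z: "z \<in> Z" "z \<notin> ZK" "z \<in> W" and q: "q \<in> W" "q \<notin> D" "q \<noteq> v" "z \<noteq> q" "z \<in> D \<or> q \<notin> Z" "q = r \<Longrightarrow> \<kappa> z \<noteq> \<gamma>" for z q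
  proof -
    have e: "{z, q} \<in> H" "c {z, q} = \<kappa> z" using full[of q z] q z W by auto
    have "\<not> (r \<in> {z, q} \<and> c {z, q} = \<gamma>)" using e(2) r z(1) q(6) by auto
    moreover have "{z, q} \<subseteq> W" using z(3) q(1) by blast
    ultimately have "{z, q} \<in> ?H" using e(1) by (intro restrict_edgesI)
    then have "\<not> crossing G {z, q}" using stay[OF _ z(1) e(2) _ z(2)] q(2) by blast
    then show ?thesis using p_eq by blast
  qed
  show False
  proof (cases "Z \<inter> D \<subseteq> ZK")
    case False
    then obtain w where w: "w \<in> Z" "w \<in> D" "w \<notin> ZK" by blast
    have wW: "w \<in> W" using w DW by blast
    have mg: "merged q" if "q \<in> W" "q \<notin> D" "q \<noteq> v" "q \<noteq> r" for q
      by (rule mergedI[OF w(2)], rule pmerge[OF w(1,3) wW, symmetric]) (use that w in auto)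
    then have sub: "{q \<in> W - D. \<not> merged q} \<subseteq> {v, r}" by blast
    show False
    proof (cases "r \<in> W - D \<and> r \<noteq> v \<and> \<not> merged r")
      case True
      \<comment> \<open>If \<open>r\<close> stays apart from \<open>D\<close>, each center of
        \<open>D\<close> whose color differs from \<gamma> has its star in \<open>M2\<close>. These
        are at least \<open>d - 2 \<ge> 2\<close> centers, against at most 2 components.\<close>
      have "{w \<in> Z \<inter> D. \<kappa> w \<noteq> \<gamma>} \<subseteq> ZK"
      proof (rule subsetI, rule ccontr)
        fix x assume x: "x \<in> {w \<in> Z \<inter> D. \<kappa> w \<noteq> \<gamma>}" "x \<notin> ZK"
        have "p x = p r" by (rule pmerge) (use x True DW in auto)
        then show False using mergedI[of x r] x True by simp
      qed
      then have "card {w \<in> Z \<inter> D. \<kappa> w \<noteq> \<gamma>} \<le> card ZK" by (rule card_mono[OF fZK])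
      moreover have "card (Z \<inter> D) \<le> card {w \<in> Z \<inter> D. \<kappa> w \<noteq> \<gamma>} + 1"
      proof -
        have "card {w \<in> Z \<inter> D. \<kappa> w = \<gamma>} \<le> Suc 0"
        proof -
          have "\<forall>a\<in>{w \<in> Z \<inter> D. \<kappa> w = \<gamma>}. \<forall>b\<in>{w \<in> Z \<inter> D. \<kappa> w = \<gamma>}. a = b"
            using Ss(9) unfolding inj_on_def by simp
          then show ?thesis using card_le_Suc0_iff_eq[of "{w \<in> Z \<inter> D. \<kappa> w = \<gamma>}"] fin(1) by simp
        qed
        moreover have "Z \<inter> D = {w \<in> Z \<inter> D. \<kappa> w \<noteq> \<gamma>} \<union> {w \<in> Z \<inter> D. \<kappa> w = \<gamma>}" by blast
        then have "card (Z \<inter> D) = card ({w \<in> Z \<inter> D. \<kappa> w \<noteq> \<gamma>} \<union> {w \<in> Z \<inter> D. \<kappa> w = \<gamma>})"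
          by (rule arg_cong)
        then have "card (Z \<inter> D) \<le> card {w \<in> Z \<inter> D. \<kappa> w \<noteq> \<gamma>} + card {w \<in> Z \<inter> D. \<kappa> w = \<gamma>}"
          using card_Un_le[of "{w \<in> Z \<inter> D. \<kappa> w \<noteq> \<gamma>}" "{w \<in> Z \<inter> D. \<kappa> w = \<gamma>}"] by linarith
        ultimately show ?thesis by linarith
      qed
      moreover have "card R \<le> 2"
      proof -
        have "R \<subseteq> p ` {v, r}" using R_sub sub by blast
        then have "card R \<le> card (p ` {v, r})" by (rule card_mono[rotated]) simp
        also have "\<dots> \<le> card {v, r}" by (rule card_image_le) simp
        also have "\<dots> \<le> 2" by (simp add: card_insert_if)
        finally show ?thesis .
      qed
      ultimately show False using RK cZD d by linarith
    next
      case r_merged: False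
      \<comment> \<open>Only \<open>v\<close> can be left over, so \<open>ZK\<close> is empty. The
        edge from a center to \<open>v\<close> granted by the hypothesis \<open>v\<close> then ties
        \<open>v\<close> to \<open>D\<close> after all.\<close>
      have sub': "{q \<in> W - D. \<not> merged q} \<subseteq> {v}" using sub r_merged by blast
      then have "R \<subseteq> {p v}" using R_sub by blast
      then have R1: "card R \<le> 1" using card_mono[of "{p v}" R] by simp
      then have "card ZK = 0" using RK by linarith
      then have ZK0: "ZK = {}" using fZK by simp
      have "R \<noteq> {}" using RK by auto
      then have nv: "v \<in> W" "\<not> merged v" using R_sub sub' by blast+
      then have "v \<noteq> t" using W by blast
      then obtain z where z: "z \<in> Z" "{z, v} \<in> ?H" using v by blast
      have "\<exists>z'\<in>Z. z' \<in> {z, v} \<and> c {z, v} = \<kappa> z'" using cov[of "{z, v}"] z(2) HH Ss(8) by blast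
      then have "c {z, v} = \<kappa> z" using Ss(7) by auto
      then have "\<not> crossing G {z, v}" using stay[OF z(2,1)] ZK0 Ss(8) by blast
      then have pz: "p v = p z" using p_eq by blast
      have zW: "z \<in> W" using z(1) Ss(3) t W by blast
      have "merged z"
      proof (cases "z \<in> D")
        case True
        then show ?thesis using mergedI by blast
      next
        case False
        show ?thesis
        proof (cases "z = r")
          case True
          then show ?thesis using r_merged zW False z(1) Ss(7) by blast
        next
          case False
          then show ?thesis using mg[OF zW \<open>z \<notin> D\<close>] z(1) Ss(7) by blast
        qed
      qed
      then show False using nv(2) pz unfolding merged_def by simp
    qed
  next
    case True
    have big: "d - 1 \<le> card ZK" using card_mono[OF fZK True] cZD by linarith
    show False
    proof (cases "Z \<subseteq> ZK")
      case True
      then have "d \<le> card ZK" using card_mono[OF fZK, of Z] Ss(4) by simp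
      moreover have "card R \<le> d"
      proof -
        have "R \<subseteq> p ` (W - D)" using R_sub by blast
        then have "card R \<le> card (p ` (W - D))" by (rule card_mono[rotated]) (use fin in simp)
        also have "\<dots> \<le> card (W - D)" by (rule card_image_le) (use fin in simp)
        finally show ?thesis using cardWD by simp
      qed
      ultimately show False using RK by linarith
    next
      case False
      \<comment> \<open>The center outside \<open>D\<close> that is not in \<open>ZK\<close> ties
        together all of \<open>W - D\<close> except \<open>v\<close> and \<open>r\<close>, so at
        most \<open>3 \<le> d - 1\<close> components remain.\<close>
      then obtain z where z: "z \<in> Z" "z \<notin> ZK" by blast
      have zD: "z \<notin> D" using z True by blast
      have zW: "z \<in> W" using z(1) Ss(3) t W by blast
      have "p q \<in> p ` {z, v, r}" if q: "q \<in> W - D" for q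
      proof (cases "q \<in> {z, v, r}")
        case True
        then show ?thesis by blast
      next
        case False
        have "q \<notin> Z" using out[of q z] z(1) zD q False by blast
        then have "p z = p q" using pmerge[OF z zW, of q] q False by blast
        then show ?thesis by blast
      qed
      then have "R \<subseteq> p ` {z, v, r}" using R_sub by blast
      then have "card R \<le> card (p ` {z, v, r})" by (rule card_mono[rotated]) simp
      also have "\<dots> \<le> card {z, v, r}" by (rule card_image_le) simp
      also have "\<dots> \<le> 3" by (simp add: card_insert_if)
      finally show False using RK big d by linarith
    qed
  qed
qed

section \<open>From the configuration on \<open>U\<close> to all edges of the graph\<close>

lemma covered_card:
  assumes F: "F \<subseteq> doubletons V" "pc c F" and Z: "finite Z" and cov: "\<And>f. f \<in> F \<Longrightarrow> \<exists>z\<in>Z. z \<in> f \<and> c f = \<kappa> z"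
  shows "card F \<le> card Z"
proof -
  define zz where "zz f = (SOME z. z \<in> Z \<and> z \<in> f \<and> c f = \<kappa> z)" for f
  have zz: "zz f \<in> Z \<and> zz f \<in> f \<and> c f = \<kappa> (zz f)" if "f \<in> F" for f
    unfolding zz_def by (rule someI_ex) (use cov[OF that] in blast)
  show ?thesis
  proof (rule card_inj_on_le[OF _ _ Z])
    show "zz ` F \<subseteq> Z" using zz by blast
    show "inj_on zz F"
    proof (rule inj_onI)
      fix f g assume fg: "f \<in> F" "g \<in> F" "zz f = zz g"
      define s where "s = zz f"
      have sf: "s \<in> f" "c f = \<kappa> s" using zz[OF fg(1)] by (auto simp: s_def)
      have sg: "s \<in> g" "c g = \<kappa> s" using zz[OF fg(2)] fg(3) by (auto simp: s_def)
      have fgV: "f \<in> doubletons V" "g \<in> doubletons V" using fg(1,2) F(1) by blast+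
      obtain x where x: "f = {s, x}" using doubletonsE[OF fgV(1) sf(1)] by blast
      obtain y where y: "g = {s, y}" using doubletonsE[OF fgV(2) sg(1)] by blast
      have "{s, x} \<in> F \<and> {s, y} \<in> F \<and> c {s, x} = c {s, y}" using fg(1,2) sf(2) sg(2) unfolding x y by simp
      then have "x = y" using F(2)[unfolded pc_def] by blast
      then show "f = g" using x y by simp
    qed
  qed
qed

lemma acyc_card_less:
  assumes "finite D" "D \<noteq> {}" "F \<subseteq> doubletons D" "acyc F" shows "card F < card D"
proof -
  have "card (parts D F) + card F = card D" by (rule card_parts[OF assms(1,3,4)])
  moreover have "card (parts D F) > 0" using assms(1,2) by (simp add: parts_def card_gt_0_iff)
  ultimately show ?thesis by linarith
qed

text \<open>An edge that the rigid configuration does not account for can serve as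
  \<open>{r, b}\<close> with a suitable \<open>t\<close>: \<open>fail\<close> then supplies a
  deficient forest where \<open>tournament_not_deficient\<close> or
  \<open>clique_not_deficient\<close> excludes one. So the stars cover all edges, apart from those
  inside \<open>D\<close> in the clique case. The second conclusion decides the minimum in the final
  bound.\<close>

theorem no_larger_tree:
  fixes V :: "'a set"
  assumes V: "finite V" "E \<subseteq> doubletons V" and con: "\<And>x y. x \<in> V \<Longrightarrow> y \<in> V \<Longrightarrow> (x, y) \<in> conn E"
    and d: "4 \<le> d" and degree: "\<And>w. w \<in> V \<Longrightarrow> d \<le> card {c {w, x} | x. {w, x} \<in> E}"
    and g: "grown V E c X T" and XV: "X \<noteq> V" and cX: "card X \<le> 2 * d"
    and ext: "\<And>w b. w \<in> X \<Longrightarrow> b \<in> V - X \<Longrightarrow> {w, b} \<in> E \<Longrightarrow> \<exists>x. {w, x} \<in> T \<and> c {w, x} = c {w, b}"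
    and HrE: "\<And>v. v \<in> V - X \<Longrightarrow> Hr v \<subseteq> E \<and> Hr v \<subseteq> doubletons (insert v X)"
    and Hr_star: "\<And>v. v \<in> V - X \<Longrightarrow> star_colored c (Hr v)"
    and Hr_unique: "\<And>v x. v \<in> V - X \<Longrightarrow> {v, x} \<in> Hr v \<Longrightarrow> unique_at c (Hr v) v x"
    and Hr_colors: "\<And>v w x. v \<in> V - X \<Longrightarrow> {w, x} \<in> E \<Longrightarrow> w \<in> insert v X \<Longrightarrow> x \<in> insert v X \<Longrightarrow>
        \<exists>y. {w, y} \<in> Hr v \<and> c {w, y} = c {w, x}"
    and main: "\<And>v w. v \<in> V - X \<Longrightarrow> w \<in> X \<Longrightarrow> {v, w} \<in> E \<Longrightarrow> \<exists>F M. deficient c (Hr v) (insert v X) F M"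
    and fail: "\<And>v t r b. v \<in> V - X \<Longrightarrow> t \<in> insert v X \<Longrightarrow> r \<in> insert v X - {t} \<Longrightarrow> b \<in> V - (insert v X - {t}) \<Longrightarrow>
        {r, b} \<in> E \<Longrightarrow> \<exists>F M. deficient c (restrict_edges c (Hr v) (insert v X - {t}) r (c {r, b})) (insert v X - {t}) F M"
    and g': "grown V E c Y F'"
  shows "card Y \<le> 2 * d" "2 * d < card V"
proof -
  note gp = grown_props[OF g V(2)]
  note gp' = grown_props[OF g' V(2)]
  have Epair: "a \<in> V \<and> b \<in> V \<and> a \<noteq> b" if "{a, b} \<in> E" for a b using subsetD[OF V(2) that] by simp
  \<comment> \<open>Vertices outside \<open>X\<close> with a neighbor outside \<open>X\<close>. If
    there are any, \<open>v\<close> is chosen among them, so that an edge from \<open>v\<close> to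
    another vertex outside \<open>X\<close> can play the role of \<open>{r, b}\<close>; this leads
    to \<open>S = {}\<close>.\<close>
  define S where "S = {u \<in> V - X. \<exists>u'\<in>V - X. {u, u'} \<in> E}"
  have "\<exists>v w. v \<in> V - X \<and> w \<in> X \<and> {v, w} \<in> E \<and> (S \<noteq> {} \<longrightarrow> v \<in> S)"
  proof (cases "S = {}")
    case True
    obtain r b where "r \<in> X" "b \<notin> X" "{r, b} \<in> E" using connected_extension[OF con gp(1,10) XV] by blast
    then show ?thesis using True Epair[of r b] by (intro exI[of _ b] exI[of _ r]) (auto simp: insert_commute)
  next
    case False
    have SV: "S \<subseteq> V" "S \<noteq> V" using gp(1,10) by (auto simp: S_def)
    obtain r b where rb: "r \<in> S" "b \<notin> S" "{r, b} \<in> E" using connected_extension[OF con SV(1) False SV(2)] by blast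
    have "b \<in> X"
    proof (rule ccontr)
      assume "b \<notin> X"
      then have "b \<in> V - X" "r \<in> V - X" "{b, r} \<in> E" using Epair[OF rb(3)] rb by (auto simp: S_def insert_commute)
      then show False using rb(2) unfolding S_def by blast
    qed
    then show ?thesis using rb by (auto simp: S_def)
  qed
  then obtain v w0 where v: "v \<in> V - X" "w0 \<in> X" "{v, w0} \<in> E" "S \<noteq> {} \<longrightarrow> v \<in> S" by blast
  define U where "U = insert v X"
  define H where "H = Hr v"
  have HE: "H \<subseteq> E" "H \<subseteq> doubletons U" using HrE[OF v(1)] by (auto simp: H_def U_def)
  have fU: "finite U" using gp(4) by (simp add: U_def)
  have cU: "card U = Suc (card X)" using gp(4) v(1) by (simp add: U_def)
  have colors: "\<exists>y. {w, y} \<in> H \<and> c {w, y} = c {w, x}" if "{w, x} \<in> E" "w \<in> U" "x \<in> U" for w x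
    using Hr_colors[OF v(1) that(1)] that(2,3) by (simp add: U_def H_def)
  have Hpair: "a \<in> U \<and> b \<in> U \<and> a \<noteq> b" if "{a, b} \<in> H" for a b using subsetD[OF HE(2) that] by simp
  obtain F M where FM: "deficient c H U F M" using main[OF v(1-3)] by (auto simp: H_def U_def)
  \<comment> \<open>Edges that leave \<open>U\<close> bring no further color to a vertex of
    \<open>X\<close>, since \<open>ext\<close> repeats their color on the tree.\<close>
  have colorsX: "\<exists>y. {w, y} \<in> H \<and> c {w, y} = c {w, x}" if w: "w \<in> X" and x: "{w, x} \<in> E" for w x
  proof (cases "x \<in> U")
    case True
    then show ?thesis using colors[OF x] w by (simp add: U_def)
  next
    case False
    then have "x \<in> V - X" using Epair[OF x] by (simp add: U_def)
    then obtain x' where x': "{w, x'} \<in> T" "c {w, x'} = c {w, x}" using ext[OF w _ x] by blast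
    have "x' \<in> X" using subsetD[OF gp(3) x'(1)] by simp
    then show ?thesis using colors[of w x'] x' gp(2) w by (auto simp: U_def)
  qed
  interpret deficient_forest U H c v d F M
  proof
    show "finite U" by (rule fU)
    show "H \<subseteq> doubletons U" by (rule HE(2))
    show "star_colored c H" using Hr_star[OF v(1)] by (simp add: H_def)
    show "v \<in> U" by (simp add: U_def)
    show "unique_at c H v x" if "{v, x} \<in> H" for x using Hr_unique[OF v(1), of x] that by (simp add: H_def)
    show "deficient c H U F M" by (rule FM)
    show "4 \<le> d" by (rule d)
    show "card U \<le> 2 * d + 1" using cU cX by simp
    show "\<exists>x. {v, x} \<in> H" using colors[OF v(3)] v(2) by (auto simp: U_def)
    fix w assume w: "w \<in> U" "w \<noteq> v"
    then have wX: "w \<in> X" by (simp add: U_def)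
    then have "d \<le> card {c {w, x} | x. {w, x} \<in> E}" using degree gp(1) by blast
    also have "\<dots> \<le> card {c {w, x} | x. {w, x} \<in> H}"
    proof (rule card_mono)
      have "{c {w, x} | x. {w, x} \<in> H} \<subseteq> (\<lambda>x. c {w, x}) ` U" using Hpair by blast
      then show "finite {c {w, x} | x. {w, x} \<in> H}" using fU finite_subset by blast
      show "{c {w, x} | x. {w, x} \<in> E} \<subseteq> {c {w, x} | x. {w, x} \<in> H}"
      proof
        fix \<gamma> assume "\<gamma> \<in> {c {w, x} | x. {w, x} \<in> E}"
        then obtain x where x: "\<gamma> = c {w, x}" "{w, x} \<in> E" by blast
        obtain y where "{w, y} \<in> H" "c {w, y} = c {w, x}" using colorsX[OF wX x(2)] by blast
        then show "\<gamma> \<in> {c {w, x} | x. {w, x} \<in> H}" using x(1) by (intro CollectI exI[of _ y]) simp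
      qed
    qed
    finally show "d \<le> card {c {w, x} | x. {w, x} \<in> H}" .
  qed
  have ext': "\<exists>x\<in>U - {v}. x \<noteq> w \<and> c {w, x} = c {v, w}" if w: "{v, w} \<in> H" for w
  proof -
    have wX: "w \<in> X" using Hpair[OF w] unfolding U_def by blast
    have e: "{w, v} \<in> E" using w HE(1) by (auto simp: insert_commute)
    obtain x where x: "{w, x} \<in> T" "c {w, x} = c {w, v}" using ext[OF wX v(1) e] by blast
    have "x \<in> X" "x \<noteq> w" using subsetD[OF gp(3) x(1)] by auto
    then show ?thesis using x(2) v(1) by (intro bexI[of _ x]) (auto simp: U_def insert_commute)
  qed
  \<comment> \<open>With \<open>r = v\<close> the color of \<open>{v, b'}\<close> is forbidden at
    \<open>v\<close>, so an edge of \<open>H\<close> at \<open>v\<close> in another color is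
    required. As \<open>v\<close> has at least 4 colors, there is an edge \<open>{v, u}\<close> of
    another color; if it leaves \<open>U\<close>, then \<open>u\<close> takes the place of
    \<open>b'\<close>.\<close>
  have outside: "\<exists>z b'. {v, z} \<in> H \<and> b' \<in> V - U \<and> {v, b'} \<in> E \<and> c {v, z} \<noteq> c {v, b'}" if "S \<noteq> {}"
  proof -
    have "v \<in> S" using v(4) that by blast
    then obtain b' where b': "b' \<in> V - X" "{v, b'} \<in> E" by (auto simp: S_def)
    have b'U: "b' \<in> V - U" using b' Epair[OF b'(2)] by (auto simp: U_def)
    obtain y where y: "{v, y} \<in> H" using vdeg by blast
    show ?thesis
    proof (cases "c {v, y} = c {v, b'}")
      case False
      then show ?thesis using y b' b'U by blast
    next
      case True
      have "\<exists>u. {v, u} \<in> E \<and> c {v, u} \<noteq> c {v, b'}"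
      proof (rule ccontr)
        assume "\<nexists>u. {v, u} \<in> E \<and> c {v, u} \<noteq> c {v, b'}"
        then have "{c {v, x} | x. {v, x} \<in> E} \<subseteq> {c {v, b'}}" by blast
        then have "card {c {v, x} | x. {v, x} \<in> E} \<le> card {c {v, b'}}" by (rule card_mono[rotated]) simp
        moreover have "d \<le> card {c {v, x} | x. {v, x} \<in> E}" using degree v(1) by blast
        moreover have "card {c {v, b'}} = 1" by simp
        ultimately show False using d by linarith
      qed
      then obtain u where u: "{v, u} \<in> E" "c {v, u} \<noteq> c {v, b'}" by blast
      show ?thesis
      proof (cases "u \<in> U")
        case True
        obtain y' where "{v, y'} \<in> H" "c {v, y'} = c {v, u}" using colors[OF u(1) vU True] by blast
        then show ?thesis using u(2) b' b'U by metis
      next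
        case False
        then have "u \<in> V - U" using Epair[OF u(1)] by blast
        then show ?thesis using y u True by metis
      qed
    qed
  qed
  have outV: "b \<in> V - (U - {v})" if "b \<in> V - X" for b using that v(1) by (auto simp: U_def)
  have fail': "\<exists>F M. deficient c (restrict_edges c H (U - {t}) r (c {r, b})) (U - {t}) F M"
    if "t \<in> U" "r \<in> U - {t}" "b \<in> V - (U - {t})" "{r, b} \<in> E" for t r b
    using fail[OF v(1), of t r b] that unfolding U_def H_def by blast
  have F'V: "F' \<subseteq> doubletons V" using gp'(2) V(2) by blast
  have "U \<subseteq> V" using gp(1) v(1) by (simp add: U_def)
  then show "2 * d < card V" using card_mono[OF V(1), of U] rigid(1) by simp
  show "card Y \<le> 2 * d" using clique_or_tournament[OF ext']
  proof
    assume "\<exists>D. clique_structure c H U v d D Z \<kappa>"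
    then obtain D where cs: "clique_structure c H U v d D Z \<kappa>" by blast
    have Ss: "D \<subseteq> U" "card D = d" "Z \<subseteq> U" "card Z = d" "card (Z - D) \<le> 1" "v \<in> U" "v \<notin> Z" "v \<notin> D" "inj_on \<kappa> Z"
      and cov: "\<And>e. e \<in> H \<Longrightarrow> \<not> e \<subseteq> D \<Longrightarrow> \<exists>z\<in>Z. z \<in> e \<and> c e = \<kappa> z"
      and special: "\<And>q a. q \<in> Z - D \<Longrightarrow> a \<in> D \<Longrightarrow> {a, q} \<in> H"
      using cs unfolding clique_structure_def by auto
    have fZD: "finite Z" "finite D" using Ss fU finite_subset by blast+
    have vz: "z \<in> Z \<and> c {z, v} = \<kappa> z" if z: "{z, v} \<in> H" for z
    proof -
      have "\<exists>x\<in>Z. x \<in> {z, v} \<and> c {z, v} = \<kappa> x" using cov[OF z] Ss(8) by blast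
      then show ?thesis using Ss(7) by auto
    qed
    note nd = clique_not_deficient[OF cs HE(2) fU rigid(1) d]
    have S0: "S = {}"
    proof (rule ccontr)
      assume "S \<noteq> {}"
      then obtain z b where zb: "{v, z} \<in> H" "b \<in> V - U" "{v, b} \<in> E" "c {v, z} \<noteq> c {v, b}"
        using outside by blast
      have "U - D - Z - {v} \<noteq> {}"
      proof
        assume "U - D - Z - {v} = {}"
        then have "U \<subseteq> D \<union> insert v (Z - D)" by blast
        then have "card U \<le> card (D \<union> insert v (Z - D))" by (rule card_mono[rotated]) (use fZD in simp)
        also have "\<dots> \<le> card D + card (insert v (Z - D))" by (rule card_Un_le)
        also have "\<dots> \<le> d + 2" using Ss(2,5) fZD by (simp add: card_insert_if)
        finally show False using rigid(1) d by linarith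
      qed
      then obtain t where t: "t \<in> U" "t \<notin> D" "t \<notin> Z" "t \<noteq> v" by blast
      have "{z, v} \<in> restrict_edges c H (U - {t}) v (c {v, b})"
      proof (rule restrict_edgesI)
        show "{z, v} \<in> H" using zb(1) by (simp add: insert_commute)
        then have "z \<in> Z" using vz by blast
        then show "{z, v} \<subseteq> U - {t}" using t Ss(3,6) by blast
        show "\<not> (v \<in> {z, v} \<and> c {z, v} = c {v, b})" using zb(4) by (simp add: insert_commute)
      qed
      moreover have "z \<in> Z" using vz[of z] zb(1) by (simp add: insert_commute)
      moreover have "v \<in> U - {t}" "b \<in> V - (U - {t})" using t Ss(6) zb(2) by auto
      ultimately show False
        using fail'[OF t(1), of v b] nd[OF t(1-3) refl, of v "c {v, b}"] zb(3) Ss(7) by blast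
    qed
    \<comment> \<open>The edge \<open>{z0, v}\<close> stays available when \<open>v\<close> is not
      deleted: \<open>a = v\<close> is excluded, and \<open>a = z0\<close> would make the forbidden
      color different from \<open>\<kappa> z0\<close>.\<close>
    have contra: False
      if e: "t \<in> U" "t \<notin> D" "t \<notin> Z" "a \<in> U - {t}" "b \<in> V - (U - {t})" "{a, b} \<in> E"
        "\<not> (\<exists>z\<in>Z. z \<in> {a, b} \<and> c {a, b} = \<kappa> z)" "v \<noteq> t \<Longrightarrow> a \<noteq> v" for t a b
    proof -
      obtain z0 where z0: "{z0, v} \<in> H" using vdeg by (auto simp: insert_commute)
      have z: "z0 \<in> Z" "c {z0, v} = \<kappa> z0" using vz[OF z0] by auto
      have r: "a \<in> Z \<Longrightarrow> c {a, b} \<noteq> \<kappa> a" using e(7) by blast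
      have "\<exists>z\<in>Z. {z, v} \<in> restrict_edges c H (U - {t}) a (c {a, b})" if vt: "v \<noteq> t"
      proof (rule bexI[OF restrict_edgesI z(1)])
        show "{z0, v} \<in> H" by (rule z0)
        show "{z0, v} \<subseteq> U - {t}" using vt z(1) e(3) Ss(3,6) by blast
        show "\<not> (a \<in> {z0, v} \<and> c {z0, v} = c {a, b})" using e(8)[OF vt] z r by auto
      qed
      then show False using fail'[OF e(1,4,5,6)] nd[OF e(1-3) refl r] by blast
    qed
    have allcov: "e \<subseteq> D \<or> (\<exists>z\<in>Z. z \<in> e \<and> c e = \<kappa> z)" if eE: "e \<in> E" for e
    proof (rule ccontr)
      assume h: "\<not> ?thesis"
      obtain a b where ab: "e = {a, b}" using eE V(2) unfolding doubletons_def by blast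
      have E: "{a, b} \<in> E" "{b, a} \<in> E" using eE ab by (auto simp: insert_commute)
      have nc: "\<not> (\<exists>z\<in>Z. z \<in> {a, b} \<and> c {a, b} = \<kappa> z)" "\<not> (\<exists>z\<in>Z. z \<in> {b, a} \<and> c {b, a} = \<kappa> z)"
        using h ab by (auto simp: insert_commute)
      have abV: "a \<in> V" "b \<in> V" "a \<noteq> b" using Epair[OF E(1)] by auto
      have UX: "U - {v} = X" using v(1) by (auto simp: U_def)
      have notboth: "a \<in> X \<or> b \<in> X"
      proof (rule ccontr)
        assume "\<not> ?thesis"
        then have "a \<in> S" using abV E unfolding S_def by blast
        then show False using S0 by blast
      qed
      show False
      proof (cases "a \<in> X \<and> b \<in> X")
        case False
        then consider "a \<in> X" "b \<in> V - X" | "b \<in> X" "a \<in> V - X" using notboth abV by blast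
        then show False
        proof cases
          case 1
          then show False using contra[of v a b] Ss(6-8) UX E(1) nc(1) by simp
        next
          case 2
          then show False using contra[of v b a] Ss(6-8) UX E(2) nc(2) by simp
        qed
      next
        case True
        have XU: "a \<in> U" "b \<in> U" "a \<noteq> v" "b \<noteq> v" using True v(1) by (auto simp: U_def)
        \<comment> \<open>If both ends lie in \<open>X\<close>, the deleted vertex is an end of the
          edge itself: with \<open>t = x\<close> the edge \<open>{y, x}\<close> leaves
          \<open>U - {t}\<close>.\<close>
        have take: False if "x \<notin> D" "x \<notin> Z" "x = a \<and> y = b \<or> x = b \<and> y = a" for x y
          using contra[of x y x] that XU abV E nc by auto
        have "\<not> (a \<in> D \<and> b \<in> D)" using h ab by simp
        then consider "a \<notin> D" "b \<in> D" | "b \<notin> D" "a \<in> D" | "a \<notin> D" "b \<notin> D" by blast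
        then show False
        proof cases
          case 1
          then have "a \<in> Z" using take by blast
          then have "{b, a} \<in> H" using special[of a b] 1 by blast
          then show False using cov[of "{b, a}"] 1 nc(2) by blast
        next
          case 2
          then have "b \<in> Z" using take by blast
          then have "{a, b} \<in> H" using special[of b a] 2 by blast
          then show False using cov[of "{a, b}"] 2 nc(1) by blast
        next
          case 3
          then have "a \<in> Z - D" "b \<in> Z - D" using take by blast+
          moreover have "\<forall>x\<in>Z - D. \<forall>y\<in>Z - D. x = y" using card_le_Suc0_iff_eq[of "Z - D"] fZD Ss(5) by simp
          ultimately show False using abV(3) by blast
        qed
      qed
    qed
    \<comment> \<open>At most \<open>d - 1\<close> tree edges inside the \<open>d\<close> vertices
      of \<open>D\<close> and at most one in each of the \<open>d\<close> stars: at most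
      \<open>2 * d - 1\<close> edges, hence \<open>2 * d\<close> vertices.\<close>
    define FD where "FD = {f \<in> F'. f \<subseteq> D}"
    have "FD \<subseteq> doubletons D"
    proof
      fix f assume f: "f \<in> FD"
      then have "f \<in> doubletons V" using F'V unfolding FD_def by blast
      then obtain a b where "f = {a, b}" "a \<noteq> b" unfolding doubletons_def by blast
      then show "f \<in> doubletons D" using f by (simp add: FD_def)
    qed
    moreover have "acyc FD" by (rule acyc_subset[OF gp'(7)]) (auto simp: FD_def)
    moreover have "D \<noteq> {}" using Ss(2) d by auto
    ultimately have 1: "card FD < d" using acyc_card_less[OF fZD(2), of FD] Ss(2) by simp
    have "card (F' - FD) \<le> card Z"
    proof (rule covered_card[OF _ _ fZD(1)])
      show "F' - FD \<subseteq> doubletons V" using F'V by blast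
      show "pc c (F' - FD)" using gp'(8) unfolding pc_def by blast
      show "\<exists>z\<in>Z. z \<in> f \<and> c f = \<kappa> z" if "f \<in> F' - FD" for f
        using allcov[of f] that gp'(2) by (auto simp: FD_def)
    qed
    moreover have "card F' = card FD + card (F' - FD)"
      using card_Un_disjoint[of FD "F' - FD"] gp'(5) by (simp add: FD_def Un_absorb1)
    ultimately show ?thesis using 1 gp'(6) Ss(4) by linarith
  next
    assume "\<exists>y. tournament_structure c H U v y d Z \<kappa> I"
    then obtain y where ts: "tournament_structure c H U v y d Z \<kappa> I" by blast
    have Ts: "U = insert y (insert v Z)" "card Z = 2 * d - 1" "y \<noteq> v" "y \<notin> Z" "v \<notin> Z" "inj_on \<kappa> Z"
      and cov: "\<And>e. e \<in> H \<Longrightarrow> \<exists>z\<in>Z. z \<in> e \<and> c e = \<kappa> z"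
      and pairs: "\<And>x z. x \<in> Z \<Longrightarrow> z \<in> Z \<Longrightarrow> x \<noteq> z \<Longrightarrow> {x, z} \<in> H"
      and y2: "2 \<le> card {z \<in> Z. {z, y} \<in> H}"
      using ts unfolding tournament_structure_def by auto
    have fZ: "finite Z" by (rule Z_sub(2))
    have arcZ: "c {z, q} = \<kappa> z" if "{z, q} \<in> H" "q \<notin> Z" for z q
      using cov[OF that(1)] that(2) by auto
    note nd = tournament_not_deficient[OF ts HE(2) fU d]
    have Wy: "U - {y} = insert v Z" and Wv: "U - {v} = insert y Z" using Ts by auto
    have UX: "U - {v} = X" using v(1) by (auto simp: U_def)
    have vz: "z \<in> Z" if z: "{z, v} \<in> H" for z using cov[OF z] Ts(5) by auto
    have S0: "S = {}"
    proof (rule ccontr)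
      assume "S \<noteq> {}"
      then obtain z b where zb: "{v, z} \<in> H" "b \<in> V - U" "{v, b} \<in> E" "c {v, z} \<noteq> c {v, b}"
        using outside by blast
      have zv: "{z, v} \<in> H" using zb(1) by (simp add: insert_commute)
      have "{z, v} \<in> restrict_edges c H (insert v Z) v (c {v, b})"
        by (rule restrict_edgesI[OF zv]) (use vz[OF zv] zb(4) in \<open>auto simp: insert_commute\<close>)
      then have "\<not> deficient c (restrict_edges c H (insert v Z) v (c {v, b})) (insert v Z) F M" for F M
        using nd[of v "insert v Z" v "c {v, b}" z] vz[OF zv] Ts(5) by blast
      moreover have "y \<in> U" "v \<in> U - {y}" "b \<in> V - (U - {y})" using Ts zb(2) by auto
      ultimately show False using fail'[of y v b] zb(3) unfolding Wy by blast
    qed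
    have contraV: False if e: "a \<in> X" "b \<in> V - X" "{a, b} \<in> E"
        "\<not> (\<exists>z\<in>Z. z \<in> {a, b} \<and> c {a, b} = \<kappa> z)" for a b
    proof -
      have r: "a \<in> Z \<Longrightarrow> c {a, b} \<noteq> \<kappa> a" using e(4) by blast
      \<comment> \<open>\<open>y\<close> has two neighboring centers, and since star colors are
        distinct, at most one of them has the forbidden color.\<close>
      have "\<exists>z1\<in>{z \<in> Z. {z, y} \<in> H}. \<kappa> z1 \<noteq> c {a, b}"
      proof (rule ccontr)
        assume "\<not> ?thesis"
        then have "\<forall>x\<in>{z \<in> Z. {z, y} \<in> H}. \<forall>z\<in>{z \<in> Z. {z, y} \<in> H}. x = z"
          using Ts(6) unfolding inj_on_def by simp
        then have "card {z \<in> Z. {z, y} \<in> H} \<le> Suc 0"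
          using card_le_Suc0_iff_eq[of "{z \<in> Z. {z, y} \<in> H}"] fZ by simp
        then show False using y2 by simp
      qed
      then obtain z1 where z1: "z1 \<in> Z" "{z1, y} \<in> H" "\<kappa> z1 \<noteq> c {a, b}" by blast
      have "c {z1, y} \<noteq> c {a, b}" using arcZ[OF z1(2) Ts(4)] z1(3) by simp
      then have "{z1, y} \<in> restrict_edges c H (insert y Z) a (c {a, b})"
        by (intro restrict_edgesI[OF z1(2)]) (use z1 in auto)
      then have "\<not> deficient c (restrict_edges c H (insert y Z) a (c {a, b})) (insert y Z) F M" for F M
        using nd[of y "insert y Z" a "c {a, b}" z1] z1(1) r by blast
      moreover have "v \<in> U" "a \<in> U - {v}" "b \<in> V - (U - {v})" using e UX vU by auto
      ultimately show False using fail'[of v a b] e(3) unfolding Wv by blast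
    qed
    \<comment> \<open>Here \<open>t\<close> and \<open>b\<close> are both \<open>y\<close>: the edge
      \<open>{a, y}\<close> brings the deleted vertex back.\<close>
    have contraY: False if e: "a \<in> Z" "{a, y} \<in> E" "\<not> (\<exists>z\<in>Z. z \<in> {a, y} \<and> c {a, y} = \<kappa> z)" for a
    proof -
      have r: "a \<in> Z \<Longrightarrow> c {a, y} \<noteq> \<kappa> a" using e(3) by blast
      obtain z1 where z1: "{z1, v} \<in> H" using vdeg by (auto simp: insert_commute)
      have "{z1, v} \<in> restrict_edges c H (insert v Z) a (c {a, y})"
        by (rule restrict_edgesI[OF z1]) (use vz[OF z1] arcZ[OF z1 Ts(5)] r e(1) Ts(5) in auto)
      then have "\<not> deficient c (restrict_edges c H (insert v Z) a (c {a, y})) (insert v Z) F M" for F M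
        using nd[of v "insert v Z" a "c {a, y}" z1] vz[OF z1] r by blast
      moreover have "y \<in> U" "a \<in> U - {y}" "y \<in> V - (U - {y})" using Ts e Epair[OF e(2)] by auto
      ultimately show False using fail'[of y a y] e(2) unfolding Wy by blast
    qed
    have allcov: "\<exists>z\<in>Z. z \<in> e \<and> c e = \<kappa> z" if eE: "e \<in> E" for e
    proof (rule ccontr)
      assume h: "\<not> ?thesis"
      obtain a b where ab: "e = {a, b}" using eE V(2) unfolding doubletons_def by blast
      have E: "{a, b} \<in> E" "{b, a} \<in> E" using eE ab by (auto simp: insert_commute)
      have nc: "\<not> (\<exists>z\<in>Z. z \<in> {a, b} \<and> c {a, b} = \<kappa> z)" "\<not> (\<exists>z\<in>Z. z \<in> {b, a} \<and> c {b, a} = \<kappa> z)"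
        using h ab by (auto simp: insert_commute)
      have abV: "a \<in> V" "b \<in> V" "a \<noteq> b" using Epair[OF E(1)] by auto
      have notboth: "a \<in> X \<or> b \<in> X"
      proof (rule ccontr)
        assume "\<not> ?thesis"
        then have "a \<in> S" using abV E unfolding S_def by blast
        then show False using S0 by blast
      qed
      have aX: "a \<in> X" using contraV[of b a] notboth abV E nc by blast
      have bX: "b \<in> X" using contraV[of a b] notboth abV E nc by blast
      have "X = insert y Z" using UX Wv by simp
      then consider "a \<in> Z" "b \<in> Z" | "a = y" "b \<in> Z" | "b = y" "a \<in> Z" using aX bX abV(3) by blast
      then show False
      proof cases
        case 1
        then show False using cov[OF pairs[OF 1 abV(3)]] nc(1) by blast
      next
        case 2
        then show False using contraY[of b] E(2) nc(2) by simp
      next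
        case 3
        then show False using contraY[of a] E(1) nc(1) by simp
      qed
    qed
    have "card F' \<le> card Z"
    proof (rule covered_card[OF F'V gp'(8) fZ])
      show "\<exists>z\<in>Z. z \<in> f \<and> c f = \<kappa> z" if "f \<in> F'" for f using allcov[of f] that gp'(2) by blast
    qed
    then show ?thesis using gp'(6) Ts(2) d by linarith
  qed
qed

section \<open>Programs with bounded loops\<close>

text \<open>A total fragment of \<open>com\<close>: every loop makes one pass per vertex, so each
  program of this kind has a polynomial in \<open>n\<close> as time bound.\<close>

datatype loop =
    Nop
  | Set nat expr expr
  | Then loop loop  (infixr ";;" 60)
  | Cond expr loop loop
  | For nat loop

primrec compile :: "loop \<Rightarrow> com" where
  "compile Nop = Skip"
| "compile (Set x a e) = Assign x a e"
| "compile (p ;; q) = Seq (compile p) (compile q)"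
| "compile (Cond b p q) = If b (compile p) (compile q)"
| "compile (For x p) = Seq (Assign x (Const 0) (Const 0))
     (While (Minus (Cell 0 (Const 0)) (Cell x (Const 0)))
       (Seq (compile p) (Assign x (Const 0) (Plus (Cell x (Const 0)) (Const 1)))))"

definition put :: "nat \<Rightarrow> nat \<Rightarrow> store \<Rightarrow> store" where
  "put x i s = s(x := (s x)(0 := i))"

text \<open>The loop variable is set afresh before each pass and holds \<open>n\<close> afterwards,
  as in the compiled \<open>While\<close>.\<close>

primrec run :: "loop \<Rightarrow> store \<Rightarrow> store" where
  "run Nop s = s"
| "run (Set x a e) s = s(x := (s x)(val a s := val e s))"
| "run (p ;; q) s = run q (run p s)"
| "run (Cond b p q) s = (if val b s \<noteq> 0 then run p s else run q s)"
| "run (For x p) s = put x (s 0 0) (fold (\<lambda>i s. run p (put x i s)) [0..<s 0 0] s)"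

primrec writes :: "loop \<Rightarrow> nat set" where
  "writes Nop = {}"
| "writes (Set x a e) = {x}"
| "writes (p ;; q) = writes p \<union> writes q"
| "writes (Cond b p q) = writes p \<union> writes q"
| "writes (For x p) = insert x (writes p)"

text \<open>Memory 0 must stay unchanged because its first entry, the number of vertices, bounds every loop.\<close>

primrec well_formed :: "loop \<Rightarrow> bool" where
  "well_formed Nop \<longleftrightarrow> True"
| "well_formed (Set x a e) \<longleftrightarrow> x \<noteq> 0"
| "well_formed (p ;; q) \<longleftrightarrow> well_formed p \<and> well_formed q"
| "well_formed (Cond b p q) \<longleftrightarrow> well_formed p \<and> well_formed q"
| "well_formed (For x p) \<longleftrightarrow> x \<noteq> 0 \<and> x \<notin> writes p \<and> well_formed p"

text \<open>An upper bound: both branches of \<open>Cond\<close> are charged. A loop pays 2 for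
  initialization and last test, and in each of its \<open>n\<close> passes (\<open>[:0, 1:]\<close>
  is the identity polynomial) 2 more for test and increment.\<close>

primrec cost :: "loop \<Rightarrow> nat poly" where
  "cost Nop = [:1:]"
| "cost (Set x a e) = [:1:]"
| "cost (p ;; q) = cost p + cost q"
| "cost (Cond b p q) = [:1:] + cost p + cost q"
| "cost (For x p) = [:2:] + [:0, 1:] * (cost p + [:2:])"

section \<open>Running time and invariants of bounded loops\<close>

lemma put_same [simp]: "put x i s x 0 = i"
  by (simp add: put_def)

lemma put_other [simp]: "m \<noteq> x \<Longrightarrow> put x i s m = s m"
  by (simp add: put_def)

lemma well_formed_writes: "well_formed p \<Longrightarrow> 0 \<notin> writes p"
  by (induction p) auto

lemma run_frame: "m \<notin> writes p \<Longrightarrow> run p s m = s m"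
proof (induction p arbitrary: s)
  case (For x p)
  have "fold (\<lambda>i s. run p (put x i s)) xs s m = s m" for xs s
    by (induction xs arbitrary: s) (use For in auto)
  then show ?case using For.prems by simp
qed auto

lemma compile_exec:
  "well_formed p \<Longrightarrow> \<exists>T. exec (compile p) s T (run p s) \<and> T \<le> poly (cost p) (s 0 0)"
proof (induction p arbitrary: s)
  case Nop
  then show ?case using exec.Skip by fastforce
next
  case (Set x a e)
  show ?case
  proof (intro exI conjI)
    show "exec (compile (Set x a e)) s 1 (run (Set x a e) s)"
      unfolding compile.simps run.simps by (rule exec.Assign)
    show "1 \<le> poly (cost (Set x a e)) (s 0 0)" by simp
  qed
next
  case (Then p q)
  obtain T where T: "exec (compile p) s T (run p s)" "T \<le> poly (cost p) (s 0 0)" using Then by auto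
  have s0: "run p s 0 = s 0" using run_frame well_formed_writes Then.prems by simp
  obtain T' where T': "exec (compile q) (run p s) T' (run q (run p s))" "T' \<le> poly (cost q) (s 0 0)"
    using Then.IH(2)[of "run p s"] Then.prems s0 by auto
  show ?case using exec.Seq[OF T(1) T'(1)] T(2) T'(2) by (intro exI[of _ "T + T'"]) simp
next
  case (Cond b p q)
  show ?case
  proof (cases "val b s = 0")
    case True
    obtain T where T: "exec (compile q) s T (run q s)" "T \<le> poly (cost q) (s 0 0)" using Cond by auto
    show ?thesis using exec.IfFalse[OF True T(1)] True T(2) by (intro exI[of _ "Suc T"]) simp
  next
    case False
    obtain T where T: "exec (compile p) s T (run p s)" "T \<le> poly (cost p) (s 0 0)" using Cond by auto
    show ?thesis using exec.IfTrue[OF False T(1)] False T(2) by (intro exI[of _ "Suc T"]) simp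
  qed
next
  case (For x p)
  define n where "n = s 0 0"
  define K where "K = poly (cost p) n"
  define t where "t i = fold (\<lambda>i s. run p (put x i s)) [0..<i] s" for i
  have wf: "x \<noteq> 0" "x \<notin> writes p" "well_formed p" "0 \<notin> writes p"
    using For.prems well_formed_writes by auto
  have t_Suc: "t (Suc i) = run p (put x i (t i))" for i by (simp add: t_def)
  have t0: "t i 0 = s 0" for i
    by (induction i) (use wf in \<open>simp_all add: t_def run_frame\<close>)
  let ?b = "Minus (Cell 0 (Const 0)) (Cell x (Const 0))"
  let ?body = "Seq (compile p) (Assign x (Const 0) (Plus (Cell x (Const 0)) (Const 1)))"
  \<comment> \<open>Induction on the number of remaining passes; the partial fold \<open>t i\<close>
    is the store before pass \<open>i\<close>.\<close>
  have loop: "\<exists>T. exec (While ?b ?body) (put x i (t i)) T (put x n (t n)) \<and> T \<le> (n - i) * (K + 2) + 1" if "i \<le> n" for i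
    using that
  proof (induction "n - i" arbitrary: i)
    case 0
    then have "i = n" by simp
    moreover have "val ?b (put x n (t n)) = 0" using t0[of n] wf by (simp add: n_def)
    ultimately show ?case using exec.WhileFalse[of ?b "put x n (t n)" ?body] by (intro exI[of _ 1]) simp
  next
    case (Suc k)
    then have i: "i < n" by simp
    have "k = n - Suc i" "Suc i \<le> n" using Suc.hyps(2) i by simp_all
    from Suc.hyps(1)[OF this]
    obtain T' where T': "exec (While ?b ?body) (put x (Suc i) (t (Suc i))) T' (put x n (t n))"
      "T' \<le> (n - Suc i) * (K + 2) + 1" by blast
    have b: "val ?b (put x i (t i)) \<noteq> 0" using t0[of i] wf i by (simp add: n_def)
    obtain Tb where Tb: "exec (compile p) (put x i (t i)) Tb (t (Suc i))" "Tb \<le> K"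
      using For.IH[OF wf(3), of "put x i (t i)"] t0[of i] wf(1) by (auto simp: t_Suc K_def n_def)
    have xi: "t (Suc i) x 0 = i" using run_frame[OF wf(2)] by (simp add: t_Suc)
    have "exec (Assign x (Const 0) (Plus (Cell x (Const 0)) (Const 1))) (t (Suc i)) 1 (put x (Suc i) (t (Suc i)))"
      using exec.Assign[of x "Const 0" "Plus (Cell x (Const 0)) (Const 1)" "t (Suc i)"] xi by (simp add: put_def)
    from exec.WhileTrue[OF b exec.Seq[OF Tb(1) this] T'(1)]
    have "exec (While ?b ?body) (put x i (t i)) (Suc (Tb + 1 + T')) (put x n (t n))" .
    moreover have "(n - Suc i) * (K + 2) + (K + 2) = (n - i) * (K + 2)"
      using i by (metis Suc_diff_Suc add.commute mult_Suc)
    then have "Suc (Tb + 1 + T') \<le> (n - i) * (K + 2) + 1" using Tb(2) T'(2) by linarith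
    ultimately show ?case by blast
  qed
  obtain T where T: "exec (While ?b ?body) (put x 0 (t 0)) T (put x n (t n))" "T \<le> n * (K + 2) + 1"
    using loop[of 0] by auto
  have "exec (Assign x (Const 0) (Const 0)) s 1 (put x 0 (t 0))"
    using exec.Assign[of x "Const 0" "Const 0" s] by (simp add: put_def t_def)
  from exec.Seq[OF this T(1)] have "exec (compile (For x p)) s (1 + T) (put x n (t n))" by simp
  moreover have "run (For x p) s = put x n (t n)" by (simp add: n_def t_def)
  moreover have "1 + T \<le> poly (cost (For x p)) (s 0 0)" using T(2) by (simp add: K_def n_def algebra_simps)
  ultimately show ?case by auto
qed

lemma poly_nat_mono: "(x::nat) \<le> y \<Longrightarrow> poly p x \<le> poly p y"
  by (induction p) (auto intro: add_mono mult_mono)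

text \<open>Invariant rule whose step may also use that the memories not written by the body are as
  at the start.\<close>

lemma run_For:
  assumes "s 0 0 = n" "x \<noteq> 0" "0 \<notin> writes p" and I0: "I 0 s"
    and step: "\<And>i t. i < n \<Longrightarrow> (\<And>m. m \<notin> insert x (writes p) \<Longrightarrow> t m = s m) \<Longrightarrow> I i t \<Longrightarrow> I (Suc i) (run p (put x i t))"
  obtains t where "I n t" "run (For x p) s = put x n t" "\<And>m. m \<notin> insert x (writes p) \<Longrightarrow> t m = s m"
proof -
  define t where "t i = fold (\<lambda>i s. run p (put x i s)) [0..<i] s" for i
  have t_Suc: "t (Suc i) = run p (put x i (t i))" for i by (simp add: t_def)
  have fr: "t i m = s m" if "m \<notin> insert x (writes p)" for i m
    by (induction i) (use that in \<open>simp_all add: t_def run_frame\<close>)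
  have "i \<le> n \<Longrightarrow> I i (t i)" for i
  proof (induction i)
    case 0
    then show ?case using I0 by (simp add: t_def)
  next
    case (Suc i)
    then show ?case using step[of i "t i"] fr by (simp add: t_Suc)
  qed
  then show thesis using that[of "t n"] fr assms(1) by (simp add: t_def)
qed

primrec nest :: "nat list \<Rightarrow> loop \<Rightarrow> loop" where
  "nest [] p = p"
| "nest (x # xs) p = For x (nest xs p)"

lemma writes_nest: "writes (nest xs p) = set xs \<union> writes p"
  by (induction xs) auto

lemma nest_invariant:
  assumes "Inv s" and "0 \<notin> set xs" "0 \<notin> writes p" "distinct xs" "set xs \<inter> writes p = {}"
    and n: "\<And>s. Inv s \<Longrightarrow> s 0 0 = n"
    and "\<And>s. Inv s \<Longrightarrow> (\<And>x. x \<in> set xs \<Longrightarrow> s x 0 < n) \<Longrightarrow> Inv (run p s)"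
    and "\<And>s x i. Inv s \<Longrightarrow> x \<in> set xs \<Longrightarrow> Inv (put x i s)"
  shows "Inv (run (nest xs p) s)"
  using assms
proof (induction xs arbitrary: s Inv)
  case Nil
  then show ?case by simp
next
  case (Cons x xs)
  have x: "x \<noteq> 0" "x \<notin> set xs" "x \<notin> writes p" using Cons.prems by auto
  have nw: "0 \<notin> writes (nest xs p)" using Cons.prems(2,3) by (simp add: writes_nest)
  have step: "Inv (run (nest xs p) (put x i t))" if i: "i < n" and t: "Inv t" for i t
  proof -
    have "(Inv (run (nest xs p) (put x i t))) \<and> run (nest xs p) (put x i t) x 0 < n"
    proof (rule Cons.IH[where Inv="\<lambda>s. Inv s \<and> s x 0 < n"])
      show "Inv (put x i t) \<and> put x i t x 0 < n" using Cons.prems(8)[OF t] i by simp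
      show "0 \<notin> set xs" "0 \<notin> writes p" "distinct xs" "set xs \<inter> writes p = {}" using Cons.prems by auto
      show "s 0 0 = n" if "Inv s \<and> s x 0 < n" for s using Cons.prems(6) that by blast
      show "Inv (run p s) \<and> run p s x 0 < n" if "Inv s \<and> s x 0 < n" "\<And>y. y \<in> set xs \<Longrightarrow> s y 0 < n" for s
        using Cons.prems(7)[of s] that run_frame[OF x(3)] by auto
      show "Inv (put y i s) \<and> put y i s x 0 < n" if "Inv s \<and> s x 0 < n" "y \<in> set xs" for s y i
      proof -
        have "x \<noteq> y" using that(2) x(2) by blast
        then show ?thesis using Cons.prems(8)[of s y i] that by simp
      qed
    qed
    then show ?thesis by blast
  qed
  obtain t where "Inv t" "run (For x (nest xs p)) s = put x n t"
    by (rule run_For[of s n x "nest xs p" "\<lambda>_. Inv", OF Cons.prems(6)[OF Cons.prems(1)] x(1) nw Cons.prems(1)]) (use step in blast)+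
  then show ?case using Cons.prems(8)[of t x n] by simp
qed

text \<open>The loops run through all tuples, in particular through \<sigma>. \<open>G\<close> is
  achieved in that pass, whatever happened before, and later passes keep it. In the induction,
  \<open>s x 0 = \<sigma> x\<close> joins the invariant of the inner loops.\<close>

lemma nest_visit:
  assumes "Inv s" and "0 \<notin> set xs" "0 \<notin> writes p" "distinct xs" "set xs \<inter> writes p = {}"
    and n: "\<And>s. Inv s \<Longrightarrow> s 0 0 = n"
    and "\<And>s. Inv s \<Longrightarrow> (\<And>x. x \<in> set xs \<Longrightarrow> s x 0 < n) \<Longrightarrow> Inv (run p s)"
    and "\<And>s x i. Inv s \<Longrightarrow> x \<in> set xs \<Longrightarrow> Inv (put x i s)"
    and "\<And>s. Inv s \<Longrightarrow> (\<And>x. x \<in> set xs \<Longrightarrow> s x 0 < n) \<Longrightarrow> G s \<Longrightarrow> G (run p s)"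
    and "\<And>s x i. x \<in> set xs \<Longrightarrow> G s \<Longrightarrow> G (put x i s)"
    and "\<And>s. Inv s \<Longrightarrow> (\<And>x. x \<in> set xs \<Longrightarrow> s x 0 = \<sigma> x) \<Longrightarrow> G (run p s)"
    and "\<And>x. x \<in> set xs \<Longrightarrow> \<sigma> x < n"
  shows "G (run (nest xs p) s)"
  using assms
proof (induction xs arbitrary: s Inv)
  case Nil
  then show ?case by simp
next
  case (Cons x xs)
  have x: "x \<noteq> 0" "x \<notin> set xs" "x \<notin> writes p" using Cons.prems by auto
  have nw: "0 \<notin> writes (nest xs p)" using Cons.prems(2,3) by (simp add: writes_nest)
  have xs: "0 \<notin> set xs" "0 \<notin> writes p" "distinct xs" "set xs \<inter> writes p = {}" using Cons.prems by auto
  have inv: "Inv (run (nest xs p) (put x i t))" if i: "i < n" and t: "Inv t" for i t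
  proof -
    have "(Inv (run (nest xs p) (put x i t))) \<and> run (nest xs p) (put x i t) x 0 < n"
    proof (rule nest_invariant[where Inv="\<lambda>s. Inv s \<and> s x 0 < n"])
      show "Inv (put x i t) \<and> put x i t x 0 < n" using Cons.prems(8)[OF t] i by simp
      show "0 \<notin> set xs" "0 \<notin> writes p" "distinct xs" "set xs \<inter> writes p = {}" by (rule xs)+
      show "s 0 0 = n" if "Inv s \<and> s x 0 < n" for s using Cons.prems(6) that by blast
      show "Inv (run p s) \<and> run p s x 0 < n" if "Inv s \<and> s x 0 < n" "\<And>y. y \<in> set xs \<Longrightarrow> s y 0 < n" for s
        using Cons.prems(7)[of s] that run_frame[OF x(3)] by auto
      show "Inv (put y i s) \<and> put y i s x 0 < n" if "Inv s \<and> s x 0 < n" "y \<in> set xs" for s y i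
      proof -
        have "x \<noteq> y" using that(2) x(2) by blast
        then show ?thesis using Cons.prems(8)[of s y i] that by simp
      qed
    qed
    then show ?thesis by blast
  qed
  have keep: "G (run (nest xs p) (put x i t))" if i: "i < n" and t: "Inv t" and g: "G t" for i t
  proof -
    have "(Inv (run (nest xs p) (put x i t)) \<and> G (run (nest xs p) (put x i t))) \<and> run (nest xs p) (put x i t) x 0 < n"
    proof (rule nest_invariant[where Inv="\<lambda>s. (Inv s \<and> G s) \<and> s x 0 < n"])
      show "(Inv (put x i t) \<and> G (put x i t)) \<and> put x i t x 0 < n"
        using Cons.prems(8)[OF t] Cons.prems(10)[of x t] g i by simp
      show "0 \<notin> set xs" "0 \<notin> writes p" "distinct xs" "set xs \<inter> writes p = {}" by (rule xs)+
      show "s 0 0 = n" if "(Inv s \<and> G s) \<and> s x 0 < n" for s using Cons.prems(6) that by blast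
      show "(Inv (run p s) \<and> G (run p s)) \<and> run p s x 0 < n" if "(Inv s \<and> G s) \<and> s x 0 < n" "\<And>y. y \<in> set xs \<Longrightarrow> s y 0 < n" for s
        using Cons.prems(7)[of s] Cons.prems(9)[of s] that run_frame[OF x(3)] by auto
      show "(Inv (put y i s) \<and> G (put y i s)) \<and> put y i s x 0 < n" if "(Inv s \<and> G s) \<and> s x 0 < n" "y \<in> set xs" for s y i
      proof -
        have "x \<noteq> y" using that(2) x(2) by blast
        then show ?thesis using Cons.prems(8)[of s y i] Cons.prems(10)[of y s i] that by simp
      qed
    qed
    then show ?thesis by blast
  qed
  have hit: "G (run (nest xs p) (put x (\<sigma> x) t))" if t: "Inv t" for t
  proof (rule Cons.IH[where Inv="\<lambda>s. Inv s \<and> s x 0 = \<sigma> x"])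
    have sx: "\<sigma> x < n" using Cons.prems(12) by simp
    show "Inv (put x (\<sigma> x) t) \<and> put x (\<sigma> x) t x 0 = \<sigma> x" using Cons.prems(8)[OF t] by simp
    show "0 \<notin> set xs" "0 \<notin> writes p" "distinct xs" "set xs \<inter> writes p = {}" by (rule xs)+
    show "s 0 0 = n" if "Inv s \<and> s x 0 = \<sigma> x" for s using Cons.prems(6) that by blast
    show "Inv (run p s) \<and> run p s x 0 = \<sigma> x" if h: "Inv s \<and> s x 0 = \<sigma> x" "\<And>y. y \<in> set xs \<Longrightarrow> s y 0 < n" for s
    proof -
      have "\<And>y. y \<in> set (x # xs) \<Longrightarrow> s y 0 < n" using h sx by (metis set_ConsD)
      then show ?thesis using Cons.prems(7)[of s] h run_frame[OF x(3)] by simp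
    qed
    show "Inv (put y i s) \<and> put y i s x 0 = \<sigma> x" if "Inv s \<and> s x 0 = \<sigma> x" "y \<in> set xs" for s y i
    proof -
      have "x \<noteq> y" using that(2) x(2) by blast
      then show ?thesis using Cons.prems(8)[of s y i] that by simp
    qed
    show "G (run p s)" if h: "Inv s \<and> s x 0 = \<sigma> x" "\<And>y. y \<in> set xs \<Longrightarrow> s y 0 < n" "G s" for s
    proof -
      have "\<And>y. y \<in> set (x # xs) \<Longrightarrow> s y 0 < n" using h sx by (metis set_ConsD)
      then show ?thesis using Cons.prems(9)[of s] h by simp
    qed
    show "G (put y i s)" if "y \<in> set xs" "G s" for s y i using Cons.prems(10)[of y s i] that by simp
    show "G (run p s)" if "Inv s \<and> s x 0 = \<sigma> x" "\<And>y. y \<in> set xs \<Longrightarrow> s y 0 = \<sigma> y" for s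
      using Cons.prems(11)[of s] that by auto
    show "\<sigma> y < n" if "y \<in> set xs" for y using Cons.prems(12) that by simp
  qed
  obtain t where "Inv t \<and> (\<sigma> x < n \<longrightarrow> G t)" "run (For x (nest xs p)) s = put x n t"
  proof (rule run_For[of s n x "nest xs p" "\<lambda>i t. Inv t \<and> (\<sigma> x < i \<longrightarrow> G t)"])
    show "s 0 0 = n" "x \<noteq> 0" "0 \<notin> writes (nest xs p)" using Cons.prems(6)[OF Cons.prems(1)] x(1) nw by auto
    show "Inv s \<and> (\<sigma> x < 0 \<longrightarrow> G s)" using Cons.prems(1) by simp
    fix i t assume i: "i < n" and t: "Inv t \<and> (\<sigma> x < i \<longrightarrow> G t)"
    show "Inv (run (nest xs p) (put x i t)) \<and> (\<sigma> x < Suc i \<longrightarrow> G (run (nest xs p) (put x i t)))"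
    proof (intro conjI impI)
      show "Inv (run (nest xs p) (put x i t))" using inv[OF i] t by blast
      assume "\<sigma> x < Suc i"
      then consider "\<sigma> x < i" | "\<sigma> x = i" by linarith
      then show "G (run (nest xs p) (put x i t))"
      proof cases
        case 1
        then show ?thesis using keep[OF i] t by blast
      next
        case 2
        then show ?thesis using hit t by blast
      qed
    qed
  qed blast
  moreover have "\<sigma> x < n" using Cons.prems(12) by simp
  ultimately show ?case using Cons.prems(10)[of x t n] by simp
qed

section \<open>Elementary procedures\<close>

abbreviation Var :: "nat \<Rightarrow> expr" where "Var x \<equiv> Cell x (Const 0)"
abbreviation Entry :: "nat \<Rightarrow> nat \<Rightarrow> expr" where "Entry m i \<equiv> Cell m (Var i)"
abbreviation Index :: "nat \<Rightarrow> nat \<Rightarrow> expr" where "Index i j \<equiv> Plus (Cell 3 (Var i)) (Var j)"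
abbreviation Entry2 :: "nat \<Rightarrow> nat \<Rightarrow> nat \<Rightarrow> expr" where "Entry2 m i j \<equiv> Cell m (Index i j)"
abbreviation Color :: "nat \<Rightarrow> nat \<Rightarrow> expr" where "Color i j \<equiv> Cell 0 (Plus (Const 1) (Index i j))"
abbreviation Neq :: "expr \<Rightarrow> expr \<Rightarrow> expr" where "Neq a b \<equiv> Plus (Minus a b) (Minus b a)"
abbreviation SetVar :: "nat \<Rightarrow> expr \<Rightarrow> loop" where "SetVar x e \<equiv> Set x (Const 0) e"
abbreviation Set2 :: "nat \<Rightarrow> nat \<Rightarrow> nat \<Rightarrow> expr \<Rightarrow> loop" where "Set2 m i j e \<equiv> Set m (Index i j) e"
abbreviation When :: "expr \<Rightarrow> loop \<Rightarrow> loop" where "When b p \<equiv> Cond b p Nop"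
abbreviation Unless :: "expr \<Rightarrow> loop \<Rightarrow> loop" where "Unless b p \<equiv> Cond b Nop p"

lemma run_Cond_Neq [simp]: "run (Cond (Neq a b) p q) s = (if val a s \<noteq> val b s then run p s else run q s)"
  by auto

lemma run_SetVar: "run (SetVar x e) s = put x (val e s) s"
  by (simp add: put_def)

lemma index_eq:
  assumes "u < n" "v < n" "a < n" "b < (n::nat)" shows "u * n + v = a * n + b \<longleftrightarrow> u = a \<and> v = b"
proof
  assume h: "u * n + v = a * n + b"
  have "(u * n + v) div n = u" "(a * n + b) div n = a" using assms by simp_all
  then have "u = a" using h by simp
  then show "u = a \<and> v = b" using h by simp
qed simp

text \<open>Memories: 0 is the input, 1 and 2 the best tree (vertices and edges), 3 the offsets \<open>u * n\<close> of
  the rows, 4 and 5 the candidate tree, 6 the set \<open>U\<close>, 7 and 9 the edges available before and after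
  deleting \<open>t\<close> and the forbidden edges at \<open>r\<close>, 10 the forest \<open>F\<close>, 11 the marked edges, and 12 a graph whose components
  are labelled in 13. The scalar 24 tells whether the pair of 25 and 26 ends an augmenting walk, and 30 to 33 hold
  \<open>v\<close>, \<open>t\<close>, \<open>r\<close>, \<open>b\<close>. Edge sets are adjacency matrices, with the pair \<open>(u, v)\<close> at address \<open>u * n + v\<close>.\<close>

definition conflict :: "nat \<Rightarrow> nat \<Rightarrow> nat \<Rightarrow> nat \<Rightarrow> nat \<Rightarrow> loop" where
  "conflict f m a b k = SetVar f (Const 0) ;;
     For k (When (Entry2 m a k) (Unless (Neq (Color a k) (Color a b)) (SetVar f (Const 1))))"

definition conflict_other :: "nat \<Rightarrow> nat \<Rightarrow> nat \<Rightarrow> nat \<Rightarrow> nat \<Rightarrow> loop" where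
  "conflict_other f m a b k = SetVar f (Const 0) ;;
     For k (When (Entry2 m a k) (Unless (Neq (Color a k) (Color a b)) (When (Neq (Var k) (Var b)) (SetVar f (Const 1)))))"

definition clear_vec :: "nat \<Rightarrow> loop" where
  "clear_vec m = For 39 (Set m (Var 39) (Const 0))"

definition clear_mat :: "nat \<Rightarrow> loop" where
  "clear_mat m = nest [39, 40] (Set2 m 39 40 (Const 0))"

definition copy_vec :: "nat \<Rightarrow> nat \<Rightarrow> loop" where
  "copy_vec m m' = For 39 (Set m' (Var 39) (Entry m 39))"

definition copy_mat :: "nat \<Rightarrow> nat \<Rightarrow> loop" where
  "copy_mat m m' = nest [39, 40] (Set2 m' 39 40 (Entry2 m 39 40))"

definition try_extend :: "nat \<Rightarrow> nat \<Rightarrow> loop" where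
  "try_extend a b = When (Entry 4 a) (Unless (Entry 4 b) (When (Color a b)
     (conflict 20 5 a b 38 ;; Unless (Var 20)
       (Set 4 (Var b) (Const 1) ;; Set2 5 a b (Const 1) ;; Set2 5 b a (Const 1)))))"

definition count_vec :: "nat \<Rightarrow> nat \<Rightarrow> loop" where
  "count_vec m x = SetVar x (Const 0) ;; For 39 (When (Entry m 39) (SetVar x (Plus (Var x) (Const 1))))"

definition commit :: loop where
  "commit = count_vec 1 27 ;; count_vec 4 28 ;; When (Minus (Var 28) (Var 27)) (copy_vec 4 1 ;; copy_mat 5 2)"

definition merge_labels :: loop where
  "merge_labels = When (Entry2 12 41 42) (SetVar 22 (Entry 13 41) ;; SetVar 23 (Entry 13 42) ;;
     For 43 (Unless (Neq (Entry 13 43) (Var 22)) (Set 13 (Var 43) (Var 23))))"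

text \<open>One run over all pairs is enough: merging renames a whole label class, so labels once
  equal stay equal.\<close>

definition labels :: loop where
  "labels = For 41 (Set 13 (Var 41) (Var 41)) ;; nest [41, 42] merge_labels"

definition reduce_pair :: "nat \<Rightarrow> nat \<Rightarrow> loop" where
  "reduce_pair a b = When (Entry2 7 a b) (conflict_other 20 7 a b 38 ;; conflict_other 21 7 b a 38 ;;
     When (Var 20) (When (Var 21) (Set2 7 a b (Const 0) ;; Set2 7 b a (Const 0))))"

text \<open>Starting with the pairs at \<open>v\<close> makes the colors at \<open>v\<close> distinct.\<close>

definition reduce :: loop where
  "reduce = For 44 (reduce_pair 30 44) ;; For 45 (For 46 (reduce_pair 45 46))"

definition build_U :: loop where
  "build_U = copy_vec 1 6 ;; Set 6 (Var 30) (Const 1)"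

definition build_H :: loop where
  "build_H = nest [39, 40] (Set2 7 39 40 (Const 0) ;;
     When (Entry 6 39) (When (Entry 6 40) (When (Color 39 40) (Set2 7 39 40 (Const 1)))))"

definition mark_colored :: loop where
  "mark_colored = Cond (Neq (Color 39 40) (Color 32 33)) (Set2 9 39 40 (Const 1))
     (When (Neq (Var 39) (Var 32)) (When (Neq (Var 40) (Var 32)) (Set2 9 39 40 (Const 1))))"

definition build_H' :: loop where
  "build_H' = nest [39, 40] (Set2 9 39 40 (Const 0) ;; When (Entry2 7 39 40)
     (Cond (Neq (Var 31) (Var 32)) (When (Neq (Var 39) (Var 31)) (When (Neq (Var 40) (Var 31)) mark_colored)) mark_colored))"

lemma writes_procedures [simp]:
  "writes (conflict f m a b k) = {f, k}" "writes (conflict_other f m a b k) = {f, k}"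
  "writes (clear_vec m) = {39, m}" "writes (clear_mat m) = {39, 40, m}"
  "writes (copy_vec m m') = {39, m'}" "writes (copy_mat m m') = {39, 40, m'}"
  "writes (try_extend a b) = {20, 38, 4, 5}" "writes (count_vec m x) = {39, x}"
  "writes commit = {1, 2, 27, 28, 39, 40}" "writes merge_labels = {13, 22, 23, 43}"
  "writes labels = {13, 22, 23, 41, 42, 43}"
  "writes (reduce_pair a b) = {7, 20, 21, 38}" "writes reduce = {7, 20, 21, 38, 44, 45, 46}"
  "writes build_U = {6, 39}" "writes build_H = {7, 39, 40}" "writes build_H' = {9, 39, 40}"
proof -
  show c: "writes (conflict f m a b k) = {f, k}" for f m a b k by (auto simp: conflict_def)
  show co: "writes (conflict_other f m a b k) = {f, k}" for f m a b k by (auto simp: conflict_other_def)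
  show "writes (clear_vec m) = {39, m}" by (auto simp: clear_vec_def)
  show "writes (clear_mat m) = {39, 40, m}" by (auto simp: clear_mat_def)
  show cv: "writes (copy_vec m m') = {39, m'}" for m m' by (auto simp: copy_vec_def)
  show cm: "writes (copy_mat m m') = {39, 40, m'}" for m m' by (auto simp: copy_mat_def)
  show "writes (try_extend a b) = {20, 38, 4, 5}" by (auto simp: try_extend_def c)
  show cn: "writes (count_vec m x) = {39, x}" for m x by (auto simp: count_vec_def)
  show "writes commit = {1, 2, 27, 28, 39, 40}" by (auto simp: commit_def cv cm cn)
  show m: "writes merge_labels = {13, 22, 23, 43}" by (auto simp: merge_labels_def)
  show "writes labels = {13, 22, 23, 41, 42, 43}" by (auto simp: labels_def m)
  show r: "writes (reduce_pair a b) = {7, 20, 21, 38}" for a b by (auto simp: reduce_pair_def co)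
  show "writes reduce = {7, 20, 21, 38, 44, 45, 46}" by (auto simp: reduce_def r)
  show "writes build_U = {6, 39}" by (auto simp: build_U_def cv)
  show "writes build_H = {7, 39, 40}" by (auto simp: build_H_def)
  show "writes build_H' = {9, 39, 40}" by (auto simp: build_H'_def mark_colored_def)
qed

definition extend_tree :: "nat set set \<Rightarrow> (nat set \<Rightarrow> nat) \<Rightarrow> nat \<Rightarrow> nat \<Rightarrow> nat set \<times> nat set set \<Rightarrow> nat set \<times> nat set set" where
  "extend_tree E c a b = (\<lambda>(Y, F). if a \<in> Y \<and> b \<notin> Y \<and> {a, b} \<in> E \<and> (\<forall>x. {a, x} \<in> F \<longrightarrow> c {a, x} \<noteq> c {a, b})
     then (insert b Y, insert {a, b} F) else (Y, F))"

text \<open>A deleted edge has a second edge of its color at either end, so no vertex loses a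
  color.\<close>

definition drop_pair :: "(nat set \<Rightarrow> nat) \<Rightarrow> nat \<Rightarrow> nat \<Rightarrow> nat set set \<Rightarrow> nat set set" where
  "drop_pair c a b H = (if {a, b} \<in> H \<and> \<not> unique_at c H a b \<and> \<not> unique_at c H b a then H - {{a, b}} else H)"

lemma drop_pair_subset: "drop_pair c a b H \<subseteq> H"
  by (auto simp: drop_pair_def)

locale input_graph =
  fixes n :: nat and E :: "nat set set" and c :: "nat set \<Rightarrow> nat"
  assumes E: "E \<subseteq> doubletons {..<n}" and c_pos: "\<And>e. e \<in> E \<Longrightarrow> 0 < c e"
begin

definition col :: "nat \<Rightarrow> nat \<Rightarrow> nat" where
  "col u v = (if {u, v} \<in> E then c {u, v} else 0)"

text \<open>The part of the store that all procedures after \<open>offsets\<close> preserve. The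
  machine has no multiplication, hence the table of the products \<open>u * n\<close>.\<close>

definition base :: "store \<Rightarrow> bool" where
  "base s \<longleftrightarrow> s 0 0 = n \<and> (\<forall>u<n. \<forall>v<n. s 0 (Suc (u * n + v)) = col u v) \<and> (\<forall>u<n. s 3 u = u * n)"

definition vec :: "store \<Rightarrow> nat \<Rightarrow> nat set \<Rightarrow> bool" where
  "vec s m X \<longleftrightarrow> (\<forall>u<n. s m u \<noteq> 0 \<longleftrightarrow> u \<in> X)"

definition mat :: "store \<Rightarrow> nat \<Rightarrow> nat set set \<Rightarrow> bool" where
  "mat s m F \<longleftrightarrow> (\<forall>u<n. \<forall>v<n. s m (u * n + v) \<noteq> 0 \<longleftrightarrow> {u, v} \<in> F)"

section \<open>Frame rules, and effect of the elementary procedures\<close>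

lemma base_n: "base s \<Longrightarrow> s 0 0 = n" by (simp add: base_def)
lemma base_off: "base s \<Longrightarrow> u < n \<Longrightarrow> s 3 u = u * n" by (simp add: base_def)
lemma base_col: "base s \<Longrightarrow> u < n \<Longrightarrow> v < n \<Longrightarrow> s 0 (Suc (u * n + v)) = col u v" by (simp add: base_def)

lemma base_cong: "t 0 = s 0 \<Longrightarrow> t 3 = s 3 \<Longrightarrow> base t \<longleftrightarrow> base s" by (simp add: base_def)
lemma vec_cong: "t m = s m \<Longrightarrow> vec t m X \<longleftrightarrow> vec s m X" by (simp add: vec_def)
lemma mat_cong: "t m = s m \<Longrightarrow> mat t m F \<longleftrightarrow> mat s m F" by (simp add: mat_def)

lemma base_run [simp]: "0 \<notin> writes p \<Longrightarrow> 3 \<notin> writes p \<Longrightarrow> base (run p s) \<longleftrightarrow> base s"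
  by (rule base_cong) (simp_all add: run_frame)
lemma vec_run [simp]: "m \<notin> writes p \<Longrightarrow> vec (run p s) m X \<longleftrightarrow> vec s m X"
  by (rule vec_cong) (simp add: run_frame)
lemma mat_run [simp]: "m \<notin> writes p \<Longrightarrow> mat (run p s) m X \<longleftrightarrow> mat s m X"
  by (rule mat_cong) (simp add: run_frame)
lemma base_put [simp]: "x \<noteq> 0 \<Longrightarrow> x \<noteq> 3 \<Longrightarrow> base (put x i s) \<longleftrightarrow> base s"
  by (rule base_cong) simp_all
lemma vec_put [simp]: "m \<noteq> x \<Longrightarrow> vec (put x i s) m X \<longleftrightarrow> vec s m X"
  by (rule vec_cong) simp
lemma mat_put [simp]: "m \<noteq> x \<Longrightarrow> mat (put x i s) m X \<longleftrightarrow> mat s m X"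
  by (rule mat_cong) simp

lemma vecD: "vec s m X \<Longrightarrow> u < n \<Longrightarrow> s m u = 0 \<longleftrightarrow> u \<notin> X" by (auto simp: vec_def)
lemma matD: "mat s m F \<Longrightarrow> u < n \<Longrightarrow> v < n \<Longrightarrow> s m (u * n + v) = 0 \<longleftrightarrow> {u, v} \<notin> F"
  unfolding mat_def by (metis neq0_conv)

lemma E_less: "{u, v} \<in> E \<Longrightarrow> u < n \<and> v < n \<and> u \<noteq> v"
  using subsetD[OF E, of "{u, v}"] by simp

lemma col_eq_0: "col u v = 0 \<longleftrightarrow> {u, v} \<notin> E"
  using c_pos by (auto simp: col_def)

lemma col_sym: "col u v = col v u"
  by (simp add: col_def insert_commute)

lemma vec_update:
  assumes "vec s m X" "u < n"
  shows "vec (s(m := (s m)(u := k))) m (if k \<noteq> 0 then insert u X else X - {u})"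
  using assms by (auto simp: vec_def)

lemma mat_update:
  assumes "mat s m F" "u < n" "v < n"
  shows "mat (s(m := (s m)(u * n + v := k, v * n + u := k))) m (if k \<noteq> 0 then insert {u, v} F else F - {{u, v}})"
  unfolding mat_def
proof (intro allI impI)
  fix a b assume ab: "a < n" "b < n"
  have e: "a * n + b = u * n + v \<longleftrightarrow> a = u \<and> b = v" "a * n + b = v * n + u \<longleftrightarrow> a = v \<and> b = u"
    using index_eq[OF ab assms(2,3)] index_eq[OF ab assms(3,2)] by auto
  have d: "{a, b} = {u, v} \<longleftrightarrow> a = u \<and> b = v \<or> a = v \<and> b = u" by (rule doubleton_eq_iff)
  have F: "s m (a * n + b) \<noteq> 0 \<longleftrightarrow> {a, b} \<in> F" using assms(1) ab unfolding mat_def by blast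
  show "((s(m := (s m)(u * n + v := k, v * n + u := k))) m (a * n + b) \<noteq> 0) =
      ({a, b} \<in> (if k \<noteq> 0 then insert {u, v} F else F - {{u, v}}))"
  proof (cases "{a, b} = {u, v}")
    case True
    then have "a * n + b = u * n + v \<or> a * n + b = v * n + u" using d e by blast
    then have "(s(m := (s m)(u * n + v := k, v * n + u := k))) m (a * n + b) = k" by auto
    moreover have "{a, b} \<in> (if k \<noteq> 0 then insert {u, v} F else F - {{u, v}}) \<longleftrightarrow> k \<noteq> 0" using True by simp
    ultimately show ?thesis by simp
  next
    case False
    then have "a * n + b \<noteq> u * n + v" "a * n + b \<noteq> v * n + u" using d e by blast+
    then have "(s(m := (s m)(u * n + v := k, v * n + u := k))) m (a * n + b) = s m (a * n + b)" by simp
    moreover have "{a, b} \<in> (if k \<noteq> 0 then insert {u, v} F else F - {{u, v}}) \<longleftrightarrow> {a, b} \<in> F" using False by simp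
    ultimately show ?thesis using F by simp
  qed
qed

lemma run_set_edge:
  assumes s: "base s" "s a 0 < n" "s b 0 < n" and m: "m \<noteq> 0" "m \<noteq> 3" "m \<noteq> a" "m \<noteq> b" and F: "mat s m F"
  shows "mat (run (Set2 m a b (Const k) ;; Set2 m b a (Const k)) s) m
    (if k \<noteq> 0 then insert {s a 0, s b 0} F else F - {{s a 0, s b 0}})"
proof -
  have "3 \<noteq> m" "a \<noteq> m" "b \<noteq> m" using m by auto
  then have "run (Set2 m a b (Const k) ;; Set2 m b a (Const k)) s =
      s(m := (s m)(s a 0 * n + s b 0 := k, s b 0 * n + s a 0 := k))"
    using s by (simp add: base_off)
  then show ?thesis using mat_update[OF F s(2,3), of k] by simp
qed

lemma run_conflict:
  assumes s: "base s" "s a 0 < n" "s b 0 < n" "mat s m F"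
    and x: "f \<noteq> 0" "f \<noteq> 3" "f \<noteq> a" "f \<noteq> b" "f \<noteq> m" "f \<noteq> k" "k \<noteq> 0" "k \<noteq> 3" "k \<noteq> a" "k \<noteq> b" "k \<noteq> m"
  shows "run (conflict f m a b k) s f 0 \<noteq> 0 \<longleftrightarrow> (\<exists>x<n. {s a 0, x} \<in> F \<and> col (s a 0) x = col (s a 0) (s b 0))"
proof -
  note d = x x[symmetric]
  let ?p = "When (Entry2 m a k) (Unless (Neq (Color a k) (Color a b)) (SetVar f (Const 1)))"
  let ?I = "\<lambda>i t. t f 0 \<noteq> 0 \<longleftrightarrow> (\<exists>x<i. {s a 0, x} \<in> F \<and> col (s a 0) x = col (s a 0) (s b 0))"
  obtain t where t: "?I n t" "run (For k ?p) (put f 0 s) = put k n t"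
  proof (rule run_For[of "put f 0 s" n k ?p ?I])
    show "put f 0 s 0 0 = n" using s(1) by (simp add: base_n d)
    show "k \<noteq> 0" "0 \<notin> writes ?p" by (simp_all add: d)
    show "?I 0 (put f 0 s)" by simp
    fix i t assume i: "i < n" and fr: "\<And>m. m \<notin> insert k (writes ?p) \<Longrightarrow> t m = put f 0 s m" and I: "?I i t"
    define r where "r = put k i t"
    have eq: "t x = s x" if "x \<noteq> k" "x \<noteq> f" for x using fr[of x] that by (simp del: put_other) (simp add: put_other)
    have p: "r 0 = s 0" "r 3 = s 3" "r a = s a" "r b = s b" "r m = s m" "r k 0 = i" "r f = t f"
      by (simp_all add: r_def eq d)
    have "run ?p r f 0 \<noteq> 0 \<longleftrightarrow> t f 0 \<noteq> 0 \<or> s m (s a 0 * n + i) \<noteq> 0 \<and> col (s a 0) i = col (s a 0) (s b 0)"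
      using s(1-3) i by (auto simp: p base_off base_col)
    then show "?I (Suc i) (run ?p (put k i t))"
      unfolding r_def using I matD[OF s(4,2) i] by (auto simp: less_Suc_eq)
  qed (rule that)
  have "run (conflict f m a b k) s f 0 = t f 0"
    using t(2) by (simp add: d conflict_def run_SetVar del: run.simps(2))
  then show ?thesis using t(1) by simp
qed

lemma run_conflict_other:
  assumes s: "base s" "s a 0 < n" "s b 0 < n" "mat s m F"
    and x: "f \<noteq> 0" "f \<noteq> 3" "f \<noteq> a" "f \<noteq> b" "f \<noteq> m" "f \<noteq> k" "k \<noteq> 0" "k \<noteq> 3" "k \<noteq> a" "k \<noteq> b" "k \<noteq> m"
  shows "run (conflict_other f m a b k) s f 0 \<noteq> 0 \<longleftrightarrow>
    (\<exists>x<n. {s a 0, x} \<in> F \<and> col (s a 0) x = col (s a 0) (s b 0) \<and> x \<noteq> s b 0)"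
proof -
  note d = x x[symmetric]
  let ?p = "When (Entry2 m a k) (Unless (Neq (Color a k) (Color a b)) (When (Neq (Var k) (Var b)) (SetVar f (Const 1))))"
  let ?I = "\<lambda>i t. t f 0 \<noteq> 0 \<longleftrightarrow> (\<exists>x<i. {s a 0, x} \<in> F \<and> col (s a 0) x = col (s a 0) (s b 0) \<and> x \<noteq> s b 0)"
  obtain t where t: "?I n t" "run (For k ?p) (put f 0 s) = put k n t"
  proof (rule run_For[of "put f 0 s" n k ?p ?I])
    show "put f 0 s 0 0 = n" using s(1) by (simp add: base_n d)
    show "k \<noteq> 0" "0 \<notin> writes ?p" by (simp_all add: d)
    show "?I 0 (put f 0 s)" by simp
    fix i t assume i: "i < n" and fr: "\<And>m. m \<notin> insert k (writes ?p) \<Longrightarrow> t m = put f 0 s m" and I: "?I i t"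
    define r where "r = put k i t"
    have eq: "t x = s x" if "x \<noteq> k" "x \<noteq> f" for x using fr[of x] that by (simp del: put_other) (simp add: put_other)
    have p: "r 0 = s 0" "r 3 = s 3" "r a = s a" "r b = s b" "r m = s m" "r k 0 = i" "r f = t f"
      by (simp_all add: r_def eq d)
    have "run ?p r f 0 \<noteq> 0 \<longleftrightarrow> t f 0 \<noteq> 0 \<or> s m (s a 0 * n + i) \<noteq> 0 \<and> col (s a 0) i = col (s a 0) (s b 0) \<and> i \<noteq> s b 0"
      using s(1-3) i by (auto simp: p base_off base_col)
    then show "?I (Suc i) (run ?p (put k i t))"
      unfolding r_def using I matD[OF s(4,2) i] by (auto simp: less_Suc_eq)
  qed (rule that)
  have "run (conflict_other f m a b k) s f 0 = t f 0"
    using t(2) by (simp add: d conflict_other_def run_SetVar del: run.simps(2))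
  then show ?thesis using t(1) by simp
qed

lemma fill_vec:
  assumes s: "s 0 0 = n" and i: "i \<notin> {0, m}" and m: "m \<noteq> 0"
    and e: "\<And>t. (\<And>m'. m' \<notin> {i, m} \<Longrightarrow> t m' = s m') \<Longrightarrow> t i 0 < n \<Longrightarrow> val e t = g (t i 0)"
    and u: "u < n"
  shows "run (For i (Set m (Var i) e)) s m u = g u"
proof -
  let ?p = "Set m (Var i) e"
  obtain t where t: "\<forall>u<n. t m u = g u" "run (For i ?p) s = put i n t"
  proof (rule run_For[of s n i ?p "\<lambda>k t. \<forall>u<k. t m u = g u"])
    fix k t assume k: "k < n" and fr: "\<And>m'. m' \<notin> insert i (writes ?p) \<Longrightarrow> t m' = s m'" and I: "\<forall>u<k. t m u = g u"
    have "val e (put i k t) = g k" using e[of "put i k t"] fr k by simp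
    then show "\<forall>u<Suc k. run ?p (put i k t) m u = g u" using I i by (auto simp: less_Suc_eq)
  qed (use s i m that in auto)
  then show ?thesis using i u by simp
qed

text \<open>Each pass sets its own entry, and by \<open>index_eq\<close> no other pass touches it.
  Only whether an entry is nonzero is tracked.\<close>

lemma fill_mat:
  assumes s: "s 0 0 = n" and ij: "i \<noteq> j" "{i, j} \<inter> insert 0 (writes p) = {}" "0 \<notin> writes p"
    and body: "\<And>t. (\<And>m'. m' \<notin> insert i (insert j (writes p)) \<Longrightarrow> t m' = s m') \<Longrightarrow> t i 0 < n \<Longrightarrow> t j 0 < n \<Longrightarrow>
      \<exists>x. run p t m = (t m)(t i 0 * n + t j 0 := x) \<and> (x \<noteq> 0 \<longleftrightarrow> P (t i 0) (t j 0))"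
    and m: "m \<notin> {i, j}" and uv: "u < n" "v < n"
  shows "run (nest [i, j] p) s m (u * n + v) \<noteq> 0 \<longleftrightarrow> P u v"
proof (rule nest_visit[where n=n and \<sigma>="\<lambda>x. if x = i then u else v" and G="\<lambda>t. t m (u * n + v) \<noteq> 0 \<longleftrightarrow> P u v"
    and Inv="\<lambda>t. \<forall>m'. m' \<notin> insert i (insert j (writes p)) \<longrightarrow> t m' = s m'"])
  let ?Inv = "\<lambda>t. \<forall>m'. m' \<notin> insert i (insert j (writes p)) \<longrightarrow> t m' = s m'"
  show "\<forall>m'. m' \<notin> insert i (insert j (writes p)) \<longrightarrow> s m' = s m'" by simp
  show "0 \<notin> set [i, j]" "0 \<notin> writes p" "distinct [i, j]" "set [i, j] \<inter> writes p = {}" using ij by auto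
  show "t 0 0 = n" if "?Inv t" for t using that s ij by auto
  show "?Inv (run p t)" if "?Inv t" for t using that by (auto simp: run_frame)
  show "?Inv (put x k t)" if "?Inv t" "x \<in> set [i, j]" for t x k using that by auto
  show "run p t m (u * n + v) \<noteq> 0 \<longleftrightarrow> P u v"
    if "?Inv t" "\<And>x. x \<in> set [i, j] \<Longrightarrow> t x 0 < n" "t m (u * n + v) \<noteq> 0 \<longleftrightarrow> P u v" for t
  proof -
    have ij: "t i 0 < n" "t j 0 < n" using that(2) by auto
    have fr: "\<And>m'. m' \<notin> insert i (insert j (writes p)) \<Longrightarrow> t m' = s m'" using that(1) by blast
    obtain x where x: "run p t m = (t m)(t i 0 * n + t j 0 := x)" "x \<noteq> 0 \<longleftrightarrow> P (t i 0) (t j 0)"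
      using body[of t, OF fr ij] by blast
    show ?thesis
    proof (cases "u = t i 0 \<and> v = t j 0")
      case True
      then show ?thesis using x by simp
    next
      case False
      then have "u * n + v \<noteq> t i 0 * n + t j 0" using index_eq[OF uv ij] by blast
      then show ?thesis using x that(3) by simp
    qed
  qed
  show "put x k t m (u * n + v) \<noteq> 0 \<longleftrightarrow> P u v" if "x \<in> set [i, j]" "t m (u * n + v) \<noteq> 0 \<longleftrightarrow> P u v" for t x k
    using that m by auto
  show "run p t m (u * n + v) \<noteq> 0 \<longleftrightarrow> P u v"
    if "?Inv t" "\<And>x. x \<in> set [i, j] \<Longrightarrow> t x 0 = (if x = i then u else v)" for t
  proof -
    have ij': "t i 0 = u" "t j 0 = v" using that(2) ij(1) by auto
    have fr: "\<And>m'. m' \<notin> insert i (insert j (writes p)) \<Longrightarrow> t m' = s m'" using that(1) by blast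
    have "t i 0 < n" "t j 0 < n" using ij' uv by simp_all
    then obtain x where x: "run p t m = (t m)(t i 0 * n + t j 0 := x)" "x \<noteq> 0 \<longleftrightarrow> P (t i 0) (t j 0)"
      using body[of t, OF fr] by blast
    then show ?thesis using ij' by simp
  qed
  show "(if x = i then u else v) < n" for x using uv by simp
qed

lemma run_clear_vec: "base s \<Longrightarrow> m \<notin> {0, 3, 39} \<Longrightarrow> vec (run (clear_vec m) s) m {}"
  unfolding vec_def clear_vec_def using fill_vec[of s 39 m "Const 0" "\<lambda>_. 0"] by (simp add: base_n del: run.simps)

lemma run_copy_vec:
  assumes "base s" "m' \<notin> {0, 3, 39}" "m \<noteq> 39" "m \<noteq> m'" "vec s m X"
  shows "vec (run (copy_vec m m') s) m' X"
  unfolding vec_def copy_vec_def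
proof (intro allI impI)
  fix u assume u: "u < n"
  have "run (For 39 (Set m' (Var 39) (Entry m 39))) s m' u = s m u"
    by (rule fill_vec[where g="s m"]) (use assms u in \<open>auto simp: base_n\<close>)
  then show "(run (For 39 (Set m' (Var 39) (Entry m 39))) s m' u \<noteq> 0) = (u \<in> X)"
    using assms(5) u by (simp add: vec_def del: run.simps)
qed

lemma run_clear_mat:
  assumes "base s" "m \<notin> {0, 3, 39, 40}" shows "mat (run (clear_mat m) s) m {}"
  unfolding mat_def clear_mat_def
proof (intro allI impI)
  fix u v assume uv: "u < n" "v < n"
  have "run (nest [39, 40] (Set2 m 39 40 (Const 0))) s m (u * n + v) \<noteq> 0 \<longleftrightarrow> False"
  proof (rule fill_mat[where P="\<lambda>_ _. False"])
    fix t :: store assume fr: "\<And>m'. m' \<notin> insert 39 (insert 40 (writes (Set2 m 39 40 (Const 0)))) \<Longrightarrow> t m' = s m'"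
      and l: "t 39 0 < n" "t 40 0 < n"
    have "t 3 = s 3" using fr assms by simp
    then show "\<exists>x. run (Set2 m 39 40 (Const 0)) t m = (t m)(t 39 0 * n + t 40 0 := x) \<and> (x \<noteq> 0 \<longleftrightarrow> False)"
      using l base_off[OF assms(1)] by (intro exI[of _ 0]) simp
  qed (use assms uv in \<open>auto simp: base_n\<close>)
  then show "(run (nest [39, 40] (Set2 m 39 40 (Const 0))) s m (u * n + v) \<noteq> 0) = ({u, v} \<in> {})" by simp
qed

lemma run_copy_mat:
  assumes "base s" "m' \<notin> {0, 3, 39, 40}" "m \<notin> {39, 40, m'}" "mat s m F"
  shows "mat (run (copy_mat m m') s) m' F"
  unfolding mat_def copy_mat_def
proof (intro allI impI)
  fix u v assume uv: "u < n" "v < n"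
  let ?p = "Set2 m' 39 40 (Entry2 m 39 40)"
  show "(run (nest [39, 40] ?p) s m' (u * n + v) \<noteq> 0) = ({u, v} \<in> F)"
  proof (rule fill_mat[where P="\<lambda>u v. {u, v} \<in> F"])
    fix t :: store assume fr: "\<And>x. x \<notin> insert 39 (insert 40 (writes ?p)) \<Longrightarrow> t x = s x"
      and l: "t 39 0 < n" "t 40 0 < n"
    have "t 3 = s 3" "t m = s m" using fr assms by auto
    then show "\<exists>x. run ?p t m' = (t m')(t 39 0 * n + t 40 0 := x) \<and> (x \<noteq> 0 \<longleftrightarrow> {t 39 0, t 40 0} \<in> F)"
      using l base_off[OF assms(1)] matD[OF assms(4) l] by (intro exI[of _ "s m (t 39 0 * n + t 40 0)"]) simp
  qed (use assms uv in \<open>auto simp: base_n\<close>)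
qed

lemma run_try_extend:
  assumes s: "base s" "s a 0 < n" "s b 0 < n" "vec s 4 Y" "mat s 5 F" and F: "F \<subseteq> E"
    and x: "{a, b} \<inter> {0, 3, 4, 5, 20, 38} = {}"
  shows "vec (run (try_extend a b) s) 4 (fst (extend_tree E c (s a 0) (s b 0) (Y, F)))"
    "mat (run (try_extend a b) s) 5 (snd (extend_tree E c (s a 0) (s b 0) (Y, F)))"
proof -
  let ?u = "s a 0" and ?v = "s b 0"
  let ?q = "Set 4 (Var b) (Const 1) ;; Set2 5 a b (Const 1) ;; Set2 5 b a (Const 1)"
  let ?c = "conflict 20 5 a b 38"
  have ab: "a \<noteq> 0" "a \<noteq> 3" "a \<noteq> 4" "a \<noteq> 5" "a \<noteq> 20" "a \<noteq> 38" "b \<noteq> 0" "b \<noteq> 3" "b \<noteq> 4" "b \<noteq> 5" "b \<noteq> 20" "b \<noteq> 38" using x by auto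
  define t where "t = run ?c s"
  have t: "base t" "vec t 4 Y" "mat t 5 F" "t a = s a" "t b = s b"
    using s x by (auto simp: t_def run_frame)
  have "t 20 0 \<noteq> 0 \<longleftrightarrow> (\<exists>x<n. {?u, x} \<in> F \<and> col ?u x = col ?u ?v)"
    unfolding t_def by (rule run_conflict[OF s(1-3,5)]) (simp_all add: ab ab[symmetric])
  moreover have "(\<exists>x<n. {?u, x} \<in> F \<and> col ?u x = col ?u ?v) \<longleftrightarrow> (\<exists>x. {?u, x} \<in> F \<and> c {?u, x} = c {?u, ?v})"
    if "{?u, ?v} \<in> E"
    using that F E_less unfolding col_def by (metis subsetD)
  ultimately have flag: "t 20 0 = 0 \<longleftrightarrow> (\<forall>x. {?u, x} \<in> F \<longrightarrow> c {?u, x} \<noteq> c {?u, ?v})" if "{?u, ?v} \<in> E"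
    using that by blast
  have v: "val (Entry 4 a) s = 0 \<longleftrightarrow> ?u \<notin> Y" "val (Entry 4 b) s = 0 \<longleftrightarrow> ?v \<notin> Y" "val (Color a b) s = 0 \<longleftrightarrow> {?u, ?v} \<notin> E"
    using s vecD[OF s(4)] by (simp_all add: base_off base_col col_eq_0)
  define t1 where "t1 = run (Set 4 (Var b) (Const 1)) t"
  have t1: "base t1" "vec t1 4 (insert ?v Y)" "mat t1 5 F" "t1 a = s a" "t1 b = s b"
    using t ab vec_update[OF t(2), of "t b 0" 1] s(3) unfolding t1_def by (auto simp: base_def mat_def)
  have t2: "mat (run (Set2 5 a b (Const 1) ;; Set2 5 b a (Const 1)) t1) 5 (insert {?u, ?v} F)"
    using run_set_edge[of t1 a b 5 F 1] t1 s(2,3) ab by simp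
  have t3: "vec (run (Set2 5 a b (Const 1) ;; Set2 5 b a (Const 1)) t1) 4 (insert ?v Y)" using t1(2) by (simp add: vec_def)
  have q: "run ?q t = run (Set2 5 a b (Const 1) ;; Set2 5 b a (Const 1)) t1" by (simp add: t1_def)
  have r: "run (try_extend a b) s = (if ?u \<in> Y \<and> ?v \<notin> Y \<and> {?u, ?v} \<in> E then if t 20 0 = 0 then run ?q t else t else s)"
  proof -
    have "run (try_extend a b) s = (if val (Entry 4 a) s \<noteq> 0 then if val (Entry 4 b) s \<noteq> 0 then s else
       if val (Color a b) s \<noteq> 0 then if t 20 0 = 0 then run ?q t else t else s else s)"
      by (simp add: try_extend_def t_def)
    then show ?thesis
      unfolding v by (cases "?u \<in> Y"; cases "?v \<in> Y"; cases "{?u, ?v} \<in> E"; simp only: if_True if_False simp_thms)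
  qed
  have ext: "extend_tree E c ?u ?v (Y, F) = (if ?u \<in> Y \<and> ?v \<notin> Y \<and> {?u, ?v} \<in> E then if t 20 0 = 0 then (insert ?v Y, insert {?u, ?v} F) else (Y, F) else (Y, F))"
    using flag by (auto simp: extend_tree_def)
  show "vec (run (try_extend a b) s) 4 (fst (extend_tree E c ?u ?v (Y, F)))"
    "mat (run (try_extend a b) s) 5 (snd (extend_tree E c ?u ?v (Y, F)))"
    unfolding r ext using t2 t3 q t s by auto
qed

lemma run_count_vec:
  assumes s: "base s" "m \<notin> {39, x}" "x \<notin> {0, 3, 39}" "vec s m X" "X \<subseteq> {..<n}"
  shows "run (count_vec m x) s x 0 = card X"
proof -
  let ?p = "When (Entry m 39) (SetVar x (Plus (Var x) (Const 1)))"
  obtain t where t: "t x 0 = card (X \<inter> {..<n})" "run (For 39 ?p) (put x 0 s) = put 39 n t"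
  proof (rule run_For[of "put x 0 s" n 39 ?p "\<lambda>i t. t x 0 = card (X \<inter> {..<i})"])
    fix i t assume i: "i < n" and fr: "\<And>m. m \<notin> insert 39 (writes ?p) \<Longrightarrow> t m = put x 0 s m"
      and I: "t x 0 = card (X \<inter> {..<i})"
    have tm: "t m = s m" using fr s by auto
    have "X \<inter> {..<Suc i} = (if i \<in> X then insert i (X \<inter> {..<i}) else X \<inter> {..<i})" by (auto simp: less_Suc_eq)
    then show "run ?p (put 39 i t) x 0 = card (X \<inter> {..<Suc i})"
      using I s tm vecD[OF s(4) i] by simp
  qed (use s that in \<open>auto simp: base_n\<close>)
  have "run (count_vec m x) s x 0 = t x 0" using t(2) s by (simp add: count_vec_def run_SetVar del: run.simps(2))
  moreover have "X \<inter> {..<n} = X" using s(5) by blast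
  ultimately show ?thesis using t(1) by simp
qed

lemma run_commit:
  assumes s: "base s" "vec s 1 X" "mat s 2 T" "vec s 4 Y" "mat s 5 F" "X \<subseteq> {..<n}" "Y \<subseteq> {..<n}"
  shows "card X < card Y \<Longrightarrow> vec (run commit s) 1 Y \<and> mat (run commit s) 2 F"
    "\<not> card X < card Y \<Longrightarrow> vec (run commit s) 1 X \<and> mat (run commit s) 2 T"
proof -
  define t where "t = run (count_vec 4 28) (run (count_vec 1 27) s)"
  have t: "base t" "vec t 1 X" "mat t 2 T" "vec t 4 Y" "mat t 5 F" using s by (simp_all add: t_def)
  have "t 28 0 = card Y" unfolding t_def by (rule run_count_vec) (use s in auto)
  moreover have "t 27 0 = card X" unfolding t_def using run_count_vec[OF s(1), of 1 27 X] s by (simp add: run_frame)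
  ultimately have r: "run commit s = (if card X < card Y then run (copy_mat 5 2) (run (copy_vec 4 1) t) else t)"
    by (simp add: commit_def t_def)
  have "vec (run (copy_vec 4 1) t) 1 Y" by (rule run_copy_vec) (use t in auto)
  moreover have "mat (run (copy_mat 5 2) (run (copy_vec 4 1) t)) 2 F" by (rule run_copy_mat) (use t in auto)
  ultimately show "card X < card Y \<Longrightarrow> vec (run commit s) 1 Y \<and> mat (run commit s) 2 F"
    "\<not> card X < card Y \<Longrightarrow> vec (run commit s) 1 X \<and> mat (run commit s) 2 T"
    using r t by auto
qed

lemma run_merge_labels:
  assumes s: "base s" "s 41 0 < n" "s 42 0 < n" "mat s 12 Q"
  defines "t \<equiv> run merge_labels s"
  shows "x < n \<Longrightarrow> t 13 x = (if {s 41 0, s 42 0} \<in> Q \<and> s 13 x = s 13 (s 41 0) then s 13 (s 42 0) else s 13 x)"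
proof -
  assume x: "x < n"
  let ?p = "Unless (Neq (Entry 13 43) (Var 22)) (Set 13 (Var 43) (Var 23))"
  let ?s = "put 23 (s 13 (s 42 0)) (put 22 (s 13 (s 41 0)) s)"
  let ?I = "\<lambda>i t. \<forall>x<n. t 13 x = (if x < i \<and> s 13 x = s 13 (s 41 0) then s 13 (s 42 0) else s 13 x)"
  obtain t' where t': "?I n t'" "run (For 43 ?p) ?s = put 43 n t'"
  proof (rule run_For[of ?s n 43 ?p ?I])
    show "?s 0 0 = n" using s(1) by (simp add: base_n)
    show "?I 0 ?s" by simp
    fix i t assume i: "i < n" and fr: "\<And>m. m \<notin> insert 43 (writes ?p) \<Longrightarrow> t m = ?s m" and I: "?I i t"
    have m: "t 22 = ?s 22" "t 23 = ?s 23" using fr by auto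
    have "t 13 i = s 13 i" using I i by simp
    then show "?I (Suc i) (run ?p (put 43 i t))" using I m by (auto simp: less_Suc_eq)
  qed (use that in auto)
  have v: "val (Entry2 12 41 42) s = 0 \<longleftrightarrow> {s 41 0, s 42 0} \<notin> Q"
    using s matD[OF s(4,2,3)] by (simp add: base_off)
  have "t = (if {s 41 0, s 42 0} \<in> Q then put 43 n t' else s)"
  proof (cases "{s 41 0, s 42 0} \<in> Q")
    case True
    then have "t = run (For 43 ?p) ?s"
      unfolding t_def merge_labels_def using v by (simp add: put_def del: run.simps(5))
    then show ?thesis using True t'(2) by simp
  next
    case False
    then show ?thesis unfolding t_def merge_labels_def using v by (simp del: run.simps(5) val.simps)
  qed
  then show "t 13 x = (if {s 41 0, s 42 0} \<in> Q \<and> s 13 x = s 13 (s 41 0) then s 13 (s 42 0) else s 13 x)"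
    using t'(1) x by simp
qed

text \<open>That equal labels imply connection is an invariant. Conversely, the ends of an edge get
  equal labels in the pass for that edge and keep them, which extends along paths.\<close>

lemma run_labels:
  assumes s: "base s" "mat s 12 Q" and Q: "Q \<subseteq> doubletons {..<n}" and xy: "x < n" "y < n"
  shows "run labels s 13 x = run labels s 13 y \<longleftrightarrow> (x, y) \<in> conn Q"
proof -
  define s1 where "s1 = run (For 41 (Set 13 (Var 41) (Var 41))) s"
  have s1: "base s1" "mat s1 12 Q" using s by (simp_all add: s1_def del: run.simps)
  have id: "s1 13 u = u" if "u < n" for u
    unfolding s1_def by (rule fill_vec[where g="\<lambda>u. u"]) (use s that in \<open>auto simp: base_n\<close>)
  let ?sound = "\<lambda>t. \<forall>x<n. \<forall>y<n. t 13 x = t 13 y \<longrightarrow> (x, y) \<in> conn Q"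
  let ?Inv = "\<lambda>t. base t \<and> mat t 12 Q \<and> ?sound t"
  have body: "?Inv (run merge_labels t)" if t: "?Inv t" and l: "t 41 0 < n" "t 42 0 < n" for t
  proof -
    let ?a = "t 41 0" and ?b = "t 42 0"
    note m = run_merge_labels[of t Q] 
    have mm: "run merge_labels t 13 x = (if {?a, ?b} \<in> Q \<and> t 13 x = t 13 ?a then t 13 ?b else t 13 x)" if "x < n" for x
      using m t l that by blast
    have snd: "(x, y) \<in> conn Q" if "x < n" "y < n" "t 13 x = t 13 y" for x y using t that by blast
    have "(x, y) \<in> conn Q" if xy: "x < n" "y < n" "run merge_labels t 13 x = run merge_labels t 13 y" for x y
    proof (cases "{?a, ?b} \<in> Q")
      case False
      then show ?thesis using mm[OF xy(1)] mm[OF xy(2)] xy snd by simp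
    next
      case True
      have ab: "(?a, ?b) \<in> conn Q" by (rule conn_edge[OF True])
      have key: "(z, w) \<in> conn Q" if "z < n" "w < n" "t 13 z = t 13 ?a" "t 13 w = t 13 ?b" for z w
      proof -
        have "(z, ?a) \<in> conn Q" by (rule snd) (use that l in auto)
        moreover have "(?b, w) \<in> conn Q" by (rule snd) (use that l in auto)
        ultimately show ?thesis using ab conn_trans by metis
      qed
      have e: "run merge_labels t 13 x = (if t 13 x = t 13 ?a then t 13 ?b else t 13 x)"
        "run merge_labels t 13 y = (if t 13 y = t 13 ?a then t 13 ?b else t 13 y)" using mm xy True by auto
      show ?thesis
      proof (cases "t 13 x = t 13 ?a")
        case xa: True
        show ?thesis
        proof (cases "t 13 y = t 13 ?a")
          case True
          then show ?thesis using xa snd xy by simp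
        next
          case False
          then show ?thesis using key[OF xy(1,2) xa] e xa xy(3) by simp
        qed
      next
        case xa: False
        show ?thesis
        proof (cases "t 13 y = t 13 ?a")
          case True
          then show ?thesis using conn_sym[OF key[OF xy(2,1) True]] e xa xy(3) by simp
        next
          case False
          then show ?thesis using e xa xy snd by simp
        qed
      qed
    qed
    then show ?thesis using t by simp
  qed
  have fin: "?Inv (run (nest [41, 42] merge_labels) s1)"
  proof (rule nest_invariant[where n=n and Inv="?Inv"])
    show "?Inv s1" using s1 id by simp
    show "?Inv (run merge_labels t)" if "?Inv t" "\<And>x. x \<in> set [41, 42] \<Longrightarrow> t x 0 < n" for t
      using body[OF that(1)] that(2) by simp
    show "?Inv (put x i t)" if "?Inv t" "x \<in> set [41, 42]" for t x i using that by auto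
  qed (auto simp: base_n)
  have edge: "run (nest [41, 42] merge_labels) s1 13 a = run (nest [41, 42] merge_labels) s1 13 b" if e: "{a, b} \<in> Q" for a b
  proof (rule nest_visit[where n=n and Inv="?Inv" and G="\<lambda>t. t 13 a = t 13 b" and \<sigma>="\<lambda>x. if x = 41 then a else b"])
    have ab: "a < n" "b < n" using subsetD[OF Q e] by auto
    show "?Inv s1" using s1 id by simp
    show "?Inv (run merge_labels t)" if "?Inv t" "\<And>x. x \<in> set [41, 42] \<Longrightarrow> t x 0 < n" for t
      using body[OF that(1)] that(2) by simp
    show "?Inv (put x i t)" if "?Inv t" "x \<in> set [41, 42]" for t x i using that by auto
    show "run merge_labels t 13 a = run merge_labels t 13 b"
      if t: "?Inv t" "\<And>x. x \<in> set [41, 42] \<Longrightarrow> t x 0 < n" "t 13 a = t 13 b" for t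
      using run_merge_labels[of t Q a] run_merge_labels[of t Q b] t ab by simp
    show "put x i t 13 a = put x i t 13 b" if "x \<in> set [41, 42]" "t 13 a = t 13 b" for t x i using that by auto
    show "run merge_labels t 13 a = run merge_labels t 13 b"
      if t: "?Inv t" "\<And>x. x \<in> set [41, 42] \<Longrightarrow> t x 0 = (if x = 41 then a else b)" for t
    proof -
      have "t 41 0 = a" "t 42 0 = b" using t(2)[of 41] t(2)[of 42] by auto
      then show ?thesis using run_merge_labels[of t Q a] run_merge_labels[of t Q b] t(1) ab e by simp
    qed
    show "(if x = 41 then a else b) < n" for x using ab by simp
  qed (auto simp: base_n)
  have "run labels s = run (nest [41, 42] merge_labels) s1" by (simp add: labels_def s1_def)
  moreover have "run (nest [41, 42] merge_labels) s1 13 x = run (nest [41, 42] merge_labels) s1 13 y" if "(x, y) \<in> conn Q"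
    using that by (induction rule: conn_induct) (use edge in auto)
  ultimately show ?thesis using fin xy by metis
qed

lemma run_reduce_pair:
  assumes s: "base s" "s a 0 < n" "s b 0 < n" "mat s 7 H" and H: "H \<subseteq> E" and x: "{a, b} \<inter> {0, 3, 7, 20, 21, 38} = {}"
  shows "mat (run (reduce_pair a b) s) 7 (drop_pair c (s a 0) (s b 0) H)"
proof -
  let ?u = "s a 0" and ?v = "s b 0"
  define t where "t = run (conflict_other 20 7 a b 38) s"
  define t' where "t' = run (conflict_other 21 7 b a 38) t"
  have ab: "a \<noteq> 0" "a \<noteq> 3" "a \<noteq> 7" "a \<noteq> 20" "a \<noteq> 21" "a \<noteq> 38" "b \<noteq> 0" "b \<noteq> 3" "b \<noteq> 7" "b \<noteq> 20" "b \<noteq> 21" "b \<noteq> 38" using x by auto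
  have t: "base t" "mat t 7 H" "t a = s a" "t b = s b" using s ab by (auto simp: t_def run_frame)
  have t': "base t'" "mat t' 7 H" "t' a = s a" "t' b = s b" "t' 20 = t 20" using t ab by (auto simp: t'_def run_frame)
  have u: "\<not> unique_at c H p q \<longleftrightarrow> (\<exists>x<n. {p, x} \<in> H \<and> col p x = col p q \<and> x \<noteq> q)" if "{p, q} \<in> H" for p q
    using H E_less that unfolding unique_at_def col_def by (metis subsetD)
  have f20: "t 20 0 \<noteq> 0 \<longleftrightarrow> (\<exists>x<n. {?u, x} \<in> H \<and> col ?u x = col ?u ?v \<and> x \<noteq> ?v)"
    unfolding t_def by (rule run_conflict_other[OF s(1-4)]) (simp_all add: ab ab[symmetric])
  have "t' 21 0 \<noteq> 0 \<longleftrightarrow> (\<exists>x<n. {t b 0, x} \<in> H \<and> col (t b 0) x = col (t b 0) (t a 0) \<and> x \<noteq> t a 0)"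
    unfolding t'_def by (rule run_conflict_other[OF t(1)]) (use t s in \<open>simp_all add: ab ab[symmetric]\<close>)
  then have f21: "t' 21 0 \<noteq> 0 \<longleftrightarrow> (\<exists>x<n. {?v, x} \<in> H \<and> col ?v x = col ?v ?u \<and> x \<noteq> ?u)" using t by simp
  have v: "val (Entry2 7 a b) s = 0 \<longleftrightarrow> {?u, ?v} \<notin> H" using s matD[OF s(4,2,3)] by (simp add: base_off)
  let ?q = "Set2 7 a b (Const 0) ;; Set2 7 b a (Const 0)"
  have r: "run (reduce_pair a b) s = (if {?u, ?v} \<in> H then if t 20 0 \<noteq> 0 \<and> t' 21 0 \<noteq> 0 then run ?q t' else t' else s)"
  proof -
    have "run (reduce_pair a b) s = (if val (Entry2 7 a b) s \<noteq> 0 then if t' 20 0 \<noteq> 0 then if t' 21 0 \<noteq> 0 then run ?q t' else t' else t' else s)"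
      by (simp add: reduce_pair_def t_def t'_def)
    then show ?thesis unfolding v t'(5)
      by (cases "{?u, ?v} \<in> H"; cases "t 20 0 = 0"; simp only: if_True if_False simp_thms)
  qed
  have "mat (run ?q t') 7 (H - {{?u, ?v}})"
    using run_set_edge[of t' a b 7 H 0] t' s(2,3) ab by simp
  moreover have "{?u, ?v} \<in> H \<Longrightarrow> drop_pair c ?u ?v H = (if t 20 0 \<noteq> 0 \<and> t' 21 0 \<noteq> 0 then H - {{?u, ?v}} else H)"
    using f20 f21 u[of ?u ?v] u[of ?v ?u] by (auto simp: drop_pair_def insert_commute)
  moreover have "{?u, ?v} \<notin> H \<Longrightarrow> drop_pair c ?u ?v H = H" by (simp add: drop_pair_def)
  ultimately show ?thesis unfolding r using t' s by auto
qed

definition reduced :: "nat set set \<Rightarrow> nat \<Rightarrow> nat set set" where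
  "reduced H v = fold (\<lambda>a. fold (\<lambda>b. drop_pair c a b) [0..<n]) [0..<n] (fold (\<lambda>b. drop_pair c v b) [0..<n] H)"

lemma fold_drop_subset: "fold (\<lambda>b. drop_pair c a b) bs H \<subseteq> H"
  by (induction bs arbitrary: H) (use drop_pair_subset in fastforce)+

lemma run_reduce:
  assumes s: "base s" "s 30 0 < n" "mat s 7 H" and H: "H \<subseteq> E"
  shows "mat (run reduce s) 7 (reduced H (s 30 0))"
proof -
  let ?v = "s 30 0"
  let ?I = "\<lambda>i t. mat t 7 (fold (\<lambda>b. drop_pair c ?v b) [0..<i] H)"
  obtain t where t: "?I n t" "run (For 44 (reduce_pair 30 44)) s = put 44 n t"
    "\<And>m. m \<notin> insert 44 (writes (reduce_pair 30 44)) \<Longrightarrow> t m = s m"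
  proof (rule run_For[of s n 44 "reduce_pair 30 44" ?I])
    fix i t assume i: "i < n" and fr: "\<And>m. m \<notin> insert 44 (writes (reduce_pair 30 44)) \<Longrightarrow> t m = s m" and I: "?I i t"
    have "base t" using s(1) fr base_cong[of t s] by simp
    moreover have "t 30 = s 30" using fr by simp
    ultimately show "?I (Suc i) (run (reduce_pair 30 44) (put 44 i t))"
      using run_reduce_pair[of "put 44 i t" 30 44 "fold (\<lambda>b. drop_pair c ?v b) [0..<i] H"] I s i H
        fold_drop_subset[of ?v "[0..<i]" H] by simp
  qed (use s in \<open>auto simp: base_n\<close>)
  define H1 where "H1 = fold (\<lambda>b. drop_pair c ?v b) [0..<n] H"
  let ?f = "\<lambda>a. fold (\<lambda>b. drop_pair c a b) [0..<n]"
  have ffsub: "fold ?f as H \<subseteq> H" for as H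
    by (induction as arbitrary: H) (use fold_drop_subset in fastforce)+
  have H1: "H1 \<subseteq> E" using fold_drop_subset[of ?v "[0..<n]" H] H by (auto simp: H1_def)
  let ?s = "put 44 n t"
  have bs: "base ?s" "mat ?s 7 H1" using s(1) t(1,3) base_cong[of t s] by (simp_all add: H1_def)
  let ?J = "\<lambda>i t. mat t 7 (fold ?f [0..<i] H1)"
  obtain t2 where t2: "?J n t2" "run (For 45 (For 46 (reduce_pair 45 46))) ?s = put 45 n t2"
  proof (rule run_For[of ?s n 45 "For 46 (reduce_pair 45 46)" ?J])
    fix i t2 assume i: "i < n" and fr: "\<And>m. m \<notin> insert 45 (writes (For 46 (reduce_pair 45 46))) \<Longrightarrow> t2 m = ?s m" and J: "?J i t2"
    let ?t = "put 45 i t2"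
    have bt: "base ?t" using bs(1) fr base_cong[of t2 ?s] by simp
    let ?Hi = "fold ?f [0..<i] H1"
    have Hi: "?Hi \<subseteq> E" using ffsub[of "[0..<i]" H1] H1 by blast
    let ?K = "\<lambda>j t. mat t 7 (fold (\<lambda>b. drop_pair c i b) [0..<j] ?Hi)"
    obtain t3 where t3: "?K n t3" "run (For 46 (reduce_pair 45 46)) ?t = put 46 n t3"
    proof (rule run_For[of ?t n 46 "reduce_pair 45 46" ?K])
      fix j t3 assume j: "j < n" and fr3: "\<And>m. m \<notin> insert 46 (writes (reduce_pair 45 46)) \<Longrightarrow> t3 m = ?t m" and K: "?K j t3"
      have "base t3" using bt fr3 base_cong[of t3 ?t] by simp
      moreover have "t3 45 = ?t 45" using fr3 by simp
      ultimately show "?K (Suc j) (run (reduce_pair 45 46) (put 46 j t3))"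
        using run_reduce_pair[of "put 46 j t3" 45 46 "fold (\<lambda>b. drop_pair c i b) [0..<j] ?Hi"] K i j Hi
          fold_drop_subset[of i "[0..<j]" ?Hi] by simp
    qed (use bt J in \<open>auto simp: base_n\<close>)
    then show "?J (Suc i) (run (For 46 (reduce_pair 45 46)) ?t)" by simp
  qed (use bs in \<open>auto simp: base_n\<close>)
  have "run reduce s = put 45 n t2" using t(2) t2(2) by (simp add: reduce_def del: run.simps(5))
  moreover have "mat (put 45 n t2) 7 (reduced H ?v)" using t2(1) by (simp add: reduced_def H1_def)
  ultimately show ?thesis by simp
qed

lemma run_build_U:
  assumes "base s" "s 30 0 < n" "vec s 1 X" shows "vec (run build_U s) 6 (insert (s 30 0) X)"
proof -
  define t where "t = run (copy_vec 1 6) s"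
  have "vec t 6 X" unfolding t_def by (rule run_copy_vec) (use assms in auto)
  moreover have "t 30 = s 30" by (simp add: t_def run_frame)
  ultimately show ?thesis using vec_update[of t 6 X "s 30 0" 1] assms(2) by (simp add: build_U_def t_def)
qed

lemma run_build_H:
  assumes "base s" "vec s 6 U" shows "mat (run build_H s) 7 {e \<in> E. e \<subseteq> U}"
  unfolding mat_def
proof (intro allI impI)
  fix u v assume uv: "u < n" "v < n"
  let ?p = "Set2 7 39 40 (Const 0) ;; When (Entry 6 39) (When (Entry 6 40) (When (Color 39 40) (Set2 7 39 40 (Const 1))))"
  have "run (nest [39, 40] ?p) s 7 (u * n + v) \<noteq> 0 \<longleftrightarrow> {u, v} \<in> E \<and> u \<in> U \<and> v \<in> U"
  proof (rule fill_mat[where P="\<lambda>u v. {u, v} \<in> E \<and> u \<in> U \<and> v \<in> U"])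
    fix t :: store assume fr: "\<And>x. x \<notin> insert 39 (insert 40 (writes ?p)) \<Longrightarrow> t x = s x" and l: "t 39 0 < n" "t 40 0 < n"
    have m: "t 3 = s 3" "t 6 = s 6" "t 0 = s 0" using fr by auto
    let ?P = "{t 39 0, t 40 0} \<in> E \<and> t 39 0 \<in> U \<and> t 40 0 \<in> U"
    show "\<exists>x. run ?p t 7 = (t 7)(t 39 0 * n + t 40 0 := x) \<and> (x \<noteq> 0 \<longleftrightarrow> ?P)"
      using l m base_off[OF assms(1)] base_col[OF assms(1) l] vecD[OF assms(2) l(1)] vecD[OF assms(2) l(2)] col_eq_0[of "t 39 0" "t 40 0"]
      by (intro exI[of _ "if ?P then 1 else 0"]) auto
  qed (use assms uv in \<open>auto simp: base_n\<close>)
  then show "(run build_H s 7 (u * n + v) \<noteq> 0) = ({u, v} \<in> {e \<in> E. e \<subseteq> U})" by (simp add: build_H_def del: nest.simps)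
qed

lemma run_build_H':
  assumes s: "base s" "mat s 7 H" "s 32 0 < n" "s 33 0 < n"
  shows "mat (run build_H' s) 9 {e \<in> H. (s 31 0 = s 32 0 \<or> s 31 0 \<notin> e) \<and>
    \<not> (s 32 0 \<in> e \<and> (\<exists>a b. e = {a, b} \<and> col a b = col (s 32 0) (s 33 0)))}"
  unfolding mat_def
proof (intro allI impI)
  fix u v assume uv: "u < n" "v < n"
  let ?p = "Set2 9 39 40 (Const 0) ;; When (Entry2 7 39 40)
     (Cond (Neq (Var 31) (Var 32)) (When (Neq (Var 39) (Var 31)) (When (Neq (Var 40) (Var 31)) mark_colored)) mark_colored)"
  let ?t = "s 31 0" and ?r = "s 32 0" and ?b = "s 33 0"
  let ?P = "\<lambda>u v. {u, v} \<in> H \<and> (?t = ?r \<or> ?t \<noteq> u \<and> ?t \<noteq> v) \<and> \<not> ((?r = u \<or> ?r = v) \<and> col u v = col ?r ?b)"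
  have r: "run (nest [39, 40] ?p) s 9 (u * n + v) \<noteq> 0 \<longleftrightarrow> ?P u v"
  proof (rule fill_mat[where P="?P"])
    fix t :: store assume fr: "\<And>x. x \<notin> insert 39 (insert 40 (writes ?p)) \<Longrightarrow> t x = s x" and l: "t 39 0 < n" "t 40 0 < n"
    have m: "t 3 = s 3" "t 7 = s 7" "t 0 = s 0" "t 31 = s 31" "t 32 = s 32" "t 33 = s 33"
      using fr by (simp_all add: mark_colored_def)
    define i j where "i = t 39 0" and "j = t 40 0"
    have ij: "i < n" "j < n" using l by (simp_all add: i_def j_def)
    define t1 where "t1 = t(9 := (t 9)(i * n + j := 0))"
    define t2 where "t2 = t(9 := (t 9)(i * n + j := 1))"
    have off: "s 3 i = i * n" "s 3 ?r = ?r * n" using base_off[OF s(1)] ij s(3) by simp_all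
    have cl: "s 0 (Suc (i * n + j)) = col i j" "s 0 (Suc (?r * n + ?b)) = col ?r ?b"
      using base_col[OF s(1)] ij s(3,4) by simp_all
    have e: "t1 39 0 = i" "t1 40 0 = j" "t1 3 = s 3" "t1 7 = s 7" "t1 0 = s 0" "t1 31 = s 31" "t1 32 = s 32" "t1 33 = s 33"
      by (simp_all add: t1_def m i_def j_def)
    have set: "run (Set2 9 39 40 (Const 1)) t1 = t2" by (simp add: e off) (simp add: t1_def t2_def)
    have mk: "run mark_colored t1 = (if col i j \<noteq> col ?r ?b \<or> i \<noteq> ?r \<and> j \<noteq> ?r then t2 else t1)"
      unfolding mark_colored_def run_Cond_Neq set by (auto simp: e off cl)
    have "run ?p t = run (When (Entry2 7 39 40) (Cond (Neq (Var 31) (Var 32))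
        (When (Neq (Var 39) (Var 31)) (When (Neq (Var 40) (Var 31)) mark_colored)) mark_colored)) t1"
      using off(1) m(1) by (simp add: t1_def i_def j_def)
    also have "\<dots> = (if s 7 (i * n + j) \<noteq> 0 \<and> (?t = ?r \<or> i \<noteq> ?t \<and> j \<noteq> ?t) then run mark_colored t1 else t1)"
      by (auto simp: e off)
    also have "\<dots> = (if ?P i j then t2 else t1)"
      unfolding mk using matD[OF s(2) ij] by auto
    finally have "run ?p t = (if ?P i j then t2 else t1)" .
    then have "run ?p t 9 = (if ?P i j then t2 else t1) 9" by (rule fun_cong)
    also have "\<dots> = (t 9)(i * n + j := if ?P i j then 1 else 0)"
    proof -
      have "(if B then t2 else t1) 9 = (t 9)(i * n + j := if B then 1 else 0)" for B by (simp add: t1_def t2_def)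
      then show ?thesis .
    qed
    finally have "run ?p t 9 = (t 9)(i * n + j := if ?P i j then 1 else 0)" .
    then show "\<exists>x. run ?p t 9 = (t 9)(t 39 0 * n + t 40 0 := x) \<and> (x \<noteq> 0 \<longleftrightarrow> ?P (t 39 0) (t 40 0))"
      unfolding i_def[symmetric] j_def[symmetric] by (intro exI[of _ "if ?P i j then 1 else 0"]) simp
  qed (use s uv in \<open>auto simp: base_n mark_colored_def\<close>)
  \<comment> \<open>The ends in the specification are determined only up to order, which
    \<open>col\<close> ignores.\<close>
  have q: "(\<exists>a b. {u, v} = {a, b} \<and> col a b = col ?r ?b) \<longleftrightarrow> col u v = col ?r ?b"
    by (metis doubleton_eq_iff col_sym)
  have b: "run build_H' s = run (nest [39, 40] ?p) s" by (simp add: build_H'_def del: nest.simps run.simps)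
  show "(run build_H' s 9 (u * n + v) \<noteq> 0) = ({u, v} \<in> {e \<in> H. (?t = ?r \<or> ?t \<notin> e) \<and>
    \<not> (?r \<in> e \<and> (\<exists>a b. e = {a, b} \<and> col a b = col ?r ?b))})"
    unfolding b r mem_Collect_eq q by blast
qed

end

section \<open>Computing a largest forest without conflicts\<close>

definition difference :: loop where
  "difference = nest [39, 40] (Set2 12 39 40 (Const 0) ;;
     When (Entry2 10 39 40) (Unless (Entry2 11 39 40) (Set2 12 39 40 (Const 1))))"

definition scan :: loop where
  "scan = When (Entry2 9 50 51) (When (Neq (Entry 13 50) (Entry 13 51))
     (conflict 20 10 50 51 38 ;; conflict 21 10 51 50 38 ;;
      Unless (Var 20) (Unless (Var 21) (SetVar 24 (Const 1) ;; SetVar 25 (Var 50) ;; SetVar 26 (Var 51)))))"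

definition set_edge :: "nat \<Rightarrow> nat \<Rightarrow> nat \<Rightarrow> nat \<Rightarrow> loop" where
  "set_edge m a b k = Set2 m a b (Const k) ;; Set2 m b a (Const k)"

text \<open>The vertex in \<open>52\<close> is the common end of the forest edge to
  \<open>53\<close> and the conflicting edge to \<open>54\<close>; running over ordered triples lets
  either end be the common one.\<close>

definition mark :: loop where
  "mark = When (Entry2 10 52 53) (When (Entry2 9 52 54) (Unless (Neq (Color 52 54) (Color 52 53))
     (When (Neq (Entry 13 52) (Entry 13 54)) (set_edge 11 52 53 1))))"

text \<open>Once \<open>24\<close> is set, further layers are skipped. This freezes the marks at the
  first reachable layer.\<close>

definition layer :: loop where
  "layer = Unless (Var 24) (difference ;; labels ;; nest [50, 51] scan ;; Unless (Var 24) (nest [52, 53, 54] mark))"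

definition exchange :: loop where
  "exchange = When (Var 24) (When (Entry2 11 55 56) (copy_mat 10 12 ;; set_edge 12 55 56 0 ;; labels ;;
     When (Neq (Entry 13 25) (Entry 13 26)) (set_edge 10 55 56 0 ;; set_edge 10 25 26 1 ;; SetVar 24 (Const 0))))"

text \<open>A sink that joins two components of \<open>F\<close> itself is simply added; otherwise
  it replaces a marked edge.\<close>

definition augment :: loop where
  "augment = copy_mat 10 12 ;; labels ;; Cond (Neq (Entry 13 25) (Entry 13 26)) (set_edge 10 25 26 1) (nest [55, 56] exchange)"

definition improve :: loop where
  "improve = clear_mat 11 ;; SetVar 24 (Const 0) ;; For 47 layer ;; When (Var 24) augment"

definition rainbow :: loop where
  "rainbow = clear_mat 10 ;; nest [57, 58] improve"

lemma writes_rainbow [simp]: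
  "writes difference = {12, 39, 40}" "writes scan = {20, 21, 24, 25, 26, 38}" "writes (set_edge m a b k) = {m}"
  "writes mark = {11}" "writes layer = {11, 12, 13, 20, 21, 22, 23, 24, 25, 26, 38, 39, 40, 41, 42, 43, 50, 51, 52, 53, 54}"
  "writes exchange = {10, 12, 13, 22, 23, 24, 39, 40, 41, 42, 43}"
  "writes augment = {10, 12, 13, 22, 23, 24, 39, 40, 41, 42, 43, 55, 56}"
  "writes improve = {10, 11, 12, 13, 20, 21, 22, 23, 24, 25, 26, 38, 39, 40, 41, 42, 43, 47, 50, 51, 52, 53, 54, 55, 56}"
  "writes rainbow = {10, 11, 12, 13, 20, 21, 22, 23, 24, 25, 26, 38, 39, 40, 41, 42, 43, 47, 50, 51, 52, 53, 54, 55, 56, 57, 58}"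
proof -
  show d: "writes difference = {12, 39, 40}" by (auto simp: difference_def)
  show s: "writes scan = {20, 21, 24, 25, 26, 38}" by (auto simp: scan_def)
  show e: "writes (set_edge m a b k) = {m}" for m a b k by (auto simp: set_edge_def)
  show m: "writes mark = {11}" by (auto simp: mark_def e)
  show l: "writes layer = {11, 12, 13, 20, 21, 22, 23, 24, 25, 26, 38, 39, 40, 41, 42, 43, 50, 51, 52, 53, 54}"
    by (auto simp: layer_def writes_nest d s m simp del: nest.simps)
  show x: "writes exchange = {10, 12, 13, 22, 23, 24, 39, 40, 41, 42, 43}" by (auto simp: exchange_def e)
  show a: "writes augment = {10, 12, 13, 22, 23, 24, 39, 40, 41, 42, 43, 55, 56}"
    by (auto simp: augment_def writes_nest e x simp del: nest.simps)
  show i: "writes improve = {10, 11, 12, 13, 20, 21, 22, 23, 24, 25, 26, 38, 39, 40, 41, 42, 43, 47, 50, 51, 52, 53, 54, 55, 56}"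
    by (auto simp: improve_def l a)
  show "writes rainbow = {10, 11, 12, 13, 20, 21, 22, 23, 24, 25, 26, 38, 39, 40, 41, 42, 43, 47, 50, 51, 52, 53, 54, 55, 56, 57, 58}"
    by (auto simp: rainbow_def writes_nest i simp del: nest.simps)
qed

text \<open>A nest over \<open>k\<close> variables executes its body \<open>n ^ k\<close> times;
  \<open>rainbow\<close> obtains its \<open>n\<^sup>2\<close> rounds in this way.\<close>

lemma nest_count:
  assumes "J k s" and "0 \<notin> set xs" "0 \<notin> writes p"
    and n: "\<And>k s. J k s \<Longrightarrow> s 0 0 = n"
    and "\<And>k s. J k s \<Longrightarrow> J (Suc k) (run p s)"
    and "\<And>k s x i. J k s \<Longrightarrow> x \<in> set xs \<Longrightarrow> J k (put x i s)"
  shows "J (k + n ^ length xs) (run (nest xs p) s)"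
  using assms
proof (induction xs arbitrary: k s)
  case Nil
  then show ?case by simp
next
  case (Cons x xs)
  let ?N = "n ^ length xs"
  obtain t where "J (k + n * ?N) t" "run (For x (nest xs p)) s = put x n t"
  proof (rule run_For[of s n x "nest xs p" "\<lambda>i t. J (k + i * ?N) t"])
    show "s 0 0 = n" using Cons.prems(4)[OF Cons.prems(1)] .
    show "x \<noteq> 0" "0 \<notin> writes (nest xs p)" using Cons.prems(2,3) by (auto simp: writes_nest)
    show "J (k + 0 * ?N) s" using Cons.prems(1) by simp
    fix i t assume "J (k + i * ?N) t"
    then have "J (k + i * ?N) (put x i t)" using Cons.prems(6) by simp
    then have "J (k + i * ?N + ?N) (run (nest xs p) (put x i t))"
      by (rule Cons.IH) (use Cons.prems in auto)
    then show "J (k + Suc i * ?N) (run (nest xs p) (put x i t))" by (simp add: algebra_simps)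
  qed
  then show ?case using Cons.prems(6)[of "k + n * ?N" t x n] by simp
qed

context input_graph
begin

lemma run_difference:
  assumes s: "base s" "mat s 10 F" "mat s 11 M" shows "mat (run difference s) 12 (F - M)"
  unfolding mat_def
proof (intro allI impI)
  fix u v assume uv: "u < n" "v < n"
  let ?p = "Set2 12 39 40 (Const 0) ;; When (Entry2 10 39 40) (Unless (Entry2 11 39 40) (Set2 12 39 40 (Const 1)))"
  have "run (nest [39, 40] ?p) s 12 (u * n + v) \<noteq> 0 \<longleftrightarrow> {u, v} \<in> F - M"
  proof (rule fill_mat[where P="\<lambda>u v. {u, v} \<in> F - M"])
    fix t :: store assume fr: "\<And>x. x \<notin> insert 39 (insert 40 (writes ?p)) \<Longrightarrow> t x = s x" and l: "t 39 0 < n" "t 40 0 < n"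
    have m: "t 3 = s 3" "t 10 = s 10" "t 11 = s 11" using fr by auto
    let ?P = "{t 39 0, t 40 0} \<in> F - M"
    show "\<exists>x. run ?p t 12 = (t 12)(t 39 0 * n + t 40 0 := x) \<and> (x \<noteq> 0 \<longleftrightarrow> ?P)"
      using l m base_off[OF s(1)] matD[OF s(2) l] matD[OF s(3) l]
      by (intro exI[of _ "if ?P then 1 else 0"]) auto
  qed (use s uv in \<open>auto simp: base_n\<close>)
  then show "(run difference s 12 (u * n + v) \<noteq> 0) = ({u, v} \<in> F - M)" by (simp add: difference_def del: nest.simps)
qed

lemma run_set_edge_mat:
  assumes "base s" "s a 0 < n" "s b 0 < n" "m \<noteq> 0" "m \<noteq> 3" "m \<noteq> a" "m \<noteq> b" "mat s m F"
  shows "mat (run (set_edge m a b k) s) m (if k \<noteq> 0 then insert {s a 0, s b 0} F else F - {{s a 0, s b 0}})"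
  unfolding set_edge_def by (rule run_set_edge) (use assms in auto)

end

locale rainbow_graph = input_graph n E c + star_graph H "{..<n}" c
  for n :: nat and E :: "nat set set" and c :: "nat set \<Rightarrow> nat" and H :: "nat set set" +
  assumes HE: "H \<subseteq> E"
begin

lemma indep_sub: "indep F \<Longrightarrow> F \<subseteq> H" "indep F \<Longrightarrow> F \<subseteq> E" "indep F \<Longrightarrow> F \<subseteq> doubletons {..<n}"
  using HE E unfolding indep_def by auto

lemma col_conflict:
  assumes F: "F \<subseteq> E" and e: "{a, b} \<in> E"
  shows "(\<exists>x<n. {a, x} \<in> F \<and> col a x = col a b) \<or> (\<exists>x<n. {b, x} \<in> F \<and> col b x = col b a) \<longleftrightarrow> (\<exists>f\<in>F. conf c {a, b} f)"
proof
  assume "(\<exists>x<n. {a, x} \<in> F \<and> col a x = col a b) \<or> (\<exists>x<n. {b, x} \<in> F \<and> col b x = col b a)"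
  then show "\<exists>f\<in>F. conf c {a, b} f"
  proof
    assume "\<exists>x<n. {a, x} \<in> F \<and> col a x = col a b"
    then obtain x where x: "{a, x} \<in> F" "col a x = col a b" by blast
    then have "c {a, x} = c {a, b}" using F e by (auto simp: col_def)
    then show ?thesis using x(1) by (intro bexI[of _ "{a, x}"]) (auto simp: conf_def)
  next
    assume "\<exists>x<n. {b, x} \<in> F \<and> col b x = col b a"
    then obtain x where x: "{b, x} \<in> F" "col b x = col b a" by blast
    moreover have "{b, a} \<in> E" using e by (simp add: insert_commute)
    moreover have "{b, x} \<in> E" using F x(1) by blast
    ultimately have "c {b, x} = c {b, a}" by (simp add: col_def)
    then show ?thesis using x(1) by (intro bexI[of _ "{b, x}"]) (auto simp: conf_def insert_commute)
  qed
next
  assume "\<exists>f\<in>F. conf c {a, b} f"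
  then obtain f where f: "f \<in> F" "{a, b} \<inter> f \<noteq> {}" "c {a, b} = c f" by (auto simp: conf_def)
  then consider "a \<in> f" | "b \<in> f" by blast
  then show "(\<exists>x<n. {a, x} \<in> F \<and> col a x = col a b) \<or> (\<exists>x<n. {b, x} \<in> F \<and> col b x = col b a)"
  proof cases
    case 1
    obtain x where x: "f = {a, x}" using doubletonsE[of f "{..<n}" a] 1 subsetD[OF E] subsetD[OF F] f(1) by metis
    have fE: "{a, x} \<in> E" using F f(1) x by blast
    have "x < n" using E_less[OF fE] by simp
    moreover have "col a x = col a b" using f(3) x fE e by (simp add: col_def)
    ultimately show ?thesis using f(1) x by blast
  next
    case 2
    obtain x where x: "f = {b, x}" using doubletonsE[of f "{..<n}" b] 2 subsetD[OF E] subsetD[OF F] f(1) by metis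
    have fE: "{b, x} \<in> E" using F f(1) x by blast
    have eb: "{b, a} \<in> E" using e by (simp add: insert_commute)
    have "x < n" using E_less[OF fE] by simp
    moreover have "col b x = col b a" using f(3) x fE eb by (simp add: col_def insert_commute)
    ultimately show ?thesis using f(1) x by blast
  qed
qed

text \<open>An edge conflicts with itself, so the two searches for conflicts also detect membership
  in \<open>F\<close>.\<close>

lemma sink_iff:
  assumes F: "indep F"
  shows "sink F {a, b} \<longleftrightarrow> {a, b} \<in> H \<and> \<not> (\<exists>x<n. {a, x} \<in> F \<and> col a x = col a b) \<and> \<not> (\<exists>x<n. {b, x} \<in> F \<and> col b x = col b a)"
proof (cases "{a, b} \<in> H")
  case True
  then have e: "{a, b} \<in> E" using HE by blast
  have "{a, b} \<notin> F" if "\<forall>f\<in>F. \<not> conf c {a, b} f" using that conf_self[OF True] by blast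
  then show ?thesis using col_conflict[OF indep_sub(2)[OF F] e] True unfolding sink_def by blast
next
  case False
  then show ?thesis unfolding sink_def by blast
qed

definition linked :: "store \<Rightarrow> nat set set \<Rightarrow> bool" where
  "linked s Q \<longleftrightarrow> (\<forall>x<n. \<forall>y<n. s 13 x = s 13 y \<longleftrightarrow> (x, y) \<in> conn Q)"

lemma linkedD: "linked s Q \<Longrightarrow> x < n \<Longrightarrow> y < n \<Longrightarrow> s 13 x = s 13 y \<longleftrightarrow> \<not> crossing Q {x, y}"
  unfolding linked_def crossing_pair by simp

lemma linked_cong: "t 13 = s 13 \<Longrightarrow> linked t Q \<longleftrightarrow> linked s Q"
  by (simp add: linked_def)

lemma linked_run [simp]: "13 \<notin> writes p \<Longrightarrow> linked (run p s) Q \<longleftrightarrow> linked s Q"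
  by (rule linked_cong) (simp add: run_frame)

lemma linked_put [simp]: "x \<noteq> 13 \<Longrightarrow> linked (put x i s) Q \<longleftrightarrow> linked s Q"
  by (rule linked_cong) simp

lemma run_labels_linked:
  "base s \<Longrightarrow> mat s 12 Q \<Longrightarrow> Q \<subseteq> doubletons {..<n} \<Longrightarrow> linked (run labels s) Q"
  unfolding linked_def using run_labels by blast

lemma run_scan:
  assumes s: "base s" "mat s 9 H" "mat s 10 F" "linked s Q" "s 50 0 < n" "s 51 0 < n" and F: "indep F"
  defines "e \<equiv> {s 50 0, s 51 0}" and "t \<equiv> run scan s"
  shows "sink F e \<Longrightarrow> crossing Q e \<Longrightarrow> t 24 0 = 1 \<and> t 25 0 = s 50 0 \<and> t 26 0 = s 51 0"
    "\<not> (sink F e \<and> crossing Q e) \<Longrightarrow> t 24 = s 24 \<and> t 25 = s 25 \<and> t 26 = s 26"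
proof -
  let ?a = "s 50 0" and ?b = "s 51 0"
  define t1 where "t1 = run (conflict 20 10 50 51 38) s"
  define t2 where "t2 = run (conflict 21 10 51 50 38) t1"
  define t3 where "t3 = put 26 ?b (put 25 ?a (put 24 1 t2))"
  have t1: "base t1" "mat t1 10 F" "t1 50 = s 50" "t1 51 = s 51" "t1 24 = s 24" "t1 25 = s 25" "t1 26 = s 26"
    using s by (simp_all add: t1_def run_frame)
  have t2: "t2 50 = s 50" "t2 51 = s 51" "t2 24 = s 24" "t2 25 = s 25" "t2 26 = s 26" "t2 20 = t1 20"
    using t1 by (simp_all add: t2_def run_frame)
  have f20: "t1 20 0 \<noteq> 0 \<longleftrightarrow> (\<exists>x<n. {?a, x} \<in> F \<and> col ?a x = col ?a ?b)"
    unfolding t1_def by (rule run_conflict) (use s in auto)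
  have "t2 21 0 \<noteq> 0 \<longleftrightarrow> (\<exists>x<n. {t1 51 0, x} \<in> F \<and> col (t1 51 0) x = col (t1 51 0) (t1 50 0))"
    unfolding t2_def by (rule run_conflict) (use t1 s in auto)
  then have f21: "t2 21 0 \<noteq> 0 \<longleftrightarrow> (\<exists>x<n. {?b, x} \<in> F \<and> col ?b x = col ?b ?a)" using t1 by simp
  have v: "val (Entry2 9 50 51) s = 0 \<longleftrightarrow> e \<notin> H" "val (Entry 13 50) s = val (Entry 13 51) s \<longleftrightarrow> \<not> crossing Q e"
    using matD[OF s(2,5,6)] linkedD[OF s(4-6)] s by (simp_all add: e_def base_off)
  have r: "run scan s = (if val (Entry2 9 50 51) s \<noteq> 0 then if val (Entry 13 50) s \<noteq> val (Entry 13 51) s then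
      if t1 20 0 \<noteq> 0 then t2 else if t2 21 0 \<noteq> 0 then t2 else t3 else s else s)"
    unfolding scan_def run.simps(4)[of "Entry2 9 50 51"] run_Cond_Neq
    using t2 by (simp add: t1_def[symmetric] t2_def[symmetric] t3_def put_def)
  have sk: "sink F e \<longleftrightarrow> e \<in> H \<and> \<not> t1 20 0 \<noteq> 0 \<and> \<not> t2 21 0 \<noteq> 0"
    unfolding e_def sink_iff[OF F] f20 f21 by blast
  have t3: "t3 24 0 = 1" "t3 25 0 = ?a" "t3 26 0 = ?b" by (simp_all add: t3_def)
  show "t 24 0 = 1 \<and> t 25 0 = s 50 0 \<and> t 26 0 = s 51 0" if "sink F e" "crossing Q e"
  proof -
    have "t = t3" unfolding t_def r using v sk that by simp
    then show ?thesis using t3 by simp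
  qed
  show "t 24 = s 24 \<and> t 25 = s 25 \<and> t 26 = s 26" if "\<not> (sink F e \<and> crossing Q e)"
  proof -
    have "t \<in> {s, t2}" unfolding t_def r using v sk that by auto
    then show ?thesis using t2 by auto
  qed
qed

lemma run_mark:
  assumes s: "base s" "mat s 9 H" "mat s 10 F" "mat s 11 M" "linked s Q" "s 52 0 < n" "s 53 0 < n" "s 54 0 < n" and F: "indep F"
  defines "f \<equiv> {s 52 0, s 53 0}" and "e \<equiv> {s 52 0, s 54 0}"
  shows "mat (run mark s) 11 (if f \<in> F \<and> e \<in> H \<and> c e = c f \<and> crossing Q e then insert f M else M)"
proof -
  have o: "s 3 (s 52 0) = s 52 0 * n" using s by (simp add: base_off)
  have v: "val (Entry2 10 52 53) s = 0 \<longleftrightarrow> f \<notin> F" "val (Entry2 9 52 54) s = 0 \<longleftrightarrow> e \<notin> H"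
      "val (Entry 13 52) s = val (Entry 13 54) s \<longleftrightarrow> \<not> crossing Q e"
      "val (Color 52 54) s = col (s 52 0) (s 54 0)" "val (Color 52 53) s = col (s 52 0) (s 53 0)"
    using matD[OF s(3,6,7)] matD[OF s(2,6,8)] linkedD[OF s(5,6,8)] base_col[OF s(1)] s(6-8)
    by (simp_all add: o f_def e_def)
  have "col (s 52 0) (s 54 0) = col (s 52 0) (s 53 0) \<longleftrightarrow> c e = c f" if "f \<in> F" "e \<in> H"
    using that indep_sub(2)[OF F] HE by (auto simp: col_def f_def e_def)
  moreover have "run mark s = (if f \<in> F then if e \<in> H then if col (s 52 0) (s 54 0) \<noteq> col (s 52 0) (s 53 0) then s
      else if crossing Q e then run (set_edge 11 52 53 1) s else s else s else s)"
    unfolding mark_def run.simps(4)[of "Entry2 10 52 53"] run.simps(4)[of "Entry2 9 52 54"] run_Cond_Neq v by simp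
  ultimately have "run mark s = (if f \<in> F \<and> e \<in> H \<and> c e = c f \<and> crossing Q e then run (set_edge 11 52 53 1) s else s)"
    by auto
  moreover have "mat (run (set_edge 11 52 53 1) s) 11 (insert f M)"
    using run_set_edge_mat[of s 52 53 11 M 1] s by (simp add: f_def)
  ultimately show ?thesis using s(4) by auto
qed

text \<open>Edges of \<open>F\<close> itself add nothing here, so the program need not exclude them.\<close>

definition next_marks :: "nat set set \<Rightarrow> nat set set \<Rightarrow> nat set set" where
  "next_marks F M = M \<union> {f \<in> F. \<exists>e\<in>H. crossing (F - M) e \<and> conf c e f}"

lemma next_marks:
  assumes F: "indep F" shows "next_marks F (marks F j) = marks F (Suc j)"
proof -
  let ?M = "marks F j"
  have "f \<in> ?M" if "f \<in> F" "e \<in> F" "crossing (F - ?M) e" "conf c e f" for e f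
  proof (rule ccontr)
    assume "f \<notin> ?M"
    moreover have "e = f" using F that unfolding indep_def by blast
    moreover have "F - ?M \<subseteq> H" using indep_sub(1)[OF F] by blast
    ultimately show False using not_crossing_edge[of e "F - ?M"] that by blast
  qed
  then show ?thesis unfolding next_marks_def by auto
qed

text \<open>The labels describe \<open>F - M\<close> for the old marks \<open>M\<close> while memory
  11 already receives new ones. So the invariant only confines the current marks between
  \<open>M\<close> and \<open>next_marks F M\<close>, and \<open>nest_visit\<close> supplies each
  single mark.\<close>

lemma run_marks:
  assumes s: "base s" "mat s 9 H" "mat s 10 F" "mat s 11 M" "linked s (F - M)" and F: "indep F"
  shows "mat (run (nest [52, 53, 54] mark) s) 11 (next_marks F M)"
proof -
  let ?Inv = "\<lambda>t. base t \<and> mat t 9 H \<and> mat t 10 F \<and> linked t (F - M) \<and> (\<exists>M'. mat t 11 M' \<and> M \<subseteq> M' \<and> M' \<subseteq> next_marks F M)"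
  have body: "?Inv (run mark t)" if t: "?Inv t" and l: "\<And>x. x \<in> set [52, 53, 54] \<Longrightarrow> t x 0 < n" for t
  proof -
    obtain M' where M': "mat t 11 M'" "M \<subseteq> M'" "M' \<subseteq> next_marks F M" using t by blast
    have l': "t 52 0 < n" "t 53 0 < n" "t 54 0 < n" using l by simp_all
    let ?f = "{t 52 0, t 53 0}" and ?e = "{t 52 0, t 54 0}"
    have "?f \<in> next_marks F M" if "?f \<in> F \<and> ?e \<in> H \<and> c ?e = c ?f \<and> crossing (F - M) ?e"
      using that unfolding next_marks_def conf_def by blast
    then show ?thesis using run_mark[of t F M' "F - M"] t M' l' F by (auto split: if_splits)
  qed
  have fin: "?Inv (run (nest [52, 53, 54] mark) s)"
  proof (rule nest_invariant[where n=n and Inv="?Inv"])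
    show "?Inv s" using s by (auto simp: next_marks_def)
    show "?Inv (run mark t)" if "?Inv t" "\<And>x. x \<in> set [52, 53, 54] \<Longrightarrow> t x 0 < n" for t by (rule body) (use that in auto)
    show "?Inv (put x i t)" if "?Inv t" "x \<in> set [52, 53, 54]" for t x i using that by auto
    show "t 0 0 = n" if "?Inv t" for t using that base_n by blast
  qed auto
  have "run (nest [52, 53, 54] mark) s 11 (a * n + b) \<noteq> 0" if ab: "{a, b} \<in> F" "{a, x} \<in> H" "c {a, x} = c {a, b}" "crossing (F - M) {a, x}"
      "a < n" "b < n" "x < n" for a b x
  proof (rule nest_visit[where n=n and Inv="?Inv" and G="\<lambda>t. t 11 (a * n + b) \<noteq> 0"
        and \<sigma>="\<lambda>y. if y = 52 then a else if y = 53 then b else x"])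
    show "run mark t 11 (a * n + b) \<noteq> 0" if t: "?Inv t" "\<And>x. x \<in> set [52, 53, 54] \<Longrightarrow> t x 0 < n" "t 11 (a * n + b) \<noteq> 0" for t
    proof -
      obtain M' where M': "mat t 11 M'" using t(1) by blast
      have "{a, b} \<in> M'" using M' t(3) ab by (simp add: mat_def)
      moreover have l': "t 52 0 < n" "t 53 0 < n" "t 54 0 < n" using t(2) by simp_all
      ultimately show ?thesis using run_mark[of t F M' "F - M"] t(1) M' F ab(5,6) by (auto simp: mat_def split: if_splits)
    qed
    show "run mark t 11 (a * n + b) \<noteq> 0" if t: "?Inv t" "\<And>y. y \<in> set [52, 53, 54] \<Longrightarrow> t y 0 = (if y = 52 then a else if y = 53 then b else x)" for t
    proof -
      obtain M' where M': "mat t 11 M'" using t(1) by blast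
      have "t 52 0 = a" "t 53 0 = b" "t 54 0 = x" using t(2)[of 52] t(2)[of 53] t(2)[of 54] by simp_all
      then show ?thesis using run_mark[of t F M' "F - M"] t(1) M' F ab by (auto simp: mat_def split: if_splits)
    qed
    show "put y i t 11 (a * n + b) \<noteq> 0" if "y \<in> set [52, 53, 54]" "t 11 (a * n + b) \<noteq> 0" for y i t using that by auto
    show "?Inv (run mark t)" if "?Inv t" "\<And>x. x \<in> set [52, 53, 54] \<Longrightarrow> t x 0 < n" for t using body that by blast
    show "?Inv (put y i t)" if "?Inv t" "y \<in> set [52, 53, 54]" for t y i using that by auto
    show "?Inv s" using s by (auto simp: next_marks_def)
  qed (use ab in \<open>auto simp: base_n\<close>)
  moreover obtain M' where M': "mat (run (nest [52, 53, 54] mark) s) 11 M'" "M \<subseteq> M'" "M' \<subseteq> next_marks F M" using fin by blast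
  ultimately have hit: "{a, b} \<in> M'" if "{a, b} \<in> F" "{a, x} \<in> H" "c {a, x} = c {a, b}" "crossing (F - M) {a, x}"
      "a < n" "b < n" "x < n" for a b x
    using that unfolding mat_def by blast
  have "f \<in> M'" if f: "f \<in> F" "e \<in> H" "crossing (F - M) e" "conf c e f" for e f
  proof -
    obtain a where a: "a \<in> e" "a \<in> f" using f(4) unfolding conf_def by blast
    have fd: "f \<in> doubletons {..<n}" "e \<in> doubletons {..<n}" using f(1,2) indep_sub(3)[OF F] H by auto
    obtain b where b: "f = {a, b}" using doubletonsE[OF fd(1) a(2)] by metis
    obtain x where x: "e = {a, x}" using doubletonsE[OF fd(2) a(1)] by metis
    have "a < n" "b < n" "x < n" using fd b x by auto
    then show ?thesis using hit[of a b x] f b x unfolding conf_def by simp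
  qed
  then have "M' = next_marks F M" using M'(2,3) unfolding next_marks_def by blast
  then show ?thesis using M'(1) by simp
qed

lemma run_scans:
  assumes s: "base s" "mat s 9 H" "mat s 10 F" "linked s Q" "s 24 0 = 0" and F: "indep F"
  defines "t \<equiv> run (nest [50, 51] scan) s"
  shows "t 24 0 \<noteq> 0 \<Longrightarrow> sink F {t 25 0, t 26 0} \<and> crossing Q {t 25 0, t 26 0} \<and> t 25 0 < n \<and> t 26 0 < n"
    "t 24 0 = 0 \<Longrightarrow> sink F e \<Longrightarrow> \<not> crossing Q e"
proof -
  let ?good = "\<lambda>a b. sink F {a, b} \<and> crossing Q {a, b} \<and> a < n \<and> b < n"
  let ?Inv = "\<lambda>t. base t \<and> mat t 9 H \<and> mat t 10 F \<and> linked t Q \<and> (t 24 0 \<noteq> 0 \<longrightarrow> ?good (t 25 0) (t 26 0))"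
  have step: "(if ?good (t 50 0) (t 51 0) then run scan t 24 0 = 1 \<and> run scan t 25 0 = t 50 0 \<and> run scan t 26 0 = t 51 0
      else run scan t 24 = t 24 \<and> run scan t 25 = t 25 \<and> run scan t 26 = t 26)"
    if t: "?Inv t" and l: "t 50 0 < n" "t 51 0 < n" for t
    using run_scan[of t F Q] t l F by (smt (verit))
  have body: "?Inv (run scan t)" if t: "?Inv t" and l: "\<And>x. x \<in> set [50, 51] \<Longrightarrow> t x 0 < n" for t
  proof -
    have "t 50 0 < n" "t 51 0 < n" using l by simp_all
    then show ?thesis using step[OF t] t by (auto split: if_splits)
  qed
  have i0: "?Inv s" using s by simp
  have "?Inv t" unfolding t_def
  proof (rule nest_invariant[where n=n and Inv="?Inv"])
    show "?Inv s" by (rule i0)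
    show "?Inv (run scan t)" if "?Inv t" "\<And>x. x \<in> set [50, 51] \<Longrightarrow> t x 0 < n" for t by (rule body) (use that in auto)
    show "?Inv (put x i t)" if "?Inv t" "x \<in> set [50, 51]" for t x i using that by auto
    show "t 0 0 = n" if "?Inv t" for t using that base_n by blast
  qed auto
  then show "t 24 0 \<noteq> 0 \<Longrightarrow> ?good (t 25 0) (t 26 0)" by blast
  show "\<not> crossing Q e" if e: "t 24 0 = 0" "sink F e"
  proof
    assume cr: "crossing Q e"
    have "e \<in> doubletons {..<n}" using e(2) H unfolding sink_def by blast
    then obtain a b where ab: "e = {a, b}" "a < n" "b < n" unfolding doubletons_def by blast
    have "t 24 0 \<noteq> 0" unfolding t_def
    proof (rule nest_visit[where n=n and Inv="?Inv" and G="\<lambda>t. t 24 0 \<noteq> 0" and \<sigma>="\<lambda>y. if y = 50 then a else b"])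
      show "run scan u 24 0 \<noteq> 0" if "?Inv u" "\<And>x. x \<in> set [50, 51] \<Longrightarrow> u x 0 < n" "u 24 0 \<noteq> 0" for u
      proof -
        have "u 50 0 < n" "u 51 0 < n" using that(2) by simp_all
        then show ?thesis using step[OF that(1)] that(3) by (auto split: if_splits)
      qed
      show "run scan u 24 0 \<noteq> 0" if "?Inv u" "\<And>y. y \<in> set [50, 51] \<Longrightarrow> u y 0 = (if y = 50 then a else b)" for u
      proof -
        have "u 50 0 = a" "u 51 0 = b" using that(2)[of 50] that(2)[of 51] by simp_all
        then show ?thesis using step[OF that(1)] e(2) cr ab by auto
      qed
    qed (use i0 body ab in \<open>auto simp: base_n\<close>)
    then show False using e(1) by simp
  qed
qed

text \<open>The state after a successful search; \<open>j\<close> is the first reachable layer, as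
  \<open>indep_exchange\<close> requires.\<close>

definition found :: "nat set set \<Rightarrow> nat \<Rightarrow> store \<Rightarrow> bool" where
  "found F j s \<longleftrightarrow> s 24 0 \<noteq> 0 \<and> (\<forall>i<j. \<not> reach F i) \<and> mat s 11 (marks F j) \<and>
     sink F {s 25 0, s 26 0} \<and> crossing (F - marks F j) {s 25 0, s 26 0} \<and> s 25 0 < n \<and> s 26 0 < n"

lemma run_layers:
  assumes s: "base s" "mat s 9 H" "mat s 10 F" "mat s 11 {}" "s 24 0 = 0" and F: "indep F"
  defines "t \<equiv> run (For 47 layer) s"
  shows "t 24 0 = 0 \<Longrightarrow> j < n \<Longrightarrow> \<not> reach F j" "t 24 0 \<noteq> 0 \<Longrightarrow> \<exists>j<n. found F j t"
proof -
  let ?I = "\<lambda>i t. t 24 0 = 0 \<and> mat t 11 (marks F i) \<and> (\<forall>j<i. \<not> reach F j) \<or> (\<exists>j<i. found F j t)"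
  obtain t' where t': "?I n t'" "t = put 47 n t'"
    unfolding t_def
  proof (rule run_For[of s n 47 layer ?I])
    show "s 0 0 = n" using s(1) by (rule base_n)
    show "?I 0 s" using s(4,5) by simp
    fix i t assume i: "i < n" and fr: "\<And>m. m \<notin> insert 47 (writes layer) \<Longrightarrow> t m = s m" and I: "?I i t"
    have "t 0 = s 0" "t 3 = s 3" "t 9 = s 9" "t 10 = s 10" using fr by simp_all
    then have b: "base t" "mat t 9 H" "mat t 10 F" using s base_cong[of t s] mat_cong[of t _ s] by auto
    let ?t = "put 47 i t"
    show "?I (Suc i) (run layer ?t)"
    proof (cases "t 24 0 = 0")
      case False
      then have "run layer ?t = ?t" by (simp add: layer_def)
      moreover obtain j where "j < i" "found F j t" using I False by blast
      ultimately show ?thesis unfolding found_def by (intro disjI2 exI[of _ j]) simp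
    next
      case True
      then have M: "mat t 11 (marks F i)" "\<forall>j<i. \<not> reach F j" using I unfolding found_def by auto
      define Q where "Q = F - marks F i"
      define u where "u = run labels (run difference ?t)"
      have u: "base u" "mat u 9 H" "mat u 10 F" "mat u 11 (marks F i)" "u 24 0 = 0"
        using b M(1) True by (simp_all add: u_def run_frame)
      have lk: "linked u Q" unfolding u_def
      proof (rule run_labels_linked)
        show "base (run difference ?t)" using b by simp
        show "mat (run difference ?t) 12 Q" unfolding Q_def by (rule run_difference) (use b M in auto)
        show "Q \<subseteq> doubletons {..<n}" using indep_sub(3)[OF F] by (auto simp: Q_def)
      qed
      define w where "w = run (nest [50, 51] scan) u"
      have nw: "writes (nest [50, 51] scan) = {20, 21, 24, 25, 26, 38, 50, 51}" by auto
      have w: "base w" "mat w 9 H" "mat w 10 F" "mat w 11 (marks F i)" "linked w Q"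
        using u lk by (simp_all add: w_def nw del: nest.simps)
      have r: "run layer ?t = (if w 24 0 = 0 then run (nest [52, 53, 54] mark) w else w)"
        using True by (simp add: layer_def u_def w_def del: nest.simps)
      show ?thesis
      proof (cases "w 24 0 = 0")
        case True
        then have "\<not> reach F i" using run_scans(2)[OF u(1-3) lk u(5) F] unfolding reach_def Q_def w_def by blast
        then have nr: "\<forall>j<Suc i. \<not> reach F j" using M(2) less_Suc_eq by blast
        have "mat (run (nest [52, 53, 54] mark) w) 11 (next_marks F (marks F i))"
          by (rule run_marks) (use w F in \<open>auto simp: Q_def\<close>)
        then have "mat (run layer ?t) 11 (marks F (Suc i))" using True r next_marks[OF F] by simp
        moreover have "run (nest [52, 53, 54] mark) w 24 = w 24" by (rule run_frame) simp
        ultimately show ?thesis using nr True r by simp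
      next
        case False
        then have "found F i w" using run_scans(1)[OF u(1-3) lk u(5) F] M(2) w(4) unfolding found_def Q_def w_def by blast
        then show ?thesis using False r by auto
      qed
    qed
  qed auto
  show "t 24 0 = 0 \<Longrightarrow> j < n \<Longrightarrow> \<not> reach F j" using t' unfolding found_def by auto
  show "t 24 0 \<noteq> 0 \<Longrightarrow> \<exists>j<n. found F j t" using t' unfolding found_def by auto
qed

lemma run_exchange:
  assumes s: "base s" "mat s 10 F" "mat s 11 M" "s 24 0 \<noteq> 0" "s 25 0 < n" "s 26 0 < n" "s 55 0 < n" "s 56 0 < n"
    and F: "F \<subseteq> doubletons {..<n}"
  defines "e \<equiv> {s 25 0, s 26 0}" and "f \<equiv> {s 55 0, s 56 0}" and "t \<equiv> run exchange s"
  shows "f \<in> M \<Longrightarrow> crossing (F - {f}) e \<Longrightarrow> t 24 0 = 0 \<and> mat t 10 (insert e (F - {f}))"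
    "\<not> (f \<in> M \<and> crossing (F - {f}) e) \<Longrightarrow> t 24 = s 24 \<and> mat t 10 F"
proof -
  define s1 where "s1 = run (copy_mat 10 12) s"
  define s2 where "s2 = run (set_edge 12 55 56 0) s1"
  define s3 where "s3 = run labels s2"
  define s4 where "s4 = run (set_edge 10 55 56 0) s3"
  define s5 where "s5 = run (set_edge 10 25 26 1) s4"
  have s1: "base s1" "mat s1 12 F" "mat s1 10 F" "s1 55 = s 55" "s1 56 = s 56" "s1 25 = s 25" "s1 26 = s 26" "s1 24 = s 24"
    using s run_copy_mat[OF s(1), of 12 10 F] by (simp_all add: s1_def run_frame)
  have s2: "base s2" "mat s2 12 (F - {f})" "mat s2 10 F" "s2 55 = s 55" "s2 56 = s 56" "s2 25 = s 25" "s2 26 = s 26" "s2 24 = s 24"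
    using s1 s run_set_edge_mat[of s1 55 56 12 F 0] by (simp_all add: s2_def run_frame f_def)
  have s3: "base s3" "linked s3 (F - {f})" "mat s3 10 F" "s3 55 = s 55" "s3 56 = s 56" "s3 25 = s 25" "s3 26 = s 26" "s3 24 = s 24"
    using s2 F run_labels_linked[OF s2(1,2)] by (auto simp: s3_def run_frame)
  have s4: "base s4" "mat s4 10 (F - {f})" "s4 25 = s 25" "s4 26 = s 26"
    using s3 s run_set_edge_mat[of s3 55 56 10 F 0] by (simp_all add: s4_def run_frame f_def)
  have s5: "mat s5 10 (insert e (F - {f}))"
    using s4 s run_set_edge_mat[of s4 25 26 10 "F - {f}" 1] by (simp add: s5_def e_def)
  have v: "val (Entry2 11 55 56) s = 0 \<longleftrightarrow> f \<notin> M" using matD[OF s(3,7,8)] s by (simp add: f_def base_off)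
  have w: "val (Entry 13 25) s3 = val (Entry 13 26) s3 \<longleftrightarrow> \<not> crossing (F - {f}) e"
    using linkedD[OF s3(2) s(5,6)] s3 by (simp add: e_def)
  have r: "t = (if f \<in> M then if crossing (F - {f}) e then put 24 0 s5 else s3 else s)"
    unfolding t_def exchange_def run.simps(4)[of "Var 24"] run.simps(4)[of "Entry2 11 55 56"] run.simps(3) run_Cond_Neq
      s1_def[symmetric] s2_def[symmetric] s3_def[symmetric] s4_def[symmetric] s5_def[symmetric] v w
    using s(4) by (simp add: put_def)
  show "f \<in> M \<Longrightarrow> crossing (F - {f}) e \<Longrightarrow> t 24 0 = 0 \<and> mat t 10 (insert e (F - {f}))" using r s5 by simp
  show "\<not> (f \<in> M \<and> crossing (F - {f}) e) \<Longrightarrow> t 24 = s 24 \<and> mat t 10 F" using r s3 s by auto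
qed

text \<open>Clearing \<open>24\<close> at the first success makes the remaining passes ineffective,
  so exactly one edge is exchanged; \<open>f0\<close> guarantees the success.\<close>

lemma run_exchanges:
  assumes s: "base s" "mat s 10 F" "mat s 11 M" "s 24 0 \<noteq> 0" "s 25 0 < n" "s 26 0 < n"
    and F: "F \<subseteq> doubletons {..<n}" and f0: "f0 \<in> M" "M \<subseteq> F" "crossing (F - {f0}) {s 25 0, s 26 0}"
  defines "e \<equiv> {s 25 0, s 26 0}"
  shows "\<exists>f\<in>M. crossing (F - {f}) e \<and> mat (run (nest [55, 56] exchange) s) 10 (insert e (F - {f}))"
proof -
  let ?done = "\<lambda>t. t 24 0 = 0 \<and> (\<exists>f\<in>M. crossing (F - {f}) e \<and> mat t 10 (insert e (F - {f})))"
  let ?Inv = "\<lambda>t. base t \<and> mat t 11 M \<and> t 25 = s 25 \<and> t 26 = s 26 \<and> (t 24 0 \<noteq> 0 \<and> mat t 10 F \<or> ?done t)"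
  have fr: "run exchange t 25 = t 25" "run exchange t 26 = t 26" "mat (run exchange t) 11 M \<longleftrightarrow> mat t 11 M" "base (run exchange t) \<longleftrightarrow> base t" for t
    by (simp_all add: run_frame)
  have id: "run exchange t = t" if "t 24 0 = 0" for t using that by (simp add: exchange_def)
  have main: "if {t 55 0, t 56 0} \<in> M \<and> crossing (F - {{t 55 0, t 56 0}}) e then ?done (run exchange t)
      else run exchange t 24 0 \<noteq> 0 \<and> mat (run exchange t) 10 F"
    if t: "?Inv t" "t 24 0 \<noteq> 0" and l: "t 55 0 < n" "t 56 0 < n" for t
  proof -
    have m: "mat t 10 F" "t 25 0 < n" "t 26 0 < n" "{t 25 0, t 26 0} = e" using t s(5,6) by (auto simp: e_def)
    have b: "base t" "mat t 11 M" using t by auto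
    show ?thesis
    proof (cases "{t 55 0, t 56 0} \<in> M \<and> crossing (F - {{t 55 0, t 56 0}}) e")
      case True
      then show ?thesis using run_exchange(1)[OF b(1) m(1) b(2) t(2) m(2,3) l F] m(4) by auto
    next
      case False
      then have "run exchange t 24 = t 24 \<and> mat (run exchange t) 10 F"
        using run_exchange(2)[OF b(1) m(1) b(2) t(2) m(2,3) l F] m(4) by auto
      then show ?thesis using False t(2) by simp
    qed
  qed
  have body: "?Inv (run exchange t)" if t: "?Inv t" and l: "\<And>x. x \<in> set [55, 56] \<Longrightarrow> t x 0 < n" for t
  proof (cases "t 24 0 = 0")
    case True
    then show ?thesis using id t by simp
  next
    case False
    have "t 55 0 < n" "t 56 0 < n" using l by simp_all
    then have "run exchange t 24 0 \<noteq> 0 \<and> mat (run exchange t) 10 F \<or> ?done (run exchange t)"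
      using main[OF t False] by (cases "{t 55 0, t 56 0} \<in> M \<and> crossing (F - {{t 55 0, t 56 0}}) e"; simp only: if_True if_False simp_thms)
    then show ?thesis unfolding fr using t by blast
  qed
  have i0: "?Inv s" using s by simp
  have pt: "?Inv (put x i t)" if "?Inv t" "x \<in> set [55, 56]" for t x i using that by auto
  have "f0 \<in> doubletons {..<n}" using f0(1,2) F by blast
  then obtain a b where ab: "f0 = {a, b}" "a < n" "b < n" unfolding doubletons_def by blast
  have fin: "?Inv (run (nest [55, 56] exchange) s)"
  proof (rule nest_invariant[where n=n and Inv="?Inv"])
    show "?Inv s" by (rule i0)
    show "?Inv (run exchange t)" if "?Inv t" "\<And>x. x \<in> set [55, 56] \<Longrightarrow> t x 0 < n" for t by (rule body) (use that in auto)
    show "?Inv (put x i t)" if "?Inv t" "x \<in> set [55, 56]" for t x i by (rule pt) (use that in auto)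
    show "t 0 0 = n" if "?Inv t" for t using that base_n by blast
  qed auto
  have "run (nest [55, 56] exchange) s 24 0 = 0"
  proof (rule nest_visit[where n=n and Inv="?Inv" and G="\<lambda>t. t 24 0 = 0" and \<sigma>="\<lambda>y. if y = 55 then a else b"])
    show "?Inv s" by (rule i0)
    show "?Inv (run exchange t)" if "?Inv t" "\<And>x. x \<in> set [55, 56] \<Longrightarrow> t x 0 < n" for t by (rule body) (use that in auto)
    show "?Inv (put x i t)" if "?Inv t" "x \<in> set [55, 56]" for t x i by (rule pt) (use that in auto)
    show "t 0 0 = n" if "?Inv t" for t using that base_n by blast
    show "run exchange t 24 0 = 0" if "t 24 0 = 0" for t using id that by simp
    show "run exchange t 24 0 = 0" if t: "?Inv t" "\<And>y. y \<in> set [55, 56] \<Longrightarrow> t y 0 = (if y = 55 then a else b)" for t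
    proof (cases "t 24 0 = 0")
      case True
      then show ?thesis using id by simp
    next
      case False
      have tt: "t 55 0 = a" "t 56 0 = b" using t(2)[of 55] t(2)[of 56] by simp_all
      have "{t 55 0, t 56 0} \<in> M \<and> crossing (F - {{t 55 0, t 56 0}}) e" using f0 ab tt by (simp add: e_def)
      then show ?thesis using main[OF t(1) False] tt ab by simp
    qed
  qed (use ab in auto)
  then show ?thesis using fin by auto
qed

lemma run_augment:
  assumes s: "base s" "mat s 10 F" "found F j s" and F: "indep F"
  shows "\<exists>F'. mat (run augment s) 10 F' \<and> indep F' \<and>
    (card F' = Suc (card F) \<or> card F' = card F \<and> 0 < j \<and> reach F' (j - 1))"
proof -
  let ?e = "{s 25 0, s 26 0}" and ?M = "marks F j"
  have fd: "s 24 0 \<noteq> 0" "\<And>i. i < j \<Longrightarrow> \<not> reach F i" "mat s 11 ?M" "sink F ?e" "crossing (F - ?M) ?e" "s 25 0 < n" "s 26 0 < n"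
    using s(3) unfolding found_def by auto
  define t where "t = run labels (run (copy_mat 10 12) s)"
  have c: "base (run (copy_mat 10 12) s)" "mat (run (copy_mat 10 12) s) 12 F"
    using s run_copy_mat[OF s(1), of 12 10 F] by simp_all
  have t: "base t" "mat t 10 F" "mat t 11 ?M" "t 24 = s 24" "t 25 = s 25" "t 26 = s 26"
    using s fd by (simp_all add: t_def run_frame)
  have lk: "linked t F" unfolding t_def by (rule run_labels_linked[OF c]) (rule indep_sub(3)[OF F])
  have "val (Entry 13 25) t = val (Entry 13 26) t \<longleftrightarrow> \<not> crossing F ?e"
    using linkedD[OF lk fd(6,7)] t by simp
  then have r: "run augment s = (if crossing F ?e then run (set_edge 10 25 26 1) t else run (nest [55, 56] exchange) t)"
    unfolding augment_def run.simps(3) run_Cond_Neq t_def[symmetric] by (simp del: nest.simps)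
  show ?thesis
  proof (cases "crossing F ?e")
    case True
    have "mat (run (set_edge 10 25 26 1) t) 10 (insert ?e F)"
      using run_set_edge_mat[of t 25 26 10 F 1] t fd by simp
    then show ?thesis using r True indep_add[OF F fd(4) True] by auto
  next
    case False
    have eH: "?e \<in> H" using fd(4) by (simp add: sink_def)
    obtain f0 where f0: "f0 \<in> ?M" "crossing (F - {f0}) ?e" using exchange_exists[OF F eH fd(5) False] by blast
    have "\<exists>f\<in>?M. crossing (F - {f}) {t 25 0, t 26 0} \<and>
        mat (run (nest [55, 56] exchange) t) 10 (insert {t 25 0, t 26 0} (F - {f}))"
      by (rule run_exchanges[OF t(1-3)]) (use t fd f0 indep_sub(3)[OF F] marks_subset[of F j] in auto)
    then obtain f where f: "f \<in> ?M" "crossing (F - {f}) ?e" "mat (run (nest [55, 56] exchange) t) 10 (insert ?e (F - {f}))"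
      using t by auto
    show ?thesis using indep_exchange[OF F fd(2) fd(4) fd(5) False f(1,2)] f(3) r False by auto
  qed
qed

text \<open>The potential is at most \<open>n\<^sup>2\<close>, so \<open>n\<^sup>2\<close> rounds suffice.\<close>

lemma run_improve:
  assumes s: "base s" "mat s 9 H" "mat s 10 F" and F: "indep F" and k: "(\<forall>j<n. \<not> reach F j) \<or> k < potential n F"
  shows "\<exists>F'. mat (run improve s) 10 F' \<and> indep F' \<and> ((\<forall>j<n. \<not> reach F' j) \<or> Suc k < potential n F')"
proof -
  define s0 where "s0 = put 24 0 (run (clear_mat 11) s)"
  define t where "t = run (For 47 layer) s0"
  have s0: "base s0" "mat s0 9 H" "mat s0 10 F" "mat s0 11 {}" "s0 24 0 = 0"
    using s run_clear_mat[OF s(1), of 11] by (simp_all add: s0_def)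
  have t: "base t" "mat t 10 F" using s0 by (simp_all add: t_def del: run.simps)
  have r: "run improve s = (if t 24 0 \<noteq> 0 then run augment t else t)"
    by (simp add: improve_def t_def s0_def put_def del: run.simps(5))
  note L = run_layers[OF s0 F, folded t_def]
  show ?thesis
  proof (cases "t 24 0 = 0")
    case True
    then show ?thesis using L(1) t F r by auto
  next
    case False
    obtain j where j: "j < n" "found F j t" using L(2)[OF False] by blast
    have rj: "reach F j" "\<And>i. i < j \<Longrightarrow> \<not> reach F i" using j(2) unfolding found_def reach_def by blast+
    \<comment> \<open>A walk is still available, so the first disjunct of \<open>k\<close> is
      false.\<close>
    have k': "k < potential n F" using k rj(1) j(1) by blast
    obtain F' where F': "mat (run augment t) 10 F'" "indep F'"
        "card F' = Suc (card F) \<or> card F' = card F \<and> 0 < j \<and> reach F' (j - 1)"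
      using run_augment[OF t j(2) F] by blast
    have "(\<forall>i<n. \<not> reach F' i) \<or> potential n F < potential n F'"
      using F'(3)
    proof
      assume c: "card F' = Suc (card F)"
      show ?thesis
      proof (cases "\<forall>i<n. \<not> reach F' i")
        case ne: False
        then obtain i where "i < n" "reach F' i" by blast
        then have "(LEAST i. reach F' i) < n" by (metis Least_le order_le_less_trans)
        then show ?thesis using potential_add[OF c] by blast
      qed blast
    next
      assume "card F' = card F \<and> 0 < j \<and> reach F' (j - 1)"
      then show ?thesis using potential_exchange[of F' F j n] rj j(1) by blast
    qed
    then show ?thesis using F' r False k' by auto
  qed
qed

theorem run_rainbow:
  assumes s: "base s" "mat s 9 H" and n: "0 < n"
  shows "\<exists>F M. mat (run rainbow s) 10 F \<and> F \<subseteq> H \<and> acyc F \<and> (\<forall>e\<in>F. \<forall>f\<in>F. conf c e f \<longrightarrow> e = f) \<and>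
    M \<subseteq> F \<and> (\<forall>e\<in>H. crossing (F - M) e \<longrightarrow> (\<exists>f\<in>M. conf c e f))"
proof -
  let ?J = "\<lambda>k t. base t \<and> mat t 9 H \<and> (\<exists>F. mat t 10 F \<and> indep F \<and> ((\<forall>j<n. \<not> reach F j) \<or> k < potential n F))"
  let ?s = "run (clear_mat 10) s"
  have fin: "?J (0 + n ^ length [57, 58::nat]) (run (nest [57, 58] improve) ?s)"
  proof (rule nest_count[where J="?J"])
    have "(\<forall>j<n. \<not> reach {} j) \<or> 0 < potential n {}"
    proof (cases "\<forall>j<n. \<not> reach {} j")
      case False
      then obtain j where "j < n" "reach {} j" by blast
      then have "(LEAST j. reach {} j) < n" by (metis Least_le order_le_less_trans)
      then show ?thesis by (simp add: potential_def)
    qed simp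
    moreover have "mat ?s 10 {}" by (rule run_clear_mat) (use s in auto)
    ultimately show "?J 0 ?s" using s indep_empty by auto
    show "?J (Suc k) (run improve t)" if J: "?J k t" for k t
    proof -
      obtain F where F: "mat t 10 F" "indep F" "(\<forall>j<n. \<not> reach F j) \<or> k < potential n F" using J by blast
      then show ?thesis using run_improve[of t F k] J by simp
    qed
    show "?J k (put x i t)" if "?J k t" "x \<in> set [57, 58]" for k t x i using that by auto
    show "t 0 0 = n" if "?J k t" for k t using that base_n by blast
  qed auto
  have r: "run (nest [57, 58] improve) ?s = run rainbow s" by (simp add: rainbow_def del: nest.simps)
  have e: "0 + n ^ length [57, 58::nat] = n\<^sup>2" by (simp add: power2_eq_square)
  obtain F where F: "mat (run rainbow s) 10 F" "indep F" "(\<forall>j<n. \<not> reach F j) \<or> n\<^sup>2 < potential n F"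
    using fin unfolding r e by blast
  have cF: "card F < n" using indep_card[OF F(2)] n by (simp add: lessThan_empty_iff)
  \<comment> \<open>\<open>card F < n\<close> bounds the potential by \<open>n\<^sup>2\<close>, so
    after \<open>n\<^sup>2\<close> rounds no augmenting walk can be left.\<close>
  have "potential n F \<le> card F * n + n" by (simp add: potential_def)
  also have "\<dots> \<le> n\<^sup>2" using mult_le_mono1[of "Suc (card F)" n n] cF by (simp add: power2_eq_square)
  finally have "\<forall>j<n. \<not> reach F j" using F(3) by simp
  then have "stuck F" using stuck_if_not_reach[OF F(2) cF] by blast
  then show ?thesis using F(1,2) unfolding stuck_def indep_def by blast
qed

end

section \<open>The algorithm\<close>

definition grow_step :: loop where
  "grow_step = When (Entry2 10 61 62) (try_extend 61 62)"

definition start :: "nat \<Rightarrow> loop" where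
  "start x = clear_vec 4 ;; clear_mat 5 ;; Set 4 (Var x) (Const 1)"

text \<open>Each round adds a vertex of the component of the root in \<open>32\<close> until all are
  present, so \<open>n\<close> rounds collect the whole component.\<close>

definition grow :: loop where
  "grow = start 32 ;; For 60 (nest [61, 62] grow_step)"

text \<open>For \<open>t = r = b\<close> nothing is deleted, and a spanning forest is itself the larger tree.\<close>

definition span_attempt :: loop where
  "span_attempt = build_U ;; build_H ;; reduce ;; build_H' ;; rainbow ;; grow ;; try_extend 32 33 ;; commit"

text \<open>The one-edge extension of the best tree comes first; its failure is the source of the
  hypothesis \<open>ext\<close> of \<open>no_larger_tree\<close>.\<close>

definition attempt :: loop where
  "attempt = copy_vec 1 4 ;; copy_mat 2 5 ;; try_extend 32 33 ;; commit ;; span_attempt"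

text \<open>A root and six pairs, hence 13 loop variables. They reach every tree with at most 7
  vertices, because a pair that does not extend the tree has no effect.\<close>

definition small :: loop where
  "small = start 70 ;; try_extend 71 72 ;; try_extend 73 74 ;; try_extend 75 76 ;; try_extend 77 78 ;;
     try_extend 79 80 ;; try_extend 81 82 ;; commit"

definition offsets :: loop where
  "offsets = For 36 (Set 3 (Var 36) (Var 35) ;; SetVar 35 (Plus (Var 35) (Cell 0 (Const 0))))"

definition program :: loop where
  "program = offsets ;; Set 1 (Const 0) (Const 1) ;; nest [70, 71, 72, 73, 74, 75, 76, 77, 78, 79, 80, 81, 82] small ;;
     For 34 (nest [30, 31, 32, 33] attempt)"

lemma writes_span [simp]:
  "writes grow_step = {4, 5, 20, 38}" "writes (start x) = {4, 5, 39, 40}"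
  "writes grow = {4, 5, 20, 38, 39, 40, 60, 61, 62}"
  "writes span_attempt = {1, 2, 4, 5, 6, 7, 9, 10, 11, 12, 13, 20, 21, 22, 23, 24, 25, 26, 27, 28, 38, 39, 40, 41, 42, 43, 44, 45, 46,
     47, 50, 51, 52, 53, 54, 55, 56, 57, 58, 60, 61, 62}"
  "writes attempt = {1, 2, 4, 5, 6, 7, 9, 10, 11, 12, 13, 20, 21, 22, 23, 24, 25, 26, 27, 28, 38, 39, 40, 41, 42, 43, 44, 45, 46,
     47, 50, 51, 52, 53, 54, 55, 56, 57, 58, 60, 61, 62}"
  "writes small = {1, 2, 4, 5, 20, 27, 28, 38, 39, 40}"
  "writes offsets = {3, 35, 36}"
proof -
  show g: "writes grow_step = {4, 5, 20, 38}" by (auto simp: grow_step_def)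
  show s: "writes (start x) = {4, 5, 39, 40}" for x by (auto simp: start_def)
  show gr: "writes grow = {4, 5, 20, 38, 39, 40, 60, 61, 62}" by (auto simp: grow_def writes_nest g s simp del: nest.simps)
  show a: "writes span_attempt = {1, 2, 4, 5, 6, 7, 9, 10, 11, 12, 13, 20, 21, 22, 23, 24, 25, 26, 27, 28, 38, 39, 40, 41, 42, 43, 44, 45, 46,
     47, 50, 51, 52, 53, 54, 55, 56, 57, 58, 60, 61, 62}"
    unfolding span_attempt_def writes.simps writes_procedures writes_rainbow gr by auto
  show "writes attempt = {1, 2, 4, 5, 6, 7, 9, 10, 11, 12, 13, 20, 21, 22, 23, 24, 25, 26, 27, 28, 38, 39, 40, 41, 42, 43, 44, 45, 46,
     47, 50, 51, 52, 53, 54, 55, 56, 57, 58, 60, 61, 62}"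
    unfolding attempt_def writes.simps writes_procedures a by auto
  show "writes small = {1, 2, 4, 5, 20, 27, 28, 38, 39, 40}" unfolding small_def writes.simps writes_procedures s by auto
  show "writes offsets = {3, 35, 36}" by (auto simp: offsets_def)
qed

lemma well_formed_program: "well_formed program"
proof -
  have basic: "well_formed (clear_vec m)" "well_formed (copy_vec m' m)" if "m \<noteq> 0" "m \<noteq> 39" for m m'
    using that by (auto simp: clear_vec_def copy_vec_def)
  have basic': "well_formed (clear_mat m)" "well_formed (copy_mat m' m)" if "m \<notin> {0, 39, 40}" for m m'
    using that by (auto simp: clear_mat_def copy_mat_def)
  have conflict: "well_formed (conflict f m a b 38)" "well_formed (conflict_other f m a b 38)" if "f \<notin> {0, 38}" for f m a b
    using that by (auto simp: conflict_def conflict_other_def)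
  have ext: "well_formed (try_extend a b)" for a b by (simp add: try_extend_def conflict)
  have com: "well_formed commit" by (simp add: commit_def count_vec_def basic basic')
  have lab: "well_formed labels" by (simp add: labels_def merge_labels_def)
  have red: "well_formed reduce" by (simp add: reduce_def reduce_pair_def conflict)
  have bld: "well_formed build_U" "well_formed build_H" "well_formed build_H'"
    by (simp_all add: build_U_def build_H_def build_H'_def mark_colored_def basic)
  have rb: "well_formed rainbow"
    by (simp add: rainbow_def improve_def augment_def exchange_def layer_def mark_def scan_def difference_def set_edge_def
        basic' conflict lab)
  have st: "well_formed (start x)" for x by (simp add: start_def basic basic')
  have gr: "well_formed grow" by (simp add: grow_def grow_step_def st ext)
  have "well_formed attempt" by (simp add: attempt_def span_attempt_def basic basic' ext com bld red rb gr)
  then show ?thesis by (simp add: program_def offsets_def small_def st ext com)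
qed

context input_graph
begin

definition best :: "store \<Rightarrow> nat set \<Rightarrow> nat set set \<Rightarrow> bool" where
  "best s X T \<longleftrightarrow> vec s 1 X \<and> mat s 2 T \<and> grown {..<n} E c X T"

definition cand :: "store \<Rightarrow> nat set \<Rightarrow> nat set set \<Rightarrow> bool" where
  "cand s Y F \<longleftrightarrow> vec s 4 Y \<and> mat s 5 F \<and> grown {..<n} E c Y F"

lemma grown_less: "grown {..<n} E c Y F \<Longrightarrow> Y \<subseteq> {..<n}" "grown {..<n} E c Y F \<Longrightarrow> F \<subseteq> E"
  using grown_props[OF _ E] by auto

lemma best_run [simp]: "1 \<notin> writes p \<Longrightarrow> 2 \<notin> writes p \<Longrightarrow> best (run p s) X T \<longleftrightarrow> best s X T"
  by (simp add: best_def)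
lemma cand_run [simp]: "4 \<notin> writes p \<Longrightarrow> 5 \<notin> writes p \<Longrightarrow> cand (run p s) X T \<longleftrightarrow> cand s X T"
  by (simp add: cand_def)
lemma best_put [simp]: "x \<noteq> 1 \<Longrightarrow> x \<noteq> 2 \<Longrightarrow> best (put x i s) X T \<longleftrightarrow> best s X T"
  by (simp add: best_def)
lemma cand_put [simp]: "x \<noteq> 4 \<Longrightarrow> x \<noteq> 5 \<Longrightarrow> cand (put x i s) X T \<longleftrightarrow> cand s X T"
  by (simp add: cand_def)

lemma grown_extend_tree:
  assumes "grown {..<n} E c Y F"
  shows "grown {..<n} E c (fst (extend_tree E c a b (Y, F))) (snd (extend_tree E c a b (Y, F)))"
  using assms grown.extend[OF assms, of a b] by (auto simp: extend_tree_def)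

lemma cand_try_extend:
  assumes s: "base s" "s a 0 < n" "s b 0 < n" "cand s Y F" and x: "{a, b} \<inter> {0, 3, 4, 5, 20, 38} = {}"
  shows "cand (run (try_extend a b) s) (fst (extend_tree E c (s a 0) (s b 0) (Y, F))) (snd (extend_tree E c (s a 0) (s b 0) (Y, F)))"
proof -
  have g: "vec s 4 Y" "mat s 5 F" "grown {..<n} E c Y F" using s(4) by (simp_all add: cand_def)
  show ?thesis unfolding cand_def
    using run_try_extend[OF s(1-3) g(1,2) grown_less(2)[OF g(3)] x] grown_extend_tree[OF g(3)] by blast
qed

lemma cand_start:
  assumes s: "base s" "s x 0 < n" and x: "x \<notin> {4, 5, 39, 40}"
  shows "cand (run (start x) s) {s x 0} {}"
proof -
  define t where "t = run (clear_mat 5) (run (clear_vec 4) s)"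
  have t: "base t" "t x = s x" using s(1) x by (simp_all add: t_def run_frame)
  have "vec (run (clear_vec 4) s) 4 {}" using run_clear_vec[OF s(1)] by simp
  then have v: "vec t 4 {}" by (simp add: t_def)
  have m: "mat t 5 {}" unfolding t_def by (rule run_clear_mat) (use s in auto)
  have "vec (t(4 := (t 4)(s x 0 := 1))) 4 {s x 0}" using vec_update[OF v s(2), of 1] by simp
  moreover have "mat (t(4 := (t 4)(s x 0 := 1))) 5 {}" using m mat_cong[of "t(4 := (t 4)(s x 0 := 1))" 5 t] by simp
  moreover have "run (start x) s = t(4 := (t 4)(s x 0 := 1))" using t(2) by (simp add: start_def t_def)
  ultimately show ?thesis unfolding cand_def using grown.single[of "s x 0" "{..<n}" E c] s(2) by simp
qed

lemma best_commit:
  assumes "base s" "best s X T" "cand s Y F"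
  shows "best (run commit s) (if card X < card Y then Y else X) (if card X < card Y then F else T)"
proof -
  have g: "vec s 1 X" "mat s 2 T" "grown {..<n} E c X T" "vec s 4 Y" "mat s 5 F" "grown {..<n} E c Y F"
    using assms(2,3) by (simp_all add: best_def cand_def)
  note r = run_commit[OF assms(1) g(1,2,4,5) grown_less(1)[OF g(3)] grown_less(1)[OF g(6)]]
  show ?thesis unfolding best_def using r g(3,6) by auto
qed

definition closed_in :: "nat set set \<Rightarrow> nat set \<Rightarrow> bool" where
  "closed_in F Y \<longleftrightarrow> (\<forall>a b. {a, b} \<in> F \<longrightarrow> a \<in> Y \<longrightarrow> b \<in> Y)"

lemma run_grow_step:
  assumes s: "base s" "mat s 10 F" "cand s Y G" "s 61 0 < n" "s 62 0 < n"
    and F: "F \<subseteq> E" "\<And>e f. e \<in> F \<Longrightarrow> f \<in> F \<Longrightarrow> conf c e f \<Longrightarrow> e = f" and G: "G \<subseteq> F"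
  shows "if {s 61 0, s 62 0} \<in> F \<and> s 61 0 \<in> Y \<and> s 62 0 \<notin> Y
    then cand (run grow_step s) (insert (s 62 0) Y) (insert {s 61 0, s 62 0} G) else cand (run grow_step s) Y G"
proof -
  let ?a = "s 61 0" and ?b = "s 62 0"
  have v: "val (Entry2 10 61 62) s = 0 \<longleftrightarrow> {?a, ?b} \<notin> F" using matD[OF s(2,4,5)] s by (simp add: base_off)
  have r: "run grow_step s = (if {?a, ?b} \<in> F then run (try_extend 61 62) s else s)"
    unfolding grow_step_def run.simps(4) v by simp
  have c: "cand (run (try_extend 61 62) s) (fst (extend_tree E c ?a ?b (Y, G))) (snd (extend_tree E c ?a ?b (Y, G)))"
    by (rule cand_try_extend) (use s in auto)
  have gY: "grown {..<n} E c Y G" using s(3) by (simp add: cand_def)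
  have nc: "c {?a, x} \<noteq> c {?a, ?b}" if "{?a, ?b} \<in> F" "?b \<notin> Y" "{?a, x} \<in> G" for x
  proof
    assume "c {?a, x} = c {?a, ?b}"
    then have "conf c {?a, x} {?a, ?b}" by (simp add: conf_def)
    then have "{?a, x} = {?a, ?b}" using F(2) that G by blast
    then have "{?a, ?b} \<in> G" using that(3) by simp
    then have "{?a, ?b} \<in> doubletons Y" by (rule subsetD[OF grown_props(3)[OF gY E]])
    then show False using that(2) by simp
  qed
  show ?thesis
  proof (cases "{?a, ?b} \<in> F \<and> ?a \<in> Y \<and> ?b \<notin> Y")
    case True
    then have "extend_tree E c ?a ?b (Y, G) = (insert ?b Y, insert {?a, ?b} G)"
      using F(1) nc by (auto simp: extend_tree_def)
    then show ?thesis using c r True by simp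
  next
    case False
    then have "extend_tree E c ?a ?b (Y, G) = (Y, G)" if "{?a, ?b} \<in> F"
      using that False unfolding extend_tree_def case_prod_conv by (intro if_not_P) blast
    then show ?thesis using c r False s(3) by auto
  qed
qed

text \<open>The number of vertices added depends on the order of the passes. It is at least one
  whenever an edge of \<open>F\<close> leaves the current set, since the pass for that edge comes
  up.\<close>

lemma run_grow_round:
  assumes s: "base s" "mat s 10 F" "cand s Y0 G0"
    and F: "F \<subseteq> E" "\<And>e f. e \<in> F \<Longrightarrow> f \<in> F \<Longrightarrow> conf c e f \<Longrightarrow> e = f" and G0: "G0 \<subseteq> F" and r: "r \<in> Y0" "Y0 \<subseteq> conn F `` {r}"
  shows "\<exists>Y G. cand (run (nest [61, 62] grow_step) s) Y G \<and> G \<subseteq> F \<and> Y0 \<subseteq> Y \<and> Y \<subseteq> conn F `` {r} \<and>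
    (if closed_in F Y0 then Y = Y0 else card Y0 < card Y)"
proof -
  let ?C = "\<lambda>t Y G. cand t Y G \<and> G \<subseteq> F \<and> Y0 \<subseteq> Y \<and> Y \<subseteq> conn F `` {r} \<and> (closed_in F Y0 \<longrightarrow> Y = Y0)"
  let ?Inv = "\<lambda>t. base t \<and> mat t 10 F \<and> (\<exists>Y G. ?C t Y G)"
  have step: "\<exists>Y G. ?C (run grow_step t) Y G \<and> (b \<in> Y' \<longrightarrow> b \<in> Y) \<and> ({t 61 0, t 62 0} \<in> F \<and> t 61 0 \<in> Y0 \<longrightarrow> t 62 0 \<in> Y)"
    if t: "base t" "mat t 10 F" "?C t Y' G'" and l: "t 61 0 < n" "t 62 0 < n" for t Y' G' b
  proof -
    let ?a = "t 61 0" and ?b = "t 62 0"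
    have c: "cand t Y' G'" "G' \<subseteq> F" "Y0 \<subseteq> Y'" "Y' \<subseteq> conn F `` {r}" "closed_in F Y0 \<longrightarrow> Y' = Y0" using t(3) by auto
    note st = run_grow_step[OF t(1,2) c(1) l F c(2)]
    show ?thesis
    proof (cases "{?a, ?b} \<in> F \<and> ?a \<in> Y' \<and> ?b \<notin> Y'")
      case True
      then have cd: "cand (run grow_step t) (insert ?b Y') (insert {?a, ?b} G')" using st by simp
      have "\<not> closed_in F Y0" using True c(5) unfolding closed_in_def by metis
      moreover have "(r, ?a) \<in> conn F" using True c(4) by auto
      then have "(r, ?b) \<in> conn F" using conn_trans[OF _ conn_edge[of ?a ?b F]] True by blast
      ultimately have "?C (run grow_step t) (insert ?b Y') (insert {?a, ?b} G')" using cd c True by auto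
      then show ?thesis by blast
    next
      case False
      then have "cand (run grow_step t) Y' G'" using st by (simp only: if_False)
      then have "?C (run grow_step t) Y' G'" using c by blast
      moreover have "{?a, ?b} \<in> F \<and> ?a \<in> Y0 \<longrightarrow> ?b \<in> Y'" using False c(3) by blast
      ultimately show ?thesis by blast
    qed
  qed
  have body: "?Inv (run grow_step t)" if t: "?Inv t" and l: "\<And>x. x \<in> set [61, 62] \<Longrightarrow> t x 0 < n" for t
  proof -
    obtain Y G where YG: "?C t Y G" using t by blast
    have l': "t 61 0 < n" "t 62 0 < n" using l by simp_all
    have b: "base t" "mat t 10 F" using t by auto
    obtain Y2 G2 where "?C (run grow_step t) Y2 G2" using step[OF b YG l', of 0] by blast
    moreover have "base (run grow_step t)" "mat (run grow_step t) 10 F" using b by simp_all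
    ultimately show ?thesis by blast
  qed
  have i0: "?Inv s" using s G0 r by auto
  have pt: "?Inv (put x i t)" if "?Inv t" "x \<in> set [61, 62]" for t x i
  proof -
    have x: "x \<noteq> 0" "x \<noteq> 3" "x \<noteq> 10" "x \<noteq> 4" "x \<noteq> 5" using that(2) by auto
    have "cand (put x i t) = cand t" using x by (intro ext) simp
    then show ?thesis using that(1) x by (simp only: base_put mat_put not_False_eq_True)
  qed
  have fin: "?Inv (run (nest [61, 62] grow_step) s)"
  proof (rule nest_invariant[where n=n and Inv="?Inv"])
    show "?Inv s" by (rule i0)
    show "?Inv (run grow_step t)" if "?Inv t" "\<And>x. x \<in> set [61, 62] \<Longrightarrow> t x 0 < n" for t by (rule body) (use that in auto)
    show "?Inv (put x i t)" if "?Inv t" "x \<in> set [61, 62]" for t x i by (rule pt) (use that in auto)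
    show "t 0 0 = n" if "?Inv t" for t using that base_n by blast
  qed auto
  obtain Y G where YG: "?C (run (nest [61, 62] grow_step) s) Y G" using fin by blast
  have fY: "finite Y" using YG grown_props(4)[OF _ E] unfolding cand_def by blast
  have "card Y0 < card Y" if nc: "\<not> closed_in F Y0"
  proof -
    obtain a b where ab: "{a, b} \<in> F" "a \<in> Y0" "b \<notin> Y0" using nc unfolding closed_in_def by blast
    have l: "a < n" "b < n" using E_less[of a b] ab F(1) by auto
    have "run (nest [61, 62] grow_step) s 4 b \<noteq> 0"
    proof (rule nest_visit[where n=n and Inv="?Inv" and G="\<lambda>t. t 4 b \<noteq> 0" and \<sigma>="\<lambda>y. if y = 61 then a else b"])
      show "?Inv s" by (rule i0)
      show "?Inv (run grow_step t)" if "?Inv t" "\<And>x. x \<in> set [61, 62] \<Longrightarrow> t x 0 < n" for t by (rule body) (use that in auto)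
      show "?Inv (put x i t)" if "?Inv t" "x \<in> set [61, 62]" for t x i by (rule pt) (use that in auto)
      show "t 0 0 = n" if "?Inv t" for t using that base_n by blast
      show "run grow_step t 4 b \<noteq> 0" if t: "?Inv t" "\<And>x. x \<in> set [61, 62] \<Longrightarrow> t x 0 < n" "t 4 b \<noteq> 0" for t
      proof -
        obtain Y' G' where Y': "?C t Y' G'" using t(1) by blast
        have l': "t 61 0 < n" "t 62 0 < n" using t(2) by simp_all
        have "b \<in> Y'" using Y' t(3) l(2) unfolding cand_def vec_def by blast
        moreover have "base t" "mat t 10 F" using t(1) by auto
        ultimately obtain Y2 G2 where "cand (run grow_step t) Y2 G2" "b \<in> Y2" using step[OF _ _ Y' l', of b] by blast
        then show ?thesis using l(2) unfolding cand_def vec_def by blast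
      qed
      show "run grow_step t 4 b \<noteq> 0" if t: "?Inv t" "\<And>y. y \<in> set [61, 62] \<Longrightarrow> t y 0 = (if y = 61 then a else b)" for t
      proof -
        obtain Y' G' where Y': "?C t Y' G'" using t(1) by blast
        have tt: "t 61 0 = a" "t 62 0 = b" using t(2)[of 61] t(2)[of 62] by simp_all
        have l': "t 61 0 < n" "t 62 0 < n" using l tt by simp_all
        have "base t" "mat t 10 F" using t(1) by auto
        then obtain Y2 G2 where "cand (run grow_step t) Y2 G2" "b \<in> Y2" using step[OF _ _ Y' l', of b] tt ab by blast
        then show ?thesis using l(2) unfolding cand_def vec_def by blast
      qed
    qed (use l in auto)
    then have "b \<in> Y" using YG l(2) unfolding cand_def vec_def by blast
    then have "Y0 \<subset> Y" using YG ab(3) by blast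
    then show ?thesis using fY by (rule psubset_card_mono[rotated])
  qed
  then show ?thesis using YG by (intro exI[of _ Y] exI[of _ G]) simp
qed

lemma run_grow:
  assumes s: "base s" "mat s 10 F" "s 32 0 < n"
    and F: "F \<subseteq> E" "\<And>e f. e \<in> F \<Longrightarrow> f \<in> F \<Longrightarrow> conf c e f \<Longrightarrow> e = f"
  shows "\<exists>G. cand (run grow s) (conn F `` {s 32 0}) G \<and> G \<subseteq> F"
proof -
  let ?r = "s 32 0"
  let ?s = "run (start 32) s"
  have s': "base ?s" "mat ?s 10 F" "cand ?s {?r} {}" using s cand_start[OF s(1), of 32] by simp_all
  let ?I = "\<lambda>i t. \<exists>Y G. cand t Y G \<and> G \<subseteq> F \<and> ?r \<in> Y \<and> Y \<subseteq> conn F `` {?r} \<and> (closed_in F Y \<or> i < card Y)"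
  let ?p = "nest [61, 62] grow_step"
  have w: "writes ?p = {4, 5, 20, 38, 61, 62}" by auto
  obtain t where t: "?I n t" "run (For 60 ?p) ?s = put 60 n t"
  proof (rule run_For[of ?s n 60 ?p ?I])
    show "?s 0 0 = n" using s'(1) by (rule base_n)
    show "0 \<notin> writes ?p" by (simp add: w del: nest.simps)
    show "?I 0 ?s" using s'(3) by (intro exI[of _ "{?r}"] exI[of _ "{}"]) simp
    fix i t assume i: "i < n" and fr: "\<And>m. m \<notin> insert 60 (writes ?p) \<Longrightarrow> t m = ?s m" and I: "?I i t"
    have e: "t 0 = ?s 0" "t 3 = ?s 3" "t 10 = ?s 10" using fr by (simp_all add: w del: nest.simps)
    have b: "base (put 60 i t)" "mat (put 60 i t) 10 F" using s' e base_cong[of t ?s] mat_cong[of t 10 ?s] by simp_all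
    obtain Y G where YG: "cand t Y G" "G \<subseteq> F" "?r \<in> Y" "Y \<subseteq> conn F `` {?r}" "closed_in F Y \<or> i < card Y" using I by blast
    have "cand (put 60 i t) Y G" using YG(1) by simp
    from run_grow_round[OF b this F YG(2-4)]
    obtain Y' G' where Y': "cand (run ?p (put 60 i t)) Y' G'" "G' \<subseteq> F" "Y \<subseteq> Y'" "Y' \<subseteq> conn F `` {?r}"
      "if closed_in F Y then Y' = Y else card Y < card Y'" by blast
    have "closed_in F Y' \<or> Suc i < card Y'" using Y'(5) YG(5) by (cases "closed_in F Y") auto
    then show "?I (Suc i) (run ?p (put 60 i t))" using Y' YG(3) by blast
  qed auto
  obtain Y G where YG: "cand t Y G" "G \<subseteq> F" "?r \<in> Y" "Y \<subseteq> conn F `` {?r}" "closed_in F Y \<or> n < card Y" using t(1) by blast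
  have "Y \<subseteq> {..<n}" using YG(1) grown_less unfolding cand_def by blast
  then have "card Y \<le> n" using card_mono[of "{..<n}" Y] by simp
  then have cl: "closed_in F Y" using YG(5) by simp
  have "y \<in> Y" if "(?r, y) \<in> conn F" for y
    using that by (induction rule: conn_induct) (use YG(3) cl in \<open>auto simp: closed_in_def\<close>)
  then have "Y = conn F `` {?r}" using YG(4) by blast
  moreover have "run grow s = put 60 n t" unfolding grow_def run.simps(3) by (rule t(2))
  ultimately show ?thesis using YG(1,2) by auto
qed

end

section \<open>A round of attempts\<close>

text \<open>The reduction as a single fold over a list of pairs, so that its properties follow by
  induction on the list.\<close>

definition drop_pairs :: "(nat set \<Rightarrow> nat) \<Rightarrow> (nat \<times> nat) list \<Rightarrow> nat set set \<Rightarrow> nat set set" where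
  "drop_pairs c ps = fold (\<lambda>(a, b). drop_pair c a b) ps"

lemma drop_pairs_simps [simp]:
  "drop_pairs c [] H = H" "drop_pairs c ((a, b) # ps) H = drop_pairs c ps (drop_pair c a b H)"
  by (simp_all add: drop_pairs_def)

lemma drop_pairs_append: "drop_pairs c (ps @ qs) H = drop_pairs c qs (drop_pairs c ps H)"
  by (simp add: drop_pairs_def)

lemma fold_product: "fold (\<lambda>(a, b). f a b) (List.product xs ys) = fold (\<lambda>a. fold (f a) ys) xs"
  by (induction xs) (simp_all add: fold_map comp_def)

lemma drop_pairs_subset: "drop_pairs c ps H \<subseteq> H"
  by (induction ps arbitrary: H) (use drop_pair_subset in fastforce)+

lemma unique_at_mono: "unique_at c H a b \<Longrightarrow> G \<subseteq> H \<Longrightarrow> unique_at c G a b"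
  unfolding unique_at_def by blast

text \<open>Deleting further edges never destroys uniqueness, so a pair that survives its own test
  remains unique at one end.\<close>

lemma drop_pairs_unique:
  "(a, b) \<in> set ps \<Longrightarrow> {a, b} \<in> drop_pairs c ps H \<Longrightarrow>
    unique_at c (drop_pairs c ps H) a b \<or> unique_at c (drop_pairs c ps H) b a"
proof (induction ps arbitrary: H)
  case (Cons p ps)
  obtain x y where p: "p = (x, y)" by fastforce
  show ?case
  proof (cases "(a, b) \<in> set ps")
    case True
    then show ?thesis using Cons p by simp
  next
    case False
    then have "p = (a, b)" using Cons.prems(1) by auto
    then have e: "{a, b} \<in> drop_pairs c ps (drop_pair c a b H)" using Cons.prems(2) by simp
    have "{a, b} \<in> drop_pair c a b H" by (rule subsetD[OF drop_pairs_subset e])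
    then have "unique_at c H a b \<or> unique_at c H b a" unfolding drop_pair_def by (auto split: if_splits)
    then show ?thesis
      by (elim disjE) (simp_all only: unique_at_mono[OF _ drop_pairs_subset] simp_thms)
  qed
qed simp

lemma drop_pair_color:
  assumes "{w, x} \<in> H" shows "\<exists>y. {w, y} \<in> drop_pair c a b H \<and> c {w, y} = c {w, x}"
proof (cases "{a, b} \<in> H \<and> \<not> unique_at c H a b \<and> \<not> unique_at c H b a \<and> {w, x} = {a, b}")
  case False
  then have "{w, x} \<in> drop_pair c a b H" using assms unfolding drop_pair_def by auto
  then show ?thesis by blast
next
  case True
  then have d: "drop_pair c a b H = H - {{a, b}}" by (simp add: drop_pair_def)
  have nu: "\<not> unique_at c H w x" using True by (auto simp: doubleton_eq_iff)
  then obtain y where y: "{w, y} \<in> H" "c {w, y} = c {w, x}" "y \<noteq> x" unfolding unique_at_def by blast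
  have "{w, y} \<noteq> {w, x}" using y(3) by (auto simp: doubleton_eq_iff)
  then show ?thesis using y d True by auto
qed

text \<open>A deleted edge at \<open>w\<close> leaves another edge of its color at \<open>w\<close>;
  that one may be deleted later, but again only in the presence of a replacement.\<close>

lemma drop_pairs_color: "{w, x} \<in> H \<Longrightarrow> \<exists>y. {w, y} \<in> drop_pairs c ps H \<and> c {w, y} = c {w, x}"
proof (induction ps arbitrary: H x)
  case (Cons p ps)
  obtain a b where p: "p = (a, b)" by fastforce
  obtain z where z: "{w, z} \<in> drop_pair c a b H" "c {w, z} = c {w, x}" using drop_pair_color[OF Cons.prems] by blast
  then show ?case using Cons.IH[OF z(1)] p by auto
qed auto

lemma drop_pairs_keep: "e \<in> H \<Longrightarrow> (\<And>a b. (a, b) \<in> set ps \<Longrightarrow> e \<noteq> {a, b}) \<Longrightarrow> e \<in> drop_pairs c ps H"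
proof (induction ps arbitrary: H)
  case (Cons p ps)
  obtain a b where p: "p = (a, b)" by fastforce
  have "e \<noteq> {a, b}" using Cons.prems(2)[of a b] p by simp
  then have "e \<in> drop_pair c a b H" using Cons.prems(1) by (simp add: drop_pair_def)
  then show ?case using Cons.IH Cons.prems(2) p by simp
qed simp

context input_graph
begin

lemma reduced_eq: "reduced H v = drop_pairs c (map (Pair v) [0..<n] @ List.product [0..<n] [0..<n]) H"
  by (simp add: reduced_def drop_pairs_def fold_product fold_map comp_def)

definition Hr :: "nat set \<Rightarrow> nat \<Rightarrow> nat set set" where
  "Hr X v = reduced {e \<in> E. e \<subseteq> insert v X} v"

lemma Hr_subset: "Hr X v \<subseteq> {e \<in> E. e \<subseteq> insert v X}"
  unfolding Hr_def reduced_eq by (rule drop_pairs_subset)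

lemma Hr_doubletons: "Hr X v \<subseteq> E \<and> Hr X v \<subseteq> doubletons (insert v X)"
proof
  show "Hr X v \<subseteq> E" using Hr_subset by blast
  show "Hr X v \<subseteq> doubletons (insert v X)"
  proof
    fix e assume "e \<in> Hr X v"
    then have e: "e \<in> doubletons {..<n}" "e \<subseteq> insert v X" using subsetD[OF Hr_subset] E by blast+
    then obtain a b where "e = {a, b}" "a \<noteq> b" unfolding doubletons_def by blast
    then show "e \<in> doubletons (insert v X)" using e(2) by simp
  qed
qed

lemma Hr_star: "star_colored c (Hr X v)"
  unfolding star_colored_def
proof (intro allI impI)
  fix a b assume h: "{a, b} \<in> Hr X v"
  then have "{a, b} \<in> E" using Hr_subset by blast
  then have "a < n" "b < n" using E_less by auto
  then have "(a, b) \<in> set (map (Pair v) [0..<n] @ List.product [0..<n] [0..<n])" by simp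
  then show "unique_at c (Hr X v) a b \<or> unique_at c (Hr X v) b a"
    using h unfolding Hr_def reduced_eq by (rule drop_pairs_unique)
qed

text \<open>After the pairs at \<open>v\<close> have been treated, \<open>{v, x}\<close> is unique
  in color at \<open>v\<close> or at \<open>x\<close>. The latter is impossible: the tree edge of
  this color that \<open>ext\<close> gives at \<open>x\<close> avoids \<open>v\<close>, so it has
  not been touched yet.\<close>

lemma Hr_unique:
  assumes g: "grown {..<n} E c X T" and v: "v \<notin> X"
    and ext: "\<And>w b. w \<in> X \<Longrightarrow> b \<in> {..<n} - X \<Longrightarrow> {w, b} \<in> E \<Longrightarrow> \<exists>x. {w, x} \<in> T \<and> c {w, x} = c {w, b}"
    and vx: "{v, x} \<in> Hr X v"
  shows "unique_at c (Hr X v) v x"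
  unfolding unique_at_def
proof (intro allI impI, elim conjE)
  fix y assume y: "{v, y} \<in> Hr X v" "c {v, y} = c {v, x}"
  define H where "H = {e \<in> E. e \<subseteq> insert v X}"
  define H1 where "H1 = drop_pairs c (map (Pair v) [0..<n]) H"
  have sub: "Hr X v \<subseteq> H1" unfolding Hr_def reduced_eq drop_pairs_append H1_def H_def by (rule drop_pairs_subset)
  have e: "{v, x} \<in> E" "{v, x} \<subseteq> insert v X" using vx Hr_subset by blast+
  have l: "v < n" "x < n" "v \<noteq> x" using E_less[OF e(1)] by auto
  have xX: "x \<in> X" using e(2) l(3) by blast
  have "(v, x) \<in> set (map (Pair v) [0..<n])" using l by simp
  moreover have "{v, x} \<in> H1" using vx sub by blast
  ultimately have "unique_at c H1 v x \<or> unique_at c H1 x v" unfolding H1_def by (rule drop_pairs_unique)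
  then show "y = x"
  proof
    assume "unique_at c H1 v x"
    then show ?thesis by (rule unique_atD) (use y sub in auto)
  next
    assume u: "unique_at c H1 x v"
    have "{x, v} \<in> E" using e(1) by (simp add: insert_commute)
    then obtain z where z: "{x, z} \<in> T" "c {x, z} = c {x, v}" using ext[OF xX, of v] l v by auto
    have zX: "{x, z} \<in> doubletons X" by (rule subsetD[OF grown_props(3)[OF g E] z(1)])
    have "{x, z} \<in> E" by (rule subsetD[OF grown_props(2)[OF g E] z(1)])
    then have "{x, z} \<in> H" using zX by (auto simp: H_def)
    then have "{x, z} \<in> H1" unfolding H1_def by (rule drop_pairs_keep) (use zX v l(3) in \<open>auto simp: doubleton_eq_iff\<close>)
    then have "z = v" using unique_atD[OF u _ z(2)] by blast
    then show ?thesis using zX v by simp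
  qed
qed

lemma Hr_color:
  assumes "{w, x} \<in> E" "w \<in> insert v X" "x \<in> insert v X"
  shows "\<exists>y. {w, y} \<in> Hr X v \<and> c {w, y} = c {w, x}"
  unfolding Hr_def reduced_eq by (rule drop_pairs_color) (use assms in auto)

text \<open>The degenerate choice \<open>t = r\<close> is free to encode that no vertex is deleted,
  because \<open>r\<close> has to stay in the forest.\<close>

definition remaining :: "nat set \<Rightarrow> nat \<Rightarrow> nat \<Rightarrow> nat \<Rightarrow> nat set" where
  "remaining X v t r = (if t = r then insert v X else insert v X - {t})"

text \<open>For \<open>r = b\<close> the value \<open>col r b\<close> is 0, which is no color, so no
  edge is forbidden.\<close>

definition edges_left :: "nat set \<Rightarrow> nat \<Rightarrow> nat \<Rightarrow> nat \<Rightarrow> nat \<Rightarrow> nat set set" where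
  "edges_left X v t r b = restrict_edges c (Hr X v) (remaining X v t r) r (col r b)"

lemma edges_left_eq:
  "edges_left X v t r b = {e \<in> Hr X v. (t = r \<or> t \<notin> e) \<and> \<not> (r \<in> e \<and> (\<exists>a b'. e = {a, b'} \<and> col a b' = col r b))}"
proof -
  have w1: "e \<subseteq> remaining X v t r \<longleftrightarrow> t = r \<or> t \<notin> e" if "e \<in> Hr X v" for e
    using that Hr_subset[of X v] unfolding remaining_def by auto
  have w2: "(\<exists>a b'. e = {a, b'} \<and> col a b' = col r b) \<longleftrightarrow> c e = col r b" if e: "e \<in> Hr X v" for e
  proof
    have eE: "e \<in> E" using e Hr_subset by blast
    show "\<exists>a b'. e = {a, b'} \<and> col a b' = col r b \<Longrightarrow> c e = col r b" using eE by (auto simp: col_def)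
    obtain p q where "e = {p, q}" using eE E unfolding doubletons_def by blast
    then show "c e = col r b \<Longrightarrow> \<exists>a b'. e = {a, b'} \<and> col a b' = col r b"
      using eE by (intro exI[of _ p] exI[of _ q]) (simp add: col_def)
  qed
  show ?thesis unfolding edges_left_def restrict_edges_def
    by (intro Collect_cong conj_cong refl) (simp_all only: w1 w2)
qed

lemma edges_left_subset: "edges_left X v t r b \<subseteq> Hr X v"
  unfolding edges_left_def by (rule restrict_edges_subset)

lemma edges_left_doubletons: "edges_left X v t r b \<subseteq> doubletons (remaining X v t r)"
  unfolding edges_left_def using Hr_doubletons by (intro restrict_edges_doubletons) blast

definition certified :: "nat set set \<Rightarrow> nat set set \<Rightarrow> nat set set \<Rightarrow> bool" where
  "certified H F M \<longleftrightarrow> F \<subseteq> H \<and> acyc F \<and> (\<forall>e\<in>F. \<forall>f\<in>F. conf c e f \<longrightarrow> e = f) \<and>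
     M \<subseteq> F \<and> (\<forall>e\<in>H. crossing (F - M) e \<longrightarrow> (\<exists>f\<in>M. conf c e f))"

lemma run_span_attempt:
  assumes s: "base s" "best s X T" and l: "s 30 0 < n" "s 31 0 < n" "s 32 0 < n" "s 33 0 < n"
  shows "\<exists>F M G Y F'. certified (edges_left X (s 30 0) (s 31 0) (s 32 0) (s 33 0)) F M \<and> G \<subseteq> F \<and>
    grown {..<n} E c (conn F `` {s 32 0}) G \<and>
    extend_tree E c (s 32 0) (s 33 0) (conn F `` {s 32 0}, G) = (Y, F') \<and>
    best (run span_attempt s) (if card X < card Y then Y else X) (if card X < card Y then F' else T)"
proof -
  let ?v = "s 30 0" and ?t = "s 31 0" and ?r = "s 32 0" and ?b = "s 33 0"
  define s1 where "s1 = run build_U s"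
  define s2 where "s2 = run build_H s1"
  define s3 where "s3 = run reduce s2"
  define s4 where "s4 = run build_H' s3"
  define s5 where "s5 = run rainbow s4"
  define s6 where "s6 = run grow s5"
  define s7 where "s7 = run (try_extend 32 33) s6"
  note d = s1_def s2_def s3_def s4_def s5_def s6_def s7_def
  have b: "base s1" "base s2" "base s3" "base s4" "base s5" "base s6" "base s7" using s(1) by (simp_all add: d)
  have g: "best s1 X T" "best s2 X T" "best s3 X T" "best s4 X T" "best s5 X T" "best s6 X T" "best s7 X T"
    using s(2) by (simp_all add: d)
  have v: "s1 30 = s 30" "s2 30 = s 30" "s3 31 = s 31" "s3 32 = s 32" "s3 33 = s 33" "s5 32 = s 32" "s6 32 = s 32" "s6 33 = s 33"
    by (simp_all add: d run_frame)
  let ?H = "edges_left X ?v ?t ?r ?b"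
  have "vec s1 6 (insert ?v X)" unfolding s1_def by (rule run_build_U) (use s l in \<open>auto simp: best_def\<close>)
  then have "mat s2 7 {e \<in> E. e \<subseteq> insert ?v X}" unfolding s2_def by (rule run_build_H[OF b(1)])
  then have "mat s3 7 (Hr X ?v)"
    using run_reduce[OF b(2), of "{e \<in> E. e \<subseteq> insert ?v X}"] v l(1) by (simp add: s3_def Hr_def)
  then have m4: "mat s4 9 ?H"
    using run_build_H'[OF b(3)] v l unfolding s4_def edges_left_eq by simp
  have HE: "?H \<subseteq> E" using edges_left_subset Hr_doubletons by blast
  interpret rg: rainbow_graph n E c ?H
  proof (intro rainbow_graph.intro rainbow_graph_axioms.intro)
    show "input_graph n E c" by unfold_locales
    show "star_graph ?H {..<n} c"
      by (rule star_graph_intro) (use HE E star_colored_subset[OF Hr_star edges_left_subset] in auto)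
    show "?H \<subseteq> E" by (rule HE)
  qed
  have "0 < n" using l(1) by simp
  then obtain F M where F: "mat s5 10 F" "certified ?H F M"
    using rg.run_rainbow[OF b(4) m4] unfolding s5_def certified_def by blast
  have FE: "F \<subseteq> E" using F(2) HE unfolding certified_def by blast
  have Fc: "\<And>e f. e \<in> F \<Longrightarrow> f \<in> F \<Longrightarrow> conf c e f \<Longrightarrow> e = f" using F(2) unfolding certified_def by blast
  have "s5 32 0 < n" using v(6) l(3) by simp
  then obtain G where G: "cand s6 (conn F `` {?r}) G" "G \<subseteq> F"
    using run_grow[OF b(5) F(1) _ FE Fc] v(6) unfolding s6_def by auto
  obtain Y F' where YF: "extend_tree E c ?r ?b (conn F `` {?r}, G) = (Y, F')" by fastforce
  have "cand s7 Y F'"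
    using cand_try_extend[OF b(6) _ _ G(1), of 32 33] v l YF by (simp add: s7_def)
  then have "best (run commit s7) (if card X < card Y then Y else X) (if card X < card Y then F' else T)"
    by (rule best_commit[OF b(7) g(7)])
  moreover have "run span_attempt s = run commit s7" by (simp add: span_attempt_def d)
  moreover have "grown {..<n} E c (conn F `` {?r}) G" using G(1) by (simp add: cand_def)
  ultimately show ?thesis using F(2) G(2) YF by metis
qed

text \<open>What the failure of a choice of \<open>v\<close>, \<open>t\<close>, \<open>r\<close>,
  \<open>b\<close> reveals: \<open>{r, b}\<close> does not extend the tree, and the forest computed
  for the choice does not span.\<close>

definition exhausted_at :: "nat set \<Rightarrow> nat set set \<Rightarrow> nat \<Rightarrow> nat \<Rightarrow> nat \<Rightarrow> nat \<Rightarrow> bool" where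
  "exhausted_at X T v t r b \<longleftrightarrow>
     (r \<in> X \<and> b \<notin> X \<and> {r, b} \<in> E \<longrightarrow> (\<exists>x. {r, x} \<in> T \<and> c {r, x} = c {r, b})) \<and>
     (v \<notin> X \<and> t \<in> insert v X \<and> r \<in> remaining X v t r \<and>
       (if t = r then b = r else b \<notin> remaining X v t r \<and> {r, b} \<in> E) \<longrightarrow>
       (\<exists>F M. deficient c (edges_left X v t r b) (remaining X v t r) F M))"

lemma spanning_class:
  assumes W: "finite W" "r \<in> W" and F: "F \<subseteq> doubletons W" "acyc F" "\<not> card F + 2 \<le> card W"
  shows "conn F `` {r} = W"
proof
  show "conn F `` {r} \<subseteq> W" using conn_closed[OF _ F(1) W(2)] by auto
  have p: "card (parts W F) + card F = card W" by (rule card_parts[OF W(1) F(1,2)])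
  have fin: "finite (parts W F)" using W(1) by (simp add: parts_def)
  have "card (parts W F) \<le> Suc 0" using p F(3) by simp
  then have eq: "\<And>A B. A \<in> parts W F \<Longrightarrow> B \<in> parts W F \<Longrightarrow> A = B" using card_le_Suc0_iff_eq[OF fin] by blast
  show "W \<subseteq> conn F `` {r}"
  proof
    fix x assume x: "x \<in> W"
    have "conn F `` {r} = conn F `` {x}" by (rule eq) (use x W(2) in \<open>auto simp: parts_def\<close>)
    then show "x \<in> conn F `` {r}" using conn_class_eq[of F r x] by simp
  qed
qed

text \<open>A forest that is not deficient spans and is grown to all of
  \<open>remaining X v t r\<close>. For \<open>t = r\<close> this set is larger than
  \<open>X\<close>; otherwise it has the size of \<open>X\<close>, and since the color of
  \<open>{r, b}\<close> was forbidden at \<open>r\<close>, this edge can be added.\<close>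

lemma deficient_if_not_larger:
  assumes F: "certified (edges_left X v t r b) F M" and G: "G \<subseteq> F" and Y: "extend_tree E c r b (conn F `` {r}, G) = (Y, F')"
    and X: "finite X" "\<not> card X < card Y" and v: "v \<notin> X" "t \<in> insert v X" "r \<in> remaining X v t r"
    and b: "if t = r then b = r else b \<notin> remaining X v t r \<and> {r, b} \<in> E"
  shows "deficient c (edges_left X v t r b) (remaining X v t r) F M"
proof (rule ccontr)
  let ?W = "remaining X v t r"
  assume "\<not> ?thesis"
  then have nc: "\<not> card F + 2 \<le> card ?W" using F unfolding deficient_def certified_def by blast
  have Fs: "F \<subseteq> edges_left X v t r b" "acyc F" using F unfolding certified_def by auto
  have fW: "finite ?W" using X(1) by (simp add: remaining_def)
  have "F \<subseteq> doubletons ?W" using Fs(1) edges_left_doubletons by blast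
  then have cl: "conn F `` {r} = ?W" by (rule spanning_class[OF fW v(3) _ Fs(2) nc])
  show False
  proof (cases "t = r")
    case True
    have "?W \<subseteq> Y" using Y cl by (auto simp: extend_tree_def split: if_splits)
    moreover have "finite Y" using Y cl fW by (auto simp: extend_tree_def split: if_splits)
    ultimately have "card ?W \<le> card Y" by (simp add: card_mono)
    then show False using X v(1) True by (simp add: remaining_def)
  next
    case False
    then have b': "b \<notin> ?W" "{r, b} \<in> E" using b by auto
    have "c {r, x} \<noteq> c {r, b}" if "{r, x} \<in> G" for x
    proof
      assume "c {r, x} = c {r, b}"
      then have "c {r, x} = col r b" using b'(2) by (simp add: col_def)
      moreover have "{r, x} \<in> edges_left X v t r b" using that G Fs(1) by blast
      ultimately show False by (simp add: edges_left_def restrict_edges_def)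
    qed
    then have "Y = insert b ?W" using Y b' v(3) unfolding cl by (simp add: extend_tree_def)
    then have "card Y = Suc (card ?W)" using fW b'(1) by simp
    moreover have "card ?W = card X" using False v X(1) by (simp add: remaining_def)
    ultimately show False using X(2) by simp
  qed
qed

lemma run_attempt:
  assumes s: "base s" "best s X T" and l: "s 30 0 < n" "s 31 0 < n" "s 32 0 < n" "s 33 0 < n"
  shows "\<exists>X' T'. best (run attempt s) X' T' \<and> (card X < card X' \<or> X' = X \<and> T' = T \<and>
    exhausted_at X T (s 30 0) (s 31 0) (s 32 0) (s 33 0))"
proof -
  let ?v = "s 30 0" and ?t = "s 31 0" and ?r = "s 32 0" and ?b = "s 33 0"
  have g: "vec s 1 X" "mat s 2 T" "grown {..<n} E c X T" using s(2) by (auto simp: best_def)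
  have fX: "finite X" using grown_props(4)[OF g(3) E] .
  define s1 where "s1 = run (copy_mat 2 5) (run (copy_vec 1 4) s)"
  define s2 where "s2 = run (try_extend 32 33) s1"
  define s3 where "s3 = run commit s2"
  have "vec (run (copy_vec 1 4) s) 4 X" by (rule run_copy_vec) (use s g in auto)
  then have "vec s1 4 X" by (simp add: s1_def)
  moreover have "mat s1 5 T" unfolding s1_def by (rule run_copy_mat) (use s g in auto)
  ultimately have c1: "cand s1 X T" using g(3) by (simp add: cand_def)
  have b: "base s1" "base s2" "base s3" using s by (simp_all add: s1_def s2_def s3_def)
  have bs: "best s1 X T" "best s2 X T" using s(2) by (simp_all add: s1_def s2_def)
  have v: "s1 32 = s 32" "s1 33 = s 33" "s3 30 = s 30" "s3 31 = s 31" "s3 32 = s 32" "s3 33 = s 33"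
    by (simp_all add: s1_def s2_def s3_def run_frame)
  obtain X2 T2 where X2: "extend_tree E c ?r ?b (X, T) = (X2, T2)" by fastforce
  have "cand s2 X2 T2" using cand_try_extend[OF b(1) _ _ c1, of 32 33] v l X2 by (simp add: s2_def)
  then have c3: "best s3 (if card X < card X2 then X2 else X) (if card X < card X2 then T2 else T)"
    unfolding s3_def by (rule best_commit[OF b(2) bs(2)])
  have r: "run attempt s = run span_attempt s3" by (simp add: attempt_def s1_def s2_def s3_def)
  have l3: "s3 30 0 < n" "s3 31 0 < n" "s3 32 0 < n" "s3 33 0 < n" using l v by simp_all
  show ?thesis
  proof (cases "card X < card X2")
    case True
    then have "best s3 X2 T2" using c3 by simp
    from run_span_attempt[OF b(3) this l3] obtain Y F' where
      "best (run attempt s) (if card X2 < card Y then Y else X2) (if card X2 < card Y then F' else T2)" unfolding r by blast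
    moreover have "card X < card (if card X2 < card Y then Y else X2)" using True by simp
    ultimately show ?thesis by blast
  next
    case False
    then have b3: "best s3 X T" using c3 by simp
    from run_span_attempt[OF b(3) b3 l3] obtain F M G Y F' where
      F: "certified (edges_left X ?v ?t ?r ?b) F M" "G \<subseteq> F" "extend_tree E c ?r ?b (conn F `` {?r}, G) = (Y, F')"
      and bt: "best (run attempt s) (if card X < card Y then Y else X) (if card X < card Y then F' else T)" unfolding r v by blast
    show ?thesis
    proof (cases "card X < card Y")
      case True
      then show ?thesis using bt by auto
    next
      case nY: False
      have "\<exists>x. {?r, x} \<in> T \<and> c {?r, x} = c {?r, ?b}" if "?r \<in> X" "?b \<notin> X" "{?r, ?b} \<in> E"
      proof (rule ccontr)
        assume "\<not> ?thesis"
        then have "X2 = insert ?b X" using X2 that by (simp add: extend_tree_def)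
        then show False using False fX that by simp
      qed
      then have "exhausted_at X T ?v ?t ?r ?b"
        unfolding exhausted_at_def using deficient_if_not_larger[OF F fX nY] by blast
      then show ?thesis using bt nY by auto
    qed
  qed
qed

lemma best_unique: "best s X T \<Longrightarrow> best s X' T' \<Longrightarrow> X = X'"
  using grown_less(1) unfolding best_def vec_def by (metis lessThan_iff subset_antisym subset_iff)

definition exhausted :: "nat set \<Rightarrow> nat set set \<Rightarrow> bool" where
  "exhausted X T \<longleftrightarrow> grown {..<n} E c X T \<and> (\<forall>v<n. \<forall>t<n. \<forall>r<n. \<forall>b<n. exhausted_at X T v t r b)"

text \<open>Without improvement the best tree is the same in all passes of the round, so the
  failures recorded for the single choices concern one and the same tree.\<close>

lemma run_attempts:
  assumes s: "base s" "best s X T"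
  defines "s' \<equiv> run (nest [30, 31, 32, 33] attempt) s"
  shows "\<exists>X' T'. best s' X' T' \<and> (card X < card X' \<or> X' = X \<and> exhausted X T)"
proof -
  let ?Inv = "\<lambda>t. base t \<and> (\<exists>X' T'. best t X' T' \<and> (card X < card X' \<or> X' = X \<and> T' = T))"
  have step: "\<exists>X' T'. best (run attempt t) X' T' \<and>
      (card X < card X' \<or> X' = X \<and> T' = T \<and> exhausted_at X T (t 30 0) (t 31 0) (t 32 0) (t 33 0))"
    if t: "?Inv t" and l: "t 30 0 < n" "t 31 0 < n" "t 32 0 < n" "t 33 0 < n" for t
  proof -
    obtain X' T' where X': "best t X' T'" "card X < card X' \<or> X' = X \<and> T' = T" using t by blast
    obtain X2 T2 where "best (run attempt t) X2 T2"
      "card X' < card X2 \<or> X2 = X' \<and> T2 = T' \<and> exhausted_at X' T' (t 30 0) (t 31 0) (t 32 0) (t 33 0)"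
      using run_attempt[OF _ X'(1) l] t by blast
    then show ?thesis using X'(2) by (metis less_trans)
  qed
  have body: "?Inv (run attempt t)" if t: "?Inv t" and l: "\<And>x. x \<in> set [30, 31, 32, 33] \<Longrightarrow> t x 0 < n" for t
  proof -
    have "t 30 0 < n" "t 31 0 < n" "t 32 0 < n" "t 33 0 < n" using l by simp_all
    moreover have "base (run attempt t)" using t by simp
    ultimately show ?thesis using step[OF t] by blast
  qed
  have pt: "?Inv (put x i t)" if "?Inv t" "x \<in> set [30, 31, 32, 33]" for t x i
  proof -
    have x: "x \<noteq> 0" "x \<noteq> 3" "x \<noteq> 1" "x \<noteq> 2" using that(2) by auto
    show ?thesis using that(1) x by (simp only: base_put best_put not_False_eq_True)
  qed
  have i0: "?Inv s" using s by blast
  have fin: "?Inv s'" unfolding s'_def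
  proof (rule nest_invariant[where n=n and Inv="?Inv"])
    show "?Inv s" by (rule i0)
    show "?Inv (run attempt t)" if "?Inv t" "\<And>x. x \<in> set [30, 31, 32, 33] \<Longrightarrow> t x 0 < n" for t by (rule body) (use that in auto)
    show "?Inv (put x i t)" if "?Inv t" "x \<in> set [30, 31, 32, 33]" for t x i by (rule pt) (use that in auto)
    show "t 0 0 = n" if "?Inv t" for t using that base_n by blast
  qed auto
  have visit: "exhausted_at X T v t r b \<or> (\<exists>X' T'. best s' X' T' \<and> card X < card X')" if vb: "v < n" "t < n" "r < n" "b < n" for v t r b
    unfolding s'_def
  proof (rule nest_visit[where n=n and Inv="?Inv" and G="\<lambda>u. exhausted_at X T v t r b \<or> (\<exists>X' T'. best u X' T' \<and> card X < card X')"
        and \<sigma>="\<lambda>x. if x = 30 then v else if x = 31 then t else if x = 32 then r else b"])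
    show "?Inv s" by (rule i0)
    show "?Inv (run attempt t)" if "?Inv t" "\<And>x. x \<in> set [30, 31, 32, 33] \<Longrightarrow> t x 0 < n" for t by (rule body) (use that in auto)
    show "?Inv (put x i t)" if "?Inv t" "x \<in> set [30, 31, 32, 33]" for t x i by (rule pt) (use that in auto)
    show "t 0 0 = n" if "?Inv t" for t using that base_n by blast
    show "exhausted_at X T v t r b \<or> (\<exists>X' T'. best (run attempt u) X' T' \<and> card X < card X')"
      if u: "?Inv u" "\<And>x. x \<in> set [30, 31, 32, 33] \<Longrightarrow> u x 0 < n"
        "exhausted_at X T v t r b \<or> (\<exists>X' T'. best u X' T' \<and> card X < card X')" for u
    proof (cases "exhausted_at X T v t r b")
      case False
      then obtain X' T' where X': "best u X' T'" "card X < card X'" using u(3) by blast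
      have "u 30 0 < n" "u 31 0 < n" "u 32 0 < n" "u 33 0 < n" using u(2) by simp_all
      moreover have "base u" using u(1) by blast
      ultimately obtain X2 T2 where "best (run attempt u) X2 T2" "card X' < card X2 \<or> X2 = X'"
        using run_attempt[OF _ X'(1)] by blast
      then show ?thesis using X'(2) by (metis less_trans)
    qed simp
    show "exhausted_at X T v t r b \<or> (\<exists>X' T'. best (put x i u) X' T' \<and> card X < card X')"
      if "x \<in> set [30, 31, 32, 33]" "exhausted_at X T v t r b \<or> (\<exists>X' T'. best u X' T' \<and> card X < card X')" for u x i
    proof -
      have "x \<noteq> 1" "x \<noteq> 2" using that(1) by auto
      then show ?thesis using that(2) by (simp only: best_put not_False_eq_True)
    qed
    show "exhausted_at X T v t r b \<or> (\<exists>X' T'. best (run attempt u) X' T' \<and> card X < card X')"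
      if u: "?Inv u" "\<And>x. x \<in> set [30, 31, 32, 33] \<Longrightarrow> u x 0 = (if x = 30 then v else if x = 31 then t else if x = 32 then r else b)" for u
    proof -
      have e: "u 30 0 = v" "u 31 0 = t" "u 32 0 = r" "u 33 0 = b" using u(2)[of 30] u(2)[of 31] u(2)[of 32] u(2)[of 33] by simp_all
      show ?thesis using step[OF u(1)] vb unfolding e by blast
    qed
  qed (use vb in auto)
  obtain X' T' where X': "best s' X' T'" "card X < card X' \<or> X' = X \<and> T' = T" using fin by blast
  show ?thesis
  proof (cases "card X < card X'")
    case False
    then have "X' = X" using X'(2) by blast
    then have "\<not> (\<exists>X' T'. best s' X' T' \<and> card X < card X')" using best_unique[OF X'(1)] by blast
    then have "exhausted X T" using visit s(2) unfolding exhausted_def best_def by blast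
    then show ?thesis using X'(1) \<open>X' = X\<close> by blast
  qed (use X' in blast)
qed

end

section \<open>Correctness of the algorithm\<close>

definition small_pairs :: "(nat \<times> nat) list" where
  "small_pairs = [(71, 72), (73, 74), (75, 76), (77, 78), (79, 80), (81, 82)]"

context input_graph
begin

definition extend_along :: "(nat \<times> nat) list \<Rightarrow> nat set \<times> nat set set \<Rightarrow> nat set \<times> nat set set" where
  "extend_along ps = fold (\<lambda>(a, b). extend_tree E c a b) ps"

lemma extend_along_simps [simp]:
  "extend_along [] YF = YF" "extend_along ((a, b) # ps) YF = extend_along ps (extend_tree E c a b YF)"
  "extend_along (ps @ qs) YF = extend_along qs (extend_along ps YF)"
  by (simp_all add: extend_along_def)

text \<open>The order of growth is a list of pairs that rebuilds the tree from its root, one pair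
  per further vertex; \<open>small\<close> runs such lists.\<close>

lemma grown_extend_along:
  assumes "grown {..<n} E c Y F"
  shows "\<exists>r ps. r < n \<and> (\<forall>(a, b)\<in>set ps. a < n \<and> b < n) \<and> Suc (length ps) = card Y \<and> extend_along ps ({r}, {}) = (Y, F)"
  using assms
proof induction
  case (single x)
  then show ?case by (intro exI[of _ x] exI[of _ "[]"]) simp
next
  case (extend Y F a b)
  obtain r ps where r: "r < n" "\<forall>(a, b)\<in>set ps. a < n \<and> b < n" "Suc (length ps) = card Y" "extend_along ps ({r}, {}) = (Y, F)"
    using extend.IH by blast
  have "extend_tree E c a b (Y, F) = (insert b Y, insert {a, b} F)" using extend.hyps by (simp add: extend_tree_def)
  then have "extend_along (ps @ [(a, b)]) ({r}, {}) = (insert b Y, insert {a, b} F)" using r(4) by simp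
  moreover have "Suc (length (ps @ [(a, b)])) = card (insert b Y)"
    using r(3) extend.hyps(3) grown_props(4)[OF extend.hyps(1) E] by simp
  moreover have "\<forall>(p, q)\<in>set (ps @ [(a, b)]). p < n \<and> q < n" using r(2) E_less[OF extend.hyps(4)] by auto
  ultimately show ?case using r(1) by blast
qed

lemma run_try_extends:
  assumes "base s" "cand s (fst YF) (snd YF)" and "\<And>x. x \<in> {70..82} \<Longrightarrow> s x 0 = \<sigma> x \<and> \<sigma> x < n" and "set ps \<subseteq> {70..82} \<times> {70..82}"
  defines "t \<equiv> fold (\<lambda>(a, b). run (try_extend a b)) ps s" and "YF' \<equiv> extend_along (map (\<lambda>(a, b). (\<sigma> a, \<sigma> b)) ps) YF"
  shows "base t \<and> cand t (fst YF') (snd YF')"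
  using assms(1-4) unfolding t_def YF'_def
proof (induction ps arbitrary: s YF)
  case Nil
  then show ?case by simp
next
  case (Cons p ps)
  obtain a b where p: "p = (a, b)" by fastforce
  have ab: "a \<in> {70..82}" "b \<in> {70..82}" using Cons.prems(4) p by auto
  have x: "{a, b} \<inter> {0, 3, 4, 5, 20, 38} = {}" using ab by auto
  let ?s = "run (try_extend a b) s"
  have "base ?s" using Cons.prems(1) by simp
  moreover have "cand ?s (fst (extend_tree E c (\<sigma> a) (\<sigma> b) YF)) (snd (extend_tree E c (\<sigma> a) (\<sigma> b) YF))"
    using cand_try_extend[OF Cons.prems(1) _ _ Cons.prems(2) x] Cons.prems(3)[OF ab(1)] Cons.prems(3)[OF ab(2)] by simp
  moreover have "?s x 0 = \<sigma> x \<and> \<sigma> x < n" if xm: "x \<in> {70..82}" for x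
  proof -
    have "x \<notin> writes (try_extend a b)" using xm by auto
    then show ?thesis using run_frame[of x "try_extend a b" s] Cons.prems(3)[OF xm] by simp
  qed
  ultimately show ?case using Cons.IH[of ?s "extend_tree E c (\<sigma> a) (\<sigma> b) YF"] Cons.prems(4) p by simp
qed

lemma run_small:
  assumes s: "base s" "best s X T" and \<sigma>: "\<And>x. x \<in> {70..82} \<Longrightarrow> s x 0 = \<sigma> x \<and> \<sigma> x < n"
  shows "\<exists>X' T'. best (run small s) X' T' \<and> card X \<le> card X' \<and>
    card (fst (extend_along (map (\<lambda>(a, b). (\<sigma> a, \<sigma> b)) small_pairs) ({\<sigma> 70}, {}))) \<le> card X'"
proof -
  let ?YF = "extend_along (map (\<lambda>(a, b). (\<sigma> a, \<sigma> b)) small_pairs) ({\<sigma> 70}, {})"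
  define s1 where "s1 = run (start 70) s"
  define s2 where "s2 = fold (\<lambda>(a, b). run (try_extend a b)) small_pairs s1"
  have "cand s1 {\<sigma> 70} {}" using cand_start[OF s(1), of 70] \<sigma>[of 70] by (simp add: s1_def)
  moreover have "base s1" "best s1 X T" using s by (simp_all add: s1_def)
  moreover have "s1 x 0 = \<sigma> x \<and> \<sigma> x < n" if xm: "x \<in> {70..82}" for x
  proof -
    have "x \<notin> writes (start 70)" using xm by auto
    then show ?thesis using run_frame[of x "start 70" s] \<sigma>[OF xm] by (simp add: s1_def)
  qed
  ultimately have c: "base s2 \<and> cand s2 (fst ?YF) (snd ?YF)"
    unfolding s2_def by (intro run_try_extends) (auto simp: small_pairs_def)
  have b: "best s2 X T" using \<open>best s1 X T\<close> by (simp add: s2_def small_pairs_def)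
  have r: "run small s = run commit s2" by (simp add: small_def s1_def s2_def small_pairs_def)
  have "best (run small s) (if card X < card (fst ?YF) then fst ?YF else X) (if card X < card (fst ?YF) then snd ?YF else T)"
    unfolding r using best_commit[OF _ b] c by blast
  then show ?thesis by (intro exI conjI) (assumption, simp_all)
qed

definition small_vars :: "nat list" where
  "small_vars = [70, 71, 72, 73, 74, 75, 76, 77, 78, 79, 80, 81, 82]"

lemma set_small_vars: "set small_vars = {70..82}"
proof -
  have "{70..82::nat} = set [70..<83]"
    unfolding set_upt by (rule set_eqI) (unfold atLeastAtMost_iff atLeastLessThan_iff, arith)
  also have "[70..<83] = small_vars" by (simp add: small_vars_def upt_rec_numeral)
  finally show ?thesis ..
qed

lemma run_smalls:
  assumes s: "base s" "best s X T" and Y: "grown {..<n} E c Y F" "card Y \<le> 7"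
  defines "t \<equiv> run (nest small_vars small) s"
  shows "\<exists>X' T'. best t X' T' \<and> card Y \<le> card X'"
proof -
  obtain r ps where r: "r < n" "\<forall>(a, b)\<in>set ps. a < n \<and> b < n" "Suc (length ps) = card Y" "extend_along ps ({r}, {}) = (Y, F)"
    using grown_extend_along[OF Y(1)] by blast
  \<comment> \<open>Padding to length 6 by \<open>(0, 0)\<close>, which never extends: a vertex
    cannot be both inside and outside the tree.\<close>
  define qs where "qs = ps @ replicate (6 - length ps) (0, 0)"
  have "extend_along (replicate k (0, 0)) YF = YF" for k YF
    by (induction k) (auto simp: extend_tree_def split: prod.split)
  then have qs: "extend_along qs ({r}, {}) = (Y, F)" using r(4) by (simp add: qs_def)
  have ql: "\<forall>(a, b)\<in>set qs. a < n \<and> b < n" using r(1,2) by (auto simp: qs_def)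
  have "length qs = 6" using r(3) Y(2) by (simp add: qs_def)
  then obtain a1 b1 a2 b2 a3 b3 a4 b4 a5 b5 a6 b6 where
    q: "qs = [(a1, b1), (a2, b2), (a3, b3), (a4, b4), (a5, b5), (a6, b6)]"
    by (auto simp: length_Suc_conv eval_nat_numeral)
  define \<sigma> where "\<sigma> = (\<lambda>x. [r, a1, b1, a2, b2, a3, b3, a4, b4, a5, b5, a6, b6] ! (x - 70))"
  have "\<sigma> x \<in> set [r, a1, b1, a2, b2, a3, b3, a4, b4, a5, b5, a6, b6]" if "x \<in> {70..82}" for x
    unfolding \<sigma>_def by (rule nth_mem) (use that in auto)
  then have \<sigma>n: "\<sigma> x < n" if "x \<in> {70..82}" for x using that ql r(1) unfolding q by fastforce
  have \<sigma>m: "map (\<lambda>(a, b). (\<sigma> a, \<sigma> b)) small_pairs = qs" "\<sigma> 70 = r"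
    unfolding q small_pairs_def \<sigma>_def by simp_all
  let ?Inv = "\<lambda>t. base t \<and> (\<exists>X' T'. best t X' T')"
  have fresh: "x \<noteq> 0" "x \<noteq> 3" "x \<noteq> 1" "x \<noteq> 2" if "x \<in> set small_vars" for x using that by (auto simp: set_small_vars)
  show ?thesis unfolding t_def
  proof (rule nest_visit[where n=n and Inv="?Inv" and G="\<lambda>t. \<exists>X' T'. best t X' T' \<and> card Y \<le> card X'" and \<sigma>="\<sigma>"])
    show "?Inv s" using s by blast
    show "0 \<notin> set small_vars" "0 \<notin> writes small" "distinct small_vars" "set small_vars \<inter> writes small = {}"
      by (simp_all add: small_vars_def)
    show "u 0 0 = n" if "?Inv u" for u using that base_n by blast
    show "?Inv (run small u)" if u: "?Inv u" "\<And>x. x \<in> set small_vars \<Longrightarrow> u x 0 < n" for u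
    proof -
      obtain X' T' where "best u X' T'" using u(1) by blast
      then obtain X2 T2 where "best (run small u) X2 T2"
        using run_small[of u X' T' "\<lambda>x. u x 0"] u by (auto simp: set_small_vars)
      then show ?thesis using u(1) by auto
    qed
    show "?Inv (put x i u)" if "?Inv u" "x \<in> set small_vars" for u x i
      using that(1) fresh[OF that(2)] by (simp only: base_put best_put not_False_eq_True)
    show "\<exists>X' T'. best (run small u) X' T' \<and> card Y \<le> card X'"
      if u: "?Inv u" "\<And>x. x \<in> set small_vars \<Longrightarrow> u x 0 < n" "\<exists>X' T'. best u X' T' \<and> card Y \<le> card X'" for u
    proof -
      obtain X' T' where X': "best u X' T'" "card Y \<le> card X'" using u(3) by blast
      then obtain X2 T2 where "best (run small u) X2 T2" "card X' \<le> card X2"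
        using run_small[of u X' T' "\<lambda>x. u x 0"] u by (auto simp: set_small_vars)
      then show ?thesis using X'(2) le_trans by blast
    qed
    show "\<exists>X' T'. best (put x i u) X' T' \<and> card Y \<le> card X'"
      if "x \<in> set small_vars" "\<exists>X' T'. best u X' T' \<and> card Y \<le> card X'" for u x i
      using that(2) fresh[OF that(1)] by (simp only: best_put not_False_eq_True)
    show "\<exists>X' T'. best (run small u) X' T' \<and> card Y \<le> card X'" if u: "?Inv u" "\<And>x. x \<in> set small_vars \<Longrightarrow> u x 0 = \<sigma> x" for u
    proof -
      obtain X' T' where X': "best u X' T'" using u(1) by blast
      have "u x 0 = \<sigma> x \<and> \<sigma> x < n" if "x \<in> {70..82}" for x using u(2)[of x] \<sigma>n[OF that] that by (simp add: set_small_vars)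
      then obtain X2 T2 where "best (run small u) X2 T2" "card (fst (extend_along qs ({r}, {}))) \<le> card X2"
        using run_small[of u X' T' \<sigma>] u(1) X' unfolding \<sigma>m by blast
      then show ?thesis unfolding qs by auto
    qed
    show "\<sigma> x < n" if "x \<in> set small_vars" for x using \<sigma>n that by (simp add: set_small_vars)
  qed
qed

text \<open>A round need not repeat the choices of an earlier one, so a later round may improve on an exhausted
  tree; it is enough that the best tree never gets smaller.\<close>

lemma run_search:
  assumes s: "base s" "best s X0 T0"
  defines "t \<equiv> run (For 34 (nest [30, 31, 32, 33] attempt)) s"
  shows "\<exists>X T X1 T1. best t X T \<and> card X0 \<le> card X \<and> exhausted X1 T1 \<and> card X1 \<le> card X"
proof -
  let ?p = "nest [30, 31, 32, 33] attempt"
  \<comment> \<open>More than \<open>i\<close> vertices after \<open>i\<close> rounds, or some round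
    was exhausted. After \<open>n\<close> rounds only the second is possible, since the tree has at
    most \<open>n\<close> vertices.\<close>
  let ?I = "\<lambda>i t. base t \<and> (\<exists>X T. best t X T \<and> card X0 \<le> card X \<and> (i < card X \<or> (\<exists>X1 T1. exhausted X1 T1 \<and> card X1 \<le> card X)))"
  have w: "writes ?p = {30, 31, 32, 33} \<union> writes attempt" by (auto simp: writes_nest simp del: nest.simps)
  obtain u where u: "?I n u" "t = put 34 n u"
    unfolding t_def
  proof (rule run_For[of s n 34 ?p ?I])
    show "s 0 0 = n" using s(1) by (rule base_n)
    show "0 \<notin> writes ?p" by (simp add: w del: nest.simps)
    have "0 < card X0" using s(2) grown_props(4,10)[OF _ E] unfolding best_def by (meson card_gt_0_iff)
    then show "?I 0 s" using s by blast
    fix i u assume i: "i < n" and I: "?I i u"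
    obtain X T where X: "best u X T" "card X0 \<le> card X" "i < card X \<or> (\<exists>X1 T1. exhausted X1 T1 \<and> card X1 \<le> card X)"
      using I by blast
    have b: "base (put 34 i u)" "best (put 34 i u) X T" using I X(1) by simp_all
    obtain X' T' where X': "best (run ?p (put 34 i u)) X' T'" "card X < card X' \<or> X' = X \<and> exhausted X T"
      using run_attempts[OF b] by blast
    have "base (run ?p (put 34 i u))" using b(1) by (simp add: w del: nest.simps)
    moreover have "card X0 \<le> card X'" using X(2) X'(2) by auto
    moreover have "Suc i < card X' \<or> (\<exists>X1 T1. exhausted X1 T1 \<and> card X1 \<le> card X')"
      using X'(2)
    proof
      assume lt: "card X < card X'"
      show ?thesis using X(3)
      proof
        assume "\<exists>X1 T1. exhausted X1 T1 \<and> card X1 \<le> card X"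
        then show ?thesis using lt by (meson less_imp_le le_trans)
      qed (use lt in simp)
    qed blast
    ultimately show "?I (Suc i) (run ?p (put 34 i u))" using X'(1) by blast
  qed auto
  obtain X T where X: "best u X T" "card X0 \<le> card X" "n < card X \<or> (\<exists>X1 T1. exhausted X1 T1 \<and> card X1 \<le> card X)"
    using u(1) by blast
  have "X \<subseteq> {..<n}" using X(1) grown_less(1) unfolding best_def by blast
  then have "card X \<le> n" using card_mono[of "{..<n}" X] by simp
  moreover have "best t X T" using X(1) u(2) by simp
  ultimately show ?thesis using X(2,3) by (meson not_less)
qed

lemma exhausted_maximal:
  assumes con: "\<And>x y. x < n \<Longrightarrow> y < n \<Longrightarrow> (x, y) \<in> conn E" and d: "4 \<le> d"
    and degree: "\<And>w. w < n \<Longrightarrow> d \<le> card {c {w, x} | x. {w, x} \<in> E}"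
    and X: "exhausted X T" "X \<noteq> {..<n}" "card X \<le> 2 * d" and Y: "grown {..<n} E c Y F"
  shows "card Y \<le> 2 * d" "2 * d < n"
proof -
  have g: "grown {..<n} E c X T" using X(1) by (simp add: exhausted_def)
  have Xn: "X \<subseteq> {..<n}" using grown_less(1)[OF g] .
  have at: "exhausted_at X T v t r b" if "v < n" "t < n" "r < n" "b < n" for v t r b
    using X(1) that unfolding exhausted_def by blast
  \<comment> \<open>\<open>exhausted_at\<close> speaks of the one-edge extension for all
    \<open>v\<close> and \<open>t\<close>; both are set to \<open>w\<close>.\<close>
  have ext: "\<exists>x. {w, x} \<in> T \<and> c {w, x} = c {w, b}" if "w \<in> X" "b \<in> {..<n} - X" "{w, b} \<in> E" for w b
    using at[of w w w b] that E_less[of w b] unfolding exhausted_at_def by auto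
  have main: "\<exists>F M. deficient c (Hr X v) (insert v X) F M" if v: "v \<in> {..<n} - X" for v
  proof -
    have "v < n" using v by simp
    \<comment> \<open>The choice \<open>t = r = b = v\<close> deletes no vertex and forbids no
      color.\<close>
    then have "exhausted_at X T v v v v" using at by blast
    then have "\<exists>F M. deficient c (edges_left X v v v v) (insert v X) F M"
      using v unfolding exhausted_at_def by (simp add: remaining_def)
    moreover have "edges_left X v v v v = Hr X v"
    proof -
      have "col v v = 0" using E_less[of v v] by (auto simp: col_def)
      moreover have "0 < c e \<and> e \<subseteq> insert v X" if "e \<in> Hr X v" for e using that Hr_subset[of X v] c_pos by blast
      ultimately show ?thesis unfolding edges_left_def restrict_edges_def by (auto simp: remaining_def)
    qed
    ultimately show ?thesis by simp
  qed
  have fail: "\<exists>F M. deficient c (restrict_edges c (Hr X v) (insert v X - {t}) r (c {r, b})) (insert v X - {t}) F M"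
    if h: "v \<in> {..<n} - X" "t \<in> insert v X" "r \<in> insert v X - {t}" "b \<in> {..<n} - (insert v X - {t})" "{r, b} \<in> E" for v t r b
  proof -
    have tr: "t \<noteq> r" using h(3) by blast
    have "v < n" "t < n" "r < n" "b < n" using h Xn by auto
    then have "exhausted_at X T v t r b" by (rule at)
    then show ?thesis using h tr unfolding exhausted_at_def edges_left_def by (simp add: remaining_def col_def)
  qed
  have "card Y \<le> 2 * d \<and> 2 * d < card {..<n}"
  proof (intro conjI)
    note R = no_larger_tree[where V="{..<n}" and E=E and c=c and d=d and X=X and T=T and Hr="Hr X" and Y=Y and F'=F]
    show "card Y \<le> 2 * d"
      by (rule R(1)) (use E con d degree g X ext main fail Y Hr_doubletons Hr_star Hr_unique[OF g] Hr_color in auto)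
    show "2 * d < card {..<n}"
      by (rule R(2)) (use E con d degree g X ext main fail Y Hr_doubletons Hr_star Hr_unique[OF g] Hr_color in auto)
  qed
  then show "card Y \<le> 2 * d" "2 * d < n" by simp_all
qed

lemma run_offsets:
  assumes "s 0 0 = n" "s 35 0 = 0" "\<And>u v. u < n \<Longrightarrow> v < n \<Longrightarrow> s 0 (Suc (u * n + v)) = col u v"
  shows "base (run offsets s)"
proof -
  let ?p = "Set 3 (Var 36) (Var 35) ;; SetVar 35 (Plus (Var 35) (Cell 0 (Const 0)))"
  let ?I = "\<lambda>i t. t 35 0 = i * n \<and> (\<forall>u<i. t 3 u = u * n)"
  obtain t where t: "?I n t" "run (For 36 ?p) s = put 36 n t" "\<And>m. m \<notin> insert 36 (writes ?p) \<Longrightarrow> t m = s m"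
  proof (rule run_For[of s n 36 ?p ?I])
    fix i t assume i: "i < n" and fr: "\<And>m. m \<notin> insert 36 (writes ?p) \<Longrightarrow> t m = s m" and I: "?I i t"
    have "t 0 = s 0" using fr by simp
    then show "?I (Suc i) (run ?p (put 36 i t))" using I assms(1) by (auto simp: less_Suc_eq)
  qed (use assms in auto)
  have "t 0 = s 0" using t(3) by simp
  then show ?thesis using t(1,2) assms unfolding base_def offsets_def by (simp del: run.simps)
qed

lemma best_out:
  assumes "best t X T" shows "out_vertices n t = X" "out_edges n t = T"
proof -
  have b: "vec t 1 X" "mat t 2 T" "X \<subseteq> {..<n}" "T \<subseteq> E" using assms grown_less[of X T] by (simp_all add: best_def)
  show "out_vertices n t = X" using b(1,3) by (auto simp: out_vertices_def vec_def)
  show "out_edges n t = T"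
  proof
    show "out_edges n t \<subseteq> T" using b(2) by (auto simp: out_edges_def mat_def)
    show "T \<subseteq> out_edges n t"
    proof
      fix e assume e: "e \<in> T"
      then have "e \<in> doubletons {..<n}" using b(4) E by blast
      then obtain u v where uv: "e = {u, v}" "u < n" "v < n" unfolding doubletons_def by blast
      then have "t 2 (u * n + v) \<noteq> 0" using b(2) e by (simp add: mat_def)
      then show "e \<in> out_edges n t" using uv unfolding out_edges_def by blast
    qed
  qed
qed

end

section \<open>Encoding of the input and the final bound\<close>

lemma nth_concat_rows: "u < m \<Longrightarrow> v < n \<Longrightarrow> concat (map (\<lambda>u. map (f u) [0..<n]) [0..<m]) ! (u * n + v) = f u v"
proof (induction m)
  case (Suc m)
  let ?w = "concat (map (\<lambda>u. map (f u) [0..<n]) [0..<m])"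
  have len: "length ?w = m * n" by (simp add: length_concat comp_def sum_list_triv)
  show ?case
  proof (cases "u < m")
    case True
    have "u * n + v < Suc u * n" using Suc.prems(2) by simp
    also have "\<dots> \<le> m * n" by (rule mult_le_mono1) (use True in simp)
    finally show ?thesis using Suc True len by (simp add: nth_append)
  next
    case False
    then have "u = m" using Suc.prems(1) by simp
    then show ?thesis using Suc.prems(2) len by (simp add: nth_append)
  qed
qed simp

lemma length_encode: "length (encode n E c) = Suc (n * n)"
  by (simp add: encode_def length_concat comp_def sum_list_triv)

text \<open>The encoding has \<open>n * n + 1\<close> entries, and the separator makes each count at
  least 1.\<close>

lemma size_encode: "n \<le> input_size (encode n E c)"
proof -
  have "length w \<le> input_size w" for w by (induction w) (simp_all add: input_size_def)
  then have "Suc (n * n) \<le> input_size (encode n E c)" using length_encode by metis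
  moreover have "n \<le> n * n" by simp
  ultimately show ?thesis by linarith
qed

text \<open>A growth inside the given tree passes through every order up to \<open>card W\<close>.
  This turns a tree of unknown size into grown trees of exactly the orders to be compared
  with.\<close>

lemma grown_subtrees:
  assumes T: "pc_tree_in W F V E c" and G: "E \<subseteq> doubletons V" and k: "1 \<le> k" "k \<le> card W"
  shows "\<exists>Y G. grown V E c Y G \<and> card Y = k"
proof -
  have t: "W \<subseteq> V" "F \<subseteq> E" "F \<subseteq> doubletons W" "W \<noteq> {}" "properly_colored F c"
    and con: "\<And>x y. x \<in> W \<Longrightarrow> y \<in> W \<Longrightarrow> (x, y) \<in> conn F"
    using T by (auto simp: pc_tree_in_def subgraph_def is_tree_def connected_graph_def conn_def simple_graph_doubletons)
  have pcF: "pc c F" using t(3,5) pc_properly_colored by blast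
  have "\<exists>Y G. grown V E c Y G \<and> Y \<subseteq> W \<and> G \<subseteq> F \<and> card Y = k" using k
  proof (induction k)
    case (Suc k)
    show ?case
    proof (cases "k = 0")
      case True
      obtain x where "x \<in> W" using t(4) by blast
      then show ?thesis using True t(1) grown.single[of x V E c] by (intro exI[of _ "{x}"] exI[of _ "{}"]) auto
    next
      case False
      then obtain Y G where YG: "grown V E c Y G" "Y \<subseteq> W" "G \<subseteq> F" "card Y = k" using Suc by auto
      have "Y \<noteq> W" using YG(4) Suc.prems(2) by auto
      then obtain r b where rb: "r \<in> Y" "b \<notin> Y" "{r, b} \<in> F" "grown V E c (insert b Y) (insert {r, b} G)"
        using grown_extend_within[OF YG(1) G t(2) pcF YG(3,2) _ con] by blast
      have "b \<in> W" using subsetD[OF t(3) rb(3)] by simp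
      moreover have "finite Y" using grown_props(4)[OF YG(1) G] .
      ultimately show ?thesis using rb YG by (intro exI[of _ "insert b Y"] exI[of _ "insert {r, b} G"]) auto
    qed
  qed simp
  then show ?thesis by blast
qed

lemma (in input_graph) run_program:
  assumes s: "s = load (encode n E c)" and con: "\<And>x y. x < n \<Longrightarrow> y < n \<Longrightarrow> (x, y) \<in> conn E" and n: "0 < n"
    and degree: "\<And>w. w < n \<Longrightarrow> d \<le> card {c {w, x} | x. {w, x} \<in> E}"
    and W: "pc_tree_in W F {..<n} E c" "min n (2 * d + 1) \<le> card W"
  shows "\<exists>X T. best (run program s) X T \<and> min n (2 * d + 1) \<le> card X"
proof -
  let ?m = "min n (2 * d + 1)"
  have s0: "s 0 0 = n" "s 35 0 = 0" "s 1 = (\<lambda>_. 0)" "s 2 = (\<lambda>_. 0)" by (auto simp: s load_def encode_def)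
  have sc: "s 0 (Suc (u * n + v)) = col u v" if uv: "u < n" "v < n" for u v
  proof -
    have "u * n + v < Suc u * n" using uv by simp
    also have "\<dots> \<le> n * n" by (rule mult_le_mono1) (use uv in simp)
    finally have "Suc (u * n + v) < length (encode n E c)" by (simp add: length_encode)
    then show ?thesis
      using nth_concat_rows[OF uv, of "\<lambda>u v. if {u, v} \<in> E then c {u, v} else 0"] by (simp add: s load_def encode_def col_def)
  qed
  define s1 where "s1 = run (Set 1 (Const 0) (Const 1)) (run offsets s)"
  have off: "base (run offsets s)" "run offsets s 1 = s 1" "run offsets s 2 = s 2"
    using run_offsets[OF s0(1,2) sc] by (simp_all add: run_frame)
  have b1: "base s1" using off(1) base_run[of "Set 1 (Const 0) (Const 1)" "run offsets s"] unfolding s1_def by simp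
  have "vec s1 1 {0}" "mat s1 2 {}" unfolding s1_def vec_def mat_def using off s0 by auto
  then have best1: "best s1 {0} {}" using grown.single[of 0 "{..<n}" E c] n by (simp add: best_def)
  have m1: "1 \<le> ?m" using n by simp
  obtain Y G where Y: "grown {..<n} E c Y G" "card Y = ?m" using grown_subtrees[OF W(1) E m1 W(2)] by blast
  \<comment> \<open>For \<open>d \<le> 3\<close> the required order is at most
    \<open>2 * 3 + 1 = 7\<close>, so the exhaustive search already reaches it.\<close>
  obtain Y7 G7 where Y7: "grown {..<n} E c Y7 G7" "card Y7 = min ?m 7"
  proof -
    have "1 \<le> min ?m 7" "min ?m 7 \<le> card W" using m1 W(2) by linarith+
    then show thesis using grown_subtrees[OF W(1) E] that by blast
  qed
  define s2 where "s2 = run (nest small_vars small) s1"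
  have b2: "base s2" unfolding s2_def using b1 by (simp add: writes_nest set_small_vars)
  obtain X2 T2 where X2: "best s2 X2 T2" "min ?m 7 \<le> card X2"
    using run_smalls[OF b1 best1 Y7(1)] Y7(2) unfolding s2_def by auto
  obtain X T X1 T1 where X: "best (run (For 34 (nest [30, 31, 32, 33] attempt)) s2) X T" "card X2 \<le> card X"
    "exhausted X1 T1" "card X1 \<le> card X"
    using run_search[OF b2 X2(1)] by blast
  have r: "run program s = run (For 34 (nest [30, 31, 32, 33] attempt)) s2"
    unfolding program_def small_vars_def[symmetric] run.simps(3) s1_def s2_def ..
  have "?m \<le> card X"
  proof (cases "d \<le> 3")
    case True
    then have "min ?m 7 = ?m" by simp
    then show ?thesis using X2(2) X(2) by linarith
  next
    case False
    show ?thesis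
    proof (rule ccontr)
      assume h: "\<not> ?thesis"
      \<comment> \<open>The exhausted tree is no larger than the final one. If the final one misses
        the required order, \<open>exhausted_maximal\<close> limits every grown tree to
        \<open>2 * d\<close> vertices and gives \<open>2 * d < n\<close>, which contradicts the
        order of \<open>Y\<close>.\<close>
      then have "X1 \<noteq> {..<n}" "card X1 \<le> 2 * d" using X(4) by auto
      from exhausted_maximal[OF con _ degree X(3) this Y(1)] False have "card Y \<le> 2 * d" "2 * d < n" by auto
      then show False using Y(2) by simp
    qed
  qed
  then show ?thesis using X(1) r by auto
qed

theorem theorem4p2:
  "\<exists>(prog :: com) (p :: nat poly). \<forall>(n :: nat) (E :: nat set set) (c :: nat set \<Rightarrow> nat).
     edge_colored_graph {..<n} E c \<and> connected_graph {..<n} E \<longrightarrow>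
     (\<exists>T t. exec prog (load (encode n E c)) T t \<and>
            T \<le> poly p (input_size (encode n E c)) \<and>
            ((\<exists>W F. pc_tree_in W F {..<n} E c \<and>
                    card W \<ge> min (card {..<n}) (2 * min_color_degree {..<n} E c + 1)) \<longrightarrow>
             pc_tree_in (out_vertices n t) (out_edges n t) {..<n} E c \<and>
             card (out_vertices n t) \<ge> min (card {..<n}) (2 * min_color_degree {..<n} E c + 1)))"
\<comment> \<open>\<open>cost program\<close> bounds the time in terms of \<open>n\<close>; as its
  coefficients are natural numbers, it is monotone, and \<open>size_encode\<close> turns this into a
  bound in the input size.\<close>
proof (intro exI[of _ "compile program"] exI[of _ "cost program"] allI impI, elim conjE)
  fix n :: nat and E :: "nat set set" and c :: "nat set \<Rightarrow> nat"
  assume G: "edge_colored_graph {..<n} E c" "connected_graph {..<n} E"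
  let ?w = "encode n E c" and ?d = "min_color_degree {..<n} E c"
  let ?s = "load ?w"
  have simple: "simple_graph {..<n} E" using G(1) by (simp add: edge_colored_graph_def)
  obtain k where k: "c ` E \<subseteq> {1..k}" using G(1) by (auto simp: edge_colored_graph_def)
  interpret input_graph n E c
  proof
    show "E \<subseteq> doubletons {..<n}" using simple by (simp add: simple_graph_doubletons)
    show "0 < c e" if "e \<in> E" for e using k that by fastforce
  qed
  have "?s 0 0 = n" by (simp add: load_def encode_def)
  then obtain T where T: "exec (compile program) ?s T (run program ?s)" "T \<le> poly (cost program) n"
    using compile_exec[OF well_formed_program, of ?s] by auto
  have time: "T \<le> poly (cost program) (input_size ?w)"
    by (rule le_trans[OF T(2) poly_nat_mono[OF size_encode]])
  have con: "(x, y) \<in> conn E" if "x < n" "y < n" for x y using G(2) that by (simp add: connected_graph_def conn_def)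
  have n: "0 < n" using G(2) by (auto simp: connected_graph_def)
  have degree: "?d \<le> card {c {w, x} | x. {w, x} \<in> E}" if "w < n" for w
    unfolding min_color_degree_def color_degree_def by (rule Min_le) (use that in auto)
  have "pc_tree_in (out_vertices n (run program ?s)) (out_edges n (run program ?s)) {..<n} E c \<and>
      min (card {..<n}) (2 * ?d + 1) \<le> card (out_vertices n (run program ?s))"
    if W: "\<exists>W F. pc_tree_in W F {..<n} E c \<and> min (card {..<n}) (2 * ?d + 1) \<le> card W"
  proof -
    obtain W F where WF: "pc_tree_in W F {..<n} E c" "min n (2 * ?d + 1) \<le> card W" using W by auto
    obtain X T' where X: "best (run program ?s) X T'" "min n (2 * ?d + 1) \<le> card X"
      using run_program[OF refl con n degree WF] by blast
    have "pc_tree_in X T' {..<n} E c" using X(1) grown_pc_tree_in[OF _ simple] by (simp add: best_def)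
    then show ?thesis using best_out[OF X(1)] X(2) by simp
  qed
  then show "\<exists>T t. exec (compile program) ?s T t \<and> T \<le> poly (cost program) (input_size ?w) \<and>
      ((\<exists>W F. pc_tree_in W F {..<n} E c \<and> min (card {..<n}) (2 * ?d + 1) \<le> card W) \<longrightarrow>
       pc_tree_in (out_vertices n t) (out_edges n t) {..<n} E c \<and> min (card {..<n}) (2 * ?d + 1) \<le> card (out_vertices n t))"
    using T(1) time by blast
qed

end
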